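(* Let $d\ge 2$, let $\Omega\subset\mathbb{R}^d$ be a bounded domain with $C^2$ boundary $\partial\Omega$, let $T>0$, and let $(u,p)$ be a weak solution of the incompressible Euler equations on $\Omega\times(0,T)$. Assume that: (1) for every open $U\Subset\Omega$, $u\in L^3(0,T;B_3^{1/3,c_0}(U))$; (2) for some $\varepsilon>0$ (arbitrarily small), $u\in L^3(0,T;L^\infty(\Omega_\varepsilon))$ and $p\in L^{3/2}(0,T;L^\infty(\Omega_\varepsilon))$; (3) the wall-normal velocity is continuous at the boundary in the sense that $$\lim_{\delta\to 0}\ \sup_{x\in\Omega_\delta}|\hat n(\pi(x))\cdot u(x,t)|=0\quad\text{in } L^3((0,T)).$$ Then energy is globally conserved: $$\frac12\int_\Omega|u(x,t)|^2\,dx=\frac12\int_\Omega|u(x,0)|^2\,dx\qquad\text{for all } t\in[0,T).$$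
   Context: $H(\Omega)$ denotes the completion in $L^2(\Omega)$ of $\{w\in C_c^\infty(\Omega;\mathbb{R}^d):\nabla\cdot w=0\}$ (divergence-free $L^2$ fields tangent to $\partial\Omega$). $C_w(0,T;X)$ denotes weakly continuous functions of time with values in $X$, on the time interval including $t=0$. Weak Euler solution: $(u,p)$ is a weak Euler solution on $\Omega\times(0,T)$ if $u\in C_w(0,T;H(\Omega))$, $p\in L^1_{loc}(\Omega\times(0,T))$ and $$\int_0^T\int_\Omega\big(u\cdot\partial_t\varphi+u\otimes u:\nabla\varphi+p\,\nabla\cdot\varphi\big)\,dx\,dt=0$$ for all vector fields $\varphi\in C_0^\infty(\Omega\times(0,T))$. For $U\subset\mathbb{R}^d$ open, $q,p\ge 1$ and $\sigma\in(0,1)$, $L^q(0,T;B_p^{\sigma,c_0}(U))$ is the set of $f\in L^q(0,T;L^p(U))$ with $$\lim_{|r|\to0}\frac{\|f(\cdot+r)-f(\cdot)\|_{L^q(0,T;L^p(U\cap(U-\{r\})))}}{|r|^\sigma}=0,$$ where the shift $r\in\mathbb{R}^d$ is in the space variable. Distance and strips: $d(x)=\inf_{y\in\partial\Omega}|x-y|$ and $\Omega_a=\{x\in\Omega:d(x)<a\}$. For $x$ sufficiently close to $\partial\Omega$, $\pi(x)$ is the unique closest point to $x$ on $\partial\Omega$, and $\hat n$ is the outward unit normal vector field on $\partial\Omega$ (so $\nabla d(x)=-\hat n(\pi(x))$ near $\partial\Omega$). *)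

theory Defs
  imports "HOL-Analysis.Analysis" "HOL-Probability.Essential_Supremum"
begin

section \<open>Differentiability classes and test functions\<close>

text \<open>For open S this is membership in \<open>C\<^sup>k(S)\<close>: iterated directional derivatives up to order k
  exist and are continuous.\<close>

fun Ck_on :: "nat \<Rightarrow> 'a::euclidean_space set \<Rightarrow> ('a \<Rightarrow> 'b::real_normed_vector) \<Rightarrow> bool" where
  "Ck_on 0 S f \<longleftrightarrow> continuous_on S f"
| "Ck_on (Suc k) S f \<longleftrightarrow>
     (\<forall>x\<in>S. f differentiable (at x)) \<and> (\<forall>v. Ck_on k S (\<lambda>x. frechet_derivative f (at x) v))"

definition test_functions :: "'a::euclidean_space set \<Rightarrow> ('a \<Rightarrow> 'b::real_normed_vector) set" where
  "test_functions S = {\<phi>. (\<forall>k. Ck_on k UNIV \<phi>) \<and>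
     compact (closure {x. \<phi> x \<noteq> 0}) \<and> closure {x. \<phi> x \<noteq> 0} \<subseteq> S}"

definition divergence :: "('a::euclidean_space \<Rightarrow> 'a) \<Rightarrow> 'a \<Rightarrow> real" where
  "divergence w x = (\<Sum>i\<in>Basis. frechet_derivative w (at x) i \<bullet> i)"

text \<open>The contraction \<open>a \<otimes> a : \<nabla>w\<close> at x, that is, the sum of \<open>a\<^sub>i a\<^sub>j \<partial>\<^sub>i w\<^sub>j\<close>.\<close>

definition tensor_grad :: "'a::euclidean_space \<Rightarrow> ('a \<Rightarrow> 'a) \<Rightarrow> 'a \<Rightarrow> real" where
  "tensor_grad a w x =
     (\<Sum>i\<in>Basis. \<Sum>j\<in>Basis. (a \<bullet> i) * (a \<bullet> j) * (frechet_derivative w (at x) i \<bullet> j))"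


section \<open>Lebesgue spaces\<close>

text \<open>Elements of Lebesgue spaces are represented by functions. All norms are real-valued, and are
  meaningful only together with membership in the corresponding space.\<close>

definition Lp_space :: "real \<Rightarrow> 'a measure \<Rightarrow> ('a \<Rightarrow> 'b::euclidean_space) set" where
  "Lp_space p M = {f. f \<in> borel_measurable M \<and> integrable M (\<lambda>x. norm (f x) powr p)}"

definition Lp_norm :: "real \<Rightarrow> 'a measure \<Rightarrow> ('a \<Rightarrow> 'b::euclidean_space) \<Rightarrow> real" where
  "Lp_norm p M f = (LINT x|M. norm (f x) powr p) powr (1 / p)"

definition Linf_space :: "'a measure \<Rightarrow> ('a \<Rightarrow> 'b::euclidean_space) set" where
  "Linf_space M = {f. f \<in> borel_measurable M \<and> esssup M (\<lambda>x. ereal (norm (f x))) < \<infinity>}"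

definition Linf_norm :: "'a measure \<Rightarrow> ('a \<Rightarrow> 'b::euclidean_space) \<Rightarrow> real" where
  "Linf_norm M f = real_of_ereal (esssup M (\<lambda>x. ereal (norm (f x))))"

text \<open>The spaces \<open>L\<^sup>q(0,T;L\<^sup>p(U))\<close> and \<open>L\<^sup>q(0,T;L\<^sup>\<infinity>(U))\<close>, as jointly measurable functions of time
  (first argument) and space whose spatial norm lies in \<open>L\<^sup>q(0,T)\<close>.\<close>

definition spacetime_measurable ::
    "real \<Rightarrow> 'a::euclidean_space set \<Rightarrow> (real \<Rightarrow> 'a \<Rightarrow> 'b::euclidean_space) \<Rightarrow> bool" where
  "spacetime_measurable T U f \<longleftrightarrow>
     (\<lambda>z. f (fst z) (snd z)) \<in> borel_measurable (lebesgue_on ({0<..<T} \<times> U))"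

definition LqLp_norm :: "real \<Rightarrow> real \<Rightarrow> real \<Rightarrow> 'a::euclidean_space set \<Rightarrow>
    (real \<Rightarrow> 'a \<Rightarrow> 'b::euclidean_space) \<Rightarrow> real" where
  "LqLp_norm q p T U f =
     Lp_norm q (lebesgue_on {0<..<T}) (\<lambda>t. Lp_norm p (lebesgue_on U) (f t))"

definition LqLp_space :: "real \<Rightarrow> real \<Rightarrow> real \<Rightarrow> 'a::euclidean_space set \<Rightarrow>
    (real \<Rightarrow> 'a \<Rightarrow> 'b::euclidean_space) set" where
  "LqLp_space q p T U = {f. spacetime_measurable T U f \<and>
     (AE t in lebesgue_on {0<..<T}. f t \<in> Lp_space p (lebesgue_on U)) \<and>
     (\<lambda>t. Lp_norm p (lebesgue_on U) (f t)) \<in> Lp_space q (lebesgue_on {0<..<T})}"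

definition LqLinf_norm :: "real \<Rightarrow> real \<Rightarrow> 'a::euclidean_space set \<Rightarrow>
    (real \<Rightarrow> 'a \<Rightarrow> 'b::euclidean_space) \<Rightarrow> real" where
  "LqLinf_norm q T U f =
     Lp_norm q (lebesgue_on {0<..<T}) (\<lambda>t. Linf_norm (lebesgue_on U) (f t))"

definition LqLinf_space :: "real \<Rightarrow> real \<Rightarrow> 'a::euclidean_space set \<Rightarrow>
    (real \<Rightarrow> 'a \<Rightarrow> 'b::euclidean_space) set" where
  "LqLinf_space q T U = {f. spacetime_measurable T U f \<and>
     (AE t in lebesgue_on {0<..<T}. f t \<in> Linf_space (lebesgue_on U)) \<and>
     (\<lambda>t. Linf_norm (lebesgue_on U) (f t)) \<in> Lp_space q (lebesgue_on {0<..<T})}"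

definition Lq_besov_c0 :: "real \<Rightarrow> real \<Rightarrow> real \<Rightarrow> real \<Rightarrow> 'a::euclidean_space set \<Rightarrow>
    (real \<Rightarrow> 'a \<Rightarrow> 'b::euclidean_space) set" where
  "Lq_besov_c0 q p \<sigma> T U = {f \<in> LqLp_space q p T U.
     ((\<lambda>r. LqLp_norm q p T (U \<inter> (\<lambda>x. x - r) ` U) (\<lambda>t x. f t (x + r) - f t x) / norm r powr \<sigma>)
        \<longlongrightarrow> 0) (at 0)}"

definition L1_loc :: "real \<Rightarrow> 'a::euclidean_space set \<Rightarrow>
    (real \<Rightarrow> 'a \<Rightarrow> 'b::euclidean_space) set" where
  "L1_loc T \<Omega> = {f. \<forall>K. compact K \<and> K \<subseteq> {0<..<T} \<times> \<Omega> \<longrightarrow>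
     (\<lambda>z. f (fst z) (snd z)) absolutely_integrable_on K}"


section \<open>Weak solutions of the Euler equations\<close>

definition solenoidal_L2 :: "'a::euclidean_space set \<Rightarrow> ('a \<Rightarrow> 'a) set" where
  "solenoidal_L2 \<Omega> = {f \<in> Lp_space 2 (lebesgue_on \<Omega>). \<forall>\<epsilon>>0. \<exists>w\<in>test_functions \<Omega>.
     (\<forall>x. divergence w x = 0) \<and> Lp_norm 2 (lebesgue_on \<Omega>) (\<lambda>x. f x - w x) < \<epsilon>}"

text \<open>Bounded linear functionals on \<open>H(\<Omega>)\<close>. Boundedness forces such a functional to agree on
  representatives of the same class; its values outside \<open>H(\<Omega>)\<close> are irrelevant.\<close>

definition solenoidal_dual :: "'a::euclidean_space set \<Rightarrow> (('a \<Rightarrow> 'a) \<Rightarrow> real) set" where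
  "solenoidal_dual \<Omega> = {l.
     (\<forall>f\<in>solenoidal_L2 \<Omega>. \<forall>g\<in>solenoidal_L2 \<Omega>. l (\<lambda>x. f x + g x) = l f + l g) \<and>
     (\<forall>c. \<forall>f\<in>solenoidal_L2 \<Omega>. l (\<lambda>x. c *\<^sub>R f x) = c * l f) \<and>
     (\<exists>C. \<forall>f\<in>solenoidal_L2 \<Omega>. \<bar>l f\<bar> \<le> C * Lp_norm 2 (lebesgue_on \<Omega>) f)}"

definition weakly_continuous_solenoidal ::
    "real \<Rightarrow> 'a::euclidean_space set \<Rightarrow> (real \<Rightarrow> 'a \<Rightarrow> 'a) set" where
  "weakly_continuous_solenoidal T \<Omega> = {u. (\<forall>t\<in>{0..<T}. u t \<in> solenoidal_L2 \<Omega>) \<and>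
     (\<forall>l\<in>solenoidal_dual \<Omega>. continuous_on {0..<T} (\<lambda>t. l (u t)))}"

definition weak_euler_solution :: "real \<Rightarrow> 'a::euclidean_space set \<Rightarrow>
    (real \<Rightarrow> 'a \<Rightarrow> 'a) \<Rightarrow> (real \<Rightarrow> 'a \<Rightarrow> real) \<Rightarrow> bool" where
  "weak_euler_solution T \<Omega> u p \<longleftrightarrow>
     u \<in> weakly_continuous_solenoidal T \<Omega> \<and> p \<in> L1_loc T \<Omega> \<and>
     (\<forall>\<phi>\<in>test_functions ({0<..<T} \<times> \<Omega>).
        (LINT t|lebesgue_on {0<..<T}. LINT x|lebesgue_on \<Omega>.
           u t x \<bullet> vector_derivative (\<lambda>s. \<phi> (s, x)) (at t)
           + tensor_grad (u t x) (\<lambda>y. \<phi> (t, y)) x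
           + p t x * divergence (\<lambda>y. \<phi> (t, y)) x) = 0)"


section \<open>Geometry of the domain\<close>

text \<open>Near each boundary point the domain is, up to a rotation, the strict epigraph of a \<open>C\<^sup>2\<close>
  function of the coordinates orthogonal to \<open>e\<close>. Only the values of \<open>\<gamma>\<close> on the hyperplane
  orthogonal to \<open>e\<close> matter.\<close>

definition C2_boundary :: "'a::euclidean_space set \<Rightarrow> bool" where
  "C2_boundary \<Omega> \<longleftrightarrow> (\<forall>y\<in>frontier \<Omega>. \<exists>r>0. \<exists>e. \<exists>\<gamma> :: 'a \<Rightarrow> real.
     norm e = 1 \<and> Ck_on 2 UNIV \<gamma> \<and>
     \<Omega> \<inter> ball y r = {x \<in> ball y r. \<gamma> (x - (x \<bullet> e) *\<^sub>R e) < x \<bullet> e})"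

definition bounded_C2_domain :: "'a::euclidean_space set \<Rightarrow> bool" where
  "bounded_C2_domain \<Omega> \<longleftrightarrow>
     open \<Omega> \<and> connected \<Omega> \<and> \<Omega> \<noteq> {} \<and> bounded \<Omega> \<and> C2_boundary \<Omega>"

definition boundary_strip :: "'a::euclidean_space set \<Rightarrow> real \<Rightarrow> 'a set" where
  "boundary_strip \<Omega> a = {x \<in> \<Omega>. infdist x (frontier \<Omega>) < a}"

text \<open>The unit vector that is orthogonal to all velocities of curves in the boundary through y and
  points out of the domain.\<close>

definition outward_normal :: "'a::euclidean_space set \<Rightarrow> 'a \<Rightarrow> 'a" where
  "outward_normal \<Omega> y = (THE n. norm n = 1 \<and>
     (\<forall>c v. c 0 = y \<and> range c \<subseteq> frontier \<Omega> \<and> (c has_vector_derivative v) (at (0::real))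
        \<longrightarrow> n \<bullet> v = 0) \<and>
     (\<exists>s0>0. \<forall>s\<in>{0<..<s0}. y - s *\<^sub>R n \<in> \<Omega> \<and> y + s *\<^sub>R n \<notin> closure \<Omega>))"

text \<open>\<open>closest_point\<close> makes a choice where the closest boundary point is not unique; in a
  sufficiently thin boundary strip it is unique.\<close>

definition wall_normal_component ::
    "'a::euclidean_space set \<Rightarrow> (real \<Rightarrow> 'a \<Rightarrow> 'a) \<Rightarrow> real \<Rightarrow> 'a \<Rightarrow> real" where
  "wall_normal_component \<Omega> u t x =
     outward_normal \<Omega> (closest_point (frontier \<Omega>) x) \<bullet> u t x"

text \<open>The spatial supremum is the essential one, because \<open>u t\<close> is determined only up to null sets.
  Requiring membership for small \<open>\<delta>\<close> rules out the junk value of \<open>LqLinf_norm\<close>.\<close>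

definition normal_velocity_vanishes ::
    "real \<Rightarrow> real \<Rightarrow> 'a::euclidean_space set \<Rightarrow> (real \<Rightarrow> 'a \<Rightarrow> 'a) \<Rightarrow> bool" where
  "normal_velocity_vanishes q T \<Omega> u \<longleftrightarrow>
     (\<forall>\<^sub>F \<delta> in at_right 0.
        wall_normal_component \<Omega> u \<in> LqLinf_space q T (boundary_strip \<Omega> \<delta>)) \<and>
     ((\<lambda>\<delta>. LqLinf_norm q T (boundary_strip \<Omega> \<delta>) (wall_normal_component \<Omega> u))
        \<longlongrightarrow> 0) (at_right 0)"

end

theory Submission
  imports Defs
begin

text \<open>Mollify the velocity at scale \<open>\<epsilon>\<close>, multiply by a cutoff that vanishes within distance
  \<open>\<delta> / 2\<close> of the boundary and is 1 beyond distance \<open>\<delta>\<close>, and mollify again: this is an admissible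
  test field, and testing the equation with it gives the increment of the mollified, localised energy.
  Its divergence is supported in the layer where the cutoff varies, so the pressure matters only
  there. The flux splits into two parts. The commutator of mollification and product is cubic in
  increments of the velocity over distances at most \<open>\<epsilon>\<close> (Constantin, E and Titi), hence vanishes for
  fixed \<open>\<delta>\<close> as \<open>\<epsilon>\<close> tends to 0. The other part contains the gradient of the cutoff, of size
  \<open>1 / \<delta>\<close>, parallel to the wall normal and supported in a layer of measure \<open>O(\<delta>)\<close>: it is bounded by
  \<open>|u|^2 + |p|\<close> times the supremum of the wall-normal velocity, which vanishes with \<open>\<delta>\<close> after
  integration in time.\<close>

section \<open>Smooth functions\<close>

text \<open>The velocity is only weakly continuous in time, so a field built from it is no smooth
  test function of time. The adjoint of the outer mollification turns the pairing of u(s) with the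
  field built from u(t) into the integral of \<theta> times the inner product of two mollified
  velocities: symmetric in s and t, and on the diagonal the localised energy. The weak equation
  gives increments in one argument with the other frozen. Products of M in L^3 or P in L^(3/2) with
  further factors are split by a weighted Young inequality: the large weight falls on what vanishes
  in the limit, the small one on integrals that stay fixed. The decisive balance is that cubic
  increments are o(\<epsilon>), which beats the factor 1/\<epsilon> of the commutator. The energy is
  claimed at every time, while jointly measurable representatives agree with the velocity only at
  almost every time; both kinds of representative are carried along.\<close>

abbreviation fderiv :: "('a::real_normed_vector => 'b::real_normed_vector) => 'a => 'a => 'b" where
  "fderiv f x \<equiv> frechet_derivative f (at x)"

abbreviation (input) "ind \<equiv> indicator"

lemmas bochner_bound = Bochner_Integration.integrable_bound
lemmas bochner_add = Bochner_Integration.integrable_add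

lemma Ck_onD: "Ck_on (Suc k) UNIV f ==> (f has_derivative fderiv f x) (at x)"
  by (simp add: frechet_derivative_works[symmetric])

lemma Ck_onD2: "Ck_on (Suc k) UNIV f ==> Ck_on k UNIV (\<lambda>x. fderiv f x v)"
  by simp

lemma Ck_onI:
  assumes "\<And>x. (f has_derivative f' x) (at x)" "\<And>v. Ck_on k UNIV (\<lambda>x. f' x v)"
  shows "Ck_on (Suc k) UNIV f"
proof -
  have "fderiv f x = f' x" for x
    using assms(1)[of x] by (rule frechet_derivative_at[symmetric])
  then show ?thesis using assms by (auto simp: differentiable_def)
qed

lemma Ck_on_Suc: "Ck_on (Suc k) UNIV f ==> Ck_on k UNIV f"
proof (induction k arbitrary: f)
  case 0
  then have "\<forall>x. f differentiable at x" by simp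
  then show ?case
    by (auto intro!: differentiable_imp_continuous_on simp: differentiable_on_def differentiable_at_withinI)
next
  case (Suc k)
  then show ?case by (metis Ck_on.simps(2))
qed

lemma Ck_on_const: "Ck_on k UNIV (\<lambda>x. c)"
proof (induction k arbitrary: c)
  case (Suc k)
  show ?case by (rule Ck_onI[where f'="\<lambda>x v. 0"]) (auto simp: Suc)
qed simp

lemma Ck_on_bounded_linear:
  assumes "bounded_linear L" shows "Ck_on k UNIV L"
proof (cases k)
  case 0
  then show ?thesis using assms by (simp add: linear_continuous_on)
next
  case (Suc n)
  show ?thesis unfolding Suc
    by (rule Ck_onI[where f'="\<lambda>x. L"]) (auto simp: assms bounded_linear_imp_has_derivative Ck_on_const)
qed

lemma Ck_on_add:
  "Ck_on k UNIV f ==> Ck_on k UNIV g ==> Ck_on k UNIV (\<lambda>x. f x + g x)"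
proof (induction k arbitrary: f g)
  case 0
  then show ?case by (simp add: continuous_on_add)
next
  case (Suc k)
  show ?case
    by (rule Ck_onI[OF has_derivative_add[OF Ck_onD[OF Suc.prems(1)] Ck_onD[OF Suc.prems(2)]]])
      (use Suc in simp)
qed

lemma Ck_on_bilinear:
  assumes "bounded_bilinear h"
  shows "Ck_on k UNIV f ==> Ck_on k UNIV g ==> Ck_on k UNIV (\<lambda>x. h (f x) (g x))"
proof (induction k arbitrary: f g)
  case 0
  then show ?case using assms by (auto intro: bounded_bilinear.continuous_on)
next
  case (Suc k)
  show ?case
    by (rule Ck_onI[OF bounded_bilinear.FDERIV[OF assms Ck_onD[OF Suc.prems(1)] Ck_onD[OF Suc.prems(2)]]])
      (rule Ck_on_add[OF Suc.IH[OF Ck_on_Suc[OF Suc.prems(1)] Ck_onD2[OF Suc.prems(2)]]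
          Suc.IH[OF Ck_onD2[OF Suc.prems(1)] Ck_on_Suc[OF Suc.prems(2)]]])
qed

lemmas Ck_on_mult = Ck_on_bilinear[OF bounded_bilinear_mult]
lemmas Ck_on_scaleR = Ck_on_bilinear[OF bounded_bilinear_scaleR]
lemmas Ck_on_inner = Ck_on_bilinear[OF bounded_bilinear_inner]

lemma Ck_on_compose_affine:
  assumes "bounded_linear L"
  shows "Ck_on k UNIV f ==> Ck_on k UNIV (\<lambda>x. f (L x + c))"
proof (induction k arbitrary: f)
  case 0
  then have "continuous_on UNIV f" by simp
  then have "continuous_on UNIV (\<lambda>x. f (L x + c))"
    by (rule continuous_on_compose2)
      (auto intro!: continuous_on_add linear_continuous_on[OF assms])
  then show ?case by simp
next
  case (Suc k)
  have "((\<lambda>x. f (L x + c)) has_derivative (\<lambda>v. fderiv f (L x + c) (L v))) (at x)" for x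
    by (rule has_derivative_compose[of "\<lambda>x. L x + c" L x UNIV f])
      (auto intro!: derivative_eq_intros bounded_linear.has_derivative[OF assms] Ck_onD[OF Suc.prems])
  then show ?case
    by (rule Ck_onI) (rule Suc.IH[OF Ck_onD2[OF Suc.prems]])
qed

text \<open>The outer function is smooth of every order, so the induction may replace it by its
  derivative while the order of the inner function drops by one.\<close>

lemma Ck_on_compose_real:
  fixes H :: "real => real"
  shows "\<lbrakk>\<And>n. Ck_on n UNIV H; Ck_on k UNIV q\<rbrakk> \<Longrightarrow> Ck_on k UNIV (\<lambda>x. H (q x))"
proof (induction k arbitrary: H)
  case 0
  have "continuous_on UNIV H" using 0(1)[of 0] by simp
  then show ?case using 0(2) by (auto intro: continuous_on_compose2)
next
  case (Suc k)
  let ?H' = "\<lambda>s. fderiv H s 1"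
  have lin: "fderiv H s r = r * ?H' s" for s r
  proof -
    interpret bounded_linear "fderiv H s"
      by (rule has_derivative_bounded_linear[OF Ck_onD[OF Suc.prems(1)[of "Suc 0"]]])
    show ?thesis using scaleR[of r 1] by simp
  qed
  have H: "((\<lambda>x. H (q x)) has_derivative (\<lambda>v. fderiv q x v * ?H' (q x))) (at x)" for x
    by (rule has_derivative_eq_rhs[OF has_derivative_compose[OF Ck_onD[OF Suc.prems(2)]
            Ck_onD[OF Suc.prems(1)[of "Suc 0"]]]]) (rule ext, rule lin)
  have H': "Ck_on n UNIV ?H'" for n
    using Suc.prems(1)[of "Suc n"] by (rule Ck_onD2)
  have "Ck_on k UNIV (\<lambda>x. ?H' (q x))"
    by (rule Suc.IH[of ?H', OF H' Ck_on_Suc[OF Suc.prems(2)]])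
  note Ck_on_mult[OF Ck_onD2[OF Suc.prems(2)] this]
  with H show ?case by (rule Ck_onI)
qed

section \<open>A smooth step function\<close>

definition flat_exp :: "real poly => real => real" where
  "flat_exp P s = (if s \<le> 0 then 0 else poly P (1 / s) * exp (- (1 / s)))"

lemma poly_exp_minus_tendsto_0:
  fixes P :: "real poly"
  shows "((\<lambda>w. poly P w * exp (- w)) \<longlongrightarrow> 0) at_top"
proof -
  have "((\<lambda>w::real. coeff P i * (w ^ i / exp w)) \<longlongrightarrow> 0) at_top" for i
    using tendsto_mult_right_zero[OF tendsto_power_div_exp_0[of i]] by simp
  then have "((\<lambda>w::real. (\<Sum>i\<le>degree P. coeff P i * (w ^ i / exp w))) \<longlongrightarrow> 0) at_top"
    by (rule tendsto_null_sum)
  moreover have "(\<Sum>i\<le>degree P. coeff P i * (w ^ i / exp w)) = poly P w * exp (- w)" for w :: real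
    unfolding poly_altdef sum_distrib_right by (intro sum.cong) (auto simp: exp_minus divide_inverse)
  ultimately show ?thesis by simp
qed

text \<open>With w = 1/s, differentiation in s is -w^2 d/dw, which sends P(w) exp(-w) to w^2 (P -
  P')(w) exp(-w); the two \<open>pCons 0\<close> are the factor w^2. The family is thus closed under
  differentiation, and smoothness of all orders is an induction over the polynomial. At 0 the right
  difference quotient is w P(w) exp(-w), which tends to 0.\<close>

lemma flat_exp_has_derivative:
  "(flat_exp P has_real_derivative flat_exp (pCons 0 (pCons 0 (P - pderiv P))) s) (at s)"
proof -
  consider "s < 0" | "s = 0" | "s > 0" by linarith
  then show ?thesis
  proof cases
    case 1
    have "((\<lambda>s. 0) has_real_derivative 0) (at s)" by simp
    then show ?thesis
      by (rule has_field_derivative_transform_within_open[where S="{..<0}", THEN DERIV_cong])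
        (use 1 in \<open>auto simp: flat_exp_def\<close>)
  next
    case 2
    have "((\<lambda>h. poly (pCons 0 P) (inverse h) * exp (- inverse h)) \<longlongrightarrow> 0) (at_right 0)"
      using filterlim_compose[OF poly_exp_minus_tendsto_0[of "pCons 0 P"] filterlim_inverse_at_top_right] .
    then have "((\<lambda>h. (flat_exp P h - flat_exp P 0) / (h - 0)) \<longlongrightarrow> 0) (at_right 0)"
    proof (rule Lim_transform_eventually)
      show "\<forall>\<^sub>F h in at_right 0. poly (pCons 0 P) (inverse h) * exp (- inverse h)
              = (flat_exp P h - flat_exp P 0) / (h - 0)"
        by (rule eventually_at_rightI[of 0 1]) (auto simp: flat_exp_def field_simps)
    qed
    moreover have "((\<lambda>h. (flat_exp P h - flat_exp P 0) / (h - 0)) \<longlongrightarrow> 0) (at_left 0)"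
      by (rule tendsto_eventually) (rule eventually_at_leftI[of "-1"], auto simp: flat_exp_def)
    ultimately show ?thesis
      using 2 by (auto simp: has_field_derivative_iff filterlim_at_split flat_exp_def)
  next
    case 3
    have "((\<lambda>s. poly P (1 / s) * exp (- (1 / s))) has_real_derivative
        flat_exp (pCons 0 (pCons 0 (P - pderiv P))) s) (at s)"
      using 3 by (auto intro!: derivative_eq_intros poly_DERIV DERIV_chain2[where f="poly P"]
        simp: flat_exp_def field_simps power2_eq_square)
    then show ?thesis
      by (rule has_field_derivative_transform_within_open[where S="{0<..}"])
        (use 3 in \<open>auto simp: flat_exp_def\<close>)
  qed
qed

lemma Ck_on_flat_exp: "Ck_on k UNIV (flat_exp P)"
proof (induction k arbitrary: P)
  case 0
  show ?case
    using DERIV_continuous[OF flat_exp_has_derivative[of P]]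
    by (simp add: continuous_on_eq_continuous_at)
next
  case (Suc k)
  show ?case
  proof (rule Ck_onI)
    show "(flat_exp P has_derivative (\<lambda>v. flat_exp (pCons 0 (pCons 0 (P - pderiv P))) s * v)) (at s)" for s
      using flat_exp_has_derivative[of P s] by (simp add: has_field_derivative_def)
    show "Ck_on k UNIV (\<lambda>s. flat_exp (pCons 0 (pCons 0 (P - pderiv P))) s * v)" for v
      by (rule Ck_on_mult[OF Suc Ck_on_const])
  qed
qed

definition flat :: "real => real" where "flat = flat_exp 1"

lemma flat_eq: "flat s = (if s \<le> 0 then 0 else exp (- (1 / s)))"
  by (simp add: flat_def flat_exp_def)

lemma Ck_on_flat: "Ck_on k UNIV flat"
  unfolding flat_def by (rule Ck_on_flat_exp)

lemma flat_pos: "s > 0 ==> flat s > 0" and flat_nonneg: "0 \<le> flat s"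
  and flat_zero: "s \<le> 0 ==> flat s = 0" and flat_le_1: "flat s \<le> 1"
  by (auto simp: flat_eq)

lemma flat_mono: "s \<le> t ==> flat s \<le> flat t"
proof (cases "s \<le> 0")
  case True
  then show ?thesis by (simp add: flat_zero flat_nonneg)
next
  case False
  assume "s \<le> t"
  then have "1 / t \<le> 1 / s" using False by (intro divide_left_mono) auto
  then show ?thesis using False \<open>s \<le> t\<close> by (simp add: flat_eq)
qed

text \<open>The normalised primitive of the bump \<open>flat s * flat (1 - s)\<close>, which
  vanishes outside (0,1). The derivative is returned together with its sign and a bound, because the
  boundary cutoff and the switches in time are rescalings of this function.\<close>

lemma smooth_step:
  obtains H H' :: "real => real" and C where
    "\<And>k. Ck_on k UNIV H" "\<And>s. (H has_real_derivative H' s) (at s)" "continuous_on UNIV H'"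
    "\<And>s. s \<le> 0 ==> H s = 0" "\<And>s. s \<ge> 1 ==> H s = 1" "\<And>s. 0 \<le> H s" "\<And>s. H s \<le> 1"
    "\<And>s. s \<le> 0 \<or> s \<ge> 1 ==> H' s = 0" "\<And>s. 0 \<le> H' s" "\<And>s. H' s \<le> C" "C > 0"
proof -
  define b where "b = (\<lambda>s. flat s * flat (1 - s))"
  have Ckb: "Ck_on k UNIV b" for k
  proof -
    have "Ck_on k UNIV (\<lambda>x. flat (- x + 1))"
      by (rule Ck_on_compose_affine[OF bounded_linear_minus[OF bounded_linear_ident] Ck_on_flat])
    then have "Ck_on k UNIV (\<lambda>x. flat (1 - x))" by simp
    then show ?thesis unfolding b_def by (rule Ck_on_mult[OF Ck_on_flat])
  qed
  have cont: "continuous_on S b" for S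
    using Ckb[of 0] by (auto intro: continuous_on_subset)
  have b0: "b s \<ge> 0" "b s \<le> 1" for s by (auto simp: b_def flat_nonneg flat_le_1 mult_le_one)
  have bz: "b s = 0" if "s \<le> 0 \<or> s \<ge> 1" for s using that by (auto simp: b_def flat_zero)
  \<comment> \<open>Integration starts at -1, so that 0 is an interior point of the interval on
    which the fundamental theorem is applied.\<close>
  define F where "F = (\<lambda>s. integral {-1..s} b)"
  have F0: "F s = 0" if "s \<le> 0" for s
    unfolding F_def using that integral_cong[of "{-1..s}" b "\<lambda>_. 0"] by (auto simp: bz)
  have FD: "(F has_real_derivative b s) (at s)" for s
  proof (cases "s < 0")
    case True
    have "((\<lambda>s. 0) has_real_derivative b s) (at s)" using True by (simp add: bz)
    then show ?thesis
      by (rule has_field_derivative_transform_within_open[where S="{..<0}"]) (use True in \<open>auto simp: F0\<close>)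
  next
    case False
    then have "(F has_real_derivative b s) (at s within {-1..s+1})"
      unfolding F_def by (intro integral_has_real_derivative cont) auto
    moreover have "at s within {-1..s + 1} = at s"
      by (rule at_within_Icc_at) (use False in auto)
    ultimately show ?thesis by simp
  qed
  have mono: "F s \<le> F t" if "s \<le> t" for s t
    by (rule DERIV_nonneg_imp_nondecreasing[OF that]) (use FD b0(1) in blast)
  have F1: "F s = F 1" if "s \<ge> 1" for s
  proof (cases "s = 1")
    case False
    have "\<exists>z. z > 1 \<and> z < s \<and> F s - F 1 = (s - 1) * b z"
      by (rule MVT2) (use that False FD in auto)
    then show ?thesis by (auto simp: bz)
  qed simp
  have "F 1 > 0"
  proof -
    obtain z where z: "z > 0" "z < 1" "F 1 - F 0 = (1 - 0) * b z"
      using MVT2[of 0 1 F b] FD by auto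
    then show ?thesis by (simp add: F0 b_def flat_pos)
  qed
  let ?H = "\<lambda>s. F s / F 1" and ?H' = "\<lambda>s. b s / F 1"
  have D: "(?H has_real_derivative ?H' s) (at s)" for s
    by (rule DERIV_cdivide[OF FD])
  have CkH': "Ck_on k UNIV ?H'" for k
    using Ck_on_mult[OF Ckb Ck_on_const[of k "1 / F 1"]] by simp
  have "Ck_on (Suc k) UNIV ?H" for k
  proof (rule Ck_onI)
    show "(?H has_derivative (\<lambda>v. ?H' s * v)) (at s)" for s
      using D[of s] by (simp only: has_field_derivative_def)
    show "Ck_on k UNIV (\<lambda>s. ?H' s * v)" for v
      by (rule Ck_on_mult[OF CkH' Ck_on_const])
  qed
  then have "Ck_on k UNIV ?H" for k by (rule Ck_on_Suc)
  have Fb: "0 \<le> F s" "F s \<le> F 1" for s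
    using mono[of 0 s] mono[of s 1] F0[of s] F0[of 0] F1[of s] by (cases "s \<le> 0"; cases "s \<le> 1"; simp)+
  show ?thesis
  proof (rule that[of ?H ?H' "1 / F 1"])
    show "Ck_on k UNIV ?H" for k by fact
    show "(?H has_real_derivative ?H' s) (at s)" for s by (rule D)
    show "continuous_on UNIV ?H'" using CkH'[of 0] by (simp only: Ck_on.simps)
    show "?H s = 0" if "s \<le> 0" for s using F0[OF that] by simp
    show "?H s = 1" if "s \<ge> 1" for s using F1[OF that] \<open>F 1 > 0\<close> by simp
    show "0 \<le> ?H s" "?H s \<le> 1" for s using Fb[of s] \<open>F 1 > 0\<close> by simp_all
    show "?H' s = 0" if "s \<le> 0 \<or> s \<ge> 1" for s using bz[OF that] by simp
    show "0 \<le> ?H' s" "?H' s \<le> 1 / F 1" for s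
      using b0[of s] \<open>F 1 > 0\<close> by (simp_all add: divide_right_mono)
    show "0 < 1 / F 1" using \<open>F 1 > 0\<close> by simp
  qed
qed

section \<open>Mollification\<close>

definition kernel :: "real => ('a::euclidean_space => real) => bool" where
  "kernel R k \<longleftrightarrow> (\<forall>n. Ck_on n UNIV k) \<and> (\<forall>z. R < norm z --> k z = 0)"

definition conv :: "('a::euclidean_space => real) => ('a => 'b::euclidean_space) => 'a => 'b" where
  "conv k F y = (LBINT x. k (y - x) *\<^sub>R F x)"

lemma kernel_Ck: "kernel R k ==> Ck_on n UNIV k"
  and kernel_zero: "kernel R k ==> R < norm z ==> k z = 0"
  by (simp_all only: kernel_def)

lemma kernel_continuous: "kernel R k ==> continuous_on UNIV k"
  using kernel_Ck[of R k 0] by simp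

lemma kernel_borel: "kernel R k ==> k \<in> borel_measurable borel"
  by (rule borel_measurable_continuous_onI[OF kernel_continuous])

lemma kernel_has_derivative:
  "kernel R k ==> (k has_derivative fderiv k z) (at z)"
  by (rule Ck_onD[OF kernel_Ck])

lemma kernel_linear: "kernel R k ==> bounded_linear (fderiv k z)"
  by (rule has_derivative_bounded_linear[OF kernel_has_derivative])

text \<open>The exterior of the ball is open, so the kernel vanishes near each of its points and
  derivatives keep the support radius. This closure lets smoothness of \<open>conv\<close> be proved
  by induction with the kernel varying.\<close>

lemma kernel_derivative:
  assumes "kernel R k" shows "kernel R (\<lambda>z. fderiv k z v)"
proof -
  have "fderiv k z v = 0" if "R < norm z" for z
  proof -
    have "((\<lambda>z. 0::real) has_derivative (\<lambda>_. 0)) (at z)" by (rule has_derivative_const)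
    then have "(k has_derivative (\<lambda>_. 0)) (at z)"
      by (rule has_derivative_transform_within_open[where s="{z. R < norm z}"])
        (use that kernel_zero[OF assms] in \<open>auto intro: open_Collect_less continuous_intros\<close>)
    from has_derivative_unique[OF this kernel_has_derivative[OF assms]] show ?thesis
      by metis
  qed
  then show ?thesis
    using Ck_onD2[OF kernel_Ck[OF assms]] unfolding kernel_def by blast
qed

lemma kernel_reflect:
  assumes "kernel R k" shows "kernel R (\<lambda>z. k (- z))"
    and "fderiv (\<lambda>z. k (- z)) z v = - fderiv k (- z) v"
proof -
  have "Ck_on n UNIV (\<lambda>z. k (- z + 0))" for n
    by (rule Ck_on_compose_affine[OF bounded_linear_minus[OF bounded_linear_ident] kernel_Ck[OF assms]])
  then show "kernel R (\<lambda>z. k (- z))" using assms by (simp add: kernel_def)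
  have "((\<lambda>z. k (- z)) has_derivative (\<lambda>v. fderiv k (- z) (- v))) (at z)"
    by (rule has_derivative_compose[OF _ kernel_has_derivative[OF assms]]) (auto intro!: derivative_eq_intros)
  from frechet_derivative_at[OF this]
  show "fderiv (\<lambda>z. k (- z)) z v = - fderiv k (- z) v"
    using linear_neg[OF bounded_linear.linear[OF kernel_linear[OF assms]]] by (metis)
qed

lemma kernel_bounded:
  assumes "kernel R k" obtains B where "B > 0" "\<And>z. \<bar>k z\<bar> \<le> B"
proof -
  have "compact (k ` cball 0 R)"
    by (intro compact_continuous_image continuous_on_subset[OF kernel_continuous[OF assms]]) auto
  then obtain B where B: "B > 0" "\<And>z. z \<in> cball 0 R ==> \<bar>k z\<bar> \<le> B"
    by (metis (no_types, lifting) bounded_pos compact_imp_bounded imageI real_norm_def)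
  have "\<bar>k z\<bar> \<le> B" for z
    using B kernel_zero[OF assms, of z] by (cases "norm z \<le> R") auto
  then show ?thesis using B(1) that by blast
qed

lemma kernel_derivative_bound:
  assumes "kernel R k"
  obtains B where "B > 0" "\<And>z v. \<bar>fderiv k z v\<bar> \<le> B * norm v"
proof -
  have "\<exists>B. B > 0 \<and> (\<forall>z. \<bar>fderiv k z i\<bar> \<le> B)" for i
    using kernel_bounded[OF kernel_derivative[OF assms]] by metis
  then obtain B where B: "\<And>i. B i > 0" "\<And>i z. \<bar>fderiv k z i\<bar> \<le> B i"
    by metis
  have "\<bar>fderiv k z v\<bar> \<le> (\<Sum>i\<in>Basis. B i) * norm v" for z v
  proof -
    interpret bounded_linear "fderiv k z" by (rule kernel_linear[OF assms])
    have "\<bar>fderiv k z v\<bar> = \<bar>fderiv k z (\<Sum>i\<in>Basis. (v \<bullet> i) *\<^sub>R i)\<bar>"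
      by (simp add: euclidean_representation)
    also have "\<dots> = \<bar>\<Sum>i\<in>Basis. (v \<bullet> i) * fderiv k z i\<bar>"
      by (simp add: sum scaleR)
    also have "\<dots> \<le> (\<Sum>i\<in>Basis. \<bar>(v \<bullet> i) * fderiv k z i\<bar>)" by (rule sum_abs)
    also have "\<dots> \<le> (\<Sum>i\<in>Basis. B i * norm v)"
    proof (rule sum_mono)
      fix i :: 'a assume "i \<in> Basis"
      then have "\<bar>v \<bullet> i\<bar> * \<bar>fderiv k z i\<bar> \<le> norm v * B i"
        by (intro mult_mono B(2) Basis_le_norm) auto
      then show "\<bar>(v \<bullet> i) * fderiv k z i\<bar> \<le> B i * norm v"
        by (simp add: abs_mult mult.commute)
    qed
    finally show ?thesis by (simp add: sum_distrib_right)
  qed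
  moreover have "(\<Sum>i\<in>(Basis::'a set). B i) > 0" by (intro sum_pos B(1)) auto
  ultimately show ?thesis using that by blast
qed

lemma kernel_lipschitz:
  assumes "kernel R k"
  obtains B where "B > 0" "\<And>x y. \<bar>k x - k y\<bar> \<le> B * norm (x - y)"
proof -
  obtain B where B: "B > 0" "\<And>z v. \<bar>fderiv k z v\<bar> \<le> B * norm v"
    using kernel_derivative_bound[OF assms] by metis
  have "norm (k x - k y) \<le> B * norm (x - y)" for x y
    by (rule differentiable_bound[of UNIV k "\<lambda>z. fderiv k z"])
      (use B kernel_has_derivative[OF assms] in \<open>auto intro!: onorm_bound\<close>)
  with B(1) that show ?thesis by simp
qed

text \<open>\<open>Ck_on\<close> speaks of directional derivatives, hence a Lipschitz hypothesis for
  basis directions only. Summing over the basis gives a Lipschitz constant in operator norm, and the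
  mean value inequality on the segment from x to y gives the quadratic remainder. It serves kernels
  on the whole space and defining functions on balls.\<close>

lemma taylor_convex:
  fixes f :: "'a::euclidean_space => real"
  assumes "convex S" and D: "\<And>x. x \<in> S ==> (f has_derivative f' x) (at x)"
    and lip: "\<And>i. i \<in> Basis ==> \<exists>B. \<forall>x\<in>S. \<forall>y\<in>S. \<bar>f' x i - f' y i\<bar> \<le> B * norm (x - y)"
  obtains B where "B > 0" "\<And>x y. x \<in> S ==> y \<in> S ==> \<bar>f y - f x - f' x (y - x)\<bar> \<le> B * (norm (y - x))^2"
proof -
  obtain B0 where B0: "\<And>i x y. i \<in> Basis ==> x \<in> S ==> y \<in> S ==> \<bar>f' x i - f' y i\<bar> \<le> B0 i * norm (x - y)"
    using lip by metis
  define B where "B i = \<bar>B0 i\<bar> + 1" for i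
  have B: "B i > 0" for i by (simp add: B_def)
  have B2: "\<bar>f' x i - f' y i\<bar> \<le> B i * norm (x - y)" if "i \<in> Basis" "x \<in> S" "y \<in> S" for i x y
    by (rule order_trans[OF B0[OF that]]) (auto simp: B_def intro!: mult_right_mono)
  let ?S = "\<Sum>i\<in>(Basis::'a set). B i"
  have S: "?S > 0" by (intro sum_pos B) auto
  have lin: "\<bar>f' x v - f' y v\<bar> \<le> ?S * norm (x - y) * norm v" if "x \<in> S" "y \<in> S" for x y v
  proof -
    let ?D = "\<lambda>v. f' x v - f' y v"
    have bl: "bounded_linear ?D"
      by (intro bounded_linear_sub has_derivative_bounded_linear[OF D] that)
    interpret bounded_linear ?D by (rule bl)
    have "\<bar>?D v\<bar> = \<bar>?D (\<Sum>i\<in>Basis. (v \<bullet> i) *\<^sub>R i)\<bar>"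
      by (simp add: euclidean_representation)
    also have "\<dots> = \<bar>\<Sum>i\<in>Basis. (v \<bullet> i) * ?D i\<bar>"
      by (simp only: sum scaleR real_scaleR_def)
    also have "\<dots> \<le> (\<Sum>i\<in>Basis. \<bar>(v \<bullet> i) * ?D i\<bar>)" by (rule sum_abs)
    also have "\<dots> \<le> (\<Sum>i\<in>Basis. B i * norm (x - y) * norm v)"
    proof (rule sum_mono)
      fix i :: 'a assume "i \<in> Basis"
      then have "\<bar>v \<bullet> i\<bar> * \<bar>?D i\<bar> \<le> norm v * (B i * norm (x - y))"
        by (intro mult_mono B2 Basis_le_norm that) auto
      then show "\<bar>(v \<bullet> i) * ?D i\<bar> \<le> B i * norm (x - y) * norm v"
        by (simp add: abs_mult mult.commute)
    qed
    finally show ?thesis by (simp add: sum_distrib_right)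
  qed
  have "\<bar>f y - f x - f' x (y - x)\<bar> \<le> ?S * (norm (y - x))^2" if "x \<in> S" "y \<in> S" for x y
  proof -
    let ?T = "closed_segment x y"
    have TS: "?T \<subseteq> S" using \<open>convex S\<close> that by (simp add: closed_segment_subset)
    have "norm (f y - f x - f' x (y - x)) \<le> norm (y - x) * (?S * norm (y - x))"
    proof (rule differentiable_bound_linearization[where S="?T" and f'=f'])
      show "x + t *\<^sub>R (y - x) \<in> ?T" if "t \<in> {0..1}" for t
      proof -
        have "x + t *\<^sub>R (y - x) = (1 - t) *\<^sub>R x + t *\<^sub>R y" by (simp add: algebra_simps)
        with that show ?thesis unfolding in_segment by (intro exI[of _ t] conjI) simp_all
      qed
      show "(f has_derivative f' z) (at z within ?T)" if "z \<in> ?T" for z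
        by (rule has_derivative_at_withinI[OF D]) (use that TS in blast)
      show "onorm (f' z - f' x) \<le> ?S * norm (y - x)" if z: "z \<in> ?T" for z
      proof (rule onorm_bound)
        show "0 \<le> ?S * norm (y - x)" using S by simp
        have "norm (z - x) \<le> norm (y - x)" using segment_bound(1)[OF z] by (simp add: norm_minus_commute)
        then have "?S * norm (z - x) * norm v \<le> ?S * norm (y - x) * norm v" for v :: 'a
          using S by (intro mult_right_mono mult_left_mono) auto
        then show "norm ((f' z - f' x) v) \<le> ?S * norm (y - x) * norm v" for v
          using lin[of z x v] z TS \<open>x \<in> S\<close> unfolding fun_diff_def real_norm_def
          by (meson order_trans subsetD)
      qed
    qed simp
    then show ?thesis by (simp add: power2_eq_square mult_ac)
  qed
  then show ?thesis using S that by blast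
qed

lemma kernel_taylor:
  assumes "kernel R k"
  obtains B where "B > 0"
    "\<And>z h. \<bar>k (z + h) - k z - fderiv k z h\<bar> \<le> B * (norm h)^2"
proof -
  obtain B where B: "B > 0"
    "\<And>x y. \<bar>k y - k x - fderiv k x (y - x)\<bar> \<le> B * (norm (y - x))^2"
  proof (rule taylor_convex[of UNIV k "\<lambda>z. fderiv k z"])
    show "\<exists>B. \<forall>x\<in>UNIV. \<forall>y\<in>UNIV. \<bar>fderiv k x i - fderiv k y i\<bar> \<le> B * norm (x - y)" for i
      using kernel_lipschitz[OF kernel_derivative[OF assms]] by metis
  qed (use kernel_has_derivative[OF assms] in auto)
  then show ?thesis using that[of B] by (metis add_diff_cancel_left')
qed

section \<open>Convolution with a smooth kernel\<close>

lemma conv_integrable: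
  fixes F :: "'a::euclidean_space => 'b::euclidean_space"
  assumes "kernel R k" "integrable lborel F"
  shows "integrable lborel (\<lambda>x. k (y - x) *\<^sub>R F x)"
proof -
  obtain B where B: "B > 0" "\<And>z. \<bar>k z\<bar> \<le> B" using kernel_bounded[OF assms(1)] by metis
  note [measurable] = kernel_borel[OF assms(1)] borel_measurable_integrable[OF assms(2)]
  show ?thesis
  proof (rule bochner_bound[of _ "\<lambda>x. B *\<^sub>R F x"])
    show "integrable lborel (\<lambda>x. B *\<^sub>R F x)" using assms(2) by simp
    show "AE x in lborel. norm (k (y - x) *\<^sub>R F x) \<le> norm (B *\<^sub>R F x)"
      using B by (auto simp: mult_right_mono abs_of_pos intro!: AE_I2)
  qed measurable
qed

text \<open>The Taylor remainder of the kernel is at most B |h|^2 uniformly in its argument, so the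
  remainder of the convolution is at most B |h|^2 times the L^1 norm of F. This explicit rate
  replaces a limit under the integral.\<close>

lemma conv_has_derivative:
  fixes F :: "'a::euclidean_space => 'b::euclidean_space"
  assumes "kernel R k" "integrable lborel F"
  shows "(conv k F has_derivative (\<lambda>v. conv (\<lambda>z. fderiv k z v) F y)) (at y)"
proof -
  let ?D = "\<lambda>z. fderiv k z"
  obtain B where B: "B > 0" "\<And>z h. \<bar>k (z + h) - k z - ?D z h\<bar> \<le> B * (norm h)^2"
    using kernel_taylor[OF assms(1)] by metis
  obtain B' where B': "B' > 0" "\<And>z h. \<bar>?D z h\<bar> \<le> B' * norm h"
    using kernel_derivative_bound[OF assms(1)] by metis
  let ?I = "LBINT x. norm (F x)"
  have intD: "integrable lborel (\<lambda>x. ?D (y - x) v *\<^sub>R F x)" for y v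
    by (rule conv_integrable[OF kernel_derivative[OF assms(1)] assms(2)])
  have intk: "integrable lborel (\<lambda>x. k (y - x) *\<^sub>R F x)" for y
    by (rule conv_integrable[OF assms])
  have I0: "?I \<ge> 0" by simp
  show ?thesis unfolding has_derivative_at'
  proof (intro conjI allI impI)
    show "bounded_linear (\<lambda>v. conv (\<lambda>z. ?D z v) F y)"
    proof (rule bounded_linear_intro)
      show "conv (\<lambda>z. ?D z (v + w)) F y = conv (\<lambda>z. ?D z v) F y + conv (\<lambda>z. ?D z w) F y" for v w
        unfolding conv_def using intD
        by (simp add: linear_add[OF bounded_linear.linear[OF kernel_linear[OF assms(1)]]] scaleR_add_left)
      show "conv (\<lambda>z. ?D z (r *\<^sub>R v)) F y = r *\<^sub>R conv (\<lambda>z. ?D z v) F y" for r v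
        unfolding conv_def
        by (simp add: linear_cmul[OF bounded_linear.linear[OF kernel_linear[OF assms(1)]]] flip: scaleR_scaleR)
      show "norm (conv (\<lambda>z. ?D z v) F y) \<le> norm v * (B' * ?I)" for v
      proof -
        have "norm (conv (\<lambda>z. ?D z v) F y) \<le> (LBINT x. (B' * norm v) * norm (F x))"
          unfolding conv_def
          by (rule Bochner_Integration.integral_norm_bound_integral[OF intD])
            (use assms(2) B' in \<open>auto intro!: mult_right_mono\<close>)
        then show ?thesis by (simp add: mult_ac)
      qed
    qed
  next
    fix e :: real assume e: "e > 0"
    \<comment> \<open>The added 1 keeps the denominator positive when F vanishes almost
      everywhere.\<close>
    define d where "d = e / (B * (?I + 1))"
    have BI: "B * (?I + 1) > 0" using B(1) I0 by (intro mult_pos_pos) linarith+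
    have d: "d > 0" unfolding d_def using e BI by simp
    show "\<exists>d>0. \<forall>x'. 0 < norm (x' - y) \<and> norm (x' - y) < d -->
      norm (conv k F x' - conv k F y - conv (\<lambda>z. ?D z (x' - y)) F y) / norm (x' - y) < e"
    proof (intro exI[of _ d] conjI allI impI d)
      fix x' assume x': "0 < norm (x' - y) \<and> norm (x' - y) < d"
      define h where "h = x' - y"
      have eq: "conv k F x' - conv k F y - conv (\<lambda>z. ?D z (x' - y)) F y =
        (LBINT x. (k (y - x + h) - k (y - x) - ?D (y - x) h) *\<^sub>R F x)"
        unfolding conv_def h_def[symmetric] using intk[of x'] intk[of y] intD[of y h]
        by (simp add: scaleR_diff_left h_def algebra_simps)
      have "norm (conv k F x' - conv k F y - conv (\<lambda>z. ?D z (x' - y)) F y)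
        \<le> (LBINT x. (B * (norm h)^2) * norm (F x))"
        unfolding eq
      proof (rule Bochner_Integration.integral_norm_bound_integral)
        have "integrable lborel (\<lambda>x. k (x' - x) *\<^sub>R F x - k (y - x) *\<^sub>R F x - ?D (y - x) h *\<^sub>R F x)"
          by (intro Bochner_Integration.integrable_diff intk intD)
        then show "integrable lborel (\<lambda>x. (k (y - x + h) - k (y - x) - ?D (y - x) h) *\<^sub>R F x)"
          by (simp add: scaleR_diff_left h_def algebra_simps)
        show "integrable lborel (\<lambda>x. (B * (norm h)^2) * norm (F x))" using assms(2) by simp
        show "norm ((k (y - x + h) - k (y - x) - ?D (y - x) h) *\<^sub>R F x) \<le> (B * (norm h)^2) * norm (F x)" for x
          using B(2)[of "y - x" h] by (simp add: mult_right_mono)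
      qed
      also have "\<dots> = norm h * (norm h * (B * ?I))" by (simp add: power2_eq_square mult_ac)
      finally have "norm (conv k F x' - conv k F y - conv (\<lambda>z. ?D z (x' - y)) F y) / norm h \<le> norm h * (B * ?I)"
        using x' by (simp add: h_def[symmetric] divide_le_eq mult_ac)
      also have "\<dots> \<le> norm h * (B * (?I + 1))" using B(1) by (intro mult_left_mono) auto
      also have "\<dots> < d * (B * (?I + 1))" using x' BI by (intro mult_strict_right_mono) (auto simp: h_def)
      also have "\<dots> = e"
        unfolding d_def using BI by (metis less_irrefl nonzero_mult_div_cancel_right times_divide_eq_left)
      finally show "norm (conv k F x' - conv k F y - conv (\<lambda>z. ?D z (x' - y)) F y) / norm (x' - y) < e"
        by (simp add: h_def)
    qed
  qed
qed

lemma Ck_on_conv: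
  assumes "kernel R k" "integrable lborel F"
  shows "Ck_on n UNIV (conv k F)"
  using assms(1)
proof (induction n arbitrary: k)
  case 0
  then show ?case
    using has_derivative_continuous[OF conv_has_derivative[OF 0 assms(2)]]
    by (simp add: continuous_on_eq_continuous_at)
next
  case (Suc n)
  show ?case
  proof (rule Ck_onI)
    show "(conv k F has_derivative (\<lambda>v. conv (\<lambda>z. fderiv k z v) F y)) (at y)" for y
      by (rule conv_has_derivative[OF Suc.prems assms(2)])
    show "Ck_on n UNIV (\<lambda>x. conv (\<lambda>z. fderiv k z v) F x)" for v
      by (rule Suc.IH[OF kernel_derivative[OF Suc.prems]])
  qed
qed

lemma conv_frechet_derivative:
  assumes "kernel R k" "integrable lborel F"
  shows "fderiv (conv k F) y v = conv (\<lambda>z. fderiv k z v) F y"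
  using frechet_derivative_at[OF conv_has_derivative[OF assms, of y]] by metis

lemma conv_zero:
  assumes "kernel R k" "\<And>x. x \<in> cball y R ==> F x = 0" shows "conv k F y = 0"
proof -
  have "k (y - x) *\<^sub>R F x = 0" for x
    using assms(2)[of x] kernel_zero[OF assms(1), of "y - x"]
    by (cases "norm (y - x) \<le> R") (auto simp: dist_norm)
  then show ?thesis by (simp only: conv_def Bochner_Integration.integral_zero)
qed

lemma conv_test_function:
  fixes F :: "'a::euclidean_space => 'b::euclidean_space" and \<Omega> :: "'a set"
  assumes "kernel R k" "integrable lborel F" and K: "compact K" "\<And>x. x \<notin> K ==> F x = 0"
    and sub: "\<And>x. x \<in> K ==> cball x R \<subseteq> \<Omega>"
  shows "conv k F \<in> test_functions \<Omega>"
proof -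
  let ?K = "{x + y |x y. x \<in> K \<and> y \<in> cball 0 R}"
  have cpt: "compact ?K" by (rule compact_sums[OF K(1) compact_cball])
  have sup: "{y. conv k F y \<noteq> 0} \<subseteq> ?K"
  proof safe
    fix y assume "conv k F y \<noteq> 0"
    then obtain x where x: "x \<in> cball y R" "F x \<noteq> 0" using conv_zero[OF assms(1)] by metis
    have "y = x + (y - x) \<and> x \<in> K \<and> y - x \<in> cball 0 R"
      using x K(2) by (auto simp: dist_norm norm_minus_commute)
    then show "\<exists>x ya. y = x + ya \<and> x \<in> K \<and> ya \<in> cball 0 R" by blast
  qed
  have cl: "closure {y. conv k F y \<noteq> 0} \<subseteq> ?K"
    by (rule closure_minimal[OF sup compact_imp_closed[OF cpt]])
  have "?K \<subseteq> \<Omega>"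
  proof safe
    fix x y :: 'a assume "x \<in> K" "y \<in> cball 0 R"
    then show "x + y \<in> \<Omega>" using sub[of x] by (auto simp: dist_norm)
  qed
  moreover have "compact (closure {y. conv k F y \<noteq> 0})"
    using bounded_subset[OF compact_imp_bounded[OF cpt] cl] by (simp add: compact_eq_bounded_closed)
  ultimately show ?thesis
    unfolding test_functions_def using Ck_on_conv[OF assms(1,2)] cl by blast
qed

text \<open>One constant serves all radii: the kernel scales with the inverse volume of the ball and
  its gradient with a further 1/\<epsilon>. This uniformity is what makes the commutator bound
  exactly of order 1/\<epsilon>.\<close>

lemma mollifier:
  obtains C where "C > 0"
    "\<And>\<epsilon>. \<epsilon> > 0 ==> \<exists>\<eta>::'a::euclidean_space => real. kernel \<epsilon> \<eta> \<and> (\<forall>z. 0 \<le> \<eta> z) \<and> integral\<^sup>L lborel \<eta> = 1 \<and>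
      (\<forall>z. \<eta> z \<le> C / measure lborel (cball (0::'a) \<epsilon>)) \<and>
      (\<forall>z v. \<bar>fderiv \<eta> z v\<bar> \<le> C / (\<epsilon> * measure lborel (cball (0::'a) \<epsilon>)) * norm v)"
proof -
  define fl' where "fl' = flat_exp (pCons 0 (pCons 0 (1 - pderiv 1)))"
  have fD: "(flat has_real_derivative fl' s) (at s)" for s
    unfolding flat_def fl'_def by (rule flat_exp_has_derivative)
  have "compact (fl' ` {0..1})"
    unfolding fl'_def using Ck_on_flat_exp[of 0]
    by (intro compact_continuous_image) (auto intro: continuous_on_subset)
  then obtain B where B: "B > 0" "\<And>s. s \<in> {0..1} ==> \<bar>fl' s\<bar> \<le> B"
    by (metis (no_types, lifting) bounded_pos compact_imp_bounded imageI real_norm_def)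
  have fl'0: "fl' s = 0" if "s \<le> 0" for s using that by (simp add: fl'_def flat_exp_def)
  let ?V = "\<lambda>\<epsilon>. measure lborel (cball (0::'a) \<epsilon>)"
  let ?n = "DIM('a)"
  \<comment> \<open>On the ball of half the radius the argument \<open>q\<close> of
    \<open>flat\<close> is at least 3/4, and that ball has volume V / 2^n; so c0 V bounds the mass
    of the unnormalised bump from below.\<close>
  define c0 where "c0 = flat (3/4) / 2 ^ ?n"
  have c0: "c0 > 0" by (simp add: c0_def flat_pos)
  \<comment> \<open>The summand 1 serves the bound on the kernel. In the gradient bound, B bounds
    the derivative of \<open>flat\<close> on [0,1] and 2 comes from differentiating |z|^2.\<close>
  define C where "C = (1 + 2 * B) / c0"
  have C: "C > 0" unfolding C_def using B(1) c0 by (intro divide_pos_pos) auto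
  have "\<exists>\<eta>::'a => real. kernel \<epsilon> \<eta> \<and> (\<forall>z. 0 \<le> \<eta> z) \<and> integral\<^sup>L lborel \<eta> = 1 \<and>
      (\<forall>z. \<eta> z \<le> C / ?V \<epsilon>) \<and> (\<forall>z v. \<bar>fderiv \<eta> z v\<bar> \<le> C / (\<epsilon> * ?V \<epsilon>) * norm v)"
    if \<epsilon>: "\<epsilon> > 0" for \<epsilon>
  proof -
    define q where "q = (\<lambda>z::'a. 1 + (- 1 / \<epsilon>^2) * (z \<bullet> z))"
    define g where "g = (\<lambda>z. flat (q z))"
    have Ckq: "Ck_on n UNIV q" for n
    proof -
      have "Ck_on n UNIV (\<lambda>z::'a. z \<bullet> z)"
        by (rule Ck_on_inner[OF Ck_on_bounded_linear[OF bounded_linear_ident] Ck_on_bounded_linear[OF bounded_linear_ident]])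
      from Ck_on_add[OF Ck_on_const Ck_on_mult[OF Ck_on_const this]] show ?thesis unfolding q_def .
    qed
    have Ckg: "Ck_on n UNIV g" for n unfolding g_def by (rule Ck_on_compose_real[OF Ck_on_flat Ckq])
    have qz: "q z \<le> 0" if "\<epsilon> \<le> norm z" for z
    proof -
      have "\<epsilon>^2 \<le> (norm z)^2" using that \<epsilon> by (intro power_mono) auto
      then show ?thesis using \<epsilon> by (simp add: q_def power2_norm_eq_inner field_simps)
    qed
    have gz: "g z = 0" if "\<epsilon> \<le> norm z" for z
      unfolding g_def by (rule flat_zero[OF qz[OF that]])
    have g01: "0 \<le> g z" "g z \<le> 1" for z by (auto simp: g_def flat_nonneg flat_le_1)
    have kg: "kernel \<epsilon> g" unfolding kernel_def using Ckg gz by auto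
    have gD: "fderiv g z v = fl' (q z) * ((- 2 / \<epsilon>^2) * (z \<bullet> v))" for z v
    proof -
      have "((\<lambda>z::'a. z \<bullet> z) has_derivative (\<lambda>v. 2 * (z \<bullet> v))) (at z)"
        by (auto intro!: derivative_eq_intros simp: inner_commute)
      from has_derivative_add[OF has_derivative_const[of 1] has_derivative_mult_right[OF this, of "- 1 / \<epsilon>^2"]]
      have "(q has_derivative (\<lambda>v. (- 2 / \<epsilon>^2) * (z \<bullet> v))) (at z)"
        unfolding q_def by simp
      from has_derivative_compose[OF this fD[of "q z", unfolded has_field_derivative_def]]
      have "(g has_derivative (\<lambda>v. fl' (q z) * ((- 2 / \<epsilon>^2) * (z \<bullet> v)))) (at z)" unfolding g_def .
      from frechet_derivative_at[OF this] show ?thesis by metis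
    qed
    have gDb: "\<bar>fderiv g z v\<bar> \<le> 2 * B / \<epsilon> * norm v" for z v
    proof (cases "\<epsilon> \<le> norm z")
      case True
      then show ?thesis using B \<epsilon> by (simp add: gD fl'0[OF qz[OF True]])
    next
      case False
      have "(norm z)^2 \<le> \<epsilon>^2" using False by (intro power_mono) auto
      then have "q z \<in> {0..1}" using \<epsilon> by (simp add: q_def power2_norm_eq_inner field_simps)
      then have 1: "\<bar>fl' (q z)\<bar> \<le> B" by (rule B(2))
      have "\<bar>z \<bullet> v\<bar> \<le> norm z * norm v" by (rule Cauchy_Schwarz_ineq2)
      also have "\<dots> \<le> \<epsilon> * norm v" using False by (intro mult_right_mono) auto
      finally have "\<bar>(- 2 / \<epsilon>^2) * (z \<bullet> v)\<bar> \<le> 2 / \<epsilon>^2 * (\<epsilon> * norm v)"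
        using \<epsilon> by (simp add: abs_mult divide_right_mono)
      then have "\<bar>fl' (q z)\<bar> * \<bar>(- 2 / \<epsilon>^2) * (z \<bullet> v)\<bar> \<le> B * (2 / \<epsilon>^2 * (\<epsilon> * norm v))"
        using 1 B(1) by (intro mult_mono) auto
      then show ?thesis using \<epsilon> by (simp add: gD abs_mult power2_eq_square mult_ac)
    qed
    have emf: "emeasure lborel (cball (0::'a) r) < \<infinity>" for r
      by (rule emeasure_bounded_finite) simp
    have gint: "integrable lborel g"
      by (rule bochner_bound[of _ "ind (cball 0 \<epsilon>) :: _ => real"])
        (use emf kernel_borel[OF kg] g01 gz in \<open>auto simp: indicator_def intro!: AE_I2 integrable_real_indicator\<close>)
    define I where "I = integral\<^sup>L lborel g"
    have "flat (3/4) * ?V (\<epsilon>/2) = (LBINT z. flat (3/4) * ind (cball (0::'a) (\<epsilon>/2)) z)"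
      by simp
    also have "\<dots> \<le> I" unfolding I_def
    proof (rule integral_mono[OF _ gint])
      show "integrable lborel (\<lambda>z. flat (3/4) * ind (cball (0::'a) (\<epsilon>/2)) z)"
        using emf by (auto intro!: integrable_real_indicator)
      show "flat (3/4) * ind (cball (0::'a) (\<epsilon>/2)) z \<le> g z" for z
      proof (cases "norm z \<le> \<epsilon> / 2")
        case True
        then have "(norm z)^2 \<le> (\<epsilon>/2)^2" by (intro power_mono) auto
        then have "3/4 \<le> q z" using \<epsilon> by (simp add: q_def power2_norm_eq_inner field_simps)
        then show ?thesis using True by (simp add: g_def flat_mono)
      qed (simp add: g01)
    qed
    finally have "flat (3/4) * ?V (\<epsilon>/2) \<le> I" .
    moreover have "?V (\<epsilon>/2) = ?V \<epsilon> / 2 ^ ?n"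
      using \<epsilon> by (simp add: content_cball power_divide)
    ultimately have I: "c0 * ?V \<epsilon> \<le> I" by (simp add: c0_def)
    have V: "?V \<epsilon> > 0" using \<epsilon> by (simp add: content_cball_pos)
    have Ip: "I > 0" using I c0 V by (meson less_le_trans mult_pos_pos)
    have C1: "1 / I \<le> (1 / c0) / ?V \<epsilon>"
      using I Ip c0 V by (simp add: field_simps)
    define \<eta> where "\<eta> = (\<lambda>z. g z * (1 / I))"
    have k\<eta>: "kernel \<epsilon> \<eta>"
      unfolding kernel_def \<eta>_def
    proof (intro conjI allI impI)
      show "Ck_on n UNIV (\<lambda>z. g z * (1 / I))" for n by (rule Ck_on_mult[OF Ckg Ck_on_const])
      show "g z * (1 / I) = 0" if "\<epsilon> < norm z" for z using gz that by simp
    qed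
    have "(\<eta> has_derivative (\<lambda>v. fderiv g z v * (1 / I))) (at z)" for z
      unfolding \<eta>_def by (rule has_derivative_mult_left[OF kernel_has_derivative[OF kg]])
    then have \<eta>D: "fderiv \<eta> z v = fderiv g z v * (1 / I)" for z v
      using frechet_derivative_at by metis
    have CV: "(1 / c0) / ?V \<epsilon> \<le> C / ?V \<epsilon>"
      using B(1) V c0 by (intro divide_right_mono) (auto simp: C_def divide_right_mono)
    show ?thesis
    proof (intro exI[of _ \<eta>] conjI allI)
      show "kernel \<epsilon> \<eta>" by (rule k\<eta>)
      show "0 \<le> \<eta> z" for z using g01 Ip by (simp add: \<eta>_def)
      show "integral\<^sup>L lborel \<eta> = 1" using gint Ip by (simp add: \<eta>_def I_def)
      have "\<eta> z \<le> 1 / I" for z using g01[of z] Ip by (simp add: \<eta>_def divide_right_mono)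
      then show "\<eta> z \<le> C / ?V \<epsilon>" for z using C1 CV by (meson order_trans)
      show "\<bar>fderiv \<eta> z v\<bar> \<le> C / (\<epsilon> * ?V \<epsilon>) * norm v" for z v
      proof -
        have "\<bar>fderiv \<eta> z v\<bar> \<le> (2 * B / \<epsilon> * norm v) * ((1 / c0) / ?V \<epsilon>)"
          unfolding \<eta>D abs_mult using gDb[of z v] C1 Ip B(1) \<epsilon> by (intro mult_mono) auto
        also have "\<dots> = (2 * B / c0) / (\<epsilon> * ?V \<epsilon>) * norm v" by simp
        also have "\<dots> \<le> C / (\<epsilon> * ?V \<epsilon>) * norm v"
          using c0 V \<epsilon> by (intro mult_right_mono divide_right_mono) (auto simp: C_def divide_right_mono)
        finally show ?thesis .
      qed
    qed
  qed
  then show ?thesis using C that by blast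
qed

section \<open>Geometry of domains with twice differentiable boundary\<close>

text \<open>A relation instead of a choice, so that the estimates apply to every minimiser.
  Uniqueness close to the boundary is the case of equal base points in
  \<open>nearest_projection_lipschitz_uniform\<close>.\<close>

definition nearest :: "'a::euclidean_space set => 'a => 'a => bool" where
  "nearest F x y \<longleftrightarrow> y \<in> F \<and> (\<forall>z\<in>F. dist x y \<le> dist x z)"

lemma nearest_infdist: "nearest F x y ==> infdist x F = dist x y"
  unfolding nearest_def infdist_def by (auto intro!: cInf_eq_minimum)

lemma nearest_exists:
  assumes "compact F" "F \<noteq> {}" obtains y where "nearest F x y"
  using distance_attains_inf[of F x] assms unfolding nearest_def by (metis compact_imp_closed)

lemma nearest_closest_point:
  assumes "compact F" "F \<noteq> {}" shows "nearest F x (closest_point F x)"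
  using closest_point_exists[of F x] assms unfolding nearest_def by (auto simp: compact_imp_closed)

text \<open>A defining function of the domain near \<open>y0\<close>: \<open>h\<close> is positive in the domain and negative
  outside, and grows with unit speed in the direction \<open>e\<close>.\<close>

definition defining_fun :: "'a::euclidean_space set => 'a => real => 'a => ('a => real) => bool" where
  "defining_fun \<Omega> y0 r e h \<longleftrightarrow> r > 0 \<and> norm e = 1 \<and> Ck_on 2 UNIV h \<and>
     (\<forall>x t. h (x + t *\<^sub>R e) = h x + t) \<and> \<Omega> \<inter> ball y0 r = {x \<in> ball y0 r. h x > 0}"

lemma C2_boundary_defining_fun:
  assumes "C2_boundary \<Omega>" "y \<in> frontier \<Omega>"
  obtains r e h where "defining_fun \<Omega> y r e h"
proof -
  obtain r e \<gamma> where r: "r > 0" "norm e = 1" "Ck_on 2 UNIV \<gamma>"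
    "\<Omega> \<inter> ball y r = {x \<in> ball y r. \<gamma> (x - (x \<bullet> e) *\<^sub>R e) < x \<bullet> e}"
    using assms unfolding C2_boundary_def by blast
  \<comment> \<open>The projection that feeds \<gamma> is invariant under translation along e, so
    such a translation changes only the first summand; this is the unit-speed property of
    \<open>h\<close>.\<close>
  define h where "h x = x \<bullet> e + (- 1) * \<gamma> (x - (x \<bullet> e) *\<^sub>R e)" for x
  have bl: "bounded_linear (\<lambda>x. x - (x \<bullet> e) *\<^sub>R e)"
    by (intro bounded_linear_sub bounded_linear_ident bounded_linear_scaleR_left
        bounded_linear_compose[OF bounded_linear_scaleR_left bounded_linear_inner_left])
  have "Ck_on 2 UNIV (\<lambda>x. \<gamma> (x - (x \<bullet> e) *\<^sub>R e + 0))"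
    by (rule Ck_on_compose_affine[OF bl r(3)])
  then have g: "Ck_on 2 UNIV (\<lambda>x. \<gamma> (x - (x \<bullet> e) *\<^sub>R e))" by (simp only: add_0_right)
  have "Ck_on 2 UNIV h"
    unfolding h_def by (rule Ck_on_add[OF Ck_on_bounded_linear[OF bounded_linear_inner_left] Ck_on_mult[OF Ck_on_const g]])
  moreover have ee: "e \<bullet> e = 1" using r(2) by (simp add: dot_square_norm)
  have P: "x + t *\<^sub>R e - ((x + t *\<^sub>R e) \<bullet> e) *\<^sub>R e = x - (x \<bullet> e) *\<^sub>R e" for x t
    by (simp add: inner_add_left ee algebra_simps)
  have "h (x + t *\<^sub>R e) = h x + t" for x t
    unfolding h_def P by (simp add: inner_add_left ee)
  moreover have "\<Omega> \<inter> ball y r = {x \<in> ball y r. h x > 0}"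
    unfolding r(4) h_def by auto
  ultimately have "defining_fun \<Omega> y r e h" unfolding defining_fun_def using r by blast
  then show ?thesis by (rule that)
qed

context
  fixes \<Omega> :: "'a::euclidean_space set" and y0 e :: 'a and r :: real and h :: "'a => real"
  assumes df: "defining_fun \<Omega> y0 r e h" and op: "open \<Omega>"
begin

lemma df_props: "r > 0" "norm e = 1" "Ck_on 2 UNIV h" "h (x + t *\<^sub>R e) = h x + t"
    "x \<in> ball y0 r ==> x \<in> \<Omega> \<longleftrightarrow> h x > 0"
  using df unfolding defining_fun_def by blast+

lemma df_derivative: "(h has_derivative fderiv h x) (at x)"
  using df_props(3) unfolding numeral_2_eq_2 by (rule Ck_onD)

lemma df_continuous: "continuous_on S h"
  using has_derivative_continuous[OF df_derivative] continuous_at_imp_continuous_on by blast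

lemma df_linear: "bounded_linear (fderiv h x)"
  by (rule has_derivative_bounded_linear[OF df_derivative])

lemma df_derivative_line:
  "((\<lambda>s. h (x + s *\<^sub>R v)) has_real_derivative fderiv h x v) (at 0)"
proof -
  have "((\<lambda>s. x + s *\<^sub>R v) has_derivative (\<lambda>s. s *\<^sub>R v)) (at 0)"
    by (auto intro!: derivative_eq_intros)
  from has_derivative_compose[OF this, of h "fderiv h x"] df_derivative[of x]
  have "((\<lambda>s. h (x + s *\<^sub>R v)) has_derivative (\<lambda>s. fderiv h x (s *\<^sub>R v))) (at 0)"
    by simp
  then show ?thesis
    unfolding has_field_derivative_def
    by (rule has_derivative_eq_rhs) (auto simp: fun_eq_iff linear_cmul[OF bounded_linear.linear[OF df_linear]])
qed

lemma df_derivative_e: "fderiv h x e = 1"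
proof -
  have "((\<lambda>s. h x + s) has_real_derivative 1) (at 0)" by (auto intro!: derivative_eq_intros)
  then have "((\<lambda>s. h (x + s *\<^sub>R e)) has_real_derivative 1) (at 0)" by (simp only: df_props(4))
  from DERIV_unique[OF df_derivative_line this] show ?thesis .
qed

lemma df_closure: "x \<in> ball y0 r ==> x \<in> closure \<Omega> ==> h x \<ge> 0"
proof (rule ccontr)
  assume x: "x \<in> ball y0 r" "x \<in> closure \<Omega>" "\<not> h x \<ge> 0"
  have "open (ball y0 r \<inter> {z. h z < 0})"
    by (rule open_Int[OF open_ball open_Collect_less[OF df_continuous continuous_on_const]])
  then have "\<Omega> \<inter> (ball y0 r \<inter> {z. h z < 0}) \<noteq> {}"
    using x open_Int_closure_eq_empty[of "ball y0 r \<inter> {z. h z < 0}" \<Omega>] by (auto simp: Int_commute)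
  then show False using df_props(5) by force
qed

text \<open>A zero of \<open>h\<close> lies outside the domain, but an arbitrarily small translation
  along e makes \<open>h\<close> positive; so zeros are exactly the limit points of the domain that
  it misses.\<close>

lemma df_frontier: assumes "x \<in> ball y0 r" shows "x \<in> frontier \<Omega> \<longleftrightarrow> h x = 0"
proof
  assume "x \<in> frontier \<Omega>"
  then have "x \<in> closure \<Omega>" "x \<notin> \<Omega>" using op by (auto simp: frontier_def interior_open)
  then show "h x = 0" using df_closure[OF assms] df_props(5)[OF assms] by auto
next
  assume h0: "h x = 0"
  then have "x \<notin> \<Omega>" using df_props(5)[OF assms] by simp
  moreover have "x \<in> closure \<Omega>" unfolding closure_approachable
  proof (intro allI impI)
    fix \<epsilon> :: real assume "\<epsilon> > 0"
    define t where "t = min \<epsilon> (r - dist y0 x) / 2"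
    have t: "0 < t" "t < \<epsilon>" "t < r - dist y0 x" using \<open>\<epsilon> > 0\<close> assms by (auto simp: t_def min_def)
    have dt: "dist (x + t *\<^sub>R e) x = t" using t df_props(2) by (simp add: dist_norm)
    have "x + t *\<^sub>R e \<in> ball y0 r"
      using dist_triangle[of y0 "x + t *\<^sub>R e" x] t dt by (simp add: dist_commute)
    moreover have "h (x + t *\<^sub>R e) > 0" using t h0 by (simp add: df_props(4))
    ultimately have "x + t *\<^sub>R e \<in> \<Omega>" using df_props(5) by blast
    then show "\<exists>y\<in>\<Omega>. dist y x < \<epsilon>"
      by (rule bexI[rotated]) (simp only: dt t)
  qed
  ultimately show "x \<in> frontier \<Omega>" using op by (simp add: frontier_def interior_open)
qed

text \<open>Follow the straight line in direction v and correct along e by the value of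
  \<open>h\<close>: the corrected curve stays on the zero set. Since the derivative of
  \<open>h\<close> in direction v is 0, the correction does not change the velocity at y.\<close>

lemma df_curve:
  assumes y: "y \<in> frontier \<Omega>" "y \<in> ball y0 r" and v: "fderiv h y v = 0"
  obtains c where "c 0 = y" "range c \<subseteq> frontier \<Omega>" "(c has_vector_derivative v) (at (0::real))"
proof -
  have hy: "h y = 0" using df_frontier y by blast
  define c0 where "c0 s = y + s *\<^sub>R v - h (y + s *\<^sub>R v) *\<^sub>R e" for s :: real
  have c0y: "c0 0 = y" by (simp add: c0_def hy)
  have "((\<lambda>s. h (y + s *\<^sub>R v)) has_derivative (\<lambda>s. 0 * s)) (at 0)"
    using df_derivative_line[of y v] v by (simp only: has_field_derivative_def)
  from has_derivative_diff[OF has_derivative_add[OF has_derivative_const[of y]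
        has_derivative_scaleR_left[OF has_derivative_ident, of v]] has_derivative_scaleR_left[OF this, of e]]
  have c0D: "(c0 has_vector_derivative v) (at 0)"
    unfolding c0_def has_vector_derivative_def by simp
  then have "isCont c0 0" by (rule has_vector_derivative_continuous)
  then have "\<forall>\<^sub>F s in at 0. c0 s \<in> ball y0 r"
    using y(2) c0y by (metis isCont_def open_ball topological_tendstoD)
  then obtain s0 where s0: "s0 > 0" "\<And>s. s \<noteq> 0 ==> dist s 0 < s0 ==> c0 s \<in> ball y0 r"
    unfolding eventually_at by blast
  have c0F: "c0 s \<in> frontier \<Omega>" if "s \<in> ball 0 s0" for s
  proof (cases "s = 0")
    case False
    then have "c0 s \<in> ball y0 r" using s0(2)[of s] that by (simp add: dist_commute)
    moreover have "h (c0 s) = 0" unfolding c0_def using df_props(4)[of "y + s *\<^sub>R v" "- h (y + s *\<^sub>R v)"] by simp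
    ultimately show ?thesis using df_frontier by blast
  qed (simp add: c0y y)
  \<comment> \<open>\<open>outward_normal\<close> quantifies over curves whose whole range lies in
    the frontier, so the curve is set to y outside a short interval.\<close>
  define c where "c s = (if s \<in> ball 0 s0 then c0 s else y)" for s
  have "(c has_vector_derivative v) (at 0)"
    by (rule has_vector_derivative_transform_within_open[OF c0D open_ball[of 0 s0]])
      (use s0(1) in \<open>auto simp: c_def\<close>)
  moreover have "range c \<subseteq> frontier \<Omega>" using c0F y by (auto simp: c_def)
  ultimately show ?thesis using that[of c] s0(1) c0y by (simp add: c_def)
qed

text \<open>Every v differs from a multiple of e by a vector in the kernel of the derivative of
  \<open>h\<close>, and that vector is the velocity of a boundary curve by \<open>df_curve\<close>.
  So a vector orthogonal to the boundary is a multiple of the gradient of \<open>h\<close>, with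
  factor n \<bullet> e.\<close>

lemma df_normal:
  assumes y: "y \<in> frontier \<Omega>" "y \<in> ball y0 r"
    and n: "\<And>c v. c 0 = y ==> range c \<subseteq> frontier \<Omega> ==> (c has_vector_derivative v) (at (0::real)) ==> n \<bullet> v = 0"
  shows "n \<bullet> v = (n \<bullet> e) * fderiv h y v"
proof -
  interpret bounded_linear "fderiv h y" by (rule df_linear)
  let ?w = "v - fderiv h y v *\<^sub>R e"
  have "fderiv h y ?w = 0"
    by (simp add: diff scaleR df_derivative_e)
  from df_curve[OF y this] have "n \<bullet> ?w = 0" using n by metis
  then show ?thesis by (simp add: inner_diff_right)
qed

end

section \<open>Nearest boundary points and the outward normal\<close>

lemma nearest_orthogonal:
  assumes "nearest F x y" "c 0 = y" "range c \<subseteq> F" "(c has_vector_derivative v) (at (0::real))"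
  shows "(x - y) \<bullet> v = 0"
proof -
  let ?f = "\<lambda>s. (x - c s) \<bullet> (x - c s)"
  have "((\<lambda>s. x - c s) has_derivative (\<lambda>s. - (s *\<^sub>R v))) (at 0)"
    using has_derivative_diff[OF has_derivative_const[of x] assms(4)[unfolded has_vector_derivative_def]] by simp
  from has_derivative_inner[OF this this]
  have "(?f has_derivative (\<lambda>s. s * (- 2 * ((x - y) \<bullet> v)))) (at 0)"
    by (simp add: assms(2) inner_commute algebra_simps)
  then have D: "(?f has_real_derivative (- 2 * ((x - y) \<bullet> v))) (at 0)"
    unfolding has_field_derivative_def
    by (rule has_derivative_eq_rhs) (simp add: fun_eq_iff)
  have "?f 0 \<le> ?f s" for s
  proof -
    have "dist x y \<le> dist x (c s)" using assms(1,3) unfolding nearest_def by blast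
    then have "(dist x y)^2 \<le> (dist x (c s))^2" by (intro power_mono) auto
    then show ?thesis by (simp add: assms(2) dist_norm power2_norm_eq_inner)
  qed
  then have "- 2 * ((x - y) \<bullet> v) = 0" by (intro DERIV_local_min[OF D, of 1]) auto
  then show ?thesis by simp
qed

text \<open>Resolves the definite description in \<open>outward_normal\<close> at boundary points
  that are nearest to some point of the domain. The unit vector from x to y qualifies; by
  \<open>df_normal\<close> any other candidate is a multiple of it of modulus 1, and the opposite
  vector points to the wrong side.\<close>

lemma outward_normal_nearest:
  assumes \<Omega>: "bounded_C2_domain \<Omega>" and x: "x \<in> \<Omega>" and near: "nearest (frontier \<Omega>) x y"
  shows "outward_normal \<Omega> y = (y - x) /\<^sub>R norm (y - x)"
proof -
  have op: "open \<Omega>" and C2: "C2_boundary \<Omega>" using \<Omega> by (auto simp: bounded_C2_domain_def)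
  have yF: "y \<in> frontier \<Omega>" using near by (simp add: nearest_def)
  have yn: "y \<notin> \<Omega>" using yF op by (simp add: frontier_def interior_open)
  then have \<rho>: "norm (y - x) > 0" using x by auto
  obtain r e h where df: "defining_fun \<Omega> y r e h" using C2_boundary_defining_fun[OF C2 yF] .
  note dp = df_props[OF df op]
  have yb: "y \<in> ball y r" using dp(1) by simp
  have hy: "h y = 0" using df_frontier[OF df op yb] yF by blast
  let ?D = "fderiv h y"
  define n0 where "n0 = (y - x) /\<^sub>R norm (y - x)"
  have nn: "norm n0 = 1" using \<rho> by (simp add: n0_def)
  have orth: "n0 \<bullet> v = 0" if "c 0 = y" "range c \<subseteq> frontier \<Omega>" "(c has_vector_derivative v) (at (0::real))" for c v
  proof -
    have "(x - y) \<bullet> v = 0" by (rule nearest_orthogonal[OF near that])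
    then show ?thesis by (simp add: n0_def inner_diff_left)
  qed
  \<comment> \<open>A connected ball that left the domain would meet the frontier, at a distance
    from x below the minimal one.\<close>
  have ballsub: "ball x (norm (y - x)) \<subseteq> \<Omega>"
  proof (rule ccontr)
    assume "\<not> ball x (norm (y - x)) \<subseteq> \<Omega>"
    moreover have "ball x (norm (y - x)) \<inter> \<Omega> \<noteq> {}" using x \<rho> centre_in_ball by blast
    ultimately have "ball x (norm (y - x)) \<inter> frontier \<Omega> \<noteq> {}"
      by (intro connected_Int_frontier) auto
    then obtain z where "z \<in> frontier \<Omega>" "dist x z < norm (y - x)" by auto
    then show False using near unfolding nearest_def by (metis dist_commute dist_norm not_le)
  qed
  have inside: "y - s *\<^sub>R n0 \<in> \<Omega>" if "0 < s" "s < norm (y - x)" for s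
  proof -
    have "y - s *\<^sub>R n0 - x = (norm (y - x) - s) *\<^sub>R n0"
      using \<rho> by (simp add: n0_def algebra_simps)
    then have "dist x (y - s *\<^sub>R n0) = norm (y - x) - s"
      using that nn by (simp add: dist_norm norm_minus_commute[of x])
    then show ?thesis using that ballsub by auto
  qed
  have n0v: "n0 \<bullet> v = (n0 \<bullet> e) * ?D v" for v
    by (rule df_normal[OF df op yF yb]) (use orth in blast)
  have n0n0: "n0 \<bullet> n0 = 1" using nn by (simp add: dot_square_norm)
  have Dn0: "?D n0 \<noteq> 0" "n0 \<bullet> e \<noteq> 0" using n0v[of n0] n0n0 by auto
  \<comment> \<open>Points shortly behind y lie in the ball around x, hence in the domain, where
    \<open>h\<close> is positive while h y = 0. This fixes the sign of the derivative along
    n0.\<close>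
  have Dneg: "?D n0 < 0"
  proof (rule ccontr)
    assume "\<not> ?D n0 < 0"
    then have pos: "?D n0 > 0" using Dn0 by linarith
    obtain d where d: "d > 0" "\<And>s. 0 < s ==> s < d ==> h (y + (- s) *\<^sub>R n0) < h y"
      using DERIV_pos_inc_left[OF df_derivative_line[OF df op, of y n0] pos] by auto
    define s where "s = min (min d r) (norm (y - x)) / 2"
    have s: "0 < s" "s < d" "s < r" "s < norm (y - x)" using d(1) dp(1) \<rho> by (auto simp: s_def min_def)
    have "y - s *\<^sub>R n0 \<in> ball y r" using s nn by (simp add: dist_norm)
    then have "h (y - s *\<^sub>R n0) > 0" using dp(5) inside[OF s(1,4)] by blast
    then show False using d(2)[OF s(1,2)] hy by simp
  qed
  obtain d where d: "d > 0" "\<And>s. 0 < s ==> s < d ==> h (y + s *\<^sub>R n0) < 0"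
    using DERIV_neg_dec_right[OF df_derivative_line[OF df op, of y n0] Dneg] hy by auto
  have outside: "y + s *\<^sub>R n0 \<notin> closure \<Omega>" if "0 < s" "s < min d r" for s
  proof
    assume "y + s *\<^sub>R n0 \<in> closure \<Omega>"
    moreover have "y + s *\<^sub>R n0 \<in> ball y r" using that nn by (simp add: dist_norm)
    ultimately have "h (y + s *\<^sub>R n0) \<ge> 0" by (rule df_closure[OF df op, rotated])
    then show False using d(2)[of s] that by auto
  qed
  show ?thesis unfolding outward_normal_def n0_def[symmetric]
  proof (rule the_equality)
    show "norm n0 = 1 \<and> (\<forall>c v. c 0 = y \<and> range c \<subseteq> frontier \<Omega> \<and> (c has_vector_derivative v) (at (0::real))
        --> n0 \<bullet> v = 0) \<and> (\<exists>s0>0. \<forall>s\<in>{0<..<s0}. y - s *\<^sub>R n0 \<in> \<Omega> \<and> y + s *\<^sub>R n0 \<notin> closure \<Omega>)"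
      using nn orth inside outside d(1) dp(1) \<rho>
      by (intro conjI exI[of _ "min (min d r) (norm (y - x))"]) auto
  next
    fix n assume n: "norm n = 1 \<and> (\<forall>c v. c 0 = y \<and> range c \<subseteq> frontier \<Omega> \<and> (c has_vector_derivative v) (at (0::real))
        --> n \<bullet> v = 0) \<and> (\<exists>s0>0. \<forall>s\<in>{0<..<s0}. y - s *\<^sub>R n \<in> \<Omega> \<and> y + s *\<^sub>R n \<notin> closure \<Omega>)"
    have nv: "n \<bullet> v = (n \<bullet> e) * ?D v" for v
      by (rule df_normal[OF df op yF yb]) (use n in blast)
    define a where "a = (n \<bullet> e) / (n0 \<bullet> e)"
    have "n \<bullet> v = (a *\<^sub>R n0) \<bullet> v" for v
      unfolding nv[of v] using n0v[of v] Dn0(2) by (simp add: a_def)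
    then have na: "n = a *\<^sub>R n0" using vector_eq_rdot[of n "a *\<^sub>R n0"] by blast
    then have "\<bar>a\<bar> = 1" using n nn by simp
    then consider "a = 1" | "a = -1" by linarith
    then show "n = n0"
    proof cases
      case 2
      then have "n = - n0" using na by simp
      obtain s0 where s0: "s0 > 0" "\<And>s. s \<in> {0<..<s0} ==> y - s *\<^sub>R n \<in> \<Omega>" using n by blast
      define s where "s = min s0 (min d r) / 2"
      have s: "0 < s" "s < s0" "s < min d r" using d(1) dp(1) s0(1) by (auto simp: s_def min_def)
      have "y + s *\<^sub>R n0 \<in> \<Omega>" using s0(2)[of s] s \<open>n = - n0\<close> by simp
      then show ?thesis using outside[OF s(1,3)] closure_subset by blast
    qed (simp add: na)
  qed
qed

section \<open>Lipschitz dependence of the nearest point\<close>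

lemma C1_lipschitz:
  fixes g :: "'a::euclidean_space => real"
  assumes g: "Ck_on (Suc 0) UNIV g"
  shows "\<exists>B. \<forall>x\<in>cball a R. \<forall>y\<in>cball a R. \<bar>g x - g y\<bar> \<le> B * norm (x - y)"
proof -
  have "\<exists>C. \<forall>x\<in>cball a R. \<bar>fderiv g x j\<bar> \<le> C" for j
  proof -
    have "continuous_on UNIV (\<lambda>x. fderiv g x j)" using g by simp
    then have "compact ((\<lambda>x. fderiv g x j) ` cball a R)"
      by (rule compact_continuous_image[OF continuous_on_subset]) auto
    then show ?thesis
      by (metis (no_types, lifting) bounded_pos compact_imp_bounded imageI real_norm_def)
  qed
  then obtain C where C: "\<And>j x. x \<in> cball a R ==> \<bar>fderiv g x j\<bar> \<le> C j" by metis
  have "norm (g x - g y) \<le> (\<Sum>j\<in>(Basis::'a set). \<bar>C j\<bar>) * norm (x - y)"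
    if "x \<in> cball a R" "y \<in> cball a R" for x y
  proof (rule differentiable_bound[of "cball a R" g "\<lambda>z. fderiv g z"])
    show "(g has_derivative fderiv g z) (at z within cball a R)" for z
      by (rule has_derivative_at_withinI[OF Ck_onD[OF g]])
    show "onorm (fderiv g z) \<le> (\<Sum>j\<in>(Basis::'a set). \<bar>C j\<bar>)" if z: "z \<in> cball a R" for z
    proof (rule onorm_componentwise_le[OF has_derivative_bounded_linear[OF Ck_onD[OF g]]], rule sum_mono)
      show "norm (fderiv g z j) \<le> \<bar>C j\<bar>" for j
        using C[OF z, of j] by simp
    qed
  qed (use that in auto)
  then show ?thesis unfolding real_norm_def by blast
qed

lemma C2_taylor:
  fixes f :: "'a::euclidean_space => real"
  assumes "Ck_on 2 UNIV f"
  obtains B where "B > 0" "\<And>x y. x \<in> cball a R ==> y \<in> cball a R ==>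
    \<bar>f y - f x - fderiv f x (y - x)\<bar> \<le> B * (norm (y - x))^2"
proof (rule taylor_convex[of "cball a R" f "\<lambda>x. fderiv f x"])
  show "(f has_derivative fderiv f x) (at x)" for x
    using assms unfolding numeral_2_eq_2 by (rule Ck_onD)
  show "\<exists>B. \<forall>x\<in>cball a R. \<forall>y\<in>cball a R.
    \<bar>fderiv f x i - fderiv f y i\<bar> \<le> B * norm (x - y)" for i
    by (rule C1_lipschitz[OF Ck_onD2[OF assms[unfolded numeral_2_eq_2]]])
qed (use that in auto)

text \<open>Both nearest points are zeros of \<open>h\<close>, so Taylor expansion makes the
  derivative of \<open>h\<close> along the chord w = y2 - y1 at most L |w|^2. Since x - y is
  orthogonal to the boundary, (x - y) \<bullet> w equals ((x - y) \<bullet> e) times that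
  derivative: quadratic in w with a small factor. In the expansion of w \<bullet> w through x1 and
  x2 the two such terms are absorbed, and |w| is bounded by twice |x1 - x2|.\<close>

lemma nearest_projection_lipschitz:
  assumes \<Omega>: "bounded_C2_domain \<Omega>" and y0: "y0 \<in> frontier \<Omega>"
  obtains r where "r > 0" "\<And>x1 x2 y1 y2. nearest (frontier \<Omega>) x1 y1 ==> nearest (frontier \<Omega>) x2 y2 ==>
     y1 \<in> ball y0 r ==> y2 \<in> ball y0 r ==> dist x1 y1 < r ==> dist x2 y2 < r ==> dist y1 y2 \<le> 2 * dist x1 x2"
proof -
  have op: "open \<Omega>" and C2: "C2_boundary \<Omega>" using \<Omega> by (auto simp: bounded_C2_domain_def)
  obtain r e h where df: "defining_fun \<Omega> y0 r e h" using C2_boundary_defining_fun[OF C2 y0] .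
  note dp = df_props[OF df op]
  obtain L where L: "L > 0" "\<And>x y. x \<in> cball y0 r ==> y \<in> cball y0 r ==>
    \<bar>h y - h x - fderiv h x (y - x)\<bar> \<le> L * (norm (y - x))^2"
    using C2_taylor[OF dp(3)] by metis
  \<comment> \<open>The bound 1 / (4 L) makes each of the two quadratic terms at most |w|^2 / 4;
    half of |w|^2 remains on the left, whence the constant 2.\<close>
  define r' where "r' = min r (1 / (4 * L))"
  have r': "r' > 0" "r' \<le> r" "r' \<le> 1 / (4 * L)" using dp(1) L(1) by (auto simp: r'_def)
  have Lr: "L * r' \<le> 1 / 4" using r'(3) L(1) by (simp add: field_simps)
  show ?thesis
  proof (rule that[OF r'(1)])
    fix x1 x2 y1 y2
    assume n1: "nearest (frontier \<Omega>) x1 y1" and n2: "nearest (frontier \<Omega>) x2 y2"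
      and b: "y1 \<in> ball y0 r'" "y2 \<in> ball y0 r'" and d: "dist x1 y1 < r'" "dist x2 y2 < r'"
    have yF: "y1 \<in> frontier \<Omega>" "y2 \<in> frontier \<Omega>" using n1 n2 by (auto simp: nearest_def)
    have yb: "y1 \<in> ball y0 r" "y2 \<in> ball y0 r" using b r'(2) by auto
    have yc: "y1 \<in> cball y0 r" "y2 \<in> cball y0 r" using yb by auto
    have h0: "h y1 = 0" "h y2 = 0" using df_frontier[OF df op] yF yb by blast+
    define w where "w = y2 - y1"
    have key: "\<bar>(x - y) \<bullet> w\<bar> \<le> 1 / 4 * (norm w)^2"
      if near: "nearest (frontier \<Omega>) x y" and y: "y \<in> frontier \<Omega>" "y \<in> ball y0 r" and d: "dist x y < r'"
        and T: "\<bar>fderiv h y w\<bar> \<le> L * (norm w)^2" for x y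
    proof -
      have "(x - y) \<bullet> w = ((x - y) \<bullet> e) * fderiv h y w"
        by (rule df_normal[OF df op y]) (rule nearest_orthogonal[OF near])
      moreover have "\<bar>(x - y) \<bullet> e\<bar> \<le> r'"
        using Cauchy_Schwarz_ineq2[of "x - y" e] dp(2) d by (simp add: dist_norm)
      ultimately have "\<bar>(x - y) \<bullet> w\<bar> \<le> r' * (L * (norm w)^2)"
        using T r'(1) by (simp add: abs_mult mult_mono)
      also have "\<dots> = (L * r') * (norm w)^2" by simp
      also have "\<dots> \<le> 1 / 4 * (norm w)^2" using Lr by (intro mult_right_mono) auto
      finally show ?thesis .
    qed
    have T1: "\<bar>fderiv h y1 w\<bar> \<le> L * (norm w)^2"
      using L(2)[OF yc] h0 by (simp add: w_def)
    have "fderiv h y2 (y1 - y2) = - fderiv h y2 w"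
      using linear_neg[OF bounded_linear.linear[OF df_linear[OF df op]], of y2 w] by (simp add: w_def)
    then have T2: "\<bar>fderiv h y2 w\<bar> \<le> L * (norm w)^2"
      using L(2)[OF yc(2,1)] h0 by (simp add: w_def norm_minus_commute)
    have "w \<bullet> w = (x1 - y1) \<bullet> w - (x2 - y2) \<bullet> w + (x2 - x1) \<bullet> w"
      by (simp add: w_def inner_diff_left)
    also have "\<dots> \<le> 1 / 4 * (norm w)^2 + 1 / 4 * (norm w)^2 + dist x1 x2 * norm w"
      using key[OF n1 yF(1) yb(1) d(1) T1] key[OF n2 yF(2) yb(2) d(2) T2] Cauchy_Schwarz_ineq2[of "x2 - x1" w]
      unfolding dist_norm norm_minus_commute[of x1 x2] by linarith
    finally have "norm w * norm w \<le> (2 * dist x1 x2) * norm w"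
      by (simp add: power2_norm_eq_inner[symmetric] power2_eq_square)
    then have "norm w \<le> 2 * dist x1 x2"
      by (cases "norm w = 0") auto
    then show "dist y1 y2 \<le> 2 * dist x1 x2" by (simp add: w_def dist_norm norm_minus_commute)
  qed
qed

lemma frontier_bounded_C2:
  fixes \<Omega> :: "'a::euclidean_space set"
  assumes "bounded_C2_domain \<Omega>" shows "compact (frontier \<Omega>)" "frontier \<Omega> \<noteq> {}"
proof -
  have \<Omega>: "bounded \<Omega>" "\<Omega> \<noteq> {}" using assms by (auto simp: bounded_C2_domain_def)
  show "compact (frontier \<Omega>)" by (rule compact_frontier_bounded[OF \<Omega>(1)])
  have "\<Omega> \<noteq> UNIV" using \<Omega>(1) not_bounded_UNIV by auto
  then show "frontier \<Omega> \<noteq> {}" using frontier_not_empty \<Omega>(2) by blast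
qed

text \<open>The radius is a third of a Lebesgue number for the cover by local balls: y1 and y2 are
  joined through x1 and x2 by three steps, so both lie in one ball of the cover.\<close>

lemma nearest_projection_lipschitz_uniform:
  assumes \<Omega>: "bounded_C2_domain \<Omega>"
  obtains \<rho> where "\<rho> > 0" "\<And>x1 x2 y1 y2. nearest (frontier \<Omega>) x1 y1 ==> nearest (frontier \<Omega>) x2 y2 ==>
     dist x1 y1 < \<rho> ==> dist x2 y2 < \<rho> ==> dist x1 x2 < \<rho> ==> dist y1 y2 \<le> 2 * dist x1 x2"
proof -
  let ?F = "frontier \<Omega>"
  have "\<exists>r>0. \<forall>x1 x2 y1 y2. nearest ?F x1 y1 --> nearest ?F x2 y2 --> y1 \<in> ball y0 r -->
     y2 \<in> ball y0 r --> dist x1 y1 < r --> dist x2 y2 < r --> dist y1 y2 \<le> 2 * dist x1 x2" if "y0 \<in> ?F" for y0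
    using nearest_projection_lipschitz[OF \<Omega> that] by metis
  then obtain r where r: "\<And>y0. y0 \<in> ?F ==> r y0 > 0"
    "\<And>y0 x1 x2 y1 y2. y0 \<in> ?F ==> nearest ?F x1 y1 ==> nearest ?F x2 y2 ==> y1 \<in> ball y0 (r y0) ==>
     y2 \<in> ball y0 (r y0) ==> dist x1 y1 < r y0 ==> dist x2 y2 < r y0 ==> dist y1 y2 \<le> 2 * dist x1 x2"
    by metis
  obtain \<epsilon> where \<epsilon>: "\<epsilon> > 0" "\<And>x. x \<in> ?F ==> \<exists>c\<in>(\<lambda>y. ball y (r y)) ` ?F. ball x \<epsilon> \<subseteq> c"
    by (rule Heine_Borel_lemma[OF frontier_bounded_C2(1)[OF \<Omega>], of "(\<lambda>y. ball y (r y)) ` ?F"])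
      (use r(1) in \<open>auto intro: centre_in_ball[THEN iffD2]\<close>)
  show ?thesis
  proof (rule that[of "\<epsilon> / 3"])
    fix x1 x2 y1 y2
    assume n: "nearest ?F x1 y1" "nearest ?F x2 y2"
      and d: "dist x1 y1 < \<epsilon> / 3" "dist x2 y2 < \<epsilon> / 3" "dist x1 x2 < \<epsilon> / 3"
    have "y1 \<in> ?F" using n by (simp add: nearest_def)
    then obtain y0 where y0: "y0 \<in> ?F" "ball y1 \<epsilon> \<subseteq> ball y0 (r y0)" using \<epsilon>(2) by blast
    \<comment> \<open>Inclusion of balls in Euclidean space forces an inequality of radii, so the
      Lebesgue number also controls the distances of the x from the y.\<close>
    have er: "\<epsilon> \<le> r y0" using y0(2) \<epsilon>(1) zero_le_dist[of y1 y0] unfolding ball_subset_ball_iff by linarith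
    have "dist y1 y2 < \<epsilon>"
      using dist_triangle[of y1 y2 x1] dist_triangle[of x1 y2 x2] d by (simp add: dist_commute)
    then have "y1 \<in> ball y1 \<epsilon>" "y2 \<in> ball y1 \<epsilon>" using \<epsilon>(1) by auto
    then have "y1 \<in> ball y0 (r y0)" "y2 \<in> ball y0 (r y0)" using y0(2) by blast+
    then show "dist y1 y2 \<le> 2 * dist x1 x2" using r(2)[OF y0(1) n] d er \<epsilon>(1) by linarith
  qed (use \<epsilon>(1) in simp)
qed

text \<open>The increment of the distance is squeezed between two linear terms. The old nearest
  point y is a competitor for x', which bounds the increment above by sgn (x' - y) \<bullet> k; the
  new one, y', is a competitor for x, which bounds it below by sgn (x - y') \<bullet> k. As y' tends
  to y at Lipschitz rate, both directions tend to sgn (x - y), the inward unit normal.\<close>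

lemma infdist_frontier_derivative:
  assumes \<Omega>: "bounded_C2_domain \<Omega>"
  obtains \<rho> where "\<rho> > 0" "\<And>x. x \<in> \<Omega> ==> infdist x (frontier \<Omega>) < \<rho> ==>
    ((\<lambda>x. infdist x (frontier \<Omega>)) has_derivative
      (\<lambda>v. - (outward_normal \<Omega> (closest_point (frontier \<Omega>) x) \<bullet> v))) (at x)"
proof -
  let ?F = "frontier \<Omega>"
  let ?d = "\<lambda>x. infdist x ?F"
  note cF = frontier_bounded_C2[OF \<Omega>]
  obtain \<rho> where \<rho>: "\<rho> > 0" "\<And>x1 x2 y1 y2. nearest ?F x1 y1 ==> nearest ?F x2 y2 ==>
     dist x1 y1 < \<rho> ==> dist x2 y2 < \<rho> ==> dist x1 x2 < \<rho> ==> dist y1 y2 \<le> 2 * dist x1 x2"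
    using nearest_projection_lipschitz_uniform[OF \<Omega>] by metis
  have op: "open \<Omega>" using \<Omega> by (simp add: bounded_C2_domain_def)
  show ?thesis
  proof (rule that[OF \<rho>(1)])
    fix x assume x: "x \<in> \<Omega>" "?d x < \<rho>"
    define y where "y = closest_point ?F x"
    have ny: "nearest ?F x y" unfolding y_def by (rule nearest_closest_point[OF cF])
    have dxy: "?d x = dist x y" by (rule nearest_infdist[OF ny])
    have "y \<notin> \<Omega>" using ny op by (auto simp: nearest_def frontier_def interior_open)
    then have xy: "x - y \<noteq> 0" using x by auto
    have on: "outward_normal \<Omega> y = (y - x) /\<^sub>R norm (y - x)"
      by (rule outward_normal_nearest[OF \<Omega> x(1) ny])
    have neg: "- (outward_normal \<Omega> y \<bullet> v) = sgn (x - y) \<bullet> v" for v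
      unfolding on by (simp add: sgn_div_norm inner_diff_left norm_minus_commute right_diff_distrib)
    have blin: "bounded_linear (\<lambda>v. - (outward_normal \<Omega> y \<bullet> v))"
      by (intro bounded_linear_minus bounded_linear_inner_right)
    have conv: "(sgn \<longlongrightarrow> sgn (x - y)) (at (x - y))" for g :: "'a => real"
      using xy by (intro tendsto_sgn tendsto_ident_at)
    have cs: "isCont sgn (x - y)" unfolding isCont_def using xy by (intro tendsto_sgn tendsto_ident_at)
    have "(?d has_derivative (\<lambda>v. sgn (x - y) \<bullet> v)) (at x)"
      unfolding has_derivative_at'
    proof (intro conjI allI impI)
      show "bounded_linear (\<lambda>v. sgn (x - y) \<bullet> v)" by (rule bounded_linear_inner_right)
      fix \<epsilon> :: real assume "\<epsilon> > 0"
      then obtain \<eta> where \<eta>: "\<eta> > 0" "\<And>z. dist z (x - y) < \<eta> ==> dist (sgn z) (sgn (x - y)) < \<epsilon>"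
        using cs unfolding continuous_at_eps_delta by blast
      \<comment> \<open>Half of \<rho> minus the distance keeps x' in the tube where nearest points
        are Lipschitz. As y' is within 2 |k| of y, the bound \<eta> / 4 keeps both comparison
        vectors within \<eta> of x - y.\<close>
      define \<delta> where "\<delta> = min (min ((\<rho> - ?d x) / 2) \<rho>) (min (\<eta> / 4) (?d x / 2))"
      have dp: "?d x > 0" using dxy xy by simp
      have \<delta>: "\<delta> > 0" "\<delta> \<le> (\<rho> - ?d x) / 2" "\<delta> \<le> \<rho>" "\<delta> \<le> \<eta> / 4" "\<delta> \<le> ?d x / 2"
      proof -
        have "0 < (\<rho> - ?d x) / 2" "0 < \<eta> / 4" "0 < ?d x / 2" using \<eta>(1) x(2) dp by simp_all
        then show "\<delta> > 0" unfolding \<delta>_def using \<rho>(1) by (simp only: min_less_iff_conj)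
        show "\<delta> \<le> (\<rho> - ?d x) / 2" "\<delta> \<le> \<rho>" "\<delta> \<le> \<eta> / 4" "\<delta> \<le> ?d x / 2"
          unfolding \<delta>_def by linarith+
      qed
      show "\<exists>d>0. \<forall>x'. 0 < norm (x' - x) \<and> norm (x' - x) < d -->
        norm (?d x' - ?d x - sgn (x - y) \<bullet> (x' - x)) / norm (x' - x) < \<epsilon>"
      proof (intro exI[of _ \<delta>] conjI allI impI \<delta>(1))
        fix x' assume x': "0 < norm (x' - x) \<and> norm (x' - x) < \<delta>"
        define k where "k = x' - x"
        have k: "0 < norm k" "norm k < \<delta>" using x' by (auto simp: k_def)
        obtain y' where ny': "nearest ?F x' y'" using nearest_exists[OF cF] by metis
        have dx'y': "?d x' = dist x' y'" by (rule nearest_infdist[OF ny'])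
        have lip: "\<bar>?d x' - ?d x\<bar> \<le> norm k"
          using infdist_triangle_abs[of x' ?F x] by (simp add: k_def dist_norm)
        have yy: "dist y y' \<le> 2 * norm k"
          using \<rho>(2)[OF ny ny'] x(2) dxy dx'y' lip k \<delta> by (simp add: k_def dist_norm norm_minus_commute)
        \<comment> \<open>The gradient inequality of the convex norm; the convention sgn 0 = 0
          covers a = 0.\<close>
        have support: "norm b - norm a \<ge> sgn a \<bullet> (b - a)" for a b :: 'a
        proof (cases "a = 0")
          case False
          have "sgn a \<bullet> b \<le> norm b"
            using Cauchy_Schwarz_ineq2[of "sgn a" b] False by (simp add: norm_sgn)
          moreover have "sgn a \<bullet> a = norm a"
            using False by (simp add: sgn_div_norm dot_square_norm power2_eq_square)
          ultimately show ?thesis by (simp add: inner_diff_right)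
        qed simp
        have up: "?d x' - ?d x \<le> sgn (x' - y) \<bullet> k"
        proof -
          have "?d x' \<le> norm (x' - y)" using ny dx'y' ny' unfolding nearest_def dist_norm by metis
          moreover have "norm (x' - y - k) - norm (x' - y) \<ge> sgn (x' - y) \<bullet> (- k)"
            using support[of "x' - y" "x' - y - k"] by simp
          moreover have "x' - y - k = x - y" by (simp add: k_def)
          ultimately show ?thesis using dxy by (simp add: dist_norm)
        qed
        have low: "?d x' - ?d x \<ge> sgn (x - y') \<bullet> k"
        proof -
          have "?d x \<le> norm (x - y')" using ny dxy ny' unfolding nearest_def dist_norm by metis
          moreover have "norm (x - y' + k) - norm (x - y') \<ge> sgn (x - y') \<bullet> k"
            using support[of "x - y'" "x - y' + k"] by simp
          moreover have "x - y' + k = x' - y'" by (simp add: k_def)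
          ultimately show ?thesis using dx'y' by (simp add: dist_norm)
        qed
        have close: "\<bar>sgn z \<bullet> k - sgn (x - y) \<bullet> k\<bar> < \<epsilon> * norm k" if "dist z (x - y) < \<eta>" for z
        proof -
          have "\<bar>(sgn z - sgn (x - y)) \<bullet> k\<bar> \<le> norm (sgn z - sgn (x - y)) * norm k"
            by (rule Cauchy_Schwarz_ineq2)
          also have "\<dots> < \<epsilon> * norm k"
            using \<eta>(2)[OF that] k by (intro mult_strict_right_mono) (auto simp: dist_norm)
          finally show ?thesis by (simp add: inner_diff_left)
        qed
        have "dist (x' - y) (x - y) < \<eta>" using k \<delta> \<eta>(1) by (simp add: dist_norm k_def)
        moreover have "dist (x - y') (x - y) < \<eta>"
          using yy k \<delta> \<eta>(1) by (simp add: dist_norm norm_minus_commute)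
        ultimately have "\<bar>?d x' - ?d x - sgn (x - y) \<bullet> k\<bar> < \<epsilon> * norm k"
          using close[of "x' - y"] close[of "x - y'"] up low by linarith
        then show "norm (?d x' - ?d x - sgn (x - y) \<bullet> (x' - x)) / norm (x' - x) < \<epsilon>"
          using k by (simp add: k_def[symmetric] divide_less_eq)
      qed
    qed
    then show "(?d has_derivative (\<lambda>v. - (outward_normal \<Omega> (closest_point ?F x) \<bullet> v))) (at x)"
      unfolding y_def[symmetric] neg .
  qed
qed

section \<open>Measure of thin boundary strips\<close>

lemma boundary_strip_open: "open \<Omega> ==> open (boundary_strip \<Omega> \<delta>)"
proof -
  assume "open \<Omega>"
  moreover have "boundary_strip \<Omega> \<delta> = \<Omega> \<inter> {x. infdist x (frontier \<Omega>) < \<delta>}"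
    by (auto simp: boundary_strip_def)
  moreover have "open {x. infdist x (frontier \<Omega>) < \<delta>}"
    by (rule open_Collect_less) (intro continuous_intros)+
  ultimately show ?thesis by auto
qed

lemma boundary_strip_ball_sets:
  "open \<Omega> ==> boundary_strip \<Omega> \<delta> \<inter> ball y r \<in> sets lebesgue"
  by (rule sets_completionI_sets) (simp add: borel_open open_Int boundary_strip_open)

text \<open>The sublevel layer has many disjoint translates in direction \<open>e\<close> inside a fixed ball.\<close>

lemma boundary_strip_measure_local:
  fixes \<Omega> :: "'a::euclidean_space set"
  assumes \<Omega>: "bounded_C2_domain \<Omega>" and y0: "y0 \<in> frontier \<Omega>"
  obtains r C where "r > 0" "\<And>\<delta>. 0 < \<delta> ==> \<delta> < r ==>
    measure lebesgue (boundary_strip \<Omega> \<delta> \<inter> ball y0 r) \<le> C * \<delta>"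
proof -
  have op: "open \<Omega>" and C2: "C2_boundary \<Omega>" using \<Omega> by (auto simp: bounded_C2_domain_def)
  note cF = frontier_bounded_C2[OF \<Omega>]
  obtain r0 e h where df: "defining_fun \<Omega> y0 r0 e h" using C2_boundary_defining_fun[OF C2 y0] .
  note dp = df_props[OF df op]
  have "Ck_on (Suc 0) UNIV h" using dp(3) unfolding numeral_2_eq_2 by (rule Ck_on_Suc)
  from C1_lipschitz[OF this] obtain B where B: "\<And>x y. x \<in> cball y0 r0 ==> y \<in> cball y0 r0 ==> \<bar>h x - h y\<bar> \<le> B * norm (x - y)"
    by metis
  define \<Lambda> where "\<Lambda> = \<bar>B\<bar> + 1"
  have \<Lambda>: "\<Lambda> > 0" "\<And>x y. x \<in> cball y0 r0 ==> y \<in> cball y0 r0 ==> \<bar>h x - h y\<bar> \<le> \<Lambda> * norm (x - y)"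
  proof -
    show "\<Lambda> > 0" by (simp add: \<Lambda>_def)
    show "\<bar>h x - h y\<bar> \<le> \<Lambda> * norm (x - y)" if "x \<in> cball y0 r0" "y \<in> cball y0 r0" for x y
      by (rule order_trans[OF B[OF that]]) (auto simp: \<Lambda>_def intro!: mult_right_mono)
  qed
  \<comment> \<open>r0 / 2 keeps the nearest boundary point of a strip point inside the ball where
    \<open>h\<close> describes the domain; 1 / (2 \<Lambda>) makes the layer thickness s at most
    1/2.\<close>
  define r where "r = min (r0 / 2) (1 / (2 * \<Lambda>))"
  have r: "r > 0" "r \<le> r0 / 2" "r \<le> 1 / (2 * \<Lambda>)" using dp(1) \<Lambda>(1) by (auto simp: r_def)
  define V where "V = measure lebesgue (ball y0 (r + 1))"
  have V0: "V \<ge> 0" by (simp add: V_def)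
  show ?thesis
  proof (rule that[of r "2 * \<Lambda> * V", OF r(1)])
    fix \<delta> :: real assume \<delta>: "0 < \<delta>" "\<delta> < r"
    define s where "s = \<Lambda> * \<delta>"
    have s: "s > 0" using \<Lambda> \<delta> by (simp add: s_def)
    have s2: "s \<le> 1 / 2"
    proof -
      have "s \<le> \<Lambda> * (1 / (2 * \<Lambda>))" unfolding s_def using \<delta> r \<Lambda> by (intro mult_left_mono) auto
      then show ?thesis using \<Lambda> by simp
    qed
    define A where "A = {x \<in> ball y0 r. 0 < h x \<and> h x \<le> s}"
    have sub: "boundary_strip \<Omega> \<delta> \<inter> ball y0 r \<subseteq> A"
    proof
      fix x assume x: "x \<in> boundary_strip \<Omega> \<delta> \<inter> ball y0 r"
      then have xO: "x \<in> \<Omega>" "infdist x (frontier \<Omega>) < \<delta>" "x \<in> ball y0 r" by (auto simp: boundary_strip_def)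
      obtain y where y: "nearest (frontier \<Omega>) x y" using nearest_exists[OF cF] by metis
      have dxy: "dist x y < \<delta>" using xO(2) nearest_infdist[OF y] by simp
      have xb: "x \<in> ball y0 r0" using xO(3) r(2) r(1) by auto
      have yb: "y \<in> ball y0 r0"
        using dist_triangle[of y0 y x] dxy xO(3) \<delta> r(2) by (simp add: dist_commute)
      have "h y = 0" using df_frontier[OF df op yb] y by (simp add: nearest_def)
      then have "\<bar>h x\<bar> \<le> \<Lambda> * dist x y" using \<Lambda>(2)[of x y] xb yb by (simp add: dist_norm)
      also have "\<dots> \<le> s" unfolding s_def using dxy \<Lambda>(1) by (intro mult_left_mono) auto
      finally have "h x \<le> s" by simp
      moreover have "h x > 0" using dp(5)[OF xb] xO(1) by simp
      ultimately show "x \<in> A" using xO(3) by (simp add: A_def)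
    qed
    have hb: "h \<in> borel_measurable borel"
      by (rule borel_measurable_continuous_onI[OF df_continuous[OF df op]])
    have Ab: "A \<in> sets borel" unfolding A_def using hb by measurable
    have Am: "A \<in> lmeasurable"
      by (rule fmeasurableI2[of "ball y0 r"]) (use Ab in \<open>auto simp: A_def sets_completionI_sets\<close>)
    \<comment> \<open>The n translations move points by at most 1, so the translates fit into the
      ball of radius r + 1. Since s is at most 1/2, n s is at least 1/2, which turns the packing
      bound into one linear in s.\<close>
    define n where "n = nat \<lfloor>1 / s\<rfloor>"
    have n1: "real n * s \<le> 1"
    proof -
      have "real n \<le> 1 / s" unfolding n_def using s by simp
      then show ?thesis using s by (simp add: field_simps)
    qed
    have n2: "1 \<le> 2 * s * real n"
    proof -
      have "1 / s \<le> real n + 1" unfolding n_def using s by linarith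
      then have "1 \<le> s * real n + s" using s by (simp add: field_simps)
      then show ?thesis using s2 by linarith
    qed
    define A' where "A' k = (+) ((real k * s) *\<^sub>R e) ` A" for k
    have A'm: "A' k \<in> lmeasurable" "measure lebesgue (A' k) = measure lebesgue A" for k
      unfolding A'_def using measurable_translation[OF Am] measure_translation by auto
    \<comment> \<open>Translation by k s along e adds exactly k s to \<open>h\<close>, so the
      translates occupy consecutive disjoint slabs of values of \<open>h\<close>.\<close>
    have hA': "real k * s < h x \<and> h x \<le> (real k + 1) * s" if xA: "x \<in> A' k" for x k
    proof -
      obtain z where z: "z \<in> A" "x = (real k * s) *\<^sub>R e + z"
        using xA unfolding A'_def by blast
      then have x: "x = z + (real k * s) *\<^sub>R e" by simp
      have "h x = h z + real k * s" unfolding x by (rule dp(4))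
      then show ?thesis using z(1) by (simp add: A_def algebra_simps)
    qed
    have disj: "A' i \<inter> A' j = {}" if "i < j" for i j
    proof (rule ccontr)
      assume "A' i \<inter> A' j \<noteq> {}"
      then obtain x where "x \<in> A' i" "x \<in> A' j" by auto
      then have "real j * s < (real i + 1) * s" using hA' by (meson le_less_trans less_le_trans)
      then have "real j < real i + 1" using s by simp
      then show False using that by simp
    qed
    have pw: "pairwise (\<lambda>i j. disjnt (A' i) (A' j)) {..<n}"
      unfolding pairwise_def disjnt_def using disj by (metis Int_commute linorder_neqE_nat)
    have "real n * measure lebesgue A = (\<Sum>k<n. measure lebesgue (A' k))" by (simp add: A'm)
    also have "\<dots> = measure lebesgue (\<Union>k<n. A' k)"
      by (rule measure_UNION'[symmetric]) (use A'm(1) pw in auto)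
    also have "\<dots> \<le> V" unfolding V_def
    proof (rule measure_mono_fmeasurable)
      show "(\<Union>k<n. A' k) \<subseteq> ball y0 (r + 1)"
      proof safe
        fix k x assume k: "k < n" and "x \<in> A' k"
        then obtain z where z: "z \<in> A" "x = (real k * s) *\<^sub>R e + z"
          unfolding A'_def by blast
        have "real k * s \<le> real n * s" using k s by (intro mult_right_mono) auto
        then have "real k * s \<le> 1" using n1 by linarith
        then have "dist z x \<le> 1" using z(2) s dp(2) by (simp add: dist_norm)
        then show "x \<in> ball y0 (r + 1)"
          using dist_triangle[of y0 x z] z(1) by (simp add: A_def)
      qed
      show "(\<Union>k<n. A' k) \<in> sets lebesgue" using A'm(1) by (auto intro!: sets.finite_UN fmeasurableD)
    qed auto
    finally have nA: "real n * measure lebesgue A \<le> V" .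
    have "measure lebesgue (boundary_strip \<Omega> \<delta> \<inter> ball y0 r) \<le> measure lebesgue A"
      by (rule measure_mono_fmeasurable[OF sub _ Am])
        (rule boundary_strip_ball_sets[OF op])
    also have "\<dots> \<le> (2 * s * real n) * measure lebesgue A"
      using mult_right_mono[OF n2, of "measure lebesgue A"] by simp
    also have "\<dots> = 2 * s * (real n * measure lebesgue A)" by simp
    also have "\<dots> \<le> 2 * s * V" using nA s by (intro mult_left_mono) auto
    finally show "measure lebesgue (boundary_strip \<Omega> \<delta> \<inter> ball y0 r) \<le> 2 * \<Lambda> * V * \<delta>"
      by (simp add: s_def mult_ac)
  qed
qed

text \<open>Finitely many local balls suffice by compactness. The cover uses half radii: a strip
  point is within \<delta> of a boundary point in a half ball, and \<delta> below the smallest half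
  radius keeps it in the full ball.\<close>

lemma boundary_strip_measure:
  fixes \<Omega> :: "'a::euclidean_space set"
  assumes \<Omega>: "bounded_C2_domain \<Omega>"
  obtains r C where "r > 0" "C > 0" "\<And>\<delta>. 0 < \<delta> ==> \<delta> < r ==>
    measure lborel (boundary_strip \<Omega> \<delta>) \<le> C * \<delta>"
proof -
  let ?F = "frontier \<Omega>"
  note cF = frontier_bounded_C2[OF \<Omega>]
  have op: "open \<Omega>" using \<Omega> by (auto simp: bounded_C2_domain_def)
  have "\<exists>r C. r > 0 \<and> (\<forall>\<delta>. 0 < \<delta> --> \<delta> < r -->
    measure lebesgue (boundary_strip \<Omega> \<delta> \<inter> ball y0 r) \<le> C * \<delta>)" if "y0 \<in> ?F" for y0
    using boundary_strip_measure_local[OF \<Omega> that] by metis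
  then obtain r C where r: "\<And>y. y \<in> ?F ==> r y > 0"
    and C: "\<And>y \<delta>. y \<in> ?F ==> 0 < \<delta> ==> \<delta> < r y ==> measure lebesgue (boundary_strip \<Omega> \<delta> \<inter> ball y (r y)) \<le> C y * \<delta>"
    by metis
  have cov: "?F \<subseteq> (\<Union>y\<in>?F. ball y (r y / 2))"
  proof
    fix y assume "y \<in> ?F"
    then show "y \<in> (\<Union>y\<in>?F. ball y (r y / 2))" using r by (intro UN_I[of y]) auto
  qed
  obtain Y where Y: "Y \<subseteq> ?F" "finite Y" "?F \<subseteq> (\<Union>y\<in>Y. ball y (r y / 2))"
    by (rule compactE_image[OF cF(1) _ cov]) auto
  have Yne: "Y \<noteq> {}" using Y(3) cF(2) by auto
  define \<rho> where "\<rho> = Min ((\<lambda>y. r y / 2) ` Y)"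
  have \<rho>: "\<rho> > 0" "\<And>y. y \<in> Y ==> \<rho> \<le> r y / 2"
  proof -
    have fin: "finite ((\<lambda>y. r y / 2) ` Y)" "(\<lambda>y. r y / 2) ` Y \<noteq> {}" using Y(2) Yne by auto
    show "\<rho> > 0" unfolding \<rho>_def Min_gr_iff[OF fin] using r Y(1) by auto
    show "\<rho> \<le> r y / 2" if "y \<in> Y" for y unfolding \<rho>_def using fin(1) that by (intro Min_le) auto
  qed
  show ?thesis
  proof (rule that[of \<rho> "(\<Sum>y\<in>Y. \<bar>C y\<bar>) + 1"])
    show "\<rho> > 0" by fact
    show "(\<Sum>y\<in>Y. \<bar>C y\<bar>) + 1 > 0" by (simp add: sum_nonneg add_nonneg_pos)
    fix \<delta> assume \<delta>: "0 < \<delta>" "\<delta> < \<rho>"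
    let ?S = "boundary_strip \<Omega> \<delta>"
    have Sm: "?S \<inter> ball y (r y) \<in> lmeasurable" for y
      by (rule fmeasurableI2[of "ball y (r y)"]) (auto intro!: boundary_strip_ball_sets op)
    have sub: "?S \<subseteq> (\<Union>y\<in>Y. ?S \<inter> ball y (r y))"
    proof
      fix x assume x: "x \<in> ?S"
      obtain z where z: "nearest ?F x z" using nearest_exists[OF cF] by metis
      then obtain y where y: "y \<in> Y" "dist y z < r y / 2" using Y(3) by (auto simp: nearest_def)
      have "dist x z < \<delta>" using x nearest_infdist[OF z] by (simp add: boundary_strip_def)
      then have "dist y x < r y"
        using dist_triangle[of y x z] y \<delta> \<rho>(2)[OF y(1)] by (simp add: dist_commute)
      then show "x \<in> (\<Union>y\<in>Y. ?S \<inter> ball y (r y))" using y(1) x by auto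
    qed
    have "measure lborel ?S = measure lebesgue ?S"
      using boundary_strip_open[OF op] by (simp add: measure_completion)
    also have "\<dots> \<le> measure lebesgue (\<Union>y\<in>Y. ?S \<inter> ball y (r y))"
      by (rule measure_mono_fmeasurable[OF sub _ fmeasurable.finite_UN[OF Y(2) Sm]])
        (use boundary_strip_open[OF op] in \<open>auto intro!: sets_completionI_sets\<close>)
    also have "\<dots> \<le> (\<Sum>y\<in>Y. measure lebesgue (?S \<inter> ball y (r y)))"
      by (rule measure_UNION_le[OF Y(2)]) (use Sm in \<open>auto simp: fmeasurableD\<close>)
    also have "\<dots> \<le> (\<Sum>y\<in>Y. \<bar>C y\<bar> * \<delta>)"
    proof (rule sum_mono)
      fix y assume y: "y \<in> Y"
      have "\<delta> < r y" using \<delta> \<rho>(2)[OF y] r[of y] y Y(1) by force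
      then have "measure lebesgue (?S \<inter> ball y (r y)) \<le> C y * \<delta>" using C y Y(1) \<delta> by blast
      also have "\<dots> \<le> \<bar>C y\<bar> * \<delta>" using \<delta> by (intro mult_right_mono) auto
      finally show "measure lebesgue (?S \<inter> ball y (r y)) \<le> \<bar>C y\<bar> * \<delta>" .
    qed
    also have "\<dots> \<le> ((\<Sum>y\<in>Y. \<bar>C y\<bar>) + 1) * \<delta>"
      using \<delta> by (simp add: sum_distrib_right distrib_right)
    finally show "measure lborel ?S \<le> ((\<Sum>y\<in>Y. \<bar>C y\<bar>) + 1) * \<delta>" .
  qed
qed

section \<open>Integration by parts and Fubini\<close>

lemma integrable_lborel_shift:
  fixes f :: "'a::euclidean_space => 'b::euclidean_space"
  assumes "integrable lborel f" shows "integrable lborel (\<lambda>x. f (c + x))"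
proof -
  have "integrable (distr lborel borel ((+) c)) f" using assms by (simp add: lborel_distr_plus)
  then show ?thesis by (rule integrable_distr[rotated]) simp
qed

lemma integral_lborel_shift:
  fixes f :: "'a::euclidean_space => 'b::euclidean_space"
  assumes [measurable]: "f \<in> borel_measurable borel"
  shows "(LBINT x. f (c + x)) = integral\<^sup>L lborel f"
proof -
  have "integral\<^sup>L lborel f = integral\<^sup>L (distr lborel borel ((+) c)) f" by (simp add: lborel_distr_plus)
  also have "\<dots> = (LBINT x. f (c + x))" by (rule integral_distr) simp_all
  finally show ?thesis by simp
qed

lemma difference_quotients_tendsto:
  fixes g :: "'a::real_normed_vector => 'b::real_normed_vector"
  assumes "(g has_derivative g') (at x)"
  shows "(\<lambda>n. real (Suc n) *\<^sub>R (g (x + (1 / real (Suc n)) *\<^sub>R h) - g x)) \<longlonglongrightarrow> g' h"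
proof -
  interpret bounded_linear g' by (rule has_derivative_bounded_linear[OF assms])
  show ?thesis
  proof (cases "h = 0")
    case True
    then show ?thesis by (simp add: zero)
  next
    case False
    show ?thesis
    proof (rule LIMSEQ_I)
      fix e :: real assume "e > 0"
      then have "e / norm h > 0" using False by simp
      then obtain d where d: "d > 0" "\<And>x'. 0 < norm (x' - x) ==> norm (x' - x) < d ==>
          norm (g x' - g x - g' (x' - x)) / norm (x' - x) < e / norm h"
        using assms unfolding has_derivative_at' by blast
      obtain N where N: "norm h / d < real N" using reals_Archimedean2 by blast
      show "\<exists>no. \<forall>n\<ge>no. norm (real (Suc n) *\<^sub>R (g (x + (1 / real (Suc n)) *\<^sub>R h) - g x) - g' h) < e"
      proof (intro exI[of _ N] allI impI)
        fix n assume "N \<le> n"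
        define m where "m = real (Suc n)"
        have m: "m > 0" "norm h / d < m" using N \<open>N \<le> n\<close> by (auto simp: m_def)
        define k where "k = (1 / m) *\<^sub>R h"
        have nk: "norm k = norm h / m" using m by (simp add: k_def)
        have k: "0 < norm k" "norm k < d" using m d(1) False by (auto simp: nk field_simps)
        have "g' h = m *\<^sub>R g' k" using m by (simp add: k_def scaleR)
        then have "m *\<^sub>R (g (x + k) - g x) - g' h = m *\<^sub>R (g (x + k) - g x - g' k)"
          by (simp add: scaleR_diff_right)
        then have "norm (m *\<^sub>R (g (x + k) - g x) - g' h) = m * norm (g (x + k) - g x - g' k)"
          using m by simp
        also have "\<dots> < m * (e / norm h * norm k)"
          using d(2)[of "x + k"] k m by (intro mult_strict_left_mono) (simp_all add: divide_less_eq)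
        also have "\<dots> = e" using m False by (simp add: nk)
        finally show "norm (real (Suc n) *\<^sub>R (g (x + (1 / real (Suc n)) *\<^sub>R h) - g x) - g' h) < e"
          by (simp only: m_def k_def)
      qed
    qed
  qed
qed

text \<open>A limit of difference quotients of a continuous function, hence Borel even at
  discontinuities of the derivative; the derivative of the boundary cutoff is known only
  pointwise.\<close>

lemma derivative_borel_measurable:
  fixes g :: "'a::euclidean_space => 'b::euclidean_space"
  assumes "\<And>x. (g has_derivative g' x) (at x)"
  shows "(\<lambda>x. g' x h) \<in> borel_measurable borel"
proof (rule borel_measurable_LIMSEQ_metric)
  have "continuous_on UNIV g"
    using has_derivative_continuous[OF assms] by (simp add: continuous_on_eq_continuous_at)
  then have [measurable]: "g \<in> borel_measurable borel" by (rule borel_measurable_continuous_onI)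
  show "(\<lambda>x. real (Suc n) *\<^sub>R (g (x + (1 / real (Suc n)) *\<^sub>R h) - g x)) \<in> borel_measurable borel" for n
    by measurable
  show "(\<lambda>n. real (Suc n) *\<^sub>R (g (x + (1 / real (Suc n)) *\<^sub>R h) - g x)) \<longlonglongrightarrow> g' x h" for x
    by (rule difference_quotients_tendsto[OF assms])
qed

lemma integrable_bounded_compact:
  fixes F :: "'a::euclidean_space => 'b::euclidean_space"
  assumes [measurable]: "F \<in> borel_measurable borel" and "bounded K" "\<And>x. x \<notin> K ==> F x = 0"
    and "\<And>x. norm (F x) \<le> B"
  shows "integrable lborel F"
proof -
  obtain R where R: "\<And>x. x \<in> K ==> norm x \<le> R" using assms(2) unfolding bounded_iff by blast
  have fin: "emeasure lborel (cball (0::'a) R) < \<infinity>" by (rule emeasure_bounded_finite) simp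
  have "integrable lborel (\<lambda>x. B * ind (cball (0::'a) R) x)"
    using fin by (auto intro!: integrable_real_indicator)
  then show ?thesis
  proof (rule bochner_bound)
    have "norm (F x) \<le> norm (B * ind (cball (0::'a) R) x)" for x
    proof (cases "x \<in> K")
      case True
      then show ?thesis using R[OF True] assms(4)[of x] by (simp add: indicator_def)
    qed (simp add: assms(3))
    then show "AE x in lborel. norm (F x) \<le> norm (B * ind (cball (0::'a) R) x)" by simp
  qed measurable
qed

lemma has_derivative_zero_outside:
  fixes g :: "'a::euclidean_space => 'b::euclidean_space"
  assumes "(g has_derivative g') (at x)" "closed K" "\<And>x. x \<notin> K ==> g x = 0" "x \<notin> K"
  shows "g' h = 0"
proof -
  have "((\<lambda>_. 0) has_derivative (\<lambda>_. 0)) (at x)" by (rule has_derivative_const)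
  then have "(g has_derivative (\<lambda>_. 0)) (at x)"
    by (rule has_derivative_transform_within_open[where s="- K"]) (use assms in auto)
  from has_derivative_unique[OF assms(1) this] show ?thesis by simp
qed

text \<open>Every difference quotient has integral 0 by translation invariance. The bound on the
  derivative is a Lipschitz bound along h, which dominates the quotients and allows the limit under
  the integral. This is the only form of integration by parts in the development.\<close>

lemma integral_derivative_zero:
  fixes g :: "'a::euclidean_space => 'b::euclidean_space"
  assumes D: "\<And>x. (g has_derivative g' x) (at x)" and K: "compact K" "\<And>x. x \<notin> K ==> g x = 0"
    and B: "\<And>x. norm (g' x h) \<le> B"
  shows "integrable lborel (\<lambda>x. g' x h)" "(LBINT x. g' x h) = 0"
proof -
  have cont: "continuous_on UNIV g"
    using has_derivative_continuous[OF D] by (simp add: continuous_on_eq_continuous_at)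
  then have gm [measurable]: "g \<in> borel_measurable borel" by (rule borel_measurable_continuous_onI)
  have g'm [measurable]: "(\<lambda>x. g' x h) \<in> borel_measurable borel"
    by (rule derivative_borel_measurable[OF D])
  have cK: "closed K" using K(1) by (rule compact_imp_closed)
  have bK: "bounded K" using K(1) by (rule compact_imp_bounded)
  show int': "integrable lborel (\<lambda>x. g' x h)"
    by (rule integrable_bounded_compact[OF g'm bK _ B]) (rule has_derivative_zero_outside[OF D cK K(2)])
  have B0: "B \<ge> 0" using order_trans[OF norm_ge_zero B] .
  have lip: "norm (g (x + s *\<^sub>R h) - g x) \<le> B * \<bar>s\<bar>" for x s
  proof -
    have "norm (g (x + s *\<^sub>R h) - g (x + 0 *\<^sub>R h)) \<le> B * norm (s - 0)"
    proof (rule differentiable_bound[of UNIV "\<lambda>s. g (x + s *\<^sub>R h)" "\<lambda>r s. s *\<^sub>R g' (x + r *\<^sub>R h) h"])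
      show "((\<lambda>s. g (x + s *\<^sub>R h)) has_derivative (\<lambda>s. s *\<^sub>R g' (x + r *\<^sub>R h) h)) (at r within UNIV)" for r
      proof -
        have "((\<lambda>s. x + s *\<^sub>R h) has_derivative (\<lambda>s. s *\<^sub>R h)) (at r)"
          by (auto intro!: derivative_eq_intros)
        from has_derivative_compose[OF this D]
        show ?thesis by (simp add: linear_cmul[OF has_derivative_linear[OF D]])
      qed
      show "onorm (\<lambda>s. s *\<^sub>R g' (x + r *\<^sub>R h) h) \<le> B" for r
        by (rule onorm_bound[OF B0]) (use mult_left_mono[OF B abs_ge_zero] in \<open>simp add: mult.commute\<close>)
    qed auto
    then show ?thesis by simp
  qed
  have gb: "norm (g x) \<le> norm (SUP y\<in>K. norm (g y)) + 1" for x
  proof (cases "x \<in> K")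
    case True
    have "bdd_above ((\<lambda>y. norm (g y)) ` K)"
      by (intro bounded_imp_bdd_above compact_imp_bounded compact_continuous_image K(1)
          continuous_on_norm continuous_on_subset[OF cont]) auto
    then have "norm (g x) \<le> (SUP y\<in>K. norm (g y))" using True by (rule cSUP_upper[rotated])
    then show ?thesis by simp
  qed (simp add: K(2))
  have gi: "integrable lborel g" by (rule integrable_bounded_compact[OF gm bK K(2) gb])
  obtain R where R: "\<And>x. x \<in> K ==> norm x \<le> R" using bK unfolding bounded_iff by blast
  let ?s = "\<lambda>n x. real (Suc n) *\<^sub>R (g (x + (1 / real (Suc n)) *\<^sub>R h) - g x)"
  \<comment> \<open>Shifts of length at most |h| enlarge the support of the quotients by at most
    |h|, which fixes the ball in the majorant.\<close>
  have "(\<lambda>n. LBINT x. ?s n x) \<longlonglongrightarrow> (LBINT x. g' x h)"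
  proof (rule integral_dominated_convergence[where w="\<lambda>x. B * ind (cball 0 (R + norm h)) x"])
    show "integrable lborel (\<lambda>x. B * ind (cball (0::'a) (R + norm h)) x)"
      by (auto intro!: integrable_real_indicator emeasure_bounded_finite)
    show "AE x in lborel. (\<lambda>n. ?s n x) \<longlonglongrightarrow> g' x h"
      by (intro AE_I2 difference_quotients_tendsto D)
    show "AE x in lborel. norm (?s n x) \<le> B * ind (cball 0 (R + norm h)) x" for n
    proof (rule AE_I2)
      fix x :: 'a
      show "norm (?s n x) \<le> B * ind (cball 0 (R + norm h)) x"
      proof (cases "norm x \<le> R + norm h")
        case True
        have "norm (?s n x) \<le> real (Suc n) * (B * (1 / real (Suc n)))"
          using lip[of x "1 / real (Suc n)"] unfolding norm_scaleR by (intro mult_mono) auto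
        also have "\<dots> = B" by simp
        finally show ?thesis using True by simp
      next
        case False
        have "norm ((1 / real (Suc n)) *\<^sub>R h) \<le> norm h"
          by (simp add: divide_le_eq mult_le_cancel_left1 del: of_nat_Suc)
        then have "norm (x + (1 / real (Suc n)) *\<^sub>R h) > R"
          using False norm_diff_ineq[of x "(1 / real (Suc n)) *\<^sub>R h"] by linarith
        moreover have "norm x > R" using False norm_ge_zero[of h] by linarith
        ultimately show ?thesis using R K(2) B0 by (metis diff_zero linorder_not_less norm_zero scaleR_zero_right mult_nonneg_nonneg indicator_pos_le)
      qed
    qed
  qed measurable
  moreover have "(LBINT x. ?s n x) = 0" for n
  proof -
    have "integrable lborel (\<lambda>x. g (x + (1 / real (Suc n)) *\<^sub>R h))"
      using integrable_lborel_shift[OF gi, of "(1 / real (Suc n)) *\<^sub>R h"] by (simp only: add.commute)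
    moreover have "(LBINT x. g (x + (1 / real (Suc n)) *\<^sub>R h)) = integral\<^sup>L lborel g"
      using integral_lborel_shift[OF gm, of "(1 / real (Suc n)) *\<^sub>R h"] by (simp only: add.commute)
    ultimately show ?thesis using gi by simp
  qed
  ultimately show "(LBINT x. g' x h) = 0" by (simp add: LIMSEQ_const_iff)
qed

text \<open>For a mollified quantity one factor of the majorant is a kernel bound times an indicator
  or a norm, the other the integrable field; exchanging integrals and integrability of both
  marginals are then settled together.\<close>

lemma fubini_bounded:
  fixes G :: "'a::euclidean_space => 'b::euclidean_space => real"
  assumes G [measurable]: "case_prod G \<in> borel_measurable (lborel \<Otimes>\<^sub>M lborel)"
    and a: "integrable lborel a" and b: "integrable lborel b"
    and le: "\<And>x y. \<bar>G x y\<bar> \<le> a x * b y"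
  shows "integrable (lborel \<Otimes>\<^sub>M lborel) (case_prod G)"
    and "(LBINT x. LBINT y. G x y) = (LBINT y. LBINT x. G x y)"
    and "integrable lborel (\<lambda>x. LBINT y. G x y)"
    and "integrable lborel (\<lambda>y. LBINT x. G x y)"
proof -
  have Gx: "integrable lborel (G x)" for x
    by (rule bochner_bound[of _ "\<lambda>y. a x * b y"])
      (use b le[of x] in \<open>auto intro!: AE_I2 order_trans[OF _ abs_ge_self]\<close>)
  show i: "integrable (lborel \<Otimes>\<^sub>M lborel) (case_prod G)"
  proof (rule lborel_pair.Fubini_integrable[OF G])
    show "integrable lborel (\<lambda>x. LBINT y. norm (case (x, y) of (x, y) => G x y))"
    proof (rule bochner_bound[of _ "\<lambda>x. a x * integral\<^sup>L lborel b"])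
      show "AE x in lborel. norm (LBINT y. norm (case (x, y) of (x, y) => G x y)) \<le> norm (a x * integral\<^sup>L lborel b)"
      proof (rule AE_I2)
        fix x
        have "(LBINT y. \<bar>G x y\<bar>) \<le> (LBINT y. a x * b y)"
          by (rule integral_mono) (use Gx[of x] b le in auto)
        then show "norm (LBINT y. norm (case (x, y) of (x, y) => G x y)) \<le> norm (a x * integral\<^sup>L lborel b)"
          by simp
      qed
    qed (use a in simp_all)
    show "AE x in lborel. integrable lborel (\<lambda>y. case (x, y) of (x, y) => G x y)"
      using Gx by simp
  qed
  show "(LBINT x. LBINT y. G x y) = (LBINT y. LBINT x. G x y)"
    by (rule lborel_pair.Fubini_integral[OF i, symmetric])
  show "integrable lborel (\<lambda>x. LBINT y. G x y)" by (rule lborel_pair.integrable_fst[OF i])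
  show "integrable lborel (\<lambda>y. LBINT x. G x y)" by (rule lborel_pair.integrable_snd[OF i])
qed

lemma conv_adjoint:
  fixes F v :: "'a::euclidean_space => 'b::euclidean_space"
  assumes k: "kernel R k" and F: "integrable lborel F" and v: "integrable lborel v"
  shows "(LBINT y. v y \<bullet> conv k F y) = (LBINT x. F x \<bullet> conv (\<lambda>z. k (- z)) v x)"
    and "integrable lborel (\<lambda>y. v y \<bullet> conv k F y)"
proof -
  obtain B where B: "B > 0" "\<And>z. \<bar>k z\<bar> \<le> B" using kernel_bounded[OF k] by metis
  note [measurable] = kernel_borel[OF k] borel_measurable_integrable[OF F] borel_measurable_integrable[OF v]
  have k': "kernel R (\<lambda>z. k (- z))" by (rule kernel_reflect[OF k])
  have m: "(\<lambda>(x, y). k (y - x) * (v y \<bullet> F x)) \<in> borel_measurable (lborel \<Otimes>\<^sub>M lborel)" by measurable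
  have le: "\<bar>k (y - x) * (v y \<bullet> F x)\<bar> \<le> (B * norm (F x)) * norm (v y)" for x y
  proof -
    have "\<bar>k (y - x)\<bar> * \<bar>v y \<bullet> F x\<bar> \<le> B * (norm (v y) * norm (F x))"
      by (intro mult_mono B Cauchy_Schwarz_ineq2) (use B(1) in auto)
    then show ?thesis by (simp add: abs_mult mult_ac)
  qed
  have a: "integrable lborel (\<lambda>x. B * norm (F x))" and b: "integrable lborel (\<lambda>y. norm (v y))"
    using F v by auto
  note fub = fubini_bounded[OF m a b le]
  have 1: "v y \<bullet> conv k F y = (LBINT x. k (y - x) * (v y \<bullet> F x))" for y
    unfolding conv_def by (subst integral_inner_right[symmetric]) (use conv_integrable[OF k F] in simp_all)
  have 2: "F x \<bullet> conv (\<lambda>z. k (- z)) v x = (LBINT y. k (y - x) * (v y \<bullet> F x))" for x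
    unfolding conv_def
    by (subst integral_inner_right[symmetric]) (use conv_integrable[OF k' v] in \<open>simp_all add: inner_commute\<close>)
  show "(LBINT y. v y \<bullet> conv k F y) = (LBINT x. F x \<bullet> conv (\<lambda>z. k (- z)) v x)"
    unfolding 1 2 by (rule fub(2)[symmetric])
  show "integrable lborel (\<lambda>y. v y \<bullet> conv k F y)"
    unfolding 1 by (rule fub(4))
qed

text \<open>The x-derivative of the product of k(y - x) and F(x) integrates to 0, which moves the
  derivative from the kernel to F.\<close>

lemma conv_derivative_parts:
  fixes F :: "'a::euclidean_space => 'b::euclidean_space"
  assumes k: "kernel R k" and K: "compact K" "\<And>x. x \<notin> K ==> F x = 0"
    and D: "\<And>x. (F has_derivative F' x) (at x)" and B: "\<And>x h. norm (F' x h) \<le> B * norm h"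
    and M: "\<And>x. norm (F x) \<le> M"
  shows "fderiv (conv k F) y h = conv k (\<lambda>x. F' x h) y"
proof -
  have "continuous_on UNIV F"
    using has_derivative_continuous[OF D] by (simp add: continuous_on_eq_continuous_at)
  then have Fm: "F \<in> borel_measurable borel" by (rule borel_measurable_continuous_onI)
  have F: "integrable lborel F"
    by (rule integrable_bounded_compact[OF Fm compact_imp_bounded[OF K(1)] K(2) M])
  have F'i: "integrable lborel (\<lambda>x. F' x h)"
    by (rule integral_derivative_zero(1)[OF D K B])
  obtain Bk where Bk: "Bk > 0" "\<And>z. \<bar>k z\<bar> \<le> Bk" using kernel_bounded[OF k] by metis
  obtain Bd where Bd: "Bd > 0" "\<And>z v. \<bar>fderiv k z v\<bar> \<le> Bd * norm v"
    using kernel_derivative_bound[OF k] by metis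
  let ?g' = "\<lambda>x h. k (y - x) *\<^sub>R F' x h - fderiv k (y - x) h *\<^sub>R F x"
  have gD: "((\<lambda>x. k (y - x) *\<^sub>R F x) has_derivative ?g' x) (at x)" for x
  proof -
    have "((\<lambda>x. y - x) has_derivative (\<lambda>h. - h)) (at x)" by (auto intro!: derivative_eq_intros)
    from has_derivative_compose[OF this kernel_has_derivative[OF k]]
    have "((\<lambda>x. k (y - x)) has_derivative (\<lambda>h. fderiv k (y - x) (- h))) (at x)" .
    from has_derivative_scaleR[OF this D]
    show ?thesis
      by (rule has_derivative_eq_rhs)
        (simp add: fun_eq_iff linear_neg[OF bounded_linear.linear[OF kernel_linear[OF k]]])
  qed
  have gB: "norm (?g' x h) \<le> Bk * (B * norm h) + Bd * norm h * M" for x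
  proof -
    have "norm (k (y - x) *\<^sub>R F' x h) \<le> Bk * (B * norm h)"
      unfolding norm_scaleR by (rule mult_mono) (use Bk B in auto)
    moreover have "norm (fderiv k (y - x) h *\<^sub>R F x) \<le> Bd * norm h * M"
      unfolding norm_scaleR by (rule mult_mono) (use Bd M in auto)
    ultimately show ?thesis by (meson add_mono norm_triangle_ineq4 order_trans)
  qed
  have "(LBINT x. ?g' x h) = 0"
    by (rule integral_derivative_zero(2)[OF gD K(1) _ gB]) (simp add: K(2))
  moreover have "(LBINT x. ?g' x h) = conv k (\<lambda>x. F' x h) y - conv (\<lambda>z. fderiv k z h) F y"
    unfolding conv_def
    by (rule Bochner_Integration.integral_diff[OF conv_integrable[OF k F'i] conv_integrable[OF kernel_derivative[OF k] F]])
  ultimately show ?thesis by (simp add: conv_frechet_derivative[OF k F])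
qed

section \<open>The energy flux through a mollified cutoff\<close>

lemma Young_cubic:
  fixes a b c :: real
  assumes "0 \<le> a" "0 \<le> b" shows "a * b^2 \<le> a ^ 3 + b ^ 3"
proof (cases "a \<le> b")
  case True
  then have "a * b^2 \<le> b * b^2" by (intro mult_right_mono) auto
  then show ?thesis using zero_le_power[OF assms(1), of 3] by (simp add: power2_eq_square power3_eq_cube)
next
  case False
  then have "a * b^2 \<le> a * a^2" using assms by (intro mult_left_mono power_mono) auto
  then show ?thesis using zero_le_power[OF assms(2), of 3] by (simp add: power2_eq_square power3_eq_cube)
qed

text \<open>Takes the place of Hoelder's inequality with exponents 3/2 and 3. The cubic inequality
  is applied to a / \<kappa>^2 against \<kappa> M and against \<kappa> sqrt P: the weights cancel in
  the products and leave \<kappa>^3 on M^3 and P^(3/2) and \<kappa>^(-6) on a^3.\<close>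

lemma Young_weighted:
  fixes a M P \<kappa> :: real
  assumes "0 \<le> a" "0 \<le> M" "0 \<le> P" "0 < \<kappa>"
  shows "(M^2 + P) * a \<le> \<kappa> ^ 3 * (M ^ 3 + P powr (3/2)) + 2 / \<kappa> ^ 6 * a ^ 3"
proof -
  have "(a / \<kappa>^2) * (\<kappa> * M)^2 \<le> (a / \<kappa>^2) ^ 3 + (\<kappa> * M) ^ 3"
    by (rule Young_cubic) (use assms in auto)
  then have 1: "M^2 * a \<le> a ^ 3 / \<kappa> ^ 6 + \<kappa> ^ 3 * M ^ 3"
    using assms by (simp add: power_mult_distrib power_divide flip: power_mult) (simp add: field_simps)
  have s: "(sqrt P)^2 = P" "sqrt P ^ 3 = P powr (3/2)"
    using assms by (simp_all add: powr_half_sqrt[symmetric] powr_powr flip: powr_realpow' powr_numeral)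
  have "(a / \<kappa>^2) * (\<kappa> * sqrt P)^2 \<le> (a / \<kappa>^2) ^ 3 + (\<kappa> * sqrt P) ^ 3"
    by (rule Young_cubic) (use assms in auto)
  then have 2: "P * a \<le> a ^ 3 / \<kappa> ^ 6 + \<kappa> ^ 3 * P powr (3/2)"
    using assms unfolding power_mult_distrib s by (simp add: power_divide flip: power_mult) (simp add: field_simps)
  show ?thesis using 1 2 by (simp add: algebra_simps)
qed

lemma linear_expand: 
  fixes f :: "'a::euclidean_space => 'b::real_normed_vector"
  shows "bounded_linear f ==> f h = (\<Sum>i\<in>Basis. (h \<bullet> i) *\<^sub>R f i)"
  using linear_sum[of f "\<lambda>i. (h \<bullet> i) *\<^sub>R i" Basis] linear_cmul[of f]
  by (simp add: euclidean_representation bounded_linear.linear)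

lemma integrable_indicator_cball: "integrable lborel (ind (cball (x::'a::euclidean_space) r) :: 'a => real)"
  by (intro integrable_real_indicator emeasure_bounded_finite) auto

text \<open>The Bochner integral of a non-integrable function is 0 by default, and the majorant has
  non-negative integral; so the bound holds without knowing whether f is integrable.\<close>

lemma norm_integral_AE_le:
  fixes f :: "'c => 'b::euclidean_space"
  assumes g: "integrable M g" and le: "AE x in M. norm (f x) \<le> g x"
  shows "norm (integral\<^sup>L M f) \<le> integral\<^sup>L M g"
proof (cases "integrable M f")
  case True
  have "norm (integral\<^sup>L M f) \<le> (LINT x|M. norm (f x))" by (rule integral_norm_bound)
  also have "\<dots> \<le> integral\<^sup>L M g" by (rule integral_mono_AE) (use True g le in auto)
  finally show ?thesis .
next
  case False
  have "AE x in M. 0 \<le> g x" using le by eventually_elim (meson norm_ge_zero order_trans)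
  then have "0 \<le> integral\<^sup>L M g" by (rule integral_nonneg_AE)
  then show ?thesis using False by (simp add: not_integrable_integral_eq)
qed

text \<open>The spatial integral in the weak equation tested with w: the first summand is v
  \<otimes> v : \<nabla>w in coordinate-free form, see \<open>tensor_grad_eq\<close>.\<close>

definition flux :: "('a::euclidean_space => 'a) => ('a => real) => ('a => 'a) => real" where
  "flux v p w = (LBINT y. fderiv w y (v y) \<bullet> v y + p y * divergence w y)"

text \<open>K carries the cutoff \<theta>, S0 carries its derivative, and S contains the
  \<epsilon>-neighbourhood of S0, which is all that the mollifier sees of the velocity and the
  pressure there. V is the volume of the mollification ball, and L, of order 1/\<delta> in the
  application, bounds the derivative of \<theta>.\<close>

locale cutoff =
  fixes \<Omega> K S0 S :: "'a::euclidean_space set" and \<epsilon> V L C :: real and \<eta> \<theta> :: "'a => real"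
    and \<theta>' :: "'a => 'a => real"
  assumes eps: "0 < \<epsilon>" and V: "V = measure lborel (cball (0::'a) \<epsilon>)" and C0: "0 \<le> C" and L0: "0 \<le> L"
    and ker: "kernel \<epsilon> \<eta>" and eta0: "\<And>z. 0 \<le> \<eta> z" and eta1: "integral\<^sup>L lborel \<eta> = 1"
    and etaC: "\<And>z. \<eta> z \<le> C / V"
    and DetaC: "\<And>z v. \<bar>fderiv \<eta> z v\<bar> \<le> C / (\<epsilon> * V) * norm v"
    and K: "compact K" "\<And>x. x \<in> K ==> cball x \<epsilon> \<subseteq> \<Omega>"
    and chi: "\<And>x. 0 \<le> \<theta> x" "\<And>x. \<theta> x \<le> 1" "\<And>x. x \<notin> K ==> \<theta> x = 0"
    and chi': "\<And>x. (\<theta> has_derivative \<theta>' x) (at x)" "\<And>x h. \<bar>\<theta>' x h\<bar> \<le> L * norm h"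
      "\<And>x h. x \<notin> S0 ==> \<theta>' x h = 0"
    and S0: "S0 \<subseteq> K" "\<And>x. x \<in> S0 ==> cball x \<epsilon> \<subseteq> S"
begin

text \<open>The kernel is reflected so that \<open>mol\<close> is the adjoint of the outer
  mollification \<open>conv \<eta>\<close>; the test field applies one and then the other, with the
  cutoff in between.\<close>

definition mol :: "('a => 'a) => 'a => 'a" where "mol = conv (\<lambda>z. \<eta> (- z))"

definition cut :: "('a => 'a) => 'a => 'a" where "cut v x = \<theta> x *\<^sub>R mol v x"

definition Dmol :: "('a => 'a) => 'a => 'a => 'a" where
  "Dmol v x h = - (LBINT y. fderiv \<eta> (y - x) h *\<^sub>R v y)"

definition Dcut :: "('a => 'a) => 'a => 'a => 'a" where
  "Dcut v x h = \<theta> x *\<^sub>R Dmol v x h + \<theta>' x h *\<^sub>R mol v x"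

text \<open>Normalised by the ball volume, so that the kernel bound C / V turns an \<eta>-weighted
  moment of the increments into C times \<open>avg\<close>, with no power of \<epsilon> left
  over.\<close>

definition avg :: "nat => ('a => 'a) => 'a => real" where
  "avg j v x = (LBINT y. ind (cball x \<epsilon>) y * norm (v y - v x) ^ j) / V"

lemma V_pos: "V > 0" using eps by (simp add: V content_cball_pos)

lemma ker': "kernel \<epsilon> (\<lambda>z. \<eta> (- z))" by (rule kernel_reflect[OF ker])

lemma eta_borel [measurable]: "\<eta> \<in> borel_measurable borel" by (rule kernel_borel[OF ker])

lemma Deta_borel [measurable]: "(\<lambda>z. fderiv \<eta> z h) \<in> borel_measurable borel"
  by (rule kernel_borel[OF kernel_derivative[OF ker]])

lemma eta_zero: "\<epsilon> < norm z ==> \<eta> z = 0" by (rule kernel_zero[OF ker])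

lemma eta_integrable: "integrable lborel \<eta>"
  using eta1 not_integrable_integral_eq by fastforce

lemma eta_shift: "integrable lborel (\<lambda>y. \<eta> (y - x))" "(LBINT y. \<eta> (y - x)) = 1"
proof -
  show "integrable lborel (\<lambda>y. \<eta> (y - x))"
    using integrable_lborel_shift[OF eta_integrable, of "- x"] by simp
  show "(LBINT y. \<eta> (y - x)) = 1"
    using integral_lborel_shift[OF eta_borel, of "- x"] eta1 by simp
qed

lemma S0_zero: "x \<notin> K ==> \<theta>' x h = 0" using S0(1) chi'(3) by blast

lemma chi'_linear: "bounded_linear (\<theta>' x)" by (rule has_derivative_bounded_linear[OF chi'(1)])

lemma chi_continuous: "continuous_on UNIV \<theta>"
  using has_derivative_continuous[OF chi'(1)] by (simp add: continuous_on_eq_continuous_at)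

lemma chi_borel [measurable]: "\<theta> \<in> borel_measurable borel"
  by (rule borel_measurable_continuous_onI[OF chi_continuous])

lemma chi'_borel [measurable]: "(\<lambda>x. \<theta>' x h) \<in> borel_measurable borel"
  by (rule derivative_borel_measurable[OF chi'(1)])

lemma mol_eq: "mol v x = (LBINT y. \<eta> (y - x) *\<^sub>R v y)"
  by (simp add: mol_def conv_def)

context
  fixes v :: "'a => 'a"
  assumes v1: "integrable lborel v"
begin

lemma v_borel: "v \<in> borel_measurable borel"
  using borel_measurable_integrable[OF v1] by simp

lemma eta_v_integrable: "integrable lborel (\<lambda>y. \<eta> (y - x) *\<^sub>R v y)"
  using conv_integrable[OF ker' v1, of x] by simp

lemma Deta_v_integrable: "integrable lborel (\<lambda>y. fderiv \<eta> (y - x) h *\<^sub>R v y)"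
  using conv_integrable[OF kernel_reflect(1)[OF kernel_derivative[OF ker]] v1, of x] by simp

lemma mol_has_derivative: "(mol v has_derivative Dmol v x) (at x)"
  unfolding mol_def
  by (rule has_derivative_eq_rhs[OF conv_has_derivative[OF ker' v1]])
    (simp add: fun_eq_iff Dmol_def conv_def kernel_reflect(2)[OF ker] scaleR_minus_left)

lemma mol_continuous: "continuous_on A (mol v)"
  using has_derivative_continuous[OF mol_has_derivative] continuous_at_imp_continuous_on by blast

lemma mol_borel: "mol v \<in> borel_measurable borel"
  by (rule borel_measurable_continuous_onI[OF mol_continuous])

lemma Dmol_borel: "(\<lambda>x. Dmol v x h) \<in> borel_measurable borel"
  by (rule derivative_borel_measurable[OF mol_has_derivative])

lemma mol_bound: "norm (mol v x) \<le> C / V * (LBINT y. norm (v y))"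
proof -
  have "norm (mol v x) \<le> (LBINT y. C / V * norm (v y))"
    unfolding mol_eq
    by (rule Bochner_Integration.integral_norm_bound_integral[OF eta_v_integrable])
      (use v1 in \<open>simp, simp only: norm_scaleR real_norm_def abs_of_nonneg[OF eta0], intro mult_right_mono etaC, simp\<close>)
  then show ?thesis by simp
qed

lemma Dmol_bound: "norm (Dmol v x h) \<le> C / (\<epsilon> * V) * (LBINT y. norm (v y)) * norm h"
proof -
  have "norm (LBINT y. fderiv \<eta> (y - x) h *\<^sub>R v y)
      \<le> (LBINT y. (C / (\<epsilon> * V) * norm h) * norm (v y))"
    by (rule Bochner_Integration.integral_norm_bound_integral[OF Deta_v_integrable])
      (use v1 in \<open>simp, simp only: norm_scaleR real_norm_def, intro mult_right_mono DetaC, simp\<close>)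
  then show ?thesis by (simp add: Dmol_def mult_ac)
qed

lemma cut_has_derivative: "(cut v has_derivative Dcut v x) (at x)"
  unfolding cut_def
  by (rule has_derivative_eq_rhs[OF has_derivative_scaleR[OF chi'(1) mol_has_derivative]])
    (simp add: fun_eq_iff Dcut_def)

lemma cut_zero: "x \<notin> K ==> cut v x = 0" by (simp add: cut_def chi)

lemma Dcut_zero: "x \<notin> K ==> Dcut v x h = 0" by (simp add: Dcut_def chi S0_zero)

lemma cut_bound: "norm (cut v x) \<le> C / V * (LBINT y. norm (v y))"
proof -
  have "norm (cut v x) \<le> 1 * norm (mol v x)"
    unfolding cut_def norm_scaleR using chi by (intro mult_right_mono) auto
  then show ?thesis using mol_bound[of x] by simp
qed

lemma Dcut_bound_ex: "\<exists>B\<ge>0. \<forall>x h. norm (Dcut v x h) \<le> B * norm h"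
proof -
  let ?I = "LBINT y. norm (v y)"
  have b: "0 \<le> C / (\<epsilon> * V) * ?I" "0 \<le> C / V * ?I" using C0 eps V_pos by auto
  have "norm (Dcut v x h) \<le> (C / (\<epsilon> * V) * ?I + L * (C / V * ?I)) * norm h" for x h
  proof -
    have "norm (\<theta> x *\<^sub>R Dmol v x h) \<le> 1 * (C / (\<epsilon> * V) * ?I * norm h)"
      unfolding norm_scaleR using chi Dmol_bound by (intro mult_mono) auto
    moreover have "norm (\<theta>' x h *\<^sub>R mol v x) \<le> L * norm h * (C / V * ?I)"
      unfolding norm_scaleR real_norm_def using chi' mol_bound L0 by (intro mult_mono) auto
    ultimately have "norm (Dcut v x h) \<le> 1 * (C / (\<epsilon> * V) * ?I * norm h) + L * norm h * (C / V * ?I)"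
      unfolding Dcut_def by (meson add_mono norm_triangle_ineq order_trans)
    then show ?thesis by (simp add: algebra_simps)
  qed
  moreover have "0 \<le> C / (\<epsilon> * V) * ?I + L * (C / V * ?I)" by (rule add_nonneg_nonneg[OF b(1) mult_nonneg_nonneg[OF L0 b(2)]])
  ultimately show ?thesis by blast
qed

lemma cut_borel: "cut v \<in> borel_measurable borel"
proof -
  note [measurable] = mol_borel
  show ?thesis unfolding cut_def[abs_def] by measurable
qed

lemma cut_integrable: "integrable lborel (cut v)"
  by (rule integrable_bounded_compact[OF cut_borel compact_imp_bounded[OF K(1)] cut_zero cut_bound])

lemma Dcut_linear: "bounded_linear (Dcut v x)"
  by (rule has_derivative_bounded_linear[OF cut_has_derivative])

lemma Dcut_borel: "(\<lambda>x. Dcut v x h) \<in> borel_measurable borel"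
  by (rule derivative_borel_measurable[OF cut_has_derivative])

lemma Dcut_integrable: "integrable lborel (\<lambda>x. Dcut v x h)"
proof -
  obtain B where "B \<ge> 0" "\<And>x h. norm (Dcut v x h) \<le> B * norm h" using Dcut_bound_ex by metis
  then show ?thesis
    by (intro integrable_bounded_compact[OF Dcut_borel compact_imp_bounded[OF K(1)] Dcut_zero, of _ "B * norm h"])
qed

lemma field_derivative: "fderiv (conv \<eta> (cut v)) y h = conv \<eta> (\<lambda>x. Dcut v x h) y"
proof -
  obtain B where "B \<ge> 0" "\<And>x h. norm (Dcut v x h) \<le> B * norm h" using Dcut_bound_ex by metis
  then show ?thesis
    by (intro conv_derivative_parts[OF ker K(1) cut_zero cut_has_derivative _ cut_bound])
qed

lemma field_test: "conv \<eta> (cut v) \<in> test_functions \<Omega>"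
  by (rule conv_test_function[OF ker cut_integrable K(1) cut_zero K(2)])

text \<open>The trace is minus the integral of the derivative of the translated kernel in direction
  v; its vanishing is incompressibility in weak form, tested with the kernel centred at x.\<close>

lemma Dmol_trace:
  assumes "(LBINT y. fderiv \<eta> (y - x) (v y)) = 0"
  shows "(\<Sum>i\<in>Basis. Dmol v x i \<bullet> i) = 0"
proof -
  have i: "integrable lborel (\<lambda>y. fderiv \<eta> (y - x) i * (v y \<bullet> i))" for i
    using integrable_inner_left[OF Deta_v_integrable[of x i], of i] by simp
  have "Dmol v x i \<bullet> i = - (LBINT y. fderiv \<eta> (y - x) i * (v y \<bullet> i))" for i
    unfolding Dmol_def using integral_inner_left[OF Deta_v_integrable[of x i], of i] by simp
  then have "(\<Sum>i\<in>Basis. Dmol v x i \<bullet> i) =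
      - (LBINT y. (\<Sum>i\<in>Basis. fderiv \<eta> (y - x) i * (v y \<bullet> i)))"
    using i by (simp add: sum_negf)
  also have "(\<lambda>y. \<Sum>i\<in>Basis. fderiv \<eta> (y - x) i * (v y \<bullet> i)) = (\<lambda>y. fderiv \<eta> (y - x) (v y))"
  proof
    show "(\<Sum>i\<in>Basis. fderiv \<eta> (y - x) i * (v y \<bullet> i)) = fderiv \<eta> (y - x) (v y)" for y
      using linear_expand[OF kernel_linear[OF ker], of "y - x" "v y"] by (simp add: mult.commute)
  qed
  also have "(LBINT y. fderiv \<eta> (y - x) (v y)) = 0"
    by (rule assms)
  finally show ?thesis by simp
qed

lemma Dcut_trace:
  assumes div: "\<And>x. x \<in> K ==> (\<Sum>i\<in>Basis. Dmol v x i \<bullet> i) = 0"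
  shows "(\<Sum>i\<in>Basis. Dcut v x i \<bullet> i) = \<theta>' x (mol v x)"
proof (cases "x \<in> K")
  case True
  have "(\<Sum>i\<in>Basis. Dcut v x i \<bullet> i) = \<theta> x * (\<Sum>i\<in>Basis. Dmol v x i \<bullet> i) + (\<Sum>i\<in>Basis. (mol v x \<bullet> i) *\<^sub>R \<theta>' x i)"
    by (simp add: Dcut_def inner_add_left sum.distrib sum_distrib_left mult.commute)
  then show ?thesis using div[OF True] linear_expand[OF chi'_linear, of x "mol v x"] by simp
qed (simp add: Dcut_zero S0_zero)

lemma field_divergence:
  assumes div: "\<And>x. x \<in> K ==> (\<Sum>i\<in>Basis. Dmol v x i \<bullet> i) = 0"
  shows "divergence (conv \<eta> (cut v)) y = conv \<eta> (\<lambda>x. \<theta>' x (mol v x)) y"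
proof -
  note Dcut_trace[OF div]
  moreover have "divergence (conv \<eta> (cut v)) y = conv \<eta> (\<lambda>x. \<Sum>i\<in>Basis. Dcut v x i \<bullet> i) y"
  proof -
    have "fderiv (conv \<eta> (cut v)) y i \<bullet> i = (LBINT x. \<eta> (y - x) *\<^sub>R (Dcut v x i \<bullet> i))" for i
      unfolding field_derivative conv_def
      by (subst integral_inner_left[symmetric]) (use conv_integrable[OF ker Dcut_integrable] in simp_all)
    moreover have "integrable lborel (\<lambda>x. \<eta> (y - x) *\<^sub>R (Dcut v x i \<bullet> i))" for i
      using integrable_inner_left[of i lborel "\<lambda>x. \<eta> (y - x) *\<^sub>R Dcut v x i"] conv_integrable[OF ker Dcut_integrable] by simp
    ultimately show ?thesis
      unfolding divergence_def conv_def by (simp add: scaleR_sum_right sum_distrib_left)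
  qed
  ultimately show ?thesis by simp
qed

lemma field_divergence_outside:
  assumes div: "\<And>x. x \<in> K ==> (\<Sum>i\<in>Basis. Dmol v x i \<bullet> i) = 0" and y: "y \<notin> S"
  shows "divergence (conv \<eta> (cut v)) y = 0"
proof -
  have "conv \<eta> (\<lambda>x. \<theta>' x (mol v x)) y = 0"
  proof (rule conv_zero[OF ker])
    fix x assume "x \<in> cball y \<epsilon>"
    then have "y \<in> cball x \<epsilon>" by (simp add: dist_commute)
    then show "\<theta>' x (mol v x) = 0" using S0(2)[of x] y chi'(3) by blast
  qed
  then show ?thesis by (simp only: field_divergence[OF div])
qed

end

text \<open>This symmetry is the reason for mollifying on both sides of the cutoff. With v and w the
  velocity at two times, either may be frozen, and for equal times the pairing is the localised
  energy.\<close>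

lemma energy_symmetric:
  assumes "integrable lborel v" "integrable lborel w"
  shows "(LBINT y. v y \<bullet> conv \<eta> (cut w) y) = (LBINT x. \<theta> x * (mol v x \<bullet> mol w x))"
proof -
  have "(LBINT y. v y \<bullet> conv \<eta> (cut w) y) = (LBINT x. cut w x \<bullet> mol v x)"
    unfolding mol_def by (rule conv_adjoint(1)[OF ker cut_integrable[OF assms(2)] assms(1)])
  then show ?thesis by (simp add: cut_def inner_commute)
qed

section \<open>The flux of a single divergence-free field\<close>

context
  fixes v :: "'a => 'a" and p :: "'a => real" and M P :: real
  assumes v1: "integrable lborel v" and v2: "integrable lborel (\<lambda>x. (norm (v x))^2)"
    and v3: "integrable lborel (\<lambda>x. norm (v x) ^ 3)"
    and divfree: "\<And>x. cball x \<epsilon> \<subseteq> \<Omega> ==> (LBINT y. fderiv \<eta> (y - x) (v y)) = 0"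
    and M: "0 \<le> M" "AE x in lborel. x \<in> S --> norm (v x) \<le> M"
    and p: "p \<in> borel_measurable borel" and P: "0 \<le> P" "AE x in lborel. x \<in> S --> \<bar>p x\<bar> \<le> P"
    and S0b: "S0 \<in> sets borel"
begin

lemmas vm [measurable] = v_borel[OF v1] and molm [measurable] = mol_borel[OF v1]
  and Dmolm [measurable] = Dmol_borel[OF v1] and Dcutm [measurable] = Dcut_borel[OF v1] and pm [measurable] = p and S0m [measurable] = S0b

lemma Km [measurable]: "K \<in> sets borel"
  using K(1) by (simp add: borel_closed compact_imp_closed)

lemma DD: "(\<Sum>i\<in>Basis. Dmol v x i \<bullet> i) = 0" if "x \<in> K" for x
  by (rule Dmol_trace[OF v1 divfree[OF K(2)[OF that]]])

lemma cball_measurable [measurable]: "Measurable.pred (borel \<Otimes>\<^sub>M borel) (\<lambda>(x::'a, y). y \<in> cball x \<epsilon>)"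
  unfolding mem_cball by measurable

text \<open>A power up to 3 of the increment is at most 1 plus its cube, and the cube is at most 8
  times the sum of the two cubes; the parts constant in y are confined to the ball.\<close>

lemma increment_integrable:
  assumes "j \<le> 3"
  shows "integrable lborel (\<lambda>y. ind (cball x \<epsilon>) y * norm (v y - v x) ^ j)"
proof (rule bochner_bound)
  let ?g = "\<lambda>y. ind (cball x \<epsilon>) y * (1 + 8 * norm (v x) ^ 3) + 8 * norm (v y) ^ 3"
  show "integrable lborel ?g"
    by (intro bochner_add integrable_mult_left integrable_mult_right integrable_indicator_cball v3)
  show "AE y in lborel. norm (ind (cball x \<epsilon>) y * norm (v y - v x) ^ j) \<le> norm (?g y)"
  proof (rule AE_I2)
    fix y
    let ?a = "norm (v y)" and ?b = "norm (v x)" and ?d = "norm (v y - v x)"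
    have "?d \<le> 2 * max ?a ?b" using norm_triangle_ineq4[of "v y" "v x"] by linarith
    then have "?d ^ 3 \<le> (2 * max ?a ?b) ^ 3" by (intro power_mono) auto
    also have "\<dots> = 8 * (max ?a ?b) ^ 3" by (simp add: power_mult_distrib)
    also have "\<dots> \<le> 8 * (?a ^ 3 + ?b ^ 3)" by (simp add: max_def)
    finally have d3: "?d ^ 3 \<le> 8 * ?a ^ 3 + 8 * ?b ^ 3" by simp
    have "?d ^ j \<le> 1 + ?d ^ 3"
    proof (cases "?d \<le> 1")
      case True
      then have "?d ^ j \<le> 1" by (intro power_le_one) auto
      then show ?thesis by (simp add: add_increasing2)
    next
      case False
      then have "?d ^ j \<le> ?d ^ 3" using assms by (intro power_increasing) auto
      then show ?thesis by simp
    qed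
    then show "norm (ind (cball x \<epsilon>) y * ?d ^ j) \<le> norm (?g y)"
      using d3 by (auto simp: indicator_def)
  qed
qed measurable

lemma avg_nonneg: "0 \<le> avg j v x"
  unfolding avg_def using V_pos by (intro divide_nonneg_pos Bochner_Integration.integral_nonneg) auto

lemma eta_increment:
  assumes "j \<le> 3"
  shows "integrable lborel (\<lambda>y. \<eta> (y - x) * norm (v y - v x) ^ j)"
    and "(LBINT y. \<eta> (y - x) * norm (v y - v x) ^ j) \<le> C * avg j v x"
proof -
  have le: "\<eta> (y - x) * norm (v y - v x) ^ j \<le> C / V * (ind (cball x \<epsilon>) y * norm (v y - v x) ^ j)" for y
  proof (cases "y \<in> cball x \<epsilon>")
    case True
    then show ?thesis using mult_right_mono[OF etaC[of "y - x"], of "norm (v y - v x) ^ j"] by simp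
  next
    case False
    then have "\<eta> (y - x) = 0" by (intro eta_zero) (simp add: dist_norm norm_minus_commute)
    then show ?thesis using False by simp
  qed
  have i: "integrable lborel (\<lambda>y. C / V * (ind (cball x \<epsilon>) y * norm (v y - v x) ^ j))"
    by (intro integrable_mult_right increment_integrable assms)
  show i2: "integrable lborel (\<lambda>y. \<eta> (y - x) * norm (v y - v x) ^ j)"
  proof (rule bochner_bound[OF i])
    show "AE y in lborel. norm (\<eta> (y - x) * norm (v y - v x) ^ j) \<le> norm (C / V * (ind (cball x \<epsilon>) y * norm (v y - v x) ^ j))"
    proof (rule AE_I2)
      fix y
      have "norm (\<eta> (y - x) * norm (v y - v x) ^ j) = \<eta> (y - x) * norm (v y - v x) ^ j"
        using eta0 by (simp add: abs_mult)
      also note le[of y]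
      also note abs_ge_self
      finally show "norm (\<eta> (y - x) * norm (v y - v x) ^ j) \<le> norm (C / V * (ind (cball x \<epsilon>) y * norm (v y - v x) ^ j))"
        by (simp only: real_norm_def)
    qed
  qed measurable
  have "(LBINT y. \<eta> (y - x) * norm (v y - v x) ^ j) \<le> (LBINT y. C / V * (ind (cball x \<epsilon>) y * norm (v y - v x) ^ j))"
    by (rule integral_mono[OF i2 i le])
  also have "\<dots> = C * avg j v x" by (simp add: avg_def)
  finally show "(LBINT y. \<eta> (y - x) * norm (v y - v x) ^ j) \<le> C * avg j v x" .
qed

text \<open>The gradient of the kernel has integral 0, so v x may be subtracted under the integral.
  One increment is gained against the factor 1/\<epsilon>.\<close>

lemma Dmol_increment: "norm (Dmol v x h) \<le> C / \<epsilon> * avg 1 v x * norm h"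
proof -
  let ?D = "\<lambda>y. fderiv \<eta> (y - x) h"
  have D0: "integrable lborel (\<lambda>z. fderiv \<eta> z h)" "(LBINT z. fderiv \<eta> z h) = 0"
    by (rule integral_derivative_zero[OF kernel_has_derivative[OF ker], of "cball 0 \<epsilon>" h "C / (\<epsilon> * V) * norm h"];
        use eta_zero DetaC in auto)+
  have Di: "integrable lborel ?D" using integrable_lborel_shift[OF D0(1), of "- x"] by simp
  have Dz: "integral\<^sup>L lborel ?D = 0"
    using integral_lborel_shift[OF Deta_borel[of h], of "- x"] D0(2) by simp
  have i: "integrable lborel (\<lambda>y. ?D y *\<^sub>R (v y - v x))"
    unfolding scaleR_diff_right
    by (intro Bochner_Integration.integrable_diff Deta_v_integrable[OF v1] integrable_scaleR_left Di)
  have "Dmol v x h = - (LBINT y. ?D y *\<^sub>R (v y - v x))"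
    unfolding Dmol_def scaleR_diff_right
    by (subst Bochner_Integration.integral_diff) (use Deta_v_integrable[OF v1] Di Dz in auto)
  then have "norm (Dmol v x h) = norm (LBINT y. ?D y *\<^sub>R (v y - v x))" by simp
  also have "\<dots> \<le> (LBINT y. (C / (\<epsilon> * V) * norm h) * (ind (cball x \<epsilon>) y * norm (v y - v x) ^ 1))"
  proof (rule Bochner_Integration.integral_norm_bound_integral[OF i])
    show "integrable lborel (\<lambda>y. (C / (\<epsilon> * V) * norm h) * (ind (cball x \<epsilon>) y * norm (v y - v x) ^ 1))"
      by (intro integrable_mult_right increment_integrable) simp
    show "norm (?D y *\<^sub>R (v y - v x)) \<le> (C / (\<epsilon> * V) * norm h) * (ind (cball x \<epsilon>) y * norm (v y - v x) ^ 1)" for y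
    proof (cases "y \<in> cball x \<epsilon>")
      case True
      then show ?thesis using mult_right_mono[OF DetaC[of "y - x" h], of "norm (v y - v x)"] by simp
    next
      case False
      then have "?D y = 0" by (intro kernel_zero[OF kernel_derivative[OF ker]]) (simp add: dist_norm norm_minus_commute)
      then show ?thesis using False by simp
    qed
  qed
  also have "\<dots> = C / \<epsilon> * avg 1 v x * norm h" by (simp add: avg_def)
  finally show ?thesis .
qed

lemma average_indicator: "measure lborel (cball (x::'a) \<epsilon>) = V"
  using content_cball[of \<epsilon> x] content_cball[of \<epsilon> "0::'a"] eps by (simp add: V)

lemma avg_Young1:
  assumes "0 < \<kappa>"
  shows "(M^2 + P) * avg 1 v x \<le> \<kappa> ^ 3 * (M ^ 3 + P powr (3/2)) + 2 / \<kappa> ^ 6 * avg 3 v x"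
proof -
  let ?Z = "M ^ 3 + P powr (3/2)"
  note i = integrable_indicator_cball[of x \<epsilon>]
  have "(M^2 + P) * (LBINT y. ind (cball x \<epsilon>) y * norm (v y - v x) ^ 1) =
      (LBINT y. (M^2 + P) * (ind (cball x \<epsilon>) y * norm (v y - v x) ^ 1))" by simp
  also have "\<dots> \<le> (LBINT y. \<kappa> ^ 3 * ?Z * ind (cball x \<epsilon>) y + 2 / \<kappa> ^ 6 * (ind (cball x \<epsilon>) y * norm (v y - v x) ^ 3))"
  proof (rule integral_mono)
    show "integrable lborel (\<lambda>y. (M^2 + P) * (ind (cball x \<epsilon>) y * norm (v y - v x) ^ 1))"
      by (intro integrable_mult_right increment_integrable) simp
    show "integrable lborel (\<lambda>y. \<kappa> ^ 3 * ?Z * ind (cball x \<epsilon>) y + 2 / \<kappa> ^ 6 * (ind (cball x \<epsilon>) y * norm (v y - v x) ^ 3))"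
      by (intro bochner_add integrable_mult_right increment_integrable i) simp
    show "(M^2 + P) * (ind (cball x \<epsilon>) y * norm (v y - v x) ^ 1) \<le>
       \<kappa> ^ 3 * ?Z * ind (cball x \<epsilon>) y + 2 / \<kappa> ^ 6 * (ind (cball x \<epsilon>) y * norm (v y - v x) ^ 3)" for y
      using Young_weighted[OF norm_ge_zero M(1) P(1) assms, of "v y - v x"] by (auto simp: indicator_def)
  qed
  also have "\<dots> = \<kappa> ^ 3 * ?Z * V + 2 / \<kappa> ^ 6 * (LBINT y. ind (cball x \<epsilon>) y * norm (v y - v x) ^ 3)"
    by (subst Bochner_Integration.integral_add)
      (use i increment_integrable[of 3 x] in \<open>simp_all add: average_indicator\<close>)
  finally have "(M^2 + P) * (LBINT y. ind (cball x \<epsilon>) y * norm (v y - v x) ^ 1) / V \<le>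
     (\<kappa> ^ 3 * ?Z * V + 2 / \<kappa> ^ 6 * (LBINT y. ind (cball x \<epsilon>) y * norm (v y - v x) ^ 3)) / V"
    using V_pos by (intro divide_right_mono) auto
  then show ?thesis using V_pos by (simp add: avg_def add_divide_distrib)
qed

lemma avg_mult_le:
  assumes "0 \<le> s" shows "s * avg 2 v x \<le> s ^ 3 + avg 3 v x"
proof -
  note i = integrable_indicator_cball[of x \<epsilon>]
  have "s * (LBINT y. ind (cball x \<epsilon>) y * norm (v y - v x) ^ 2) =
      (LBINT y. s * (ind (cball x \<epsilon>) y * norm (v y - v x) ^ 2))" by simp
  also have "\<dots> \<le> (LBINT y. s ^ 3 * ind (cball x \<epsilon>) y + ind (cball x \<epsilon>) y * norm (v y - v x) ^ 3)"
  proof (rule integral_mono)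
    show "integrable lborel (\<lambda>y. s * (ind (cball x \<epsilon>) y * norm (v y - v x) ^ 2))"
      by (intro integrable_mult_right increment_integrable) simp
    show "integrable lborel (\<lambda>y. s ^ 3 * ind (cball x \<epsilon>) y + ind (cball x \<epsilon>) y * norm (v y - v x) ^ 3)"
      by (intro bochner_add integrable_mult_right increment_integrable i) simp
    show "s * (ind (cball x \<epsilon>) y * norm (v y - v x) ^ 2) \<le> s ^ 3 * ind (cball x \<epsilon>) y + ind (cball x \<epsilon>) y * norm (v y - v x) ^ 3" for y
      using Young_cubic[OF assms norm_ge_zero, of "v y - v x"] by (auto simp: indicator_def)
  qed
  also have "\<dots> = s ^ 3 * V + (LBINT y. ind (cball x \<epsilon>) y * norm (v y - v x) ^ 3)"
    by (subst Bochner_Integration.integral_add)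
      (use i increment_integrable[of 3 x] in \<open>simp_all add: average_indicator\<close>)
  finally have "s * (LBINT y. ind (cball x \<epsilon>) y * norm (v y - v x) ^ 2) / V \<le>
     (s ^ 3 * V + (LBINT y. ind (cball x \<epsilon>) y * norm (v y - v x) ^ 3)) / V"
    using V_pos by (intro divide_right_mono) auto
  then show ?thesis using V_pos by (simp add: avg_def add_divide_distrib)
qed

text \<open>In place of Hoelder's inequality: for fixed y, \<open>avg_mult_le\<close> with s the
  length of the increment at y gives the cube of s plus \<open>avg 3\<close>; averaging over y makes
  this twice \<open>avg 3\<close>.\<close>

lemma avg_product: "avg 1 v x * avg 2 v x \<le> 2 * avg 3 v x"
proof -
  note i = integrable_indicator_cball[of x \<epsilon>]
  have "(LBINT y. ind (cball x \<epsilon>) y * norm (v y - v x) ^ 1) * avg 2 v x =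
      (LBINT y. (ind (cball x \<epsilon>) y * norm (v y - v x) ^ 1) * avg 2 v x)" by simp
  also have "\<dots> \<le> (LBINT y. ind (cball x \<epsilon>) y * norm (v y - v x) ^ 3 + ind (cball x \<epsilon>) y * avg 3 v x)"
  proof (rule integral_mono)
    show "integrable lborel (\<lambda>y. (ind (cball x \<epsilon>) y * norm (v y - v x) ^ 1) * avg 2 v x)"
      by (intro integrable_mult_left increment_integrable) simp
    show "integrable lborel (\<lambda>y. ind (cball x \<epsilon>) y * norm (v y - v x) ^ 3 + ind (cball x \<epsilon>) y * avg 3 v x)"
      by (intro bochner_add integrable_mult_left increment_integrable i) simp
    show "(ind (cball x \<epsilon>) y * norm (v y - v x) ^ 1) * avg 2 v x \<le> ind (cball x \<epsilon>) y * norm (v y - v x) ^ 3 + ind (cball x \<epsilon>) y * avg 3 v x" for y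
      using avg_mult_le[OF norm_ge_zero, of "v y - v x"] by (auto simp: indicator_def)
  qed
  also have "\<dots> = (LBINT y. ind (cball x \<epsilon>) y * norm (v y - v x) ^ 3) + V * avg 3 v x"
    by (subst Bochner_Integration.integral_add)
      (use i increment_integrable[of 3 x] in \<open>simp_all add: average_indicator\<close>)
  finally have "(LBINT y. ind (cball x \<epsilon>) y * norm (v y - v x) ^ 1) * avg 2 v x / V \<le>
     ((LBINT y. ind (cball x \<epsilon>) y * norm (v y - v x) ^ 3) + V * avg 3 v x) / V"
    using V_pos by (intro divide_right_mono) auto
  then show ?thesis using V_pos by (simp add: avg_def add_divide_distrib)
qed

lemma increment_average_borel: "avg 3 v \<in> borel_measurable borel"
proof -
  have "(\<lambda>(x, y). ind (cball x \<epsilon>) y * norm (v y - v x) ^ 3) = (\<lambda>(x, y). (if dist x y \<le> \<epsilon> then 1 else 0) * norm (v y - v x) ^ 3)"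
    by (auto simp: fun_eq_iff indicator_def)
  moreover have "(\<lambda>(x, y). (if dist x y \<le> \<epsilon> then 1 else 0) * norm (v y - v x) ^ 3) \<in> borel_measurable (borel \<Otimes>\<^sub>M lborel)"
    by measurable
  ultimately have "(\<lambda>x. LBINT y. ind (cball x \<epsilon>) y * norm (v y - v x) ^ 3) \<in> borel_measurable borel"
    using lborel.borel_measurable_lebesgue_integral by simp
  then show ?thesis unfolding avg_def[abs_def] by measurable
qed

lemma increment_average_integrable: "integrable lborel (\<lambda>x. ind K x * avg 3 v x)"
proof -
  obtain R where R: "\<And>x. x \<in> K ==> norm x \<le> R"
    using compact_imp_bounded[OF K(1)] unfolding bounded_iff by blast
  let ?g = "\<lambda>x. 8 * norm (v x) ^ 3 + 8 / V * (LBINT y. norm (v y) ^ 3) * ind (cball 0 R) x"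
  show ?thesis
proof (rule bochner_bound)
  show "integrable lborel ?g"
    by (intro bochner_add integrable_mult_right integrable_indicator_cball v3)
  show "(\<lambda>x. ind K x * avg 3 v x) \<in> borel_measurable lborel"
    using increment_average_borel by measurable
  show "AE x in lborel. norm (ind K x * avg 3 v x) \<le> norm (?g x)"
  proof (rule AE_I2)
    fix x
    have I0: "0 \<le> (LBINT y. norm (v y) ^ 3)" by simp
    have pw: "norm (v y - v x) ^ 3 \<le> 8 * norm (v y) ^ 3 + 8 * norm (v x) ^ 3" for y
    proof -
      let ?a = "norm (v y)" and ?b = "norm (v x)" and ?d = "norm (v y - v x)"
      have "?d \<le> 2 * max ?a ?b" using norm_triangle_ineq4[of "v y" "v x"] by linarith
      then have "?d ^ 3 \<le> (2 * max ?a ?b) ^ 3" by (intro power_mono) auto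
      also have "\<dots> = 8 * (max ?a ?b) ^ 3" by (simp add: power_mult_distrib)
      also have "\<dots> \<le> 8 * (?a ^ 3 + ?b ^ 3)" by (simp add: max_def)
      finally show ?thesis by simp
    qed
    have "(LBINT y. ind (cball x \<epsilon>) y * norm (v y - v x) ^ 3)
        \<le> (LBINT y. 8 * norm (v y) ^ 3 + ind (cball x \<epsilon>) y * (8 * norm (v x) ^ 3))"
    proof (rule integral_mono)
      show "integrable lborel (\<lambda>y. ind (cball x \<epsilon>) y * norm (v y - v x) ^ 3)"
        by (rule increment_integrable) simp
      show "integrable lborel (\<lambda>y. 8 * norm (v y) ^ 3 + ind (cball x \<epsilon>) y * (8 * norm (v x) ^ 3))"
        by (intro bochner_add integrable_mult_right integrable_mult_left integrable_indicator_cball v3)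
      show "ind (cball x \<epsilon>) y * norm (v y - v x) ^ 3 \<le> 8 * norm (v y) ^ 3 + ind (cball x \<epsilon>) y * (8 * norm (v x) ^ 3)" for y
        using pw[of y] by (auto simp: indicator_def)
    qed
    also have "\<dots> = 8 * (LBINT y. norm (v y) ^ 3) + V * (8 * norm (v x) ^ 3)"
      by (subst Bochner_Integration.integral_add)
        (use v3 integrable_indicator_cball[of x \<epsilon>] in \<open>simp_all add: average_indicator\<close>)
    finally have "avg 3 v x \<le> (8 * (LBINT y. norm (v y) ^ 3) + V * (8 * norm (v x) ^ 3)) / V"
      unfolding avg_def using V_pos by (intro divide_right_mono) auto
    also have "\<dots> = 8 * norm (v x) ^ 3 + 8 / V * (LBINT y. norm (v y) ^ 3)"
      using V_pos by (simp add: field_simps)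
    finally have le: "avg 3 v x \<le> 8 * norm (v x) ^ 3 + 8 / V * (LBINT y. norm (v y) ^ 3)" .
    have g0: "0 \<le> ?g x" using V_pos I0 by simp
    show "norm (ind K x * avg 3 v x) \<le> norm (?g x)"
    proof (cases "x \<in> K")
      case True
      then show ?thesis using le avg_nonneg[of 3 x] R[OF True] g0 by simp
    qed (use g0 in simp)
  qed
qed
qed

lemma mol_bound_S0: "norm (mol v x) \<le> M" if x: "x \<in> S0"
proof -
  have "norm (mol v x) \<le> (LBINT y. M * \<eta> (y - x))"
    unfolding mol_eq
  proof (rule norm_integral_AE_le)
    show "integrable lborel (\<lambda>y. M * \<eta> (y - x))" using eta_shift(1) by simp
    show "AE y in lborel. norm (\<eta> (y - x) *\<^sub>R v y) \<le> M * \<eta> (y - x)"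
      using M(2)
    proof eventually_elim
      case (elim y)
      show ?case
      proof (cases "y \<in> cball x \<epsilon>")
        case True
        then have "norm (v y) \<le> M" using elim S0(2)[OF x] by blast
        then show ?thesis using mult_right_mono[OF _ eta0, of "norm (v y)" M "y - x"] eta0 by (simp add: mult.commute)
      next
        case False
        then have "\<eta> (y - x) = 0" by (intro eta_zero) (simp add: dist_norm norm_minus_commute)
        then show ?thesis by simp
      qed
    qed
  qed
  then show ?thesis using eta_shift by simp
qed

lemma mol_close: "norm (mol v x - v x) \<le> (LBINT y. \<eta> (y - x) * norm (v y - v x) ^ 1)"
proof -
  have c: "integrable lborel (\<lambda>y. \<eta> (y - x) *\<^sub>R v x)" using eta_shift(1) by simp
  have "mol v x - v x = (LBINT y. \<eta> (y - x) *\<^sub>R v y) - (LBINT y. \<eta> (y - x) *\<^sub>R v x)"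
    unfolding mol_eq using eta_shift by simp
  also have "\<dots> = (LBINT y. \<eta> (y - x) *\<^sub>R (v y - v x))"
    unfolding scaleR_diff_right using eta_v_integrable[OF v1] c by simp
  also have "norm \<dots> \<le> (LBINT y. norm (\<eta> (y - x) *\<^sub>R (v y - v x)))"
    by (rule integral_norm_bound)
  finally show ?thesis using eta0 by simp
qed

text \<open>Exchanges the mollified velocity for v itself, because the wall-normal hypothesis
  concerns v. The cost L C \<open>avg 1\<close> is harmless, as L is fixed while \<epsilon> tends to
  0.\<close>

lemma transport_bound:
  "\<bar>\<theta>' x (mol v x)\<bar> \<le> \<bar>\<theta>' x (v x)\<bar> + L * (ind S0 x * (C * avg 1 v x))"
proof (cases "x \<in> S0")
  case True
  have "\<theta>' x (mol v x) = \<theta>' x (v x) + \<theta>' x (mol v x - v x)"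
    by (simp add: linear_diff[OF bounded_linear.linear[OF chi'_linear]])
  moreover have "\<bar>\<theta>' x (mol v x - v x)\<bar> \<le> L * (C * avg 1 v x)"
    using chi'(2)[of x "mol v x - v x"] mult_left_mono[OF order_trans[OF mol_close eta_increment(2)[of 1 x]] L0]
    by simp
  ultimately show ?thesis using True by simp
qed (simp add: chi'(3))

text \<open>The commutator: the \<eta>-average of the quadratic form of the derivative of the cut
  field, evaluated on the fluctuation of v about its own average.\<close>

definition remainder :: "'a => real" where
  "remainder x = (LBINT y. \<eta> (y - x) * (Dcut v x (v y - mol v x) \<bullet> (v y - mol v x)))"

text \<open>The translated kernel is a probability density with mean \<open>mol v x\<close>; the
  average of a quadratic form is its value at the mean plus its average over fluctuations, since the
  cross terms cancel.\<close>

lemma eta_quadratic: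
  assumes "bounded_linear A"
  shows "(LBINT y. \<eta> (y - x) * (A (v y) \<bullet> v y)) =
      A (mol v x) \<bullet> mol v x + (LBINT y. \<eta> (y - x) * (A (v y - mol v x) \<bullet> (v y - mol v x)))"
    and "integrable lborel (\<lambda>y. \<eta> (y - x) * (A (v y - mol v x) \<bullet> (v y - mol v x)))"
proof -
  interpret A: bounded_linear A by fact
  obtain B where B: "\<And>h. norm (A h) \<le> norm h * B" "B \<ge> 0" using A.nonneg_bounded by metis
  let ?m = "mol v x"
  have Am [measurable]: "A \<in> borel_measurable borel"
    by (intro borel_measurable_continuous_onI linear_continuous_on assms)
  have iv: "integrable lborel (\<lambda>y. \<eta> (y - x) *\<^sub>R v y)" by (rule eta_v_integrable[OF v1])
  have i1: "integrable lborel (\<lambda>y. \<eta> (y - x) * (A ?m \<bullet> v y))"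
    using integrable_inner_right[OF iv, of "A ?m"] by simp
  have e1: "(LBINT y. \<eta> (y - x) * (A ?m \<bullet> v y)) = A ?m \<bullet> ?m"
    using integral_inner_right[OF iv, of "A ?m"] by (simp add: mol_eq)
  have T: "bounded_linear (\<lambda>w. A w \<bullet> ?m)"
    by (rule bounded_linear_compose[OF bounded_linear_inner_left assms])
  have i2: "integrable lborel (\<lambda>y. \<eta> (y - x) * (A (v y) \<bullet> ?m))"
    using integrable_bounded_linear[OF T iv] by (simp add: A.scaleR)
  have e2: "(LBINT y. \<eta> (y - x) * (A (v y) \<bullet> ?m)) = A ?m \<bullet> ?m"
    using integral_bounded_linear[OF T iv] by (simp add: A.scaleR mol_eq)
  have i3: "integrable lborel (\<lambda>y. \<eta> (y - x) * (A ?m \<bullet> ?m))" using eta_shift(1) by simp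
  have e3: "(LBINT y. \<eta> (y - x) * (A ?m \<bullet> ?m)) = A ?m \<bullet> ?m" using eta_shift by simp
  have i0: "integrable lborel (\<lambda>y. \<eta> (y - x) * (A (v y) \<bullet> v y))"
  proof (rule bochner_bound[of _ "\<lambda>y. C / V * B * (norm (v y))^2"])
    show "integrable lborel (\<lambda>y. C / V * B * (norm (v y))^2)" using v2 by simp
    show "AE y in lborel. norm (\<eta> (y - x) * (A (v y) \<bullet> v y)) \<le> norm (C / V * B * (norm (v y))^2)"
    proof (rule AE_I2)
      fix y
      have "\<bar>A (v y) \<bullet> v y\<bar> \<le> norm (v y) * B * norm (v y)"
        using Cauchy_Schwarz_ineq2 mult_right_mono[OF B(1)] norm_ge_zero order_trans by meson
      then have "\<eta> (y - x) * \<bar>A (v y) \<bullet> v y\<bar> \<le> C / V * (norm (v y) * B * norm (v y))"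
        using etaC C0 V_pos by (intro mult_mono) auto
      also have "\<dots> = C / V * B * (norm (v y))^2" by (simp add: power2_eq_square mult_ac)
      also have "\<dots> \<le> norm (C / V * B * (norm (v y))^2)" unfolding real_norm_def by (rule abs_ge_self)
      finally show "norm (\<eta> (y - x) * (A (v y) \<bullet> v y)) \<le> norm (C / V * B * (norm (v y))^2)"
        using eta0 by (simp add: abs_mult)
    qed
  qed measurable
  have eq: "\<eta> (y - x) * (A (v y - ?m) \<bullet> (v y - ?m)) =
     \<eta> (y - x) * (A (v y) \<bullet> v y) - \<eta> (y - x) * (A ?m \<bullet> v y) - \<eta> (y - x) * (A (v y) \<bullet> ?m) + \<eta> (y - x) * (A ?m \<bullet> ?m)" for y
    by (simp add: A.diff inner_diff algebra_simps)
  show "integrable lborel (\<lambda>y. \<eta> (y - x) * (A (v y - ?m) \<bullet> (v y - ?m)))"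
    unfolding eq by (intro bochner_add Bochner_Integration.integrable_diff i0 i1 i2 i3)
  show "(LBINT y. \<eta> (y - x) * (A (v y) \<bullet> v y)) =
      A ?m \<bullet> ?m + (LBINT y. \<eta> (y - x) * (A (v y - ?m) \<bullet> (v y - ?m)))"
    unfolding eq using i0 i1 i2 i3 e1 e2 e3 by simp
qed

text \<open>The mean minimises the mean square deviation, so fluctuations about
  \<open>mol v x\<close> are controlled by increments from v x.\<close>

lemma variance_le:
  "integrable lborel (\<lambda>y. \<eta> (y - x) * norm (v y - mol v x) ^ 2)"
  "(LBINT y. \<eta> (y - x) * norm (v y - mol v x) ^ 2) \<le> (LBINT y. \<eta> (y - x) * norm (v y - v x) ^ 2)"
proof -
  let ?m = "mol v x"
  have n: "a \<bullet> a = norm a ^ 2" for a :: 'a by (simp add: power2_norm_eq_inner)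
  note q = eta_quadratic[OF bounded_linear_ident, of x, unfolded n]
  show i: "integrable lborel (\<lambda>y. \<eta> (y - x) * norm (v y - ?m) ^ 2)" by (rule q(2))
  have iv: "integrable lborel (\<lambda>y. \<eta> (y - x) *\<^sub>R v y)" by (rule eta_v_integrable[OF v1])
  have i1: "integrable lborel (\<lambda>y. \<eta> (y - x) * ((?m - v x) \<bullet> v y))"
    using integrable_inner_right[OF iv, of "?m - v x"] by simp
  have e1: "(LBINT y. \<eta> (y - x) * ((?m - v x) \<bullet> v y)) = (?m - v x) \<bullet> ?m"
    using integral_inner_right[OF iv, of "?m - v x"] by (simp add: mol_eq)
  have i2: "integrable lborel (\<lambda>y. \<eta> (y - x) * c)" and e2: "(LBINT y. \<eta> (y - x) * c) = c" for c :: real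
    using eta_shift by simp_all
  have eq: "\<eta> (y - x) * norm (v y - v x) ^ 2 =
     \<eta> (y - x) * norm (v y - ?m) ^ 2 + 2 * (\<eta> (y - x) * ((?m - v x) \<bullet> v y)) - 2 * (\<eta> (y - x) * ((?m - v x) \<bullet> ?m)) + \<eta> (y - x) * norm (?m - v x) ^ 2" for y
    by (simp add: power2_norm_eq_inner inner_diff algebra_simps inner_commute)
  have "(LBINT y. \<eta> (y - x) * norm (v y - v x) ^ 2) = (LBINT y. \<eta> (y - x) * norm (v y - ?m) ^ 2) + norm (?m - v x) ^ 2"
    unfolding eq using i i1 e1 eta_shift[of x] by simp
  then show "(LBINT y. \<eta> (y - x) * norm (v y - ?m) ^ 2) \<le> (LBINT y. \<eta> (y - x) * norm (v y - v x) ^ 2)" by simp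
qed

text \<open>The derivative of the cut field has two parts. The mollified gradient is bounded by C /
  \<epsilon> times \<open>avg 1\<close>, and with the variance C \<open>avg 2\<close> this gives the
  cubic term. The gradient of the cutoff acts only on S0, where the mollified velocity is bounded by
  M and the variance is linear in increments.\<close>

lemma remainder_bound:
  "AE x in lborel. \<bar>remainder x\<bar> \<le> ind K x * (2 * C^2 / \<epsilon> * avg 3 v x) + ind S0 x * (2 * L * M^2 * C * avg 1 v x)"
  using M(2)
proof eventually_elim
  case (elim x)
  show ?case
  proof (cases "x \<in> K")
    case False
    then have "x \<notin> S0" "remainder x = 0" using S0(1) by (auto simp: remainder_def Dcut_zero[OF v1])
    then show ?thesis using False by simp
  next
    case True
    let ?m = "mol v x"
    let ?q2 = "LBINT y. \<eta> (y - x) * norm (v y - v x) ^ 2"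
    define a where "a = C / \<epsilon> * avg 1 v x + L * (ind S0 x * M)"
    have a0: "0 \<le> C / \<epsilon> * avg 1 v x" "0 \<le> L * (ind S0 x * M)" using C0 eps L0 M(1) avg_nonneg by auto
    have Db: "norm (Dcut v x h) \<le> a * norm h" for h
    proof -
      have "norm (\<theta> x *\<^sub>R Dmol v x h) \<le> 1 * (C / \<epsilon> * avg 1 v x * norm h)"
        unfolding norm_scaleR using chi Dmol_increment by (intro mult_mono) auto
      moreover have "norm (\<theta>' x h *\<^sub>R ?m) \<le> L * (ind S0 x * M) * norm h"
      proof (cases "x \<in> S0")
        case True
        have "norm (\<theta>' x h *\<^sub>R ?m) \<le> L * norm h * M"
          unfolding norm_scaleR real_norm_def using chi'(2) mol_bound_S0[OF True] L0 by (intro mult_mono) auto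
        then show ?thesis using True by (simp add: mult_ac)
      qed (simp add: chi'(3))
      ultimately have "norm (Dcut v x h) \<le> 1 * (C / \<epsilon> * avg 1 v x * norm h) + L * (ind S0 x * M) * norm h"
        unfolding Dcut_def by (meson add_mono norm_triangle_ineq order_trans)
      then show ?thesis by (simp add: a_def algebra_simps)
    qed
    have "\<bar>remainder x\<bar> \<le> (LBINT y. a * (\<eta> (y - x) * norm (v y - ?m) ^ 2))"
      unfolding remainder_def real_norm_def[symmetric]
    proof (rule Bochner_Integration.integral_norm_bound_integral[OF eta_quadratic(2)[OF Dcut_linear[OF v1]]])
      show "integrable lborel (\<lambda>y. a * (\<eta> (y - x) * norm (v y - ?m) ^ 2))" using variance_le(1) by simp
      show "norm (\<eta> (y - x) * (Dcut v x (v y - ?m) \<bullet> (v y - ?m))) \<le> a * (\<eta> (y - x) * norm (v y - ?m) ^ 2)" for y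
      proof -
        have "\<bar>Dcut v x (v y - ?m) \<bullet> (v y - ?m)\<bar> \<le> a * norm (v y - ?m) * norm (v y - ?m)"
          using Cauchy_Schwarz_ineq2 mult_right_mono[OF Db] norm_ge_zero order_trans by meson
        then have "\<eta> (y - x) * \<bar>Dcut v x (v y - ?m) \<bullet> (v y - ?m)\<bar> \<le> \<eta> (y - x) * (a * norm (v y - ?m) * norm (v y - ?m))"
          using eta0 by (intro mult_left_mono) auto
        then show ?thesis using eta0 by (simp add: abs_mult power2_eq_square mult_ac)
      qed
    qed
    also have "\<dots> = a * (LBINT y. \<eta> (y - x) * norm (v y - ?m) ^ 2)" by simp
    also have "\<dots> \<le> a * ?q2"
      using a0 variance_le(2) unfolding a_def by (intro mult_left_mono) auto
    also have "\<dots> = C / \<epsilon> * avg 1 v x * ?q2 + L * (ind S0 x * M) * ?q2" by (simp add: a_def algebra_simps)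
    also have "\<dots> \<le> 2 * C^2 / \<epsilon> * avg 3 v x + ind S0 x * (2 * L * M^2 * C * avg 1 v x)"
    proof (rule add_mono)
      have "C / \<epsilon> * avg 1 v x * ?q2 \<le> C / \<epsilon> * avg 1 v x * (C * avg 2 v x)"
        using a0(1) eta_increment(2)[of 2 x] by (intro mult_left_mono) auto
      also have "\<dots> = C^2 / \<epsilon> * (avg 1 v x * avg 2 v x)" by (simp add: power2_eq_square)
      also have "\<dots> \<le> C^2 / \<epsilon> * (2 * avg 3 v x)"
        using avg_product eps by (intro mult_left_mono) auto
      finally show "C / \<epsilon> * avg 1 v x * ?q2 \<le> 2 * C^2 / \<epsilon> * avg 3 v x" by (simp add: mult_ac)
    next
      show "L * (ind S0 x * M) * ?q2 \<le> ind S0 x * (2 * L * M^2 * C * avg 1 v x)"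
      proof (cases "x \<in> S0")
        case S: True
        have "x \<in> S" using S0(2)[OF S] eps by auto
        then have vx: "norm (v x) \<le> M" using elim by simp
        \<comment> \<open>Points of S0 and their \<epsilon>-neighbours lie in S, so one factor of
          the squared increment is at most 2 M and the other remains as a first-order
          increment.\<close>
        have "?q2 \<le> (LBINT y. 2 * M * (\<eta> (y - x) * norm (v y - v x) ^ 1))"
        proof (rule integral_mono_AE)
          show "integrable lborel (\<lambda>y. \<eta> (y - x) * norm (v y - v x) ^ 2)" by (rule eta_increment(1)) simp
          show "integrable lborel (\<lambda>y. 2 * M * (\<eta> (y - x) * norm (v y - v x) ^ 1))"
            by (intro integrable_mult_right eta_increment(1)) simp
          show "AE y in lborel. \<eta> (y - x) * norm (v y - v x) ^ 2 \<le> 2 * M * (\<eta> (y - x) * norm (v y - v x) ^ 1)"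
            using M(2)
          proof eventually_elim
            case (elim y)
            show ?case
            proof (cases "y \<in> cball x \<epsilon>")
              case True
              then have "norm (v y) \<le> M" using elim S0(2)[OF S] by blast
              then have "norm (v y - v x) \<le> 2 * M" using vx norm_triangle_ineq4[of "v y" "v x"] by linarith
              then have "norm (v y - v x) * (\<eta> (y - x) * norm (v y - v x)) \<le> 2 * M * (\<eta> (y - x) * norm (v y - v x))"
                using eta0 by (intro mult_right_mono) auto
              then show ?thesis by (simp add: power2_eq_square mult_ac)
            next
              case False
              then have "\<eta> (y - x) = 0" by (intro eta_zero) (simp add: dist_norm norm_minus_commute)
              then show ?thesis by simp
            qed
          qed
        qed
        also have "\<dots> = 2 * M * (LBINT y. \<eta> (y - x) * norm (v y - v x) ^ 1)" by simp
        also have "\<dots> \<le> 2 * M * (C * avg 1 v x)"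
          using eta_increment(2)[of 1 x] M(1) by (intro mult_left_mono) auto
        finally have "L * M * ?q2 \<le> L * M * (2 * M * (C * avg 1 v x))"
          using L0 M(1) by (intro mult_left_mono) auto
        then show ?thesis using S by (simp add: power2_eq_square mult_ac)
      qed simp
    qed
    finally show ?thesis using True by simp
  qed
qed

lemma Dcut_expand: "Dcut v x h = (\<Sum>i\<in>Basis. (h \<bullet> i) *\<^sub>R Dcut v x i)"
  by (rule linear_expand[OF Dcut_linear[OF v1]])

lemma theta'_expand: "\<theta>' x h = (\<Sum>i\<in>Basis. (h \<bullet> i) * \<theta>' x i)"
  using linear_expand[OF chi'_linear, of x h] by (simp only: real_scaleR_def)

lemma theta'_v_integrable: "integrable lborel (\<lambda>x. \<bar>\<theta>' x (v x)\<bar>)"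
proof (rule bochner_bound[of _ "\<lambda>x. L * norm (v x)"])
  show "integrable lborel (\<lambda>x. L * norm (v x))" using v1 by simp
  have "(\<lambda>x. \<theta>' x (v x)) = (\<lambda>x. \<Sum>i\<in>Basis. (v x \<bullet> i) * \<theta>' x i)"
    by (rule ext) (rule theta'_expand)
  then have "(\<lambda>x. \<theta>' x (v x)) \<in> borel_measurable lborel" by simp
  then show "(\<lambda>x. \<bar>\<theta>' x (v x)\<bar>) \<in> borel_measurable lborel" by measurable
  show "AE x in lborel. norm \<bar>\<theta>' x (v x)\<bar> \<le> norm (L * norm (v x))"
    using chi'(2) L0 by (intro AE_I2) simp
qed

lemma theta'_mol_integrable: "integrable lborel (\<lambda>x. \<theta>' x (mol v x))"
proof (rule integrable_bounded_compact[OF _ compact_imp_bounded[OF K(1)] S0_zero])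
  have "(\<lambda>x. \<theta>' x (mol v x)) = (\<lambda>x. \<Sum>i\<in>Basis. (mol v x \<bullet> i) * \<theta>' x i)"
    by (rule ext) (rule theta'_expand)
  then show "(\<lambda>x. \<theta>' x (mol v x)) \<in> borel_measurable borel" by simp
  show "norm (\<theta>' x (mol v x)) \<le> L * (C / V * (LBINT y. norm (v y)))" for x
    using order_trans[OF chi'(2) mult_left_mono[OF mol_bound[OF v1] L0]] by simp
qed

text \<open>The compactly supported field |mol v|^2 / 2 times \<open>cut v\<close> has a divergence
  with integral 0. As \<open>mol v\<close> is divergence-free on K, that divergence is the
  self-advection of the mollified velocity up to a term with the derivative of \<theta>. So the
  resolved part of the flux lives only where the cutoff varies.\<close>

lemma cubic_identity:
  "integrable lborel (\<lambda>x. Dcut v x (mol v x) \<bullet> mol v x)"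
  "integrable lborel (\<lambda>x. \<theta>' x (mol v x) * (norm (mol v x))^2)"
  "(LBINT x. Dcut v x (mol v x) \<bullet> mol v x) = 1/2 * (LBINT x. \<theta>' x (mol v x) * (norm (mol v x))^2)"
proof -
  let ?m = "mol v"
  define Bm where "Bm = C / V * (LBINT y. norm (v y))"
  define Bd where "Bd = C / (\<epsilon> * V) * (LBINT y. norm (v y))"
  have Bm: "norm (?m x) \<le> Bm" "norm (cut v x) \<le> Bm" for x
    unfolding Bm_def by (rule mol_bound[OF v1], rule cut_bound[OF v1])
  have Bm0: "0 \<le> Bm" using order_trans[OF norm_ge_zero Bm(1)] .
  have Bd: "norm (Dmol v x h) \<le> Bd * norm h" for x h unfolding Bd_def by (rule Dmol_bound[OF v1])
  have Bd0: "0 \<le> Bd" using C0 eps V_pos by (simp add: Bd_def)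
  obtain Bc where Bc: "Bc \<ge> 0" "\<And>x h. norm (Dcut v x h) \<le> Bc * norm h" using Dcut_bound_ex[OF v1] by metis
  define F' where "F' x h = (1/2 * (?m x \<bullet> ?m x)) *\<^sub>R Dcut v x h + (Dmol v x h \<bullet> ?m x) *\<^sub>R cut v x" for x h
  have FD: "((\<lambda>x. (1/2 * (?m x \<bullet> ?m x)) *\<^sub>R cut v x) has_derivative F' x) (at x)" for x
  proof -
    note has_derivative_mult_right[OF has_derivative_inner[OF mol_has_derivative[OF v1] mol_has_derivative[OF v1]], of "1/2" x]
    from has_derivative_scaleR[OF this cut_has_derivative[OF v1]] show ?thesis
      by (rule has_derivative_eq_rhs) (simp add: F'_def fun_eq_iff inner_commute)
  qed
  have F'b: "norm (F' x h) \<le> (1/2 * (Bm * Bm)) * (Bc * norm h) + (Bd * norm h * Bm) * Bm" for x h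
  proof -
    have "\<bar>?m x \<bullet> ?m x\<bar> \<le> Bm * Bm"
      by (rule order_trans[OF Cauchy_Schwarz_ineq2]) (intro mult_mono Bm Bm0 norm_ge_zero)
    then have "norm ((1/2 * (?m x \<bullet> ?m x)) *\<^sub>R Dcut v x h) \<le> (1/2 * (Bm * Bm)) * (Bc * norm h)"
      unfolding norm_scaleR using Bc Bm0 by (intro mult_mono) auto
    moreover have "\<bar>Dmol v x h \<bullet> ?m x\<bar> \<le> Bd * norm h * Bm"
      by (rule order_trans[OF Cauchy_Schwarz_ineq2]) (intro mult_mono Bd Bm Bd0 Bm0 norm_ge_zero mult_nonneg_nonneg)
    then have "norm ((Dmol v x h \<bullet> ?m x) *\<^sub>R cut v x) \<le> (Bd * norm h * Bm) * Bm"
      unfolding norm_scaleR using Bm Bm0 Bd0 by (intro mult_mono) auto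
    ultimately show ?thesis unfolding F'_def by (meson add_mono norm_triangle_ineq order_trans)
  qed
  have F0: "integrable lborel (\<lambda>x. F' x h)" "(LBINT x. F' x h) = 0" for h
    using integral_derivative_zero[OF FD K(1) _ F'b] cut_zero[OF v1] by simp_all
  have tr: "(\<Sum>i\<in>Basis. F' x i \<bullet> i) = 1/2 * (\<theta>' x (?m x) * (norm (?m x))^2) + \<theta> x * (Dmol v x (?m x) \<bullet> ?m x)" for x
  proof -
    have "(\<Sum>i\<in>Basis. F' x i \<bullet> i) = (1/2 * (?m x \<bullet> ?m x)) * (\<Sum>i\<in>Basis. Dcut v x i \<bullet> i) + (\<Sum>i\<in>Basis. (cut v x \<bullet> i) *\<^sub>R Dmol v x i) \<bullet> ?m x"
      by (simp add: F'_def inner_add_left sum.distrib sum_distrib_left inner_sum_left mult.commute)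
    also have "(\<Sum>i\<in>Basis. (cut v x \<bullet> i) *\<^sub>R Dmol v x i) = Dmol v x (cut v x)"
      by (rule linear_expand[symmetric, OF has_derivative_bounded_linear[OF mol_has_derivative[OF v1]]])
    also have "\<dots> = \<theta> x *\<^sub>R Dmol v x (?m x)"
      unfolding cut_def by (rule linear_cmul[OF has_derivative_linear[OF mol_has_derivative[OF v1]]])
    finally show ?thesis by (simp add: Dcut_trace[OF v1 DD] power2_norm_eq_inner)
  qed
  have F0i: "integrable lborel (\<lambda>x. F' x i \<bullet> i)" "(LBINT x. F' x i \<bullet> i) = 0" for i
    using F0[of i] integrable_inner_left[OF F0(1), of i i] integral_inner_left[OF F0(1), of i i] by simp_all
  have i0: "integrable lborel (\<lambda>x. \<Sum>i\<in>Basis. F' x i \<bullet> i)" "(LBINT x. (\<Sum>i\<in>Basis. F' x i \<bullet> i)) = 0"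
    using F0i by simp_all
  have D: "Dcut v x (?m x) \<bullet> ?m x = (\<Sum>i\<in>Basis. F' x i \<bullet> i) + 1/2 * (\<theta>' x (?m x) * (norm (?m x))^2)" for x
    unfolding tr by (simp add: Dcut_def inner_add_left power2_norm_eq_inner)
  show i2: "integrable lborel (\<lambda>x. \<theta>' x (?m x) * (norm (?m x))^2)"
  proof (rule bochner_bound[of _ "\<lambda>x. Bm^2 * \<theta>' x (?m x)"])
    show "integrable lborel (\<lambda>x. Bm^2 * \<theta>' x (?m x))" using theta'_mol_integrable by simp
    show "(\<lambda>x. \<theta>' x (?m x) * (norm (?m x))^2) \<in> borel_measurable lborel"
      using borel_measurable_integrable[OF theta'_mol_integrable] by measurable
    show "AE x in lborel. norm (\<theta>' x (?m x) * (norm (?m x))^2) \<le> norm (Bm^2 * \<theta>' x (?m x))"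
    proof (rule AE_I2)
      fix x
      have "(norm (?m x))^2 \<le> Bm^2" by (intro power_mono Bm) simp
      from mult_left_mono[OF this abs_ge_zero[of "\<theta>' x (?m x)"]]
      show "norm (\<theta>' x (?m x) * (norm (?m x))^2) \<le> norm (Bm^2 * \<theta>' x (?m x))"
        by (simp add: abs_mult mult.commute)
    qed
  qed
  show "integrable lborel (\<lambda>x. Dcut v x (?m x) \<bullet> ?m x)"
    unfolding D by (intro bochner_add i0 integrable_mult_right i2)
  show "(LBINT x. Dcut v x (?m x) \<bullet> ?m x) = 1/2 * (LBINT x. \<theta>' x (?m x) * (norm (?m x))^2)"
    unfolding D using i0 i2 by simp
qed

text \<open>The derivative of the test field is the mollification of \<open>Dcut\<close>; exchanging
  the integrals moves the outer kernel onto the quadratic form in v, where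
  \<open>eta_quadratic\<close> separates the mean from the commutator.\<close>

lemma advection_eq:
  "integrable lborel (\<lambda>y. fderiv (conv \<eta> (cut v)) y (v y) \<bullet> v y)"
  "(LBINT y. fderiv (conv \<eta> (cut v)) y (v y) \<bullet> v y) =
     1/2 * (LBINT x. \<theta>' x (mol v x) * (norm (mol v x))^2) + integral\<^sup>L lborel remainder"
  "integrable lborel remainder"
proof -
  obtain B where B: "B \<ge> 0" "\<And>x h. norm (Dcut v x h) \<le> B * norm h" using Dcut_bound_ex[OF v1] by metis
  define G where "G x y = \<eta> (y - x) * (Dcut v x (v y) \<bullet> v y)" for x y
  have Gm: "case_prod G \<in> borel_measurable (lborel \<Otimes>\<^sub>M lborel)"
    unfolding G_def Dcut_expand[of _ "v _"] by measurable
  have a: "integrable lborel (\<lambda>x. C / V * B * ind K x)"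
    using emeasure_compact_finite[OF K(1)] by (auto intro!: integrable_real_indicator)
  have Gle: "\<bar>G x y\<bar> \<le> (C / V * B * ind K x) * (norm (v y))^2" for x y
  proof (cases "x \<in> K")
    case True
    have "\<bar>Dcut v x (v y) \<bullet> v y\<bar> \<le> B * norm (v y) * norm (v y)"
      using Cauchy_Schwarz_ineq2 mult_right_mono[OF B(2)] norm_ge_zero order_trans by meson
    then have "\<eta> (y - x) * \<bar>Dcut v x (v y) \<bullet> v y\<bar> \<le> C / V * (B * norm (v y) * norm (v y))"
      using etaC C0 V_pos by (intro mult_mono) auto
    then show ?thesis using True eta0 by (simp add: G_def abs_mult power2_eq_square mult_ac)
  qed (simp add: G_def Dcut_zero[OF v1])
  note fub = fubini_bounded[OF Gm a v2 Gle]
  have 1: "fderiv (conv \<eta> (cut v)) y (v y) \<bullet> v y = (LBINT x. G x y)" for y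
  proof -
    have "integrable lborel (\<lambda>x. \<eta> (y - x) *\<^sub>R Dcut v x (v y))"
      by (rule conv_integrable[OF ker Dcut_integrable[OF v1]])
    from integral_inner_left[OF this, of "v y"] show ?thesis
      by (simp add: field_derivative[OF v1] conv_def G_def)
  qed
  have 2: "(LBINT y. G x y) = Dcut v x (mol v x) \<bullet> mol v x + remainder x" for x
    unfolding G_def remainder_def by (rule eta_quadratic(1)[OF Dcut_linear[OF v1]])
  have 3: "remainder x = (LBINT y. G x y) - Dcut v x (mol v x) \<bullet> mol v x" for x using 2 by simp
  show r: "integrable lborel remainder"
    unfolding 3[abs_def] by (rule Bochner_Integration.integrable_diff[OF fub(3) cubic_identity(1)])
  show "integrable lborel (\<lambda>y. fderiv (conv \<eta> (cut v)) y (v y) \<bullet> v y)"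
    unfolding 1 by (rule fub(4))
  have "(LBINT y. fderiv (conv \<eta> (cut v)) y (v y) \<bullet> v y) = (LBINT x. LBINT y. G x y)"
    unfolding 1 by (rule fub(2)[symmetric])
  also have "\<dots> = (LBINT x. Dcut v x (mol v x) \<bullet> mol v x) + integral\<^sup>L lborel remainder"
    unfolding 2 by (rule Bochner_Integration.integral_add[OF cubic_identity(1) r])
  finally show "(LBINT y. fderiv (conv \<eta> (cut v)) y (v y) \<bullet> v y) =
     1/2 * (LBINT x. \<theta>' x (mol v x) * (norm (mol v x))^2) + integral\<^sup>L lborel remainder"
    by (simp add: cubic_identity(3))
qed

text \<open>The kernel has integral 1, so mollification preserves the mass of a non-negative
  function; this converts the pressure term into an integral of the unmollified cutoff
  gradient.\<close>

lemma conv_nonneg_integral: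
  assumes F: "integrable lborel F" and F0: "\<And>x. 0 \<le> F x" "\<And>x. x \<notin> K ==> F x = (0::real)"
  shows "integrable lborel (conv \<eta> F)" "integral\<^sup>L lborel (conv \<eta> F) = integral\<^sup>L lborel F"
proof -
  obtain R where R: "\<And>x. x \<in> K ==> norm x \<le> R"
    using compact_imp_bounded[OF K(1)] unfolding bounded_iff by blast
  have [measurable]: "F \<in> borel_measurable borel" using borel_measurable_integrable[OF F] by simp
  define G where "G x y = \<eta> (y - x) * F x" for x y
  have Gm: "case_prod G \<in> borel_measurable (lborel \<Otimes>\<^sub>M lborel)" unfolding G_def by measurable
  have b: "integrable lborel (\<lambda>y. C / V * ind (cball (0::'a) (R + \<epsilon>)) y)"
    by (intro integrable_mult_right integrable_indicator_cball)
  have Gle: "\<bar>G x y\<bar> \<le> F x * (C / V * ind (cball (0::'a) (R + \<epsilon>)) y)" for x y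
  proof (cases "x \<in> K \<and> norm (y - x) \<le> \<epsilon>")
    case True
    then have "norm y \<le> R + \<epsilon>" using R[of x] norm_triangle_sub[of y x] by linarith
    then show ?thesis using mult_right_mono[OF etaC F0(1), of "y - x" x] eta0 F0(1)
      by (simp add: G_def abs_mult mult.commute)
  next
    case False
    then have "G x y = 0" using F0(2)[of x] eta_zero[of "y - x"] by (auto simp: G_def)
    then show ?thesis using F0(1) C0 V_pos by simp
  qed
  note fub = fubini_bounded[OF Gm F b Gle]
  have c: "conv \<eta> F y = (LBINT x. G x y)" for y by (simp add: conv_def G_def)
  show "integrable lborel (conv \<eta> F)" unfolding c[abs_def] by (rule fub(4))
  have "integral\<^sup>L lborel (conv \<eta> F) = (LBINT x. LBINT y. G x y)"
    unfolding c by (rule fub(2)[symmetric])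
  also have "\<dots> = integral\<^sup>L lborel F" unfolding G_def using eta_shift by simp
  finally show "integral\<^sup>L lborel (conv \<eta> F) = integral\<^sup>L lborel F" .
qed

text \<open>The absolute value passes inside the mollification, the factor P is available because
  the divergence is supported in S, and conservation of mass removes the kernel.\<close>

lemma pressure_bound:
  "integrable lborel (\<lambda>y. p y * divergence (conv \<eta> (cut v)) y)"
  "\<bar>LBINT y. p y * divergence (conv \<eta> (cut v)) y\<bar> \<le> P * (LBINT x. \<bar>\<theta>' x (mol v x)\<bar>)"
proof -
  let ?F = "\<lambda>x. \<theta>' x (mol v x)" and ?A = "\<lambda>x. \<bar>\<theta>' x (mol v x)\<bar>"
  have Ai: "integrable lborel ?A" using theta'_mol_integrable by simp
  note cA = conv_nonneg_integral[OF Ai abs_ge_zero, unfolded abs_eq_0, OF S0_zero]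
  have d: "divergence (conv \<eta> (cut v)) = conv \<eta> ?F" by (rule ext) (rule field_divergence[OF v1 DD])
  have le: "\<bar>conv \<eta> ?F y\<bar> \<le> conv \<eta> ?A y" for y
    unfolding conv_def
    by (rule order_trans[OF eq_refl[OF real_norm_def[symmetric]]],
      rule Bochner_Integration.integral_norm_bound_integral[OF conv_integrable[OF ker theta'_mol_integrable] conv_integrable[OF ker Ai]])
      (use eta0 in \<open>simp add: abs_mult\<close>)
  have z: "conv \<eta> ?F y = 0" if "y \<notin> S" for y
  proof (rule conv_zero[OF ker])
    fix x assume "x \<in> cball y \<epsilon>"
    then have "y \<in> cball x \<epsilon>" by (simp add: dist_commute)
    then show "?F x = 0" using S0(2)[of x] that chi'(3) by blast
  qed
  have ae: "AE y in lborel. norm (p y * conv \<eta> ?F y) \<le> P * conv \<eta> ?A y"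
    using P(2)
  proof eventually_elim
    case (elim y)
    have c0: "0 \<le> conv \<eta> ?A y" using order_trans[OF abs_ge_zero le] .
    show ?case
    proof (cases "y \<in> S")
      case True
      then have "\<bar>p y\<bar> * \<bar>conv \<eta> ?F y\<bar> \<le> P * conv \<eta> ?A y" using elim le P(1) by (intro mult_mono) auto
      then show ?thesis by (simp add: abs_mult)
    qed (use z c0 P(1) in simp)
  qed
  have Pi: "integrable lborel (\<lambda>y. P * conv \<eta> ?A y)" using cA(1) by simp
  have "conv \<eta> ?F \<in> borel_measurable borel"
    using Ck_on_conv[OF ker theta'_mol_integrable, of 0] by (intro borel_measurable_continuous_onI) simp
  then have m: "(\<lambda>y. p y * conv \<eta> ?F y) \<in> borel_measurable lborel" by measurable
  show "integrable lborel (\<lambda>y. p y * divergence (conv \<eta> (cut v)) y)"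
    unfolding d by (rule bochner_bound[OF Pi m])
      (use ae in \<open>eventually_elim, simp add: order_trans[OF _ abs_ge_self]\<close>)
  have "norm (LBINT y. p y * conv \<eta> ?F y) \<le> (LBINT y. P * conv \<eta> ?A y)"
    by (rule norm_integral_AE_le[OF Pi ae])
  then show "\<bar>LBINT y. p y * divergence (conv \<eta> (cut v)) y\<bar> \<le> P * (LBINT x. ?A x)"
    unfolding d using cA(2) by simp
qed

text \<open>The quantity L C (M^2 + P) \<open>avg 1\<close> occurs three times: once from exchanging
  \<open>mol v\<close> for v in the transport term, twice from the remainder. Young's inequality
  with weight \<kappa> then gives the coefficients 3 \<kappa>^3 and 6 / \<kappa>^6.\<close>

theorem flux_bound:
  assumes \<kappa>: "0 < \<kappa>"
  shows "integrable lborel (\<lambda>y. fderiv (conv \<eta> (cut v)) y (v y) \<bullet> v y + p y * divergence (conv \<eta> (cut v)) y)"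
    and "\<bar>flux v p (conv \<eta> (cut v))\<bar> \<le> (M^2 + P) * (LBINT x. \<bar>\<theta>' x (v x)\<bar>)
      + 3 * L * C * \<kappa> ^ 3 * (M ^ 3 + P powr (3/2)) * measure lborel K
      + (6 * L * C / \<kappa> ^ 6 + 2 * C^2 / \<epsilon>) * (LBINT x. ind K x * avg 3 v x)"
proof -
  let ?A = "\<lambda>x. \<bar>\<theta>' x (mol v x)\<bar>"
  let ?Z = "M ^ 3 + P powr (3/2)"
  let ?W = "\<lambda>x. (M^2 + P) * \<bar>\<theta>' x (v x)\<bar> + 3 * L * C * \<kappa> ^ 3 * ?Z * ind K x
      + (6 * L * C / \<kappa> ^ 6 + 2 * C^2 / \<epsilon>) * (ind K x * avg 3 v x)"
  show "integrable lborel (\<lambda>y. fderiv (conv \<eta> (cut v)) y (v y) \<bullet> v y + p y * divergence (conv \<eta> (cut v)) y)"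
    by (rule bochner_add[OF advection_eq(1) pressure_bound(1)])
  have Ai: "integrable lborel ?A" using theta'_mol_integrable by simp
  have Ki: "integrable lborel (ind K :: 'a => real)"
    using emeasure_compact_finite[OF K(1)] by (intro integrable_real_indicator) auto
  note Wi = integrable_mult_right[OF theta'_v_integrable, of "M^2 + P"]
    integrable_mult_right[OF Ki, of "3 * L * C * \<kappa> ^ 3 * ?Z"]
    integrable_mult_right[OF increment_average_integrable, of "6 * L * C / \<kappa> ^ 6 + 2 * C^2 / \<epsilon>"]
  have W: "integrable lborel ?W"
    by (intro bochner_add Wi)
  let ?U = "\<lambda>x. 1/2 * \<bar>\<theta>' x (mol v x) * (norm (mol v x))^2\<bar> + \<bar>remainder x\<bar> + P * ?A x"
  have U: "integrable lborel ?U"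
    by (intro bochner_add integrable_mult_right integrable_abs cubic_identity(2) advection_eq(3) Ai)
  have "flux v p (conv \<eta> (cut v)) = 1/2 * (LBINT x. \<theta>' x (mol v x) * (norm (mol v x))^2) + integral\<^sup>L lborel remainder
      + (LBINT y. p y * divergence (conv \<eta> (cut v)) y)"
    unfolding flux_def advection_eq(2)[symmetric]
    by (rule Bochner_Integration.integral_add[OF advection_eq(1) pressure_bound(1)])
  moreover have "\<bar>LBINT x. \<theta>' x (mol v x) * (norm (mol v x))^2\<bar> \<le> (LBINT x. \<bar>\<theta>' x (mol v x) * (norm (mol v x))^2\<bar>)"
    by (rule integral_abs_bound)
  moreover have "\<bar>integral\<^sup>L lborel remainder\<bar> \<le> (LBINT x. \<bar>remainder x\<bar>)"
    by (rule integral_abs_bound)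
  moreover note pressure_bound(2)
  moreover have "(LBINT x. ?U x) = 1/2 * (LBINT x. \<bar>\<theta>' x (mol v x) * (norm (mol v x))^2\<bar>) + (LBINT x. \<bar>remainder x\<bar>)
      + P * (LBINT x. ?A x)"
    using cubic_identity(2) advection_eq(3) Ai by simp
  ultimately have "\<bar>flux v p (conv \<eta> (cut v))\<bar> \<le> (LBINT x. ?U x)" by linarith
  also have "\<dots> \<le> (LBINT x. ?W x)"
  proof (rule integral_mono_AE[OF U W])
    show "AE x in lborel. ?U x \<le> ?W x"
      using remainder_bound
    proof eventually_elim
      case (elim x)
      define a where "a = avg 1 v x"
      have a0: "0 \<le> a" unfolding a_def by (rule avg_nonneg)
      have MP: "0 \<le> M^2 + P" using P(1) by simp
      have LC: "0 \<le> L * C" using L0 C0 by simp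
      have 1: "1/2 * \<bar>\<theta>' x (mol v x) * (norm (mol v x))^2\<bar> \<le> M^2 * ?A x"
      proof (cases "x \<in> S0")
        case True
        have "(norm (mol v x))^2 \<le> M^2" by (intro power_mono mol_bound_S0[OF True]) simp
        then have "?A x * (norm (mol v x))^2 \<le> ?A x * M^2" by (intro mult_left_mono) auto
        moreover have "0 \<le> ?A x * M^2" by simp
        ultimately have "1/2 * (?A x * (norm (mol v x))^2) \<le> ?A x * M^2" by linarith
        then show ?thesis by (simp only: abs_mult abs_power2 mult.commute[of "M^2"])
      qed (simp add: chi'(3))
      have 2: "(M^2 + P) * ?A x \<le> (M^2 + P) * \<bar>\<theta>' x (v x)\<bar> + (M^2 + P) * (L * (ind S0 x * (C * a)))"
        using mult_left_mono[OF transport_bound MP, of x] by (simp add: a_def distrib_left)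
      have 3: "ind S0 x * (2 * L * M^2 * C * a) \<le> ind S0 x * (2 * (L * C) * ((M^2 + P) * a))"
      proof (rule mult_left_mono)
        have "M^2 * a \<le> (M^2 + P) * a" using a0 P(1) by (intro mult_right_mono) auto
        from mult_left_mono[OF this LC] have "2 * ((L * C) * (M^2 * a)) \<le> 2 * ((L * C) * ((M^2 + P) * a))" by linarith
        then show "2 * L * M^2 * C * a \<le> 2 * (L * C) * ((M^2 + P) * a)" by (simp only: mult_ac)
      qed simp
      have 4: "(M^2 + P) * a \<le> \<kappa> ^ 3 * ?Z + 2 / \<kappa> ^ 6 * avg 3 v x" unfolding a_def by (rule avg_Young1[OF \<kappa>])
      have "?U x \<le> (M^2 + P) * \<bar>\<theta>' x (v x)\<bar> + 3 * (L * C) * (ind S0 x * ((M^2 + P) * a)) + ind K x * (2 * C^2 / \<epsilon> * avg 3 v x)"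
        using 1 2 3 elim unfolding a_def[symmetric] by (simp add: algebra_simps)
      also have "\<dots> \<le> (M^2 + P) * \<bar>\<theta>' x (v x)\<bar> + 3 * (L * C) * (ind K x * (\<kappa> ^ 3 * ?Z + 2 / \<kappa> ^ 6 * avg 3 v x)) + ind K x * (2 * C^2 / \<epsilon> * avg 3 v x)"
      proof -
        have "ind S0 x * ((M^2 + P) * a) \<le> ind K x * (\<kappa> ^ 3 * ?Z + 2 / \<kappa> ^ 6 * avg 3 v x)"
          using 4 order_trans[OF mult_nonneg_nonneg[OF MP a0] 4] S0(1)
          by (cases "x \<in> S0"; cases "x \<in> K") auto
        from mult_left_mono[OF this, of "3 * (L * C)"] LC show ?thesis by linarith
      qed
      also have "\<dots> = ?W x" by (simp add: algebra_simps)
      finally show ?case .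
    qed
  qed
  also have "\<dots> = (M^2 + P) * (LBINT x. \<bar>\<theta>' x (v x)\<bar>)
      + 3 * L * C * \<kappa> ^ 3 * ?Z * measure lborel K
      + (6 * L * C / \<kappa> ^ 6 + 2 * C^2 / \<epsilon>) * (LBINT x. ind K x * avg 3 v x)"
    using theta'_v_integrable Ki increment_average_integrable by simp
  finally show "\<bar>flux v p (conv \<eta> (cut v))\<bar> \<le> (M^2 + P) * (LBINT x. \<bar>\<theta>' x (v x)\<bar>)
      + 3 * L * C * \<kappa> ^ 3 * ?Z * measure lborel K
      + (6 * L * C / \<kappa> ^ 6 + 2 * C^2 / \<epsilon>) * (LBINT x. ind K x * avg 3 v x)" .
qed

declare vm [measurable del] molm [measurable del] Dmolm [measurable del] Dcutm [measurable del]
  pm [measurable del] S0m [measurable del] Km [measurable del] cball_measurable [measurable del]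

end

end

section \<open>Evolution in time\<close>

lemma integrable_indicator_mult:
  fixes f :: "'a::euclidean_space => real"
  assumes "integrable lborel (\<lambda>x. ind B x * f x)" "A \<subseteq> B" "A \<in> sets borel"
  shows "integrable lborel (\<lambda>x. ind A x * f x)"
proof -
  have "integrable lborel (\<lambda>x. ind A x *\<^sub>R (ind B x * f x))"
    using assms by (intro integrable_mult_indicator) auto
  moreover have "(\<lambda>x. ind A x *\<^sub>R (ind B x * f x)) = (\<lambda>x. ind A x * f x)"
    using assms(2) by (auto simp: indicator_def fun_eq_iff)
  ultimately show ?thesis by (simp only:)
qed

lemma integral_indicator_split:
  fixes f :: "real => real"
  assumes "integrable lborel (\<lambda>x. ind {a<..c} x * f x)" "a \<le> b" "b \<le> c"
  shows "(LBINT x. ind {a<..c} x * f x) =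
    (LBINT x. ind {a<..b} x * f x) + (LBINT x. ind {b<..c} x * f x)"
proof -
  have "integrable lborel (\<lambda>x. ind {a<..b} x * f x)" "integrable lborel (\<lambda>x. ind {b<..c} x * f x)"
    by (rule integrable_indicator_mult[OF assms(1)]; use assms in auto)+
  then have "(LBINT x. ind {a<..b} x * f x) + (LBINT x. ind {b<..c} x * f x) =
     (LBINT x. ind {a<..b} x * f x + ind {b<..c} x * f x)" by simp
  also have "(\<lambda>x. ind {a<..b} x * f x + ind {b<..c} x * f x) = (\<lambda>x. ind {a<..c} x * f x)"
    using assms by (auto simp: indicator_def fun_eq_iff)
  finally show ?thesis by simp
qed

text \<open>Time regularity of the test field is not needed: the quadratic form \<open>A t t\<close> is telescoped
  over a fine partition, freezing one of the two arguments on each step.\<close>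

lemma diagonal_increment_le:
  fixes A B :: "real => real => real"
  assumes ab: "a \<le> b"
    and sym: "\<And>t \<tau>. t \<in> {a..b} ==> \<tau> \<in> {a..b} ==> A t \<tau> = A \<tau> t"
    and inc: "\<And>s t \<tau>. a \<le> s ==> s \<le> t ==> t \<le> b ==> \<tau> \<in> {a..b} ==>
      A t \<tau> - A s \<tau> = (LBINT \<sigma>. ind {s<..t} \<sigma> * B \<sigma> \<tau>)"
    and r: "integrable lborel (\<lambda>\<sigma>. ind {a<..b} \<sigma> * r \<sigma>)"
    and g: "integrable lborel (\<lambda>\<sigma>. ind {a<..b} \<sigma> * g \<sigma>)"
    and bound: "\<And>e. e > 0 ==> \<exists>d>0. \<forall>\<tau>\<in>{a..b}. AE \<sigma> in lborel. \<sigma> \<in> {a<..b} --> \<bar>\<sigma> - \<tau>\<bar> \<le> d --> \<bar>B \<sigma> \<tau>\<bar> \<le> r \<sigma> + e * g \<sigma>"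
  shows "\<bar>A b b - A a a\<bar> \<le> 2 * (LBINT \<sigma>. ind {a<..b} \<sigma> * r \<sigma>)"
proof -
  have main: "\<bar>A b b - A a a\<bar> \<le> 2 * (LBINT \<sigma>. ind {a<..b} \<sigma> * r \<sigma>) + e * (2 * (LBINT \<sigma>. ind {a<..b} \<sigma> * g \<sigma>))"
    if "e > 0" for e
  proof -
    obtain d where d: "d > 0" "\<And>\<tau>. \<tau> \<in> {a..b} ==> AE \<sigma> in lborel. \<sigma> \<in> {a<..b} --> \<bar>\<sigma> - \<tau>\<bar> \<le> d --> \<bar>B \<sigma> \<tau>\<bar> \<le> r \<sigma> + e * g \<sigma>"
      using bound[OF \<open>e > 0\<close>] by blast
    let ?f = "\<lambda>\<sigma>. r \<sigma> + e * g \<sigma>"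
    have fe: "ind {a<..b} \<sigma> * ?f \<sigma> = ind {a<..b} \<sigma> * r \<sigma> + e * (ind {a<..b} \<sigma> * g \<sigma>)" for \<sigma>
      by (simp add: algebra_simps)
    have f: "integrable lborel (\<lambda>\<sigma>. ind {a<..b} \<sigma> * ?f \<sigma>)"
      unfolding fe using r g by simp
    have fsub: "integrable lborel (\<lambda>\<sigma>. ind {s<..t} \<sigma> * ?f \<sigma>)" if "a \<le> s" "t \<le> b" for s t
      by (rule integrable_indicator_mult[OF f]) (use that in auto)
    have step: "\<bar>A t \<tau> - A s \<tau>\<bar> \<le> (LBINT \<sigma>. ind {s<..t} \<sigma> * ?f \<sigma>)"
      if st: "a \<le> s" "s \<le> t" "t \<le> b" "t - s \<le> d" and \<tau>: "\<tau> = s \<or> \<tau> = t" for s t \<tau>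
    proof -
      have \<tau>ab: "\<tau> \<in> {a..b}" using st \<tau> by auto
      have "norm (LBINT \<sigma>. ind {s<..t} \<sigma> * B \<sigma> \<tau>) \<le> (LBINT \<sigma>. ind {s<..t} \<sigma> * ?f \<sigma>)"
      proof (rule norm_integral_AE_le[OF fsub[OF st(1,3)]])
        show "AE \<sigma> in lborel. norm (ind {s<..t} \<sigma> * B \<sigma> \<tau>) \<le> ind {s<..t} \<sigma> * ?f \<sigma>"
          using d(2)[OF \<tau>ab]
        proof eventually_elim
          case (elim \<sigma>)
          show ?case
          proof (cases "\<sigma> \<in> {s<..t}")
            case True
            then have "\<sigma> \<in> {a<..b}" "\<bar>\<sigma> - \<tau>\<bar> \<le> d" using st \<tau> by auto
            then show ?thesis using elim True by simp
          qed simp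
        qed
      qed
      then show ?thesis using inc[OF st(1-3) \<tau>ab] by simp
    qed
    have two: "\<bar>A t t - A s s\<bar> \<le> 2 * (LBINT \<sigma>. ind {s<..t} \<sigma> * ?f \<sigma>)"
      if st: "a \<le> s" "s \<le> t" "t \<le> b" "t - s \<le> d" for s t
    proof -
      \<comment> \<open>By symmetry the diagonal increment is an increment with second argument t
        plus one with second argument s; this is the factor 2 of the conclusion.\<close>
      have "A s t = A t s" using st by (intro sym) auto
      then show ?thesis using step[OF st, of s] step[OF st, of t] by auto
    qed
    obtain n :: nat where n: "(b - a) / d < real n" using reals_Archimedean2 by blast
    have n0: "n > 0" using n d(1) ab by (cases "n = 0") (auto simp: divide_less_0_iff)
    define h where "h = (b - a) / real n"
    have h: "0 \<le> h" "h \<le> d" "a + real n * h = b"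
      using n n0 d(1) ab by (auto simp: h_def field_simps)
    have "\<bar>A (a + real k * h) (a + real k * h) - A a a\<bar> \<le> 2 * (LBINT \<sigma>. ind {a<..a + real k * h} \<sigma> * ?f \<sigma>)" if "k \<le> n" for k
      using that
    proof (induction k)
      case (Suc k)
      let ?s = "a + real k * h" and ?t = "a + real (Suc k) * h"
      have "real (Suc k) * h \<le> real n * h" using Suc.prems h(1) by (intro mult_right_mono) auto
      then have tb: "?t \<le> b" using h(3) by linarith
      have st: "a \<le> ?s" "?s \<le> ?t" "?t - ?s \<le> d" using h by (auto simp: algebra_simps)
      have "(LBINT \<sigma>. ind {a<..?t} \<sigma> * ?f \<sigma>) =
        (LBINT \<sigma>. ind {a<..?s} \<sigma> * ?f \<sigma>) + (LBINT \<sigma>. ind {?s<..?t} \<sigma> * ?f \<sigma>)"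
        by (rule integral_indicator_split[OF fsub[OF order_refl tb] st(1,2)])
      moreover have "\<bar>A ?s ?s - A a a\<bar> \<le> 2 * (LBINT \<sigma>. ind {a<..?s} \<sigma> * ?f \<sigma>)"
        using Suc by simp
      ultimately show ?case using two[OF st(1,2) tb st(3)] by linarith
    qed simp
    from this[of n] have "\<bar>A b b - A a a\<bar> \<le> 2 * (LBINT \<sigma>. ind {a<..b} \<sigma> * ?f \<sigma>)"
      using h(3) by simp
    also have "(LBINT \<sigma>. ind {a<..b} \<sigma> * ?f \<sigma>) =
       (LBINT \<sigma>. ind {a<..b} \<sigma> * r \<sigma>) + e * (LBINT \<sigma>. ind {a<..b} \<sigma> * g \<sigma>)"
      unfolding fe using r g by simp
    finally show ?thesis by simp
  qed
  show ?thesis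
  proof (rule field_le_epsilon)
    fix \<epsilon> :: real assume "\<epsilon> > 0"
    let ?G = "2 * (LBINT \<sigma>. ind {a<..b} \<sigma> * g \<sigma>)"
    have "\<epsilon> / (\<bar>?G\<bar> + 1) > 0" using \<open>\<epsilon> > 0\<close> by (intro divide_pos_pos) auto
    from main[OF this] have "\<bar>A b b - A a a\<bar> \<le> 2 * (LBINT \<sigma>. ind {a<..b} \<sigma> * r \<sigma>) + \<epsilon> / (\<bar>?G\<bar> + 1) * ?G" .
    also have "\<epsilon> / (\<bar>?G\<bar> + 1) * ?G \<le> \<epsilon> / (\<bar>?G\<bar> + 1) * (\<bar>?G\<bar> + 1)"
      using \<open>\<epsilon> > 0\<close> by (intro mult_left_mono) auto
    also have "\<dots> = \<epsilon>" by (simp add: add_nonneg_eq_0_iff)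
    finally show "\<bar>A b b - A a a\<bar> \<le> 2 * (LBINT \<sigma>. ind {a<..b} \<sigma> * r \<sigma>) + \<epsilon>" by simp
  qed
qed

text \<open>Smooth Heaviside functions whose whole transition lies within 1/(n+1) to the right of s,
  so their derivatives are one-sided approximate identities at s.\<close>

lemma smooth_switch:
  obtains \<rho> \<rho>' :: "nat => real => real => real" where
    "\<And>n s k. Ck_on k UNIV (\<rho> n s)" "\<And>n s t. (\<rho> n s has_real_derivative \<rho>' n s t) (at t)"
    "\<And>n s t. t \<le> s ==> \<rho> n s t = 0" "\<And>n s t. s + 1 / real (Suc n) \<le> t ==> \<rho> n s t = 1"
    "\<And>n s t. 0 \<le> \<rho> n s t" "\<And>n s t. \<rho> n s t \<le> 1" "\<And>n s. continuous_on UNIV (\<rho>' n s)"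
    "\<And>n s t. 0 \<le> \<rho>' n s t" "\<And>n s t. t \<notin> {s..s + 1 / real (Suc n)} ==> \<rho>' n s t = 0"
    "\<And>n s. integrable lborel (\<rho>' n s)" "\<And>n s. integral\<^sup>L lborel (\<rho>' n s) = 1"
proof -
  obtain H H' :: "real => real" and C where H:
    "\<And>k. Ck_on k UNIV H" "\<And>s. (H has_real_derivative H' s) (at s)" "continuous_on UNIV H'"
    "\<And>s. s \<le> 0 ==> H s = 0" "\<And>s. s \<ge> 1 ==> H s = 1" "\<And>s. 0 \<le> H s" "\<And>s. H s \<le> 1"
    "\<And>s. s \<le> 0 \<or> s \<ge> 1 ==> H' s = 0" "\<And>s. 0 \<le> H' s" "\<And>s. H' s \<le> C" "C > 0"
    using smooth_step by blast
  define \<rho> where "\<rho> n s t = H (real (Suc n) * t + (- real (Suc n) * s))" for n s t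
  define \<rho>' where "\<rho>' n s t = real (Suc n) * H' (real (Suc n) * t + (- real (Suc n) * s))" for n s t
  have D: "(\<rho> n s has_real_derivative \<rho>' n s t) (at t)" for n s t
    unfolding \<rho>_def \<rho>'_def
    by (rule DERIV_cong[OF DERIV_chain2[OF H(2)]]) (auto intro!: derivative_eq_intros)
  have c: "continuous_on UNIV (\<rho>' n s)" for n s
    unfolding \<rho>'_def by (intro continuous_intros continuous_on_compose2[OF H(3)]) auto
  have z: "\<rho>' n s t = 0" if out: "t \<notin> {s..s + 1 / real (Suc n)}" for n s t
  proof -
    consider "t < s" | "t > s + 1 / real (Suc n)" using out unfolding atLeastAtMost_iff by linarith
    then have "real (Suc n) * t + (- real (Suc n) * s) \<le> 0 \<or> real (Suc n) * t + (- real (Suc n) * s) \<ge> 1"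
      by cases (auto simp: field_simps simp del: of_nat_Suc)
    then show ?thesis unfolding \<rho>'_def by (simp add: H(8))
  qed
  have z0: "\<rho> n s t = 0" if "t \<le> s" for n s t
    unfolding \<rho>_def by (rule H(4)) (use that in \<open>simp add: mult_left_mono del: of_nat_Suc\<close>)
  have z1: "\<rho> n s t = 1" if "s + 1 / real (Suc n) \<le> t" for n s t
    unfolding \<rho>_def by (rule H(5)) (use that in \<open>simp add: field_simps del: of_nat_Suc\<close>)
  have hb: "has_bochner_integral lborel (\<rho>' n s) 1" for n s
  proof -
    have "has_bochner_integral lborel (\<lambda>x. \<rho>' n s x * ind {s..s + 1 / real (Suc n)} x) (\<rho> n s (s + 1 / real (Suc n)) - \<rho> n s s)"
      by (rule has_bochner_integral_FTC_Icc_real[OF _ D])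
        (use c in \<open>auto simp: continuous_on_eq_continuous_at\<close>)
    moreover have "(\<lambda>x. \<rho>' n s x * ind {s..s + 1 / real (Suc n)} x) = \<rho>' n s"
      using z by (auto simp: fun_eq_iff indicator_def)
    ultimately show ?thesis using z0[of s s n] z1[of s n] by simp
  qed
  show ?thesis
  proof (rule that[of \<rho> \<rho>'])
    show "Ck_on k UNIV (\<rho> n s)" for n s k
      unfolding \<rho>_def by (rule Ck_on_compose_affine[OF bounded_linear_mult_right H(1)])
    show "integrable lborel (\<rho>' n s)" "integral\<^sup>L lborel (\<rho>' n s) = 1" for n s
      using hb[of n s] has_bochner_integral_integral_eq by (blast intro: integrable.intros)+
    show "0 \<le> \<rho>' n s t" for n s t unfolding \<rho>'_def using H(9) by simp
  qed (use D c z z0 z1 H(6,7) in \<open>auto simp: \<rho>_def\<close>)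
qed

text \<open>The mass sits to the right of s, so only the continuity of m from the right
  enters.\<close>

lemma approximate_identity:
  fixes m :: "real => real"
  assumes k: "\<And>n. integrable lborel (\<rho>' n)" "\<And>n. integral\<^sup>L lborel (\<rho>' n) = 1" "\<And>n t. 0 \<le> \<rho>' n t"
      "\<And>n t. t \<notin> {s..s + 1 / real (Suc n)} ==> \<rho>' n t = (0::real)"
    and m: "continuous (at s within {s..}) m"
    and i: "\<And>n. integrable lborel (\<lambda>t. \<rho>' n t * m t)"
  shows "(\<lambda>n. LBINT t. \<rho>' n t * m t) \<longlonglongrightarrow> m s"
proof (rule LIMSEQ_I)
  fix e :: real assume "e > 0"
  then have e2: "e / 2 > 0" by simp
  obtain d where d: "d > 0" "\<And>t. t \<in> {s..} ==> dist t s < d ==> dist (m t) (m s) < e / 2"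
    using m e2 unfolding continuous_within_eps_delta by blast
  obtain N where N: "1 / d < real N" using reals_Archimedean2 by blast
  show "\<exists>no. \<forall>n\<ge>no. norm ((LBINT t. \<rho>' n t * m t) - m s) < e"
  proof (intro exI[of _ N] allI impI)
    fix n assume "N \<le> n"
    then have "1 / d < real (Suc n)" using N by simp
    then have nd: "1 / real (Suc n) < d" using d(1) by (simp add: field_simps del: of_nat_Suc)
    have "(LBINT t. \<rho>' n t * m t) - m s = (LBINT t. \<rho>' n t * m t) - (LBINT t. \<rho>' n t * m s)"
      using k(2) by simp
    also have "\<dots> = (LBINT t. \<rho>' n t * m t - \<rho>' n t * m s)"
      by (rule Bochner_Integration.integral_diff[symmetric, OF i]) (use k(1) in simp)
    also have "norm \<dots> \<le> (LBINT t. e / 2 * \<rho>' n t)"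
    proof (rule norm_integral_AE_le)
      show "integrable lborel (\<lambda>t. e / 2 * \<rho>' n t)" using k(1) by simp
      show "AE t in lborel. norm (\<rho>' n t * m t - \<rho>' n t * m s) \<le> e / 2 * \<rho>' n t"
      proof (rule AE_I2)
        fix t
        show "norm (\<rho>' n t * m t - \<rho>' n t * m s) \<le> e / 2 * \<rho>' n t"
        proof (cases "t \<in> {s..s + 1 / real (Suc n)}")
          case True
          then have "dist (m t) (m s) < e / 2" using nd by (intro d(2)) (auto simp: dist_real_def simp del: of_nat_Suc)
          then have "\<rho>' n t * \<bar>m t - m s\<bar> \<le> \<rho>' n t * (e / 2)"
            using k(3) by (intro mult_left_mono) (auto simp: dist_real_def)
          moreover have "norm (\<rho>' n t * m t - \<rho>' n t * m s) = \<rho>' n t * \<bar>m t - m s\<bar>"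
            using k(3)[of n t] by (simp add: abs_mult flip: right_diff_distrib)
          ultimately show ?thesis by (simp add: mult.commute)
        qed (simp add: k(4))
      qed
    qed
    also have "\<dots> = e / 2" using k(2) by simp
    finally show "norm ((LBINT t. \<rho>' n t * m t) - m s) < e" using \<open>e > 0\<close> by simp
  qed
qed

text \<open>The weak equation is tested with the difference of a switch at s and a switch at t.
  Their derivatives concentrate at s and t and recover the values of m, while the difference itself
  tends to the indicator of (s,t]. Continuity of m up to time 0 then admits s = 0.\<close>

lemma weak_derivative_increment:
  fixes m g :: "real => real"
  assumes T: "T > 0" and m: "continuous_on {0..<T} m"
    and g: "integrable lborel (\<lambda>t. ind {0<..<T} t * g t)"
    and weak: "\<And>\<phi> \<phi>'. \<phi> \<in> test_functions {0<..<T} ==> (\<And>t. (\<phi> has_real_derivative \<phi>' t) (at t)) ==> continuous_on UNIV \<phi>' ==>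
      (LBINT t. ind {0<..<T} t * (\<phi>' t * m t + \<phi> t * g t)) = 0"
    and st: "0 \<le> s" "s \<le> t" "t < T"
  shows "m t - m s = (LBINT r. ind {s<..t} r * g r)"
proof -
  obtain \<rho> \<rho>' :: "nat => real => real => real" where \<rho>:
    "\<And>n s k. Ck_on k UNIV (\<rho> n s)" "\<And>n s t. (\<rho> n s has_real_derivative \<rho>' n s t) (at t)"
    "\<And>n s t. t \<le> s ==> \<rho> n s t = 0" "\<And>n s t. s + 1 / real (Suc n) \<le> t ==> \<rho> n s t = 1"
    "\<And>n s t. 0 \<le> \<rho> n s t" "\<And>n s t. \<rho> n s t \<le> 1" "\<And>n s. continuous_on UNIV (\<rho>' n s)"
    "\<And>n s t. 0 \<le> \<rho>' n s t" "\<And>n s t. t \<notin> {s..s + 1 / real (Suc n)} ==> \<rho>' n s t = 0"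
    "\<And>n s. integrable lborel (\<rho>' n s)" "\<And>n s. integral\<^sup>L lborel (\<rho>' n s) = 1"
    using smooth_switch by blast
  have pos: "m t - m s = (LBINT r. ind {s<..t} r * g r)" if st: "0 < s" "s \<le> t" "t < T" for s t
  proof -
    obtain N where N: "1 / (T - t) < real N" using reals_Archimedean2 by blast
    have small: "t + 1 / real (Suc n) < T" if "N \<le> n" for n
    proof -
      have "1 / (T - t) < real (Suc n)" using N that by simp
      then have "1 / real (Suc n) < T - t" using st by (simp add: field_simps del: of_nat_Suc)
      then show ?thesis by simp
    qed
    \<comment> \<open>The shift by N makes the switch at t complete before T, so that every test
      function in the sequence is compactly supported in the open interval.\<close>
    let ?n = "\<lambda>n. n + N"
    have mi: "integrable lborel (\<lambda>r. \<rho>' (?n n) x r * m r)" if x: "s \<le> x" "x \<le> t" for n x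
    proof -
      let ?I = "{x..x + 1 / real (Suc (?n n))}"
      have sub: "?I \<subseteq> {0..<T}" using small[of "?n n"] x st by auto
      have "set_integrable lborel ?I (\<lambda>r. \<rho>' (?n n) x r * m r)"
        by (rule borel_integrable_atLeastAtMost')
          (intro continuous_on_mult continuous_on_subset[OF \<rho>(7)] continuous_on_subset[OF m sub] subset_UNIV)
      moreover have "(\<lambda>r. ind ?I r *\<^sub>R (\<rho>' (?n n) x r * m r)) = (\<lambda>r. \<rho>' (?n n) x r * m r)"
        using \<rho>(9)[of _ x "?n n"] by (auto simp: fun_eq_iff indicator_def simp del: of_nat_Suc)
      ultimately show ?thesis unfolding set_integrable_def by (simp only:)
    qed
    have cm: "continuous (at x within {x..}) m" if "s \<le> x" "x \<le> t" for x
    proof -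
      have "continuous (at x) m"
        by (rule continuous_on_interior[OF m]) (use that st in auto)
      then show ?thesis by (rule continuous_at_imp_continuous_at_within)
    qed
    have lim: "(\<lambda>n. LBINT r. \<rho>' (?n n) x r * m r) \<longlonglongrightarrow> m x" if x: "s \<le> x" "x \<le> t" for x
    proof (rule approximate_identity)
      show "\<rho>' (?n n) x r = 0" if "r \<notin> {x..x + 1 / real (Suc n)}" for n r
      proof (rule \<rho>(9))
        have "1 / real (Suc (?n n)) \<le> 1 / real (Suc n)" by (intro divide_left_mono) auto
        then show "r \<notin> {x..x + 1 / real (Suc (?n n))}" using that by auto
      qed
    qed (use \<rho> mi[OF x] cm[OF x] in auto)
    let ?q = "\<lambda>n r. \<rho> (?n n) s r - \<rho> (?n n) t r"
    let ?g = "\<lambda>r. ind {0<..<T} r * g r"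
    have \<rho>m [measurable]: "\<rho> n x \<in> borel_measurable borel" for n x
      using \<rho>(1)[of 0] by (intro borel_measurable_continuous_onI) simp
    have gm [measurable]: "?g \<in> borel_measurable lborel" using g by (rule borel_measurable_integrable)
    have qm: "(\<lambda>r. ind {0<..<T} r * (?q n r * g r)) \<in> borel_measurable lborel" for n
    proof -
      have "(\<lambda>r. ?q n r * ?g r) \<in> borel_measurable lborel" by measurable
      then show ?thesis by (simp only: mult.left_commute)
    qed
    have qle: "AE r in lborel. norm (ind {0<..<T} r * (?q n r * g r)) \<le> \<bar>?g r\<bar>" for n
    proof (rule AE_I2)
      fix r
      have "\<bar>?q n r\<bar> \<le> 1" using \<rho>(5,6)[of "?n n" s r] \<rho>(5,6)[of "?n n" t r] by linarith
      from mult_right_mono[OF this, of "\<bar>?g r\<bar>"]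
      show "norm (ind {0<..<T} r * (?q n r * g r)) \<le> \<bar>?g r\<bar>" by (simp add: abs_mult mult_ac)
    qed
    have limg: "(\<lambda>n. LBINT r. ind {0<..<T} r * (?q n r * g r)) \<longlonglongrightarrow> (LBINT r. ind {s<..t} r * g r)"
    proof (rule integral_dominated_convergence[where w="\<lambda>r. \<bar>ind {0<..<T} r * g r\<bar>"])
      show "(\<lambda>r. ind {0<..<T} r * (?q n r * g r)) \<in> borel_measurable lborel" for n by (rule qm)
      show "integrable lborel (\<lambda>r. \<bar>ind {0<..<T} r * g r\<bar>)" using g by simp
      have eq2: "ind {s<..t} r * g r = ind {s<..t} r * (ind {0<..<T} r * g r)" for r
        using st by (auto simp: indicator_def)
      show "(\<lambda>r. ind {s<..t} r * g r) \<in> borel_measurable lborel"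
        unfolding eq2 by measurable
      have l1: "(\<lambda>n. \<rho> (?n n) x r) \<longlonglongrightarrow> ind {x<..} r" for x r
      proof (cases "x < r")
        case True
        obtain K where K: "1 / (r - x) < real K" using reals_Archimedean2 by blast
        have "\<rho> (?n n) x r = 1" if "K \<le> n" for n
        proof (rule \<rho>(4))
          have "1 / (r - x) < real (Suc (?n n))" using K that by simp
          then show "x + 1 / real (Suc (?n n)) \<le> r" using True by (simp add: field_simps del: of_nat_Suc)
        qed
        then have "\<forall>\<^sub>F n in sequentially. \<rho> (?n n) x r = ind {x<..} r"
          using True by (intro eventually_sequentiallyI[of K]) simp
        then show ?thesis by (rule tendsto_eventually)
      qed (simp add: \<rho>(3))
      show "AE r in lborel. (\<lambda>n. ind {0<..<T} r * (?q n r * g r)) \<longlonglongrightarrow> ind {s<..t} r * g r"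
      proof (rule AE_I2)
        fix r
        have "(\<lambda>n. ind {0<..<T} r * (?q n r * g r)) \<longlonglongrightarrow> ind {0<..<T} r * ((ind {s<..} r - ind {t<..} r) * g r)"
          by (intro tendsto_intros l1)
        moreover have "\<rho> (?n n) s r - \<rho> (?n n) t r = 0" if "T \<le> r" for n
          using \<rho>(4)[of s "?n n" r] \<rho>(4)[of t "?n n" r] small[of "?n n"] that st by simp
        moreover have "ind {0<..<T} r * ((ind {s<..} r - ind {t<..} r) * g r) = ind {s<..t} r * g r"
          using st by (auto simp: indicator_def)
        ultimately show "(\<lambda>n. ind {0<..<T} r * (?q n r * g r)) \<longlonglongrightarrow> ind {s<..t} r * g r"
          by simp
      qed
      show "AE r in lborel. norm (ind {0<..<T} r * (?q n r * g r)) \<le> \<bar>?g r\<bar>" for n by (rule qle)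
    qed
    have z: "(LBINT r. \<rho>' (?n n) s r * m r) - (LBINT r. \<rho>' (?n n) t r * m r)
       + (LBINT r. ind {0<..<T} r * (?q n r * g r)) = 0" for n
    proof -
      let ?\<phi> = "\<lambda>r. \<rho> (?n n) s r + (-1) * \<rho> (?n n) t r" and ?\<phi>' = "\<lambda>r. \<rho>' (?n n) s r - \<rho>' (?n n) t r"
      have supp: "closure {r. ?\<phi> r \<noteq> 0} \<subseteq> {s..t + 1 / real (Suc (?n n))}"
      proof (rule closure_minimal)
        show "{r. ?\<phi> r \<noteq> 0} \<subseteq> {s..t + 1 / real (Suc (?n n))}"
        proof
          fix r assume r: "r \<in> {r. ?\<phi> r \<noteq> 0}"
          have "s \<le> r" using r \<rho>(3)[of r s "?n n"] \<rho>(3)[of r t "?n n"] st by force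
          moreover have "r \<le> t + 1 / real (Suc (?n n))"
            using r \<rho>(4)[of s "?n n" r] \<rho>(4)[of t "?n n" r] st by force
          ultimately show "r \<in> {s..t + 1 / real (Suc (?n n))}" by simp
        qed
      qed simp
      have tf: "?\<phi> \<in> test_functions {0<..<T}"
        unfolding test_functions_def
      proof (intro CollectI conjI allI)
        show "Ck_on k UNIV ?\<phi>" for k by (rule Ck_on_add[OF \<rho>(1) Ck_on_mult[OF Ck_on_const \<rho>(1)]])
        show "compact (closure {r. ?\<phi> r \<noteq> 0})"
          using bounded_subset[OF bounded_closed_interval supp] by (simp add: compact_eq_bounded_closed)
        show "closure {r. ?\<phi> r \<noteq> 0} \<subseteq> {0<..<T}"
          by (rule order_trans[OF supp]) (use small[of "?n n"] st in auto)
      qed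
      have "(LBINT r. ind {0<..<T} r * (?\<phi>' r * m r + ?\<phi> r * g r)) = 0"
        by (rule weak[OF tf]) (auto intro!: derivative_eq_intros \<rho>(2) continuous_intros \<rho>(7))
      moreover have "ind {0<..<T} r * (?\<phi>' r * m r + ?\<phi> r * g r) =
        (\<rho>' (?n n) s r * m r - \<rho>' (?n n) t r * m r) + ind {0<..<T} r * (?q n r * g r)" for r
      proof (cases "r \<in> {0<..<T}")
        case False
        then have "\<rho>' (?n n) s r = 0" "\<rho>' (?n n) t r = 0"
          using small[of "?n n"] st by (auto intro!: \<rho>(9))
        then show ?thesis using False by simp
      qed (simp add: algebra_simps)
      moreover have "integrable lborel (\<lambda>r. ind {0<..<T} r * (?q n r * g r))"
        by (rule bochner_bound[OF integrable_abs[OF g] qm])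
          (use qle[of n] in eventually_elim, simp)
      ultimately show ?thesis using mi[of s n] mi[of t n] st by simp
    qed
    have "(\<lambda>n. 0 :: real) \<longlonglongrightarrow> m s - m t + (LBINT r. ind {s<..t} r * g r)"
      using tendsto_add[OF tendsto_diff[OF lim[of s] lim[of t]] limg] st unfolding z by simp
    then have "m s - m t + (LBINT r. ind {s<..t} r * g r) = 0"
      by (simp add: LIMSEQ_const_iff)
    then show ?thesis by simp
  qed
  show ?thesis
  proof (cases "s = 0")
    case False
    then show ?thesis using pos st by simp
  next
    \<comment> \<open>Test functions supported in the open interval cannot start at 0; the initial
      time is reached as the limit of the positive times t/(n+1).\<close>
    case s0: True
    show ?thesis
    proof (cases "t = 0")
      case True
      then show ?thesis using s0 by simp
    next
      case False
      then have t0: "t > 0" using st s0 by simp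
      define s' where "s' n = t / real (Suc n)" for n
      have s': "0 < s' n" "s' n \<le> t" for n using t0 by (auto simp: s'_def divide_le_eq)
      have s'lim: "s' \<longlonglongrightarrow> 0"
        unfolding s'_def using tendsto_mult_right_zero[OF LIMSEQ_inverse_real_of_nat, of t]
        by (simp add: divide_inverse)
      have s'T: "s' n \<in> {0..<T}" for n using s'[of n] st by simp
      have "(\<lambda>n. m (s' n)) \<longlonglongrightarrow> m 0"
        by (rule continuous_on_tendsto_compose[OF m s'lim]) (use T in simp, rule always_eventually, use s'T in blast)
      then have 1: "(\<lambda>n. m t - m (s' n)) \<longlonglongrightarrow> m t - m 0" by (intro tendsto_intros)
      have 2: "(\<lambda>n. LBINT r. ind {s' n<..t} r * g r) \<longlonglongrightarrow> (LBINT r. ind {0<..t} r * g r)"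
      proof (rule integral_dominated_convergence[where w="\<lambda>r. \<bar>ind {0<..<T} r * g r\<bar>"])
        show "(\<lambda>r. ind {s' n<..t} r * g r) \<in> borel_measurable lborel" for n
          by (rule borel_measurable_integrable[OF integrable_indicator_mult[OF g]]) (use s'[of n] st in auto)
        show "(\<lambda>r. ind {0<..t} r * g r) \<in> borel_measurable lborel"
          by (rule borel_measurable_integrable[OF integrable_indicator_mult[OF g]]) (use st in auto)
        show "integrable lborel (\<lambda>r. \<bar>ind {0<..<T} r * g r\<bar>)" using g by simp
        show "AE r in lborel. (\<lambda>n. ind {s' n<..t} r * g r) \<longlonglongrightarrow> ind {0<..t} r * g r"
        proof (intro AE_I2 tendsto_intros)
          fix r
          show "(\<lambda>n. ind {s' n<..t} r :: real) \<longlonglongrightarrow> ind {0<..t} r"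
          proof (cases "0 < r")
            case True
            then have "\<forall>\<^sub>F n in sequentially. s' n < r" using order_tendstoD(2)[OF s'lim] by blast
            then have "\<forall>\<^sub>F n in sequentially. ind {s' n<..t} r = (ind {0<..t} r :: real)"
              by eventually_elim (use True in \<open>auto simp: indicator_def\<close>)
            then show ?thesis by (rule tendsto_eventually)
          next
            case False
            then have "ind {s' n<..t} r = (0::real)" for n using s'(1)[of n] by (auto simp: indicator_def)
            then show ?thesis using False by simp
          qed
        qed
        show "AE r in lborel. norm (ind {s' n<..t} r * g r) \<le> \<bar>ind {0<..<T} r * g r\<bar>" for n
          using s'[of n] st by (intro AE_I2) (auto simp: indicator_def)
      qed
      have "m t - m (s' n) = (LBINT r. ind {s' n<..t} r * g r)" for n
        using pos[OF s'[of n] st(3)] .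
      then show ?thesis using LIMSEQ_unique[OF 1] 2 s0 by simp
    qed
  qed
qed

section \<open>Solenoidal fields\<close>

lemma kernel_shift:
  assumes "kernel R k"
  shows "kernel (R + norm x) (\<lambda>y. k (y - x))"
    and "fderiv (\<lambda>y. k (y - x)) y h = fderiv k (y - x) h"
proof -
  have "Ck_on n UNIV (\<lambda>y. k (y + (- x)))" for n
    by (rule Ck_on_compose_affine[OF bounded_linear_ident kernel_Ck[OF assms]])
  moreover have "k (y - x) = 0" if "R + norm x < norm y" for y
    by (rule kernel_zero[OF assms]) (use that norm_triangle_sub[of y x] in linarith)
  ultimately show "kernel (R + norm x) (\<lambda>y. k (y - x))" unfolding kernel_def by simp
  have "((\<lambda>y. y - x) has_derivative (\<lambda>h. h)) (at y)" by (auto intro!: derivative_eq_intros)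
  from frechet_derivative_at[OF has_derivative_compose[OF this kernel_has_derivative[OF assms]]]
  show "fderiv (\<lambda>y. k (y - x)) y h = fderiv k (y - x) h" by metis
qed

lemma kernel_integral_derivative:
  assumes "kernel R k"
  shows "integrable lborel (\<lambda>z. fderiv k z h)" "(LBINT z. fderiv k z h) = 0"
proof -
  obtain B where B: "B > 0" "\<And>z v. \<bar>fderiv k z v\<bar> \<le> B * norm v"
    using kernel_derivative_bound[OF assms] by metis
  have z: "x \<notin> cball 0 R ==> k x = 0" for x using kernel_zero[OF assms, of x] by simp
  show "integrable lborel (\<lambda>z. fderiv k z h)" "(LBINT z. fderiv k z h) = 0"
    using integral_derivative_zero[of k "\<lambda>z. fderiv k z" "cball 0 R" h "B * norm h",
        OF kernel_has_derivative[OF assms] compact_cball z] B by simp_all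
qed

lemma kernel_mult:
  assumes "kernel R k" "kernel R' l"
  shows "kernel R (\<lambda>z. k z * l z)"
    "fderiv (\<lambda>z. k z * l z) z h = k z * fderiv l z h + fderiv k z h * l z"
proof -
  show "kernel R (\<lambda>z. k z * l z)"
    unfolding kernel_def using Ck_on_mult[OF kernel_Ck[OF assms(1)] kernel_Ck[OF assms(2)]] kernel_zero[OF assms(1)] by auto
  show "fderiv (\<lambda>z. k z * l z) z h = k z * fderiv l z h + fderiv k z h * l z"
    using frechet_derivative_at[OF has_derivative_mult[OF kernel_has_derivative[OF assms(1)] kernel_has_derivative[OF assms(2)]], of z] by metis
qed

section \<open>Bounds for vector-valued test functions\<close>

lemma test_function_zero:
  assumes "\<phi> \<in> test_functions \<Omega>" "x \<notin> \<Omega>" shows "\<phi> x = 0"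
  using assms closure_subset[of "{x. \<phi> x \<noteq> 0}"] unfolding test_functions_def by blast

lemma test_function_Ck: "\<phi> \<in> test_functions \<Omega> ==> Ck_on n UNIV \<phi>"
  unfolding test_functions_def by blast

lemma test_function_derivative:
  "\<phi> \<in> test_functions \<Omega> ==> (\<phi> has_derivative fderiv \<phi> x) (at x)"
  by (rule Ck_onD[OF test_function_Ck])

lemma test_function_borel: "\<phi> \<in> test_functions \<Omega> ==> \<phi> \<in> borel_measurable borel"
  using test_function_Ck[of \<phi> \<Omega> 0] by (intro borel_measurable_continuous_onI) simp

text \<open>The components are kernels in the sense of \<open>kernel\<close>, so the scalar bounds
  on values and derivatives carry over coordinate by coordinate.\<close>

lemma test_function_component:
  fixes \<phi> :: "'a::euclidean_space => 'b::euclidean_space"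
  assumes "\<phi> \<in> test_functions \<Omega>"
  obtains R where "\<And>j. kernel R (\<lambda>x. \<phi> x \<bullet> j)"
    "\<And>j x h. fderiv (\<lambda>x. \<phi> x \<bullet> j) x h = fderiv \<phi> x h \<bullet> j"
proof -
  have "bounded {x. \<phi> x \<noteq> 0}"
    by (rule bounded_subset[OF compact_imp_bounded closure_subset]) (use assms in \<open>simp add: test_functions_def\<close>)
  then obtain R where R: "\<And>x. \<phi> x \<noteq> 0 ==> norm x \<le> R" unfolding bounded_iff by blast
  show ?thesis
  proof (rule that)
    show "kernel R (\<lambda>x. \<phi> x \<bullet> j)" for j
      unfolding kernel_def
    proof (intro conjI allI impI)
      show "Ck_on n UNIV (\<lambda>x. \<phi> x \<bullet> j)" for n
        by (rule Ck_on_inner[OF test_function_Ck[OF assms] Ck_on_const])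
      show "\<phi> z \<bullet> j = 0" if "R < norm z" for z using R[of z] that by fastforce
    qed
    show "fderiv (\<lambda>x. \<phi> x \<bullet> j) x h = fderiv \<phi> x h \<bullet> j" for j x h
      using frechet_derivative_at[OF has_derivative_inner_left[OF test_function_derivative[OF assms]], of x j] by metis
  qed
qed

lemma test_function_bounds:
  fixes \<phi> :: "'a::euclidean_space => 'b::euclidean_space"
  assumes "\<phi> \<in> test_functions \<Omega>"
  obtains B where "B > 0" "\<And>x. norm (\<phi> x) \<le> B" "\<And>x h. norm (fderiv \<phi> x h) \<le> B * norm h"
    "\<And>x y. norm (\<phi> x - \<phi> y) \<le> B * norm (x - y)"
proof -
  obtain R where R: "\<And>j. kernel R (\<lambda>x. \<phi> x \<bullet> j)"
    "\<And>j x h. fderiv (\<lambda>x. \<phi> x \<bullet> j) x h = fderiv \<phi> x h \<bullet> j"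
    using test_function_component[OF assms] by metis
  have "\<exists>B>0. \<forall>x. \<bar>\<phi> x \<bullet> j\<bar> \<le> B" for j using kernel_bounded[OF R(1)] by metis
  then obtain b where b: "\<And>j. b j > 0" "\<And>j x. \<bar>\<phi> x \<bullet> j\<bar> \<le> b j" by metis
  have "\<exists>B>0. \<forall>x h. \<bar>fderiv \<phi> x h \<bullet> j\<bar> \<le> B * norm h" for j
    using kernel_derivative_bound[OF R(1), of j] unfolding R(2) by metis
  then obtain c where c: "\<And>j. c j > 0" "\<And>j x h. \<bar>fderiv \<phi> x h \<bullet> j\<bar> \<le> c j * norm h" by metis
  define B where "B = (\<Sum>j\<in>Basis. b j + c j)"
  have B: "B > 0" unfolding B_def by (intro sum_pos add_pos_pos b c) auto
  have D: "norm (fderiv \<phi> x h) \<le> B * norm h" for x h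
  proof -
    have "norm (fderiv \<phi> x h) \<le> (\<Sum>j\<in>Basis. c j * norm h)"
      by (rule order_trans[OF norm_le_l1 sum_mono]) (rule c(2))
    also have "\<dots> \<le> (\<Sum>j\<in>Basis. (b j + c j) * norm h)"
      using b(1) by (intro sum_mono mult_right_mono) (auto intro: less_imp_le)
    finally show ?thesis by (simp add: B_def sum_distrib_right)
  qed
  show ?thesis
  proof (rule that[OF B _ D])
    show "norm (\<phi> x) \<le> B" for x
    proof -
      have "norm (\<phi> x) \<le> (\<Sum>j\<in>Basis. b j)" by (rule order_trans[OF norm_le_l1 sum_mono]) (rule b(2))
      also have "\<dots> \<le> B" unfolding B_def using c(1) by (intro sum_mono) (auto intro: less_imp_le)
      finally show ?thesis .
    qed
    show "norm (\<phi> x - \<phi> y) \<le> B * norm (x - y)" for x y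
      by (rule differentiable_bound[of UNIV \<phi> "\<lambda>z. fderiv \<phi> z"])
        (use B D test_function_derivative[OF assms] in \<open>auto intro!: onorm_bound\<close>)
  qed
qed

text \<open>The divergence of the translated kernel times \<phi> has integral 0; since \<phi> is
  divergence-free, only the derivative of the kernel in direction \<phi> is left.\<close>

lemma test_function_solenoidal:
  fixes \<phi> :: "'a::euclidean_space => 'a"
  assumes \<phi>: "\<phi> \<in> test_functions \<Omega>" and div: "\<And>x. divergence \<phi> x = 0" and k: "kernel R k"
  shows "integrable lborel (\<lambda>y. fderiv k (y - x) (\<phi> y))"
    "(LBINT y. fderiv k (y - x) (\<phi> y)) = 0"
proof -
  obtain R' where R': "\<And>j. kernel R' (\<lambda>x. \<phi> x \<bullet> j)"
    "\<And>j x h. fderiv (\<lambda>x. \<phi> x \<bullet> j) x h = fderiv \<phi> x h \<bullet> j"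
    using test_function_component[OF \<phi>] by metis
  let ?k = "\<lambda>y. k (y - x)"
  note ks = kernel_shift[OF k, of x]
  note km = kernel_mult[OF ks(1) R'(1)]
  have D: "fderiv (\<lambda>y. ?k y * (\<phi> y \<bullet> i)) y i =
      ?k y * (fderiv \<phi> y i \<bullet> i) + (\<phi> y \<bullet> i) * fderiv k (y - x) i" for i y
    unfolding km(2) R'(2) ks(2) by simp
  have eq: "(\<Sum>i\<in>Basis. fderiv (\<lambda>y. ?k y * (\<phi> y \<bullet> i)) y i) = fderiv k (y - x) (\<phi> y)" for y
  proof -
    have "(\<Sum>i\<in>Basis. fderiv (\<lambda>y. ?k y * (\<phi> y \<bullet> i)) y i) =
      ?k y * divergence \<phi> y + (\<Sum>i\<in>Basis. (\<phi> y \<bullet> i) *\<^sub>R fderiv k (y - x) i)"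
      unfolding D by (simp add: sum.distrib sum_distrib_left divergence_def)
    then show ?thesis using linear_expand[OF kernel_linear[OF k], of "y - x" "\<phi> y"] div by simp
  qed
  note z = kernel_integral_derivative[OF km(1)]
  have "integrable lborel (\<lambda>y. \<Sum>i\<in>Basis. fderiv (\<lambda>y. ?k y * (\<phi> y \<bullet> i)) y i)"
    by (intro Bochner_Integration.integrable_sum z(1))
  then show "integrable lborel (\<lambda>y. fderiv k (y - x) (\<phi> y))" unfolding eq .
  have "(LBINT y. (\<Sum>i\<in>Basis. fderiv (\<lambda>y. ?k y * (\<phi> y \<bullet> i)) y i)) = 0"
    using z by (subst Bochner_Integration.integral_sum) simp_all
  then show "(LBINT y. fderiv k (y - x) (\<phi> y)) = 0" unfolding eq .
qed

text \<open>Membership in \<open>H(\<Omega>)\<close> for the extension by zero.\<close>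

definition solenoidal_ext :: "'a::euclidean_space set => ('a => 'a) => bool" where
  "solenoidal_ext \<Omega> v \<longleftrightarrow> v \<in> borel_measurable borel \<and> integrable lborel (\<lambda>x. (norm (v x))^2) \<and>
     (\<forall>x. x \<notin> \<Omega> --> v x = 0) \<and>
     (\<forall>e>0. \<exists>\<phi>\<in>test_functions \<Omega>. (\<forall>x. divergence \<phi> x = 0) \<and> (LBINT x. (norm (v x - \<phi> x))^2) < e)"

lemma le_1_plus_square: "(a::real) \<le> 1 + a^2"
  using zero_le_power2[of "a - 1/2"] by (simp add: power2_eq_square algebra_simps)

lemma bounded_integrable_indicator:
  fixes \<Omega> :: "'a::euclidean_space set"
  assumes "open \<Omega>" "bounded \<Omega>" shows "integrable lborel (ind \<Omega> :: 'a => real)"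
  using assms by (intro integrable_real_indicator emeasure_bounded_finite) auto

lemma solenoidal_ext_integrable:
  assumes v: "solenoidal_ext \<Omega> v" and \<Omega>: "open \<Omega>" "bounded \<Omega>"
  shows "integrable lborel v" "(LBINT x. norm (v x)) \<le> measure lborel \<Omega> + (LBINT x. (norm (v x))^2)"
proof -
  have vm: "v \<in> borel_measurable borel" and v2: "integrable lborel (\<lambda>x. (norm (v x))^2)" and z: "\<And>x. x \<notin> \<Omega> ==> v x = 0"
    using v unfolding solenoidal_ext_def by blast+
  let ?g = "\<lambda>x. ind \<Omega> x + (norm (v x))^2"
  have g: "integrable lborel ?g" using bounded_integrable_indicator[OF \<Omega>] v2 by simp
  have le: "norm (v x) \<le> ?g x" for x
    using le_1_plus_square[of "norm (v x)"] z[of x] by (cases "x \<in> \<Omega>") auto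
  show i: "integrable lborel v"
    by (rule bochner_bound[OF g])
      (use vm le in \<open>auto intro!: AE_I2 intro: order_trans[OF _ abs_ge_self]\<close>)
  have "(LBINT x. norm (v x)) \<le> (LBINT x. ?g x)"
    by (rule integral_mono[OF integrable_norm[OF i] g le])
  also have "\<dots> = measure lborel \<Omega> + (LBINT x. (norm (v x))^2)"
    using bounded_integrable_indicator[OF \<Omega>] v2 by simp
  finally show "(LBINT x. norm (v x)) \<le> measure lborel \<Omega> + (LBINT x. (norm (v x))^2)" .
qed

lemma sum_power2_le: "norm (a + b) ^ 2 \<le> 2 * norm a ^ 2 + 2 * norm (b::'a::real_normed_vector) ^ 2"
proof -
  have "norm (a + b) ^ 2 \<le> (norm a + norm b) ^ 2" by (intro power_mono norm_triangle_ineq) auto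
  also have "\<dots> \<le> 2 * norm a ^ 2 + 2 * norm b ^ 2"
    using zero_le_power2[of "norm a - norm b"] by (simp add: power2_eq_square algebra_simps)
  finally show ?thesis .
qed

lemma test_function_square_integrable:
  fixes \<phi> :: "'a::euclidean_space => 'b::euclidean_space"
  assumes "\<phi> \<in> test_functions \<Omega>" "bounded \<Omega>"
  shows "integrable lborel \<phi>" "integrable lborel (\<lambda>x. (norm (\<phi> x))^2)"
proof -
  obtain B where B: "B > 0" "\<And>x. norm (\<phi> x) \<le> B" using test_function_bounds[OF assms(1)] by metis
  note m [measurable] = test_function_borel[OF assms(1)]
  show "integrable lborel \<phi>"
    by (rule integrable_bounded_compact[OF m assms(2) test_function_zero[OF assms(1)] B(2)])
  show "integrable lborel (\<lambda>x. (norm (\<phi> x))^2)"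
  proof (rule integrable_bounded_compact[OF _ assms(2), of _ "B^2"])
    show "norm ((norm (\<phi> x))^2) \<le> B^2" for x using B(2)[of x] by (simp add: power_mono)
  qed (use test_function_zero[OF assms(1)] in auto)
qed

lemma difference_square_integrable:
  fixes v \<phi> :: "'a::euclidean_space => 'b::euclidean_space"
  assumes "v \<in> borel_measurable borel" "\<phi> \<in> borel_measurable borel"
    "integrable lborel (\<lambda>x. (norm (v x))^2)" "integrable lborel (\<lambda>x. (norm (\<phi> x))^2)"
  shows "integrable lborel (\<lambda>x. (norm (v x - \<phi> x))^2)"
proof (rule bochner_bound)
  show "integrable lborel (\<lambda>x. 2 * (norm (v x))^2 + 2 * (norm (\<phi> x))^2)" using assms by simp
  show "(\<lambda>x. (norm (v x - \<phi> x))^2) \<in> borel_measurable lborel" using assms(1,2) by measurable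
  show "AE x in lborel. norm ((norm (v x - \<phi> x))^2) \<le> norm (2 * (norm (v x))^2 + 2 * (norm (\<phi> x))^2)"
    using sum_power2_le[of "v _" "- \<phi> _"] by (intro AE_I2) simp
qed

text \<open>The identity passes from compactly supported solenoidal fields to their L^2 limits. It
  therefore holds at every x, even if the kernel reaches across the boundary: the extension by zero
  is divergence-free in the whole space. The L^1 error is controlled by e plus the squared error
  over e on the bounded domain.\<close>

lemma solenoidal_ext_divfree:
  assumes v: "solenoidal_ext \<Omega> v" and \<Omega>: "open \<Omega>" "bounded \<Omega>" and k: "kernel R k"
  shows "(LBINT y. fderiv k (y - x) (v y)) = 0"
proof -
  have vm [measurable]: "v \<in> borel_measurable borel" and v2: "integrable lborel (\<lambda>x. (norm (v x))^2)" and z: "\<And>x. x \<notin> \<Omega> ==> v x = 0"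
    using v unfolding solenoidal_ext_def by blast+
  note v1 = solenoidal_ext_integrable(1)[OF v \<Omega>]
  obtain B where B: "B > 0" "\<And>z h. \<bar>fderiv k z h\<bar> \<le> B * norm h"
    using kernel_derivative_bound[OF k] by metis
  let ?D = "\<lambda>y. fderiv k (y - x)"
  have Dv: "?D y h = (\<Sum>i\<in>Basis. (h \<bullet> i) * ?D y i)" for y h
    using linear_expand[OF kernel_linear[OF k], of "y - x" h] by (simp only: real_scaleR_def)
  have iv: "integrable lborel (\<lambda>y. ?D y (v y))"
  proof (rule bochner_bound[of _ "\<lambda>y. B * norm (v y)"])
    show "integrable lborel (\<lambda>y. B * norm (v y))" using v1 by simp
    have [measurable]: "(\<lambda>y. ?D y i) \<in> borel_measurable borel" for i
      using kernel_borel[OF kernel_derivative[OF k]] by measurable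
    have "(\<lambda>y. ?D y (v y)) = (\<lambda>y. \<Sum>i\<in>Basis. (v y \<bullet> i) * ?D y i)" by (rule ext) (rule Dv)
    then show "(\<lambda>y. ?D y (v y)) \<in> borel_measurable lborel" by simp
    show "AE y in lborel. norm (?D y (v y)) \<le> norm (B * norm (v y))"
      using B by (intro AE_I2) (simp add: abs_mult)
  qed
  have le: "\<bar>LBINT y. ?D y (v y)\<bar> \<le> e * (B * (measure lborel \<Omega> + 1))" if e: "e > 0" for e
  proof -
    \<comment> \<open>Accuracy e^2 in the squared norm, so that its quotient by e is again of order
      e.\<close>
    have "e^2 > 0" using e by simp
    then obtain \<phi> where \<phi>: "\<phi> \<in> test_functions \<Omega>" "\<And>x. divergence \<phi> x = 0" "(LBINT x. (norm (v x - \<phi> x))^2) < e^2"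
      using v unfolding solenoidal_ext_def by blast
    note s = test_function_solenoidal[OF \<phi>(1,2) k, of x]
    have d2: "integrable lborel (\<lambda>x. (norm (v x - \<phi> x))^2)"
      by (rule difference_square_integrable[OF vm test_function_borel[OF \<phi>(1)] v2 test_function_square_integrable(2)[OF \<phi>(1) \<Omega>(2)]])
    have "(LBINT y. ?D y (v y)) = (LBINT y. ?D y (v y) - ?D y (\<phi> y))"
      using iv s by simp
    also have "norm \<dots> \<le> (LBINT y. B * (e * ind \<Omega> y + (norm (v y - \<phi> y))^2 / e))"
    proof (rule norm_integral_AE_le)
      show "integrable lborel (\<lambda>y. B * (e * ind \<Omega> y + (norm (v y - \<phi> y))^2 / e))"
        using bounded_integrable_indicator[OF \<Omega>] d2 by simp
      show "AE y in lborel. norm (?D y (v y) - ?D y (\<phi> y)) \<le> B * (e * ind \<Omega> y + (norm (v y - \<phi> y))^2 / e)"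
      proof (rule AE_I2)
        fix y
        have "?D y (v y) - ?D y (\<phi> y) = ?D y (v y - \<phi> y)"
          by (rule linear_diff[symmetric, OF bounded_linear.linear[OF kernel_linear[OF k]]])
        then have 1: "norm (?D y (v y) - ?D y (\<phi> y)) \<le> B * norm (v y - \<phi> y)" using B(2) by simp
        have "norm (v y - \<phi> y) \<le> e * ind \<Omega> y + (norm (v y - \<phi> y))^2 / e"
        proof (cases "y \<in> \<Omega>")
          case True
          have "norm (v y - \<phi> y) / e \<le> 1 + (norm (v y - \<phi> y) / e)^2" by (rule le_1_plus_square)
          then have "norm (v y - \<phi> y) \<le> e * (1 + (norm (v y - \<phi> y) / e)^2)" using e by (simp add: divide_le_eq mult.commute)
          also have "\<dots> = e + (norm (v y - \<phi> y))^2 / e" using e by (simp add: power_divide field_simps power2_eq_square)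
          finally show ?thesis using True by simp
        qed (use z test_function_zero[OF \<phi>(1)] in simp)
        from mult_left_mono[OF this, of B] 1 B(1)
        show "norm (?D y (v y) - ?D y (\<phi> y)) \<le> B * (e * ind \<Omega> y + (norm (v y - \<phi> y))^2 / e)" by linarith
      qed
    qed
    also have "\<dots> = B * (e * measure lborel \<Omega> + (LBINT x. (norm (v x - \<phi> x))^2) / e)"
      using bounded_integrable_indicator[OF \<Omega>] d2 by simp
    also have "\<dots> \<le> B * (e * measure lborel \<Omega> + e^2 / e)"
      using \<phi>(3) B(1) e by (intro mult_left_mono add_left_mono divide_right_mono) auto
    also have "\<dots> = e * (B * (measure lborel \<Omega> + 1))" using e by (simp add: power2_eq_square algebra_simps)
    finally show ?thesis by simp
  qed
  define X where "X = B * (measure lborel \<Omega> + 1)"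
  have X: "X > 0" unfolding X_def using B(1) by (intro mult_pos_pos) (auto simp: add_nonneg_pos)
  have "\<bar>LBINT y. ?D y (v y)\<bar> \<le> 0"
  proof (rule field_le_epsilon)
    fix \<epsilon> :: real assume "\<epsilon> > 0"
    then have "\<bar>LBINT y. ?D y (v y)\<bar> \<le> \<epsilon> / X * X" unfolding X_def by (intro le) (use X in \<open>simp add: X_def\<close>)
    then show "\<bar>LBINT y. ?D y (v y)\<bar> \<le> 0 + \<epsilon>" using X by simp
  qed
  then show ?thesis by simp
qed

section \<open>The localised energy balance\<close>

lemma test_function_flux_data:
  fixes \<psi> :: "'a::euclidean_space => 'a"
  assumes "\<psi> \<in> test_functions \<Omega>"
  shows "(\<lambda>y. fderiv \<psi> y h) \<in> borel_measurable borel" "divergence \<psi> \<in> borel_measurable borel"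
    "bounded_linear (fderiv \<psi> y)"
proof -
  show m: "(\<lambda>y. fderiv \<psi> y h) \<in> borel_measurable borel" for h
    by (rule derivative_borel_measurable[OF test_function_derivative[OF assms]])
  show "divergence \<psi> \<in> borel_measurable borel" unfolding divergence_def[abs_def] using m by simp
  show "bounded_linear (fderiv \<psi> y)"
    by (rule has_derivative_bounded_linear[OF test_function_derivative[OF assms]])
qed

lemma divergence_le:
  fixes D :: "'a::euclidean_space => 'a"
  assumes "\<And>h. norm (D h) \<le> c * norm h"
  shows "\<bar>\<Sum>i\<in>(Basis::'a set). D i \<bullet> i\<bar> \<le> real DIM('a) * c"
proof -
  have "\<bar>\<Sum>i\<in>(Basis::'a set). D i \<bullet> i\<bar> \<le> (\<Sum>i\<in>(Basis::'a set). \<bar>D i \<bullet> i\<bar>)" by (rule sum_abs)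
  also have "\<dots> \<le> (\<Sum>i\<in>(Basis::'a set). c)"
  proof (rule sum_mono)
    fix i :: 'a assume i: "i \<in> Basis"
    have "\<bar>D i \<bullet> i\<bar> \<le> norm (D i) * norm i" by (rule Cauchy_Schwarz_ineq2)
    then show "\<bar>D i \<bullet> i\<bar> \<le> c" using assms[of i] i by simp
  qed
  finally show ?thesis by simp
qed

lemma flux_section_measurable:
  fixes v :: "real \<times> 'a::euclidean_space => 'a"
  assumes v: "v \<in> borel_measurable borel" and q: "q \<in> borel_measurable borel" and \<psi>: "\<psi> \<in> test_functions \<Omega>"
  shows "(\<lambda>t. flux (\<lambda>x. v (t, x)) (\<lambda>x. q (t, x)) \<psi>) \<in> borel_measurable borel"
proof -
  have [measurable]: "v \<in> borel_measurable (borel \<Otimes>\<^sub>M borel)" "q \<in> borel_measurable (borel \<Otimes>\<^sub>M borel)"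
    using v q by (simp_all add: borel_prod)
  note [measurable] = test_function_flux_data(1,2)[OF \<psi>]
  have exp: "fderiv \<psi> y (v (t, y)) = (\<Sum>i\<in>Basis. (v (t, y) \<bullet> i) *\<^sub>R fderiv \<psi> y i)" for t y
    by (rule linear_expand[OF test_function_flux_data(3)[OF \<psi>]])
  have [measurable]: "(\<lambda>(t, y). fderiv \<psi> y (v (t, y))) \<in> borel_measurable (borel \<Otimes>\<^sub>M lborel)"
    unfolding exp by measurable
  have "(\<lambda>(t, y). fderiv \<psi> y (v (t, y)) \<bullet> v (t, y) + q (t, y) * divergence \<psi> y) \<in> borel_measurable (borel \<Otimes>\<^sub>M lborel)"
    by measurable
  from lborel.borel_measurable_lebesgue_integral[OF this] show ?thesis unfolding flux_def by simp
qed

text \<open>The extension by zero of the velocity, \<open>w\<close>, is Borel in space at every time; \<open>uB\<close> and \<open>qB\<close>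
  are jointly Borel versions of velocity and of the pressure in the strip \<open>S\<close>.\<close>

locale euler_data =
  fixes \<Omega> S :: "'a::euclidean_space set" and T :: real and w :: "real => 'a => 'a"
    and uB :: "real \<times> 'a => 'a" and qB :: "real \<times> 'a => real" and M P :: "real => real"
  assumes Tpos: "0 < T" and Omega: "open \<Omega>" "bounded \<Omega>" and SO: "S \<subseteq> \<Omega>"
    and w: "\<And>t. t \<in> {0..<T} ==> solenoidal_ext \<Omega> (w t)"
    and wcont: "\<And>g B. g \<in> borel_measurable borel ==> (\<And>x. norm (g x) \<le> B) ==>
      continuous_on {0..<T} (\<lambda>t. LBINT x. w t x \<bullet> g x)"
    and wbdd: "\<And>b. b < T ==> \<exists>B. \<forall>t\<in>{0..b}. (LBINT x. (norm (w t x))^2) \<le> B"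
    and uB: "uB \<in> borel_measurable borel" "integrable lborel (\<lambda>z. norm (uB z) ^ 3)"
      "AE t in lborel. t \<in> {0<..<T} --> w t = (\<lambda>x. uB (t, x))"
    and qB: "qB \<in> borel_measurable borel"
    and MP: "\<And>t. 0 \<le> M t" "\<And>t. 0 \<le> P t"
      "integrable lborel (\<lambda>t. ind {0<..<T} t * (M t ^ 3 + P t powr (3/2)))"
      "AE t in lborel. t \<in> {0<..<T} --> (AE x in lborel. x \<in> S --> norm (uB (t, x)) \<le> M t)"
      "AE t in lborel. t \<in> {0<..<T} --> (AE x in lborel. x \<in> S --> \<bar>qB (t, x)\<bar> \<le> P t)"
    and weak: "\<And>\<psi> \<phi> \<phi>'. \<psi> \<in> test_functions \<Omega> ==> (\<And>y. y \<notin> S ==> divergence \<psi> y = 0) ==>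
      \<phi> \<in> test_functions {0<..<T} ==> (\<And>t. (\<phi> has_real_derivative \<phi>' t) (at t)) ==> continuous_on UNIV \<phi>' ==>
      (LBINT t. ind {0<..<T} t * (\<phi>' t * (LBINT x. w t x \<bullet> \<psi> x)
         + \<phi> t * flux (\<lambda>x. uB (t, x)) (\<lambda>x. qB (t, x)) \<psi>)) = 0"
begin

lemma uBm [measurable]: "uB \<in> borel_measurable (borel \<Otimes>\<^sub>M borel)" using uB(1) by (simp add: borel_prod)

lemma qBm [measurable]: "qB \<in> borel_measurable (borel \<Otimes>\<^sub>M borel)" using qB by (simp add: borel_prod)

text \<open>Collects the almost-everywhere statements at one time, so that a single null set of
  times is discarded.\<close>

definition good :: "real => bool" where
  "good t \<longleftrightarrow> t \<in> {0<..<T} \<and> w t = (\<lambda>x. uB (t, x)) \<and> integrable lborel (\<lambda>x. norm (w t x) ^ 3) \<and>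
     (AE x in lborel. x \<in> S --> norm (w t x) \<le> M t) \<and> (AE x in lborel. x \<in> S --> \<bar>qB (t, x)\<bar> \<le> P t)"

abbreviation Z :: "real => real" where "Z t \<equiv> M t ^ 3 + P t powr (3/2)"

text \<open>A time-integrable bound for the flux against any field whose gradient and divergence are
  at most 1; it scales linearly with those bounds.\<close>

definition G :: "real => real" where
  "G t = measure lborel \<Omega> * (2 + Z t) + (LBINT x. norm (uB (t, x)) ^ 3)"

lemma uB3: "integrable (lborel \<Otimes>\<^sub>M lborel) (\<lambda>(t, x). norm (uB (t, x)) ^ 3)"
  using uB(2) by (simp add: lborel_prod case_prod_beta')

lemma AE_good: "AE t in lborel. t \<in> {0<..<T} --> good t"
  using uB(3) lborel_pair.AE_integrable_fst[OF uB3] MP(4,5)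
  by eventually_elim (auto simp: good_def)

lemma Z_nonneg: "0 \<le> Z t" using MP(1,2) by simp

lemma G_integrable: "integrable lborel (\<lambda>t. ind {0<..<T} t * G t)"
proof -
  have 1: "integrable lborel (\<lambda>t. ind {0<..<T} t :: real)"
    using Tpos by (intro integrable_real_indicator) auto
  have "integrable lborel (\<lambda>t. ind {0<..<T} t *\<^sub>R (LBINT x. norm (uB (t, x)) ^ 3))"
    by (rule integrable_mult_indicator[OF _ lborel_pair.integrable_fst[OF uB3]]) simp
  then have 2: "integrable lborel (\<lambda>t. ind {0<..<T} t * (LBINT x. norm (uB (t, x)) ^ 3))" by simp
  have "ind {0<..<T} t * G t = 2 * measure lborel \<Omega> * ind {0<..<T} t
      + measure lborel \<Omega> * (ind {0<..<T} t * Z t) + ind {0<..<T} t * (LBINT x. norm (uB (t, x)) ^ 3)" for t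
    by (simp add: G_def algebra_simps)
  then show ?thesis
    using 1 2 MP(3) by (simp only:) (intro bochner_add integrable_mult_right)
qed

lemma w_props: "t \<in> {0..<T} ==> w t \<in> borel_measurable borel" "t \<in> {0..<T} ==> integrable lborel (\<lambda>x. (norm (w t x))^2)"
    "t \<in> {0..<T} ==> x \<notin> \<Omega> ==> w t x = 0"
  using w unfolding solenoidal_ext_def by blast+

lemma w_integrable: "t \<in> {0..<T} ==> integrable lborel (w t)"
  by (rule solenoidal_ext_integrable(1)[OF w Omega])

lemma le_1_plus_cube: "0 \<le> (a::real) ==> a^2 \<le> 1 + a ^ 3"
  using Young_cubic[of 1 a] by simp

text \<open>Stated for a gradient D and a divergence d given separately, so that it applies both to
  a test field and to the difference of the fields built at two times.\<close>

lemma flux_integrand_bound: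
  assumes t: "good t" and c0: "0 \<le> c" and D: "\<And>y h. norm (D y h) \<le> c * norm h" and d: "\<And>y. \<bar>d y\<bar> \<le> c"
    and d0: "\<And>y. y \<notin> S ==> d y = 0"
    and Dm: "\<And>h. (\<lambda>y. D y h) \<in> borel_measurable borel" and dm: "d \<in> borel_measurable borel"
    and lin: "\<And>y. bounded_linear (D y)"
  shows "integrable lborel (\<lambda>y. D y (uB (t, y)) \<bullet> uB (t, y) + qB (t, y) * d y)"
    and "\<bar>LBINT y. D y (uB (t, y)) \<bullet> uB (t, y) + qB (t, y) * d y\<bar> \<le> c * G t"
proof -
  note [measurable] = Dm dm
  have tT: "t \<in> {0..<T}" and wu: "w t = (\<lambda>x. uB (t, x))" and w3: "integrable lborel (\<lambda>x. norm (uB (t, x)) ^ 3)"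
    and q: "AE x in lborel. x \<in> S --> \<bar>qB (t, x)\<bar> \<le> P t" using t by (auto simp: good_def)
  have z: "uB (t, x) = 0" if "x \<notin> \<Omega>" for x using w_props(3)[OF tT that] wu by metis
  let ?f = "\<lambda>y. D y (uB (t, y)) \<bullet> uB (t, y) + qB (t, y) * d y"
  let ?g = "\<lambda>y. c * ((2 + Z t) * ind \<Omega> y + norm (uB (t, y)) ^ 3)"
  have gi: "integrable lborel ?g" using bounded_integrable_indicator[OF Omega] w3 by simp
  \<comment> \<open>The inequality a^2 \<le> 1 + a^3 at a = sqrt P bounds the pressure by 1 +
    P^(3/2).\<close>
  have P1: "P t \<le> 1 + Z t"
  proof -
    have "(sqrt (P t))^2 \<le> 1 + sqrt (P t) ^ 3" using le_1_plus_cube[of "sqrt (P t)"] MP(2) by simp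
    moreover have "sqrt (P t) ^ 3 = P t powr (3/2)"
      using MP(2)[of t] by (simp add: powr_half_sqrt[symmetric] powr_powr flip: powr_realpow' powr_numeral)
    moreover have "0 \<le> M t ^ 3" using MP(1) by simp
    moreover have "(sqrt (P t))^2 = P t" using MP(2) by simp
    ultimately show ?thesis by linarith
  qed
  have ae: "AE y in lborel. norm (?f y) \<le> ?g y"
    using q
  proof eventually_elim
    case (elim y)
    let ?n = "norm (uB (t, y))"
    have n0: "0 \<le> ?n ^ 3" by simp
    show ?case
    proof (cases "y \<in> \<Omega>")
      case True
      have "\<bar>D y (uB (t, y)) \<bullet> uB (t, y)\<bar> \<le> c * ?n * ?n"
        using Cauchy_Schwarz_ineq2 mult_right_mono[OF D] norm_ge_zero order_trans by meson
      also have "\<dots> \<le> c * (1 + ?n ^ 3)"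
        using mult_left_mono[OF le_1_plus_cube[of ?n] c0] by (simp add: power2_eq_square mult.assoc)
      finally have 1: "\<bar>D y (uB (t, y)) \<bullet> uB (t, y)\<bar> \<le> c * (1 + ?n ^ 3)" .
      have 2: "\<bar>qB (t, y) * d y\<bar> \<le> c * (1 + Z t)"
      proof (cases "y \<in> S")
        case True
        then have "\<bar>qB (t, y)\<bar> * \<bar>d y\<bar> \<le> (1 + Z t) * c"
          using elim P1 d[of y] Z_nonneg[of t] by (intro mult_mono) auto
        then show ?thesis by (simp add: abs_mult mult.commute)
      qed (use d0 c0 Z_nonneg[of t] in simp)
      have "norm (?f y) \<le> c * (1 + ?n ^ 3) + c * (1 + Z t)"
        using 1 2 unfolding real_norm_def by linarith
      then show ?thesis using True by (simp add: algebra_simps)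
    next
      case False
      then have "d y = 0" using d0 SO by blast
      then show ?thesis using z[OF False] False by simp
    qed
  qed
  have exp: "D y h = (\<Sum>i\<in>Basis. (h \<bullet> i) *\<^sub>R D y i)" for y h by (rule linear_expand[OF lin])
  have "(\<lambda>y. D y (uB (t, y))) = (\<lambda>y. \<Sum>i\<in>Basis. (uB (t, y) \<bullet> i) *\<^sub>R D y i)" by (rule ext) (rule exp)
  then have "(\<lambda>y. D y (uB (t, y))) \<in> borel_measurable borel" by simp
  then have fm: "?f \<in> borel_measurable lborel" by measurable
  show "integrable lborel ?f"
    by (rule bochner_bound[OF gi fm])
      (use ae in eventually_elim, simp add: order_trans[OF _ abs_ge_self])
  have "norm (integral\<^sup>L lborel ?f) \<le> integral\<^sup>L lborel ?g" by (rule norm_integral_AE_le[OF gi ae])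
  also have "\<dots> = c * G t"
    using bounded_integrable_indicator[OF Omega] w3 by (simp add: G_def mult.commute)
  finally show "\<bar>integral\<^sup>L lborel ?f\<bar> \<le> c * G t" by simp
qed

lemma flux_uB_measurable:
  assumes "\<psi> \<in> test_functions \<Omega>"
  shows "(\<lambda>t. flux (\<lambda>x. uB (t, x)) (\<lambda>x. qB (t, x)) \<psi>) \<in> borel_measurable borel"
  by (rule flux_section_measurable[OF uB(1) qB assms])

text \<open>The condition on the divergence confines the pressure to the strip S, where its bound
  makes the flux integrable in time; the weak equation can then be integrated between any two
  times.\<close>

lemma increment:
  fixes \<psi> :: "'a => 'a"
  assumes \<psi>: "\<psi> \<in> test_functions \<Omega>" and div: "\<And>y. y \<notin> S ==> divergence \<psi> y = 0"
    and st: "0 \<le> s" "s \<le> t" "t < T"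
  shows "(LBINT x. w t x \<bullet> \<psi> x) - (LBINT x. w s x \<bullet> \<psi> x) =
    (LBINT \<sigma>. ind {s<..t} \<sigma> * flux (\<lambda>x. uB (\<sigma>, x)) (\<lambda>x. qB (\<sigma>, x)) \<psi>)"
proof (rule weak_derivative_increment[OF Tpos _ _ _ st])
  obtain B where B: "B > 0" "\<And>x. norm (\<psi> x) \<le> B" "\<And>x h. norm (fderiv \<psi> x h) \<le> B * norm h"
    using test_function_bounds[OF \<psi>] by metis
  show "continuous_on {0..<T} (\<lambda>t. LBINT x. w t x \<bullet> \<psi> x)"
    by (rule wcont[OF test_function_borel[OF \<psi>] B(2)])
  show "(LBINT t. ind {0<..<T} t * (\<phi>' t * (LBINT x. w t x \<bullet> \<psi> x)
      + \<phi> t * flux (\<lambda>x. uB (t, x)) (\<lambda>x. qB (t, x)) \<psi>)) = 0"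
    if "\<phi> \<in> test_functions {0<..<T}" "\<And>t. (\<phi> has_real_derivative \<phi>' t) (at t)" "continuous_on UNIV \<phi>'" for \<phi> \<phi>'
    by (rule weak[OF \<psi> div that])
  define c where "c = real DIM('a) * B"
  have c: "0 \<le> c" "B \<le> c" using B(1) DIM_positive[where 'a='a] by (auto simp: c_def intro: Suc_leI)
  have d: "\<bar>divergence \<psi> y\<bar> \<le> c" for y unfolding divergence_def c_def by (rule divergence_le[OF B(3)])
  have D: "norm (fderiv \<psi> y h) \<le> c * norm h" for y h
    by (rule order_trans[OF B(3)]) (use c in \<open>auto intro: mult_right_mono\<close>)
  show "integrable lborel (\<lambda>t. ind {0<..<T} t * flux (\<lambda>x. uB (t, x)) (\<lambda>x. qB (t, x)) \<psi>)"
  proof (rule bochner_bound[of _ "\<lambda>t. c * (ind {0<..<T} t * G t)"])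
    show "integrable lborel (\<lambda>t. c * (ind {0<..<T} t * G t))" using G_integrable by simp
    show "(\<lambda>t. ind {0<..<T} t * flux (\<lambda>x. uB (t, x)) (\<lambda>x. qB (t, x)) \<psi>) \<in> borel_measurable lborel"
      using flux_uB_measurable[OF \<psi>] by measurable
    show "AE t in lborel. norm (ind {0<..<T} t * flux (\<lambda>x. uB (t, x)) (\<lambda>x. qB (t, x)) \<psi>) \<le> norm (c * (ind {0<..<T} t * G t))"
      using AE_good
    proof eventually_elim
      case (elim t)
      show ?case
      proof (cases "t \<in> {0<..<T}")
        case True
        then have "\<bar>flux (\<lambda>x. uB (t, x)) (\<lambda>x. qB (t, x)) \<psi>\<bar> \<le> c * G t"
          unfolding flux_def using elim
          by (intro flux_integrand_bound(2) c(1) D d div test_function_flux_data[OF \<psi>]) auto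
        then show ?thesis using True order_trans[OF _ abs_ge_self] by simp
      qed simp
    qed
  qed
qed

end

section \<open>The balance for a fixed cutoff and mollifier\<close>

locale euler_cutoff = euler_data \<Omega> S T w uB qB M P + cutoff \<Omega> K S0 S \<epsilon> V L C \<eta> \<theta> \<theta>'
  for \<Omega> S K S0 :: "'a::euclidean_space set" and T w uB qB M P \<epsilon> V L C \<eta> \<theta> \<theta>' +
  assumes S0b: "S0 \<in> sets borel"
begin

definition tst :: "real => 'a => 'a" where "tst t = conv \<eta> (cut (w t))"

lemma w_trace: "t \<in> {0..<T} ==> (\<Sum>i\<in>Basis. Dmol (w t) x i \<bullet> i) = 0"
  by (rule Dmol_trace[OF w_integrable solenoidal_ext_divfree[OF w Omega ker]])

lemma tst_test: "t \<in> {0..<T} ==> tst t \<in> test_functions \<Omega>"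
  unfolding tst_def by (rule field_test[OF w_integrable])

lemma tst_divergence: "t \<in> {0..<T} ==> y \<notin> S ==> divergence (tst t) y = 0"
  unfolding tst_def by (rule field_divergence_outside[OF w_integrable w_trace])

lemma mol_w_continuous_time: "continuous_on {0..<T} (\<lambda>t. mol (w t) x)"
proof (rule continuous_on_componentwise[THEN iffD2], intro ballI)
  fix i :: 'a assume i: "i \<in> Basis"
  obtain B where B: "B > 0" "\<And>z. \<bar>\<eta> z\<bar> \<le> B" using kernel_bounded[OF ker] by metis
  have c: "continuous_on {0..<T} (\<lambda>t. LBINT y. w t y \<bullet> (\<eta> (y - x) *\<^sub>R i))"
    by (rule wcont[of _ B]) (use B i in \<open>simp_all\<close>)
  have e: "mol (w t) x \<bullet> i = (LBINT y. w t y \<bullet> (\<eta> (y - x) *\<^sub>R i))" if "t \<in> {0..<T}" for t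
    unfolding mol_eq using integral_inner_left[OF eta_v_integrable[OF w_integrable[OF that], of x], of i] by simp
  show "continuous_on {0..<T} (\<lambda>t. mol (w t) x \<bullet> i)"
    by (rule continuous_on_eq[OF c e[symmetric]])
qed

text \<open>For fixed x the mollified velocity is continuous in time by weak continuity; in x it is
  Lipschitz with one constant for all times up to b, because the L^2 norms are bounded there.
  Together this is joint continuity on the compact set [0,b] times K, hence uniform
  continuity.\<close>

lemma mol_w_uniform:
  assumes b: "0 \<le> b" "b < T" and e: "e > 0"
  obtains d where "d > 0" "\<And>s t x. s \<in> {0..b} ==> t \<in> {0..b} ==> \<bar>s - t\<bar> \<le> d ==> x \<in> K ==> norm (mol (w s) x - mol (w t) x) \<le> e"
proof -
  obtain B where B: "\<And>t. t \<in> {0..b} ==> (LBINT x. (norm (w t x))^2) \<le> B" using wbdd[OF b(2)] by blast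
  have tT: "t \<in> {0..<T}" if "t \<in> {0..b}" for t using that b by auto
  define Lip where "Lip = C / (\<epsilon> * V) * (measure lborel \<Omega> + \<bar>B\<bar>)"
  have Lip0: "0 \<le> Lip" unfolding Lip_def using C0 eps V_pos by simp
  have lip: "norm (mol (w t) x - mol (w t) y) \<le> Lip * norm (x - y)" if t: "t \<in> {0..b}" for t x y
  proof (rule differentiable_bound[of UNIV "mol (w t)" "\<lambda>x. Dmol (w t) x"])
    show "(mol (w t) has_derivative Dmol (w t) z) (at z within UNIV)" for z
      using mol_has_derivative[OF w_integrable[OF tT[OF t]]] by simp
    have I: "(LBINT x. norm (w t x)) \<le> measure lborel \<Omega> + \<bar>B\<bar>"
      using solenoidal_ext_integrable(2)[OF w[OF tT[OF t]] Omega] B[OF t] by linarith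
    show "onorm (Dmol (w t) z) \<le> Lip" for z
    proof (rule onorm_bound[OF Lip0])
      fix h
      have "norm (Dmol (w t) z h) \<le> C / (\<epsilon> * V) * (LBINT x. norm (w t x)) * norm h"
        by (rule Dmol_bound[OF w_integrable[OF tT[OF t]]])
      also have "\<dots> \<le> Lip * norm h"
        unfolding Lip_def using I C0 eps V_pos by (intro mult_right_mono mult_left_mono) auto
      finally show "norm (Dmol (w t) z h) \<le> Lip * norm h" .
    qed
  qed auto
  have "continuous_on ({0..b} \<times> K) (\<lambda>z. mol (w (fst z)) (snd z))"
    unfolding continuous_on_iff
  proof (intro ballI allI impI)
    fix z and e' :: real assume z: "z \<in> {0..b} \<times> K" and e': "e' > 0"
    obtain t0 x0 where zz: "z = (t0, x0)" "t0 \<in> {0..b}" "x0 \<in> K" using z by auto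
    obtain d where d: "d > 0" "\<And>t. t \<in> {0..<T} ==> dist t t0 < d ==> dist (mol (w t) x0) (mol (w t0) x0) < e' / 2"
      using mol_w_continuous_time[of x0] tT[OF zz(2)] e' unfolding continuous_on_iff by (meson half_gt_zero)
    define Y where "Y = Lip + 1"
    have Y: "Y > 0" "Lip \<le> Y" using Lip0 by (auto simp: Y_def)
    define d' where "d' = min d (e' / (2 * Y))"
    have d': "d' > 0" "d' \<le> d" "d' * Y \<le> e' / 2"
    proof -
      show "d' > 0" "d' \<le> d" using d(1) e' Y by (auto simp: d'_def)
      have "d' * Y \<le> e' / (2 * Y) * Y"
        using Y by (intro mult_right_mono) (auto simp: d'_def)
      then show "d' * Y \<le> e' / 2" using Y by simp
    qed
    show "\<exists>d>0. \<forall>z'\<in>{0..b} \<times> K. dist z' z < d --> dist (mol (w (fst z')) (snd z')) (mol (w (fst z)) (snd z)) < e'"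
    proof (intro exI[of _ d'] conjI d'(1) ballI impI)
      fix z' assume z': "z' \<in> {0..b} \<times> K" "dist z' z < d'"
      have f: "dist (fst z') t0 < d'" using z'(2) dist_fst_le[of z' z] zz(1) by simp
      have s: "dist (snd z') x0 < d'" using z'(2) dist_snd_le[of z' z] zz(1) by simp
      have t': "fst z' \<in> {0..b}" using z'(1) by auto
      have "dist (mol (w (fst z')) (snd z')) (mol (w (fst z')) x0) \<le> Lip * dist (snd z') x0"
        using lip[OF t', of "snd z'" x0] by (simp add: dist_norm)
      also have "\<dots> \<le> Y * d'" using s Y by (intro mult_mono) auto
      also have "\<dots> \<le> e' / 2" using d'(3) by (simp add: mult.commute)
      finally have 1: "dist (mol (w (fst z')) (snd z')) (mol (w (fst z')) x0) \<le> e' / 2" .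
      have 2: "dist (mol (w (fst z')) x0) (mol (w t0) x0) < e' / 2"
        by (rule d(2)[OF tT[OF t']]) (use f d'(2) in linarith)
      show "dist (mol (w (fst z')) (snd z')) (mol (w (fst z)) (snd z)) < e'"
        using dist_triangle[of "mol (w (fst z')) (snd z')" "mol (w t0) x0" "mol (w (fst z')) x0"] 1 2 zz(1) by simp
    qed
  qed
  from compact_uniformly_continuous[OF this compact_Times[OF compact_Icc K(1)]]
  obtain d where d: "d > 0" "\<And>z z'. z \<in> {0..b} \<times> K ==> z' \<in> {0..b} \<times> K ==> dist z' z < d ==>
      dist (mol (w (fst z')) (snd z')) (mol (w (fst z)) (snd z)) < e"
    using e unfolding uniformly_continuous_on_def by meson
  show ?thesis
  proof (rule that[of "d / 2"])
    show "norm (mol (w s) x - mol (w t) x) \<le> e" if "s \<in> {0..b}" "t \<in> {0..b}" "\<bar>s - t\<bar> \<le> d / 2" "x \<in> K" for s t x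
    proof -
      have "dist (s, x) (t, x) < d" using that d(1) by (simp add: dist_Pair_Pair dist_real_def)
      from d(2)[OF _ _ this] that show ?thesis by (simp add: dist_norm less_imp_le)
    qed
  qed (use d(1) in simp)
qed

text \<open>The derivative of the test field falls on the outer kernel, so uniform closeness of the
  mollified velocities on K is enough, at a cost that depends on \<epsilon> but not on the
  times.\<close>

lemma tst_derivative_close:
  assumes st: "s \<in> {0..<T}" "t \<in> {0..<T}" and close: "\<And>x. x \<in> K ==> norm (mol (w s) x - mol (w t) x) \<le> e" and e: "0 \<le> e"
  shows "norm (fderiv (tst s) y h - fderiv (tst t) y h) \<le> C / (\<epsilon> * V) * measure lborel K * e * norm h"
proof -
  let ?D = "\<lambda>z. fderiv \<eta> z h"
  have F: "fderiv (tst r) y h = (LBINT x. ?D (y - x) *\<^sub>R cut (w r) x)"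
    and Fi: "integrable lborel (\<lambda>x. ?D (y - x) *\<^sub>R cut (w r) x)" if "r \<in> {0..<T}" for r
  proof -
    show "fderiv (tst r) y h = (LBINT x. ?D (y - x) *\<^sub>R cut (w r) x)"
      unfolding tst_def conv_frechet_derivative[OF ker cut_integrable[OF w_integrable[OF that]]] conv_def ..
    show "integrable lborel (\<lambda>x. ?D (y - x) *\<^sub>R cut (w r) x)"
      by (rule conv_integrable[OF kernel_derivative[OF ker] cut_integrable[OF w_integrable[OF that]]])
  qed
  have Ki: "integrable lborel (ind K :: 'a => real)"
    using emeasure_compact_finite[OF K(1)] K(1) by (intro integrable_real_indicator) (auto simp: borel_closed compact_imp_closed)
  have "fderiv (tst s) y h - fderiv (tst t) y h =
     (LBINT x. ?D (y - x) *\<^sub>R cut (w s) x - ?D (y - x) *\<^sub>R cut (w t) x)"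
    unfolding F[OF st(1)] F[OF st(2)] by (rule Bochner_Integration.integral_diff[symmetric, OF Fi[OF st(1)] Fi[OF st(2)]])
  also have "norm \<dots> \<le> (LBINT x. C / (\<epsilon> * V) * norm h * e * ind K x)"
  proof (rule norm_integral_AE_le)
    show "integrable lborel (\<lambda>x. C / (\<epsilon> * V) * norm h * e * ind K x)" using Ki by simp
    show "AE x in lborel. norm (?D (y - x) *\<^sub>R cut (w s) x - ?D (y - x) *\<^sub>R cut (w t) x) \<le> C / (\<epsilon> * V) * norm h * e * ind K x"
    proof (rule AE_I2)
      fix x
      have eq: "?D (y - x) *\<^sub>R cut (w s) x - ?D (y - x) *\<^sub>R cut (w t) x = (?D (y - x) * \<theta> x) *\<^sub>R (mol (w s) x - mol (w t) x)"
        by (simp add: cut_def scaleR_diff_right)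
      show "norm (?D (y - x) *\<^sub>R cut (w s) x - ?D (y - x) *\<^sub>R cut (w t) x) \<le> C / (\<epsilon> * V) * norm h * e * ind K x"
      proof (cases "x \<in> K")
        case True
        have "\<bar>?D (y - x) * \<theta> x\<bar> \<le> C / (\<epsilon> * V) * norm h * 1"
          unfolding abs_mult using chi[of x] DetaC C0 eps V_pos by (intro mult_mono) auto
        then have "\<bar>?D (y - x) * \<theta> x\<bar> * norm (mol (w s) x - mol (w t) x) \<le> C / (\<epsilon> * V) * norm h * 1 * e"
          using close[OF True] C0 eps V_pos by (intro mult_mono) auto
        then show ?thesis unfolding eq using True by simp
      qed (simp add: eq chi)
    qed
  qed
  also have "\<dots> = C / (\<epsilon> * V) * measure lborel K * e * norm h"
    using K(1) by (simp add: mult_ac borel_closed compact_imp_closed)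
  finally show ?thesis .
qed

lemma flux_bound_at:
  assumes t: "good t" and \<kappa>: "0 < \<kappa>"
  shows "\<bar>flux (\<lambda>x. uB (t, x)) (\<lambda>x. qB (t, x)) (tst t)\<bar> \<le> ((M t)^2 + P t) * (LBINT x. \<bar>\<theta>' x (uB (t, x))\<bar>)
      + 3 * L * C * \<kappa> ^ 3 * Z t * measure lborel K
      + (6 * L * C / \<kappa> ^ 6 + 2 * C^2 / \<epsilon>) * (LBINT x. ind K x * avg 3 (\<lambda>x. uB (t, x)) x)"
proof -
  have tT: "t \<in> {0..<T}" and wu: "w t = (\<lambda>x. uB (t, x))" using t by (auto simp: good_def)
  have q: "(\<lambda>x. qB (t, x)) \<in> borel_measurable borel" by measurable
  have "integrable lborel (\<lambda>x. norm (w t x) ^ 3)" "AE x in lborel. x \<in> S --> norm (w t x) \<le> M t"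
    "AE x in lborel. x \<in> S --> \<bar>qB (t, x)\<bar> \<le> P t" using t by (auto simp: good_def)
  from flux_bound(2)[OF w_integrable[OF tT] w_props(2)[OF tT] this(1) solenoidal_ext_divfree[OF w[OF tT] Omega ker] MP(1) this(2) q MP(2) this(3) S0b \<kappa>]
  show ?thesis unfolding tst_def wu .
qed

text \<open>\<open>diagonal_increment_le\<close> is applied to the pairing of the velocity at one
  time with the field built at another. On the diagonal the flux is bounded by
  \<open>flux_bound_at\<close>, whose wall-normal term is split by Young's inequality with weight
  \<mu>; off the diagonal the error is e times \<open>G\<close>.\<close>

theorem energy_cutoff:
  assumes t: "t \<in> {0..<T}" and \<kappa>: "0 < \<kappa>" and \<mu>: "0 < \<mu>"
    and N: "\<And>\<sigma>. 0 \<le> N \<sigma>" "integrable lborel (\<lambda>\<sigma>. ind {0<..<T} \<sigma> * N \<sigma> ^ 3)"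
      "AE \<sigma> in lborel. \<sigma> \<in> {0<..<T} --> (LBINT x. \<bar>\<theta>' x (uB (\<sigma>, x))\<bar>) \<le> L1 * N \<sigma>" and L1: "0 \<le> L1"
    and D: "integrable lborel (\<lambda>\<sigma>. ind {0<..<T} \<sigma> * (LBINT x. ind K x * avg 3 (\<lambda>x. uB (\<sigma>, x)) x))"
  shows "\<bar>(LBINT x. \<theta> x * (norm (mol (w t) x))^2) - (LBINT x. \<theta> x * (norm (mol (w 0) x))^2)\<bar> \<le>
    2 * (L1 * (\<mu> ^ 3 * (LBINT \<sigma>. ind {0<..<T} \<sigma> * Z \<sigma>) + 2 / \<mu> ^ 6 * (LBINT \<sigma>. ind {0<..<T} \<sigma> * N \<sigma> ^ 3))
      + 3 * L * C * \<kappa> ^ 3 * measure lborel K * (LBINT \<sigma>. ind {0<..<T} \<sigma> * Z \<sigma>)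
      + (6 * L * C / \<kappa> ^ 6 + 2 * C^2 / \<epsilon>) * (LBINT \<sigma>. ind {0<..<T} \<sigma> * (LBINT x. ind K x * avg 3 (\<lambda>x. uB (\<sigma>, x)) x)))"
proof -
  let ?A = "\<lambda>t \<tau>. LBINT y. w t y \<bullet> tst \<tau> y"
  let ?D = "\<lambda>\<sigma>. LBINT x. ind K x * avg 3 (\<lambda>x. uB (\<sigma>, x)) x"
  let ?B = "\<lambda>\<sigma> \<tau>. flux (\<lambda>x. uB (\<sigma>, x)) (\<lambda>x. qB (\<sigma>, x)) (tst \<tau>)"
  define c3 where "c3 = 6 * L * C / \<kappa> ^ 6 + 2 * C^2 / \<epsilon>"
  define c2 where "c2 = 3 * L * C * \<kappa> ^ 3 * measure lborel K"
  \<comment> \<open>The density of the diagonal flux bound: wall-normal term, cost of replacing the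
    mollified velocity, and cubic increments.\<close>
  define r where "r \<sigma> = L1 * (\<mu> ^ 3 * Z \<sigma> + 2 / \<mu> ^ 6 * N \<sigma> ^ 3) + c2 * Z \<sigma> + c3 * ?D \<sigma>" for \<sigma>
  have c0: "0 \<le> c2" "0 \<le> c3" using L0 C0 \<kappa> eps by (auto simp: c2_def c3_def)
  have tT: "s \<in> {0..<T}" if "s \<in> {0..t}" for s using that t by auto
  have A: "?A s \<tau> = (LBINT x. \<theta> x * (mol (w s) x \<bullet> mol (w \<tau>) x))" if "s \<in> {0..t}" "\<tau> \<in> {0..t}" for s \<tau>
    unfolding tst_def by (rule energy_symmetric[OF w_integrable w_integrable]) (use tT that in auto)
  have re: "ind {0<..<T} \<sigma> * r \<sigma> = (L1 * \<mu> ^ 3) * (ind {0<..<T} \<sigma> * Z \<sigma>) + (L1 * (2 / \<mu> ^ 6)) * (ind {0<..<T} \<sigma> * N \<sigma> ^ 3)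
      + c2 * (ind {0<..<T} \<sigma> * Z \<sigma>) + c3 * (ind {0<..<T} \<sigma> * ?D \<sigma>)" for \<sigma>
    unfolding r_def by (simp add: algebra_simps)
  have ri: "integrable lborel (\<lambda>\<sigma>. ind {0<..<T} \<sigma> * r \<sigma>)"
    unfolding re by (intro bochner_add integrable_mult_right MP(3) N(2) D)
  have D0: "0 \<le> ?D \<sigma>" for \<sigma>
    by (intro Bochner_Integration.integral_nonneg) (auto simp: avg_def intro!: mult_nonneg_nonneg divide_nonneg_pos V_pos Bochner_Integration.integral_nonneg)
  have r0: "0 \<le> r \<sigma>" for \<sigma>
  proof -
    have 1: "0 \<le> \<mu> ^ 3 * Z \<sigma>" by (rule mult_nonneg_nonneg[OF _ Z_nonneg]) (use \<mu> in simp)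
    have 2: "0 \<le> 2 / \<mu> ^ 6 * N \<sigma> ^ 3" using \<mu> N(1) by simp
    have 3: "0 \<le> c2 * Z \<sigma>" by (rule mult_nonneg_nonneg[OF c0(1) Z_nonneg])
    have 4: "0 \<le> c3 * ?D \<sigma>" by (rule mult_nonneg_nonneg[OF c0(2) D0])
    show ?thesis unfolding r_def using mult_nonneg_nonneg[OF L1 add_nonneg_nonneg[OF 1 2]] 3 4 by linarith
  qed
  have sub: "{0<..t} \<subseteq> {0<..<T}" using t by auto
  have "\<bar>?A t t - ?A 0 0\<bar> \<le> 2 * (LBINT \<sigma>. ind {0<..t} \<sigma> * r \<sigma>)"
  proof (rule diagonal_increment_le[where A="?A" and B="?B" and g=G])
    show "0 \<le> t" using t by simp
    show "?A s \<tau> = ?A \<tau> s" if "s \<in> {0..t}" "\<tau> \<in> {0..t}" for s \<tau>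
      unfolding A[OF that] A[OF that(2,1)] by (simp only: inner_commute)
    show "?A t' \<tau> - ?A s \<tau> = (LBINT \<sigma>. ind {s<..t'} \<sigma> * ?B \<sigma> \<tau>)"
      if "0 \<le> s" "s \<le> t'" "t' \<le> t" "\<tau> \<in> {0..t}" for s t' \<tau>
      by (rule increment[OF tst_test tst_divergence]) (use that tT t in auto)
    show "integrable lborel (\<lambda>\<sigma>. ind {0<..t} \<sigma> * r \<sigma>)" by (rule integrable_indicator_mult[OF ri sub]) simp
    show "integrable lborel (\<lambda>\<sigma>. ind {0<..t} \<sigma> * G \<sigma>)" by (rule integrable_indicator_mult[OF G_integrable sub]) simp
    fix e :: real assume e: "e > 0"
    \<comment> \<open>Absorbs the constant of \<open>tst_derivative_close\<close> and the dimension
      lost in passing from gradient to divergence; the added 1 makes it positive.\<close>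
    define X where "X = real DIM('a) * (C / (\<epsilon> * V) * measure lborel K) + 1"
    have X0: "0 \<le> C / (\<epsilon> * V) * measure lborel K" using C0 eps V_pos by simp
    have X: "X > 0" unfolding X_def by (rule add_nonneg_pos[OF mult_nonneg_nonneg[OF of_nat_0_le_iff X0] zero_less_one])
    have e': "e / X > 0" using e X by simp
    obtain d where d: "d > 0" "\<And>s \<tau> x. s \<in> {0..t} ==> \<tau> \<in> {0..t} ==> \<bar>s - \<tau>\<bar> \<le> d ==> x \<in> K ==> norm (mol (w s) x - mol (w \<tau>) x) \<le> e / X"
      using mol_w_uniform[of t "e / X"] t e' by (metis atLeastLessThan_iff)
    show "\<exists>d>0. \<forall>\<tau>\<in>{0..t}. AE \<sigma> in lborel. \<sigma> \<in> {0<..t} --> \<bar>\<sigma> - \<tau>\<bar> \<le> d --> \<bar>?B \<sigma> \<tau>\<bar> \<le> r \<sigma> + e * G \<sigma>"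
    proof (intro exI[of _ d] conjI ballI d(1))
      fix \<tau> assume \<tau>: "\<tau> \<in> {0..t}"
      show "AE \<sigma> in lborel. \<sigma> \<in> {0<..t} --> \<bar>\<sigma> - \<tau>\<bar> \<le> d --> \<bar>?B \<sigma> \<tau>\<bar> \<le> r \<sigma> + e * G \<sigma>"
        using AE_good N(3)
      proof eventually_elim
        case (elim \<sigma>)
        show ?case
        proof (intro impI)
          assume \<sigma>: "\<sigma> \<in> {0<..t}" "\<bar>\<sigma> - \<tau>\<bar> \<le> d"
          then have \<sigma>T: "\<sigma> \<in> {0<..<T}" and \<sigma>t: "\<sigma> \<in> {0..t}" using t by auto
          have g: "good \<sigma>" using elim(1) \<sigma>T by blast
          have "\<bar>?B \<sigma> \<sigma>\<bar> \<le> ((M \<sigma>)^2 + P \<sigma>) * (LBINT x. \<bar>\<theta>' x (uB (\<sigma>, x))\<bar>) + c2 * Z \<sigma> + c3 * ?D \<sigma>"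
            using flux_bound_at[OF g \<kappa>] by (simp add: c2_def c3_def mult_ac)
          moreover have "((M \<sigma>)^2 + P \<sigma>) * (LBINT x. \<bar>\<theta>' x (uB (\<sigma>, x))\<bar>) \<le> L1 * (\<mu> ^ 3 * Z \<sigma> + 2 / \<mu> ^ 6 * N \<sigma> ^ 3)"
          proof -
            have "((M \<sigma>)^2 + P \<sigma>) * (LBINT x. \<bar>\<theta>' x (uB (\<sigma>, x))\<bar>) \<le> ((M \<sigma>)^2 + P \<sigma>) * (L1 * N \<sigma>)"
              using elim(2) \<sigma>T MP(2) by (intro mult_left_mono) auto
            also have "\<dots> = L1 * (((M \<sigma>)^2 + P \<sigma>) * N \<sigma>)" by simp
            also have "\<dots> \<le> L1 * (\<mu> ^ 3 * Z \<sigma> + 2 / \<mu> ^ 6 * N \<sigma> ^ 3)"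
              by (intro mult_left_mono Young_weighted N(1) MP(1,2) \<mu> L1)
            finally show ?thesis .
          qed
          ultimately have B1: "\<bar>?B \<sigma> \<sigma>\<bar> \<le> r \<sigma>" unfolding r_def by linarith
          have \<sigma>0: "\<sigma> \<in> {0..<T}" and \<tau>0: "\<tau> \<in> {0..<T}" using tT \<sigma>t \<tau> by blast+
          note tf = tst_test[OF \<tau>0] tst_test[OF \<sigma>0]
          note fd = test_function_flux_data
          let ?E = "\<lambda>y h. fderiv (tst \<tau>) y h - fderiv (tst \<sigma>) y h"
          let ?d = "\<lambda>y. divergence (tst \<tau>) y - divergence (tst \<sigma>) y"
          have E: "norm (?E y h) \<le> C / (\<epsilon> * V) * measure lborel K * (e / X) * norm h" for y h
            by (rule tst_derivative_close[OF \<tau>0 \<sigma>0]) (use d(2)[OF \<tau> \<sigma>t] \<sigma>(2) e' in \<open>auto simp: abs_minus_commute\<close>)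
          have dE: "?d y = (\<Sum>i\<in>Basis. ?E y i \<bullet> i)" for y
            unfolding divergence_def by (simp add: inner_diff_left sum_subtractf)
          have dle: "\<bar>?d y\<bar> \<le> real DIM('a) * (C / (\<epsilon> * V) * measure lborel K * (e / X))" for y
            unfolding dE by (rule divergence_le[OF E])
          have Xe1: "real DIM('a) * (C / (\<epsilon> * V) * measure lborel K * (e / X)) \<le> e"
          proof -
            have "real DIM('a) * (C / (\<epsilon> * V) * measure lborel K * (e / X)) = (X - 1) * (e / X)" by (simp add: X_def)
            also have "\<dots> \<le> X * (e / X)" using e' by (intro mult_right_mono) auto
            also have "\<dots> = e" using X by simp
            finally show ?thesis .
          qed
          have Xe2: "C / (\<epsilon> * V) * measure lborel K * (e / X) \<le> e"
          proof -
            have "1 * (C / (\<epsilon> * V) * measure lborel K * (e / X)) \<le> real DIM('a) * (C / (\<epsilon> * V) * measure lborel K * (e / X))"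
            proof (rule mult_right_mono)
              show "1 \<le> real DIM('a)" using DIM_positive[where 'a='a] by (simp add: Suc_leI)
              show "0 \<le> C / (\<epsilon> * V) * measure lborel K * (e / X)" by (rule mult_nonneg_nonneg[OF X0 less_imp_le[OF e']])
            qed
            then show ?thesis using Xe1 by simp
          qed
          have i1: "integrable lborel (\<lambda>y. fderiv \<psi> y (uB (\<sigma>, y)) \<bullet> uB (\<sigma>, y) + qB (\<sigma>, y) * divergence \<psi> y)"
            if \<psi>: "\<psi> \<in> test_functions \<Omega>" and div: "\<And>y. y \<notin> S ==> divergence \<psi> y = 0" for \<psi> :: "'a => 'a"
          proof -
            obtain b where b: "b > 0" "\<And>x. norm (\<psi> x) \<le> b" "\<And>x h. norm (fderiv \<psi> x h) \<le> b * norm h"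
              using test_function_bounds[OF \<psi>] by metis
            have dp: "real DIM('a) \<ge> 1" using DIM_positive[where 'a='a] by (simp add: Suc_leI)
            show ?thesis
            proof (rule flux_integrand_bound(1)[OF g, of "real DIM('a) * b"])
              show "0 \<le> real DIM('a) * b" using b by simp
              show "norm (fderiv \<psi> y h) \<le> real DIM('a) * b * norm h" for y h
                by (rule order_trans[OF b(3)]) (use mult_right_mono[OF mult_right_mono[OF dp less_imp_le[OF b(1)]] norm_ge_zero[of h]] in simp)
              show "\<bar>divergence \<psi> y\<bar> \<le> real DIM('a) * b" for y unfolding divergence_def by (rule divergence_le[OF b(3)])
            qed (use fd[OF \<psi>] div in auto)
          qed
          have "?B \<sigma> \<tau> - ?B \<sigma> \<sigma> = (LBINT y. ?E y (uB (\<sigma>, y)) \<bullet> uB (\<sigma>, y) + qB (\<sigma>, y) * ?d y)"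
            unfolding flux_def
            by (subst Bochner_Integration.integral_diff[symmetric, OF i1[OF tf(1) tst_divergence[OF \<tau>0]] i1[OF tf(2) tst_divergence[OF \<sigma>0]]])
              (simp_all add: inner_diff_left algebra_simps)
          moreover have "\<bar>LBINT y. ?E y (uB (\<sigma>, y)) \<bullet> uB (\<sigma>, y) + qB (\<sigma>, y) * ?d y\<bar> \<le> e * G \<sigma>"
          proof (rule flux_integrand_bound(2)[OF g])
            show "0 \<le> e" using e by simp
            show "norm (?E y h) \<le> e * norm h" for y h
              by (rule order_trans[OF E mult_right_mono[OF Xe2]]) simp
            show "\<bar>?d y\<bar> \<le> e" for y using dle[of y] Xe1 by linarith
            show "?d y = 0" if "y \<notin> S" for y using tst_divergence[OF \<tau>0 that] tst_divergence[OF \<sigma>0 that] by simp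
            show "(\<lambda>y. ?E y h) \<in> borel_measurable borel" for h using fd(1)[OF tf(1)] fd(1)[OF tf(2)] by measurable
            show "?d \<in> borel_measurable borel" using fd(2)[OF tf(1)] fd(2)[OF tf(2)] by measurable
            show "bounded_linear (?E y)" for y by (rule bounded_linear_sub[OF fd(3)[OF tf(1)] fd(3)[OF tf(2)]])
          qed
          ultimately show "\<bar>?B \<sigma> \<tau>\<bar> \<le> r \<sigma> + e * G \<sigma>" using B1 by linarith
        qed
      qed
    qed
  qed
  also have "(LBINT \<sigma>. ind {0<..t} \<sigma> * r \<sigma>) \<le> (LBINT \<sigma>. ind {0<..<T} \<sigma> * r \<sigma>)"
    by (rule integral_mono[OF integrable_indicator_mult[OF ri sub] ri])
      (use r0 sub in \<open>auto simp: indicator_def\<close>)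
  also have "(LBINT \<sigma>. ind {0<..<T} \<sigma> * r \<sigma>) = L1 * (\<mu> ^ 3 * (LBINT \<sigma>. ind {0<..<T} \<sigma> * Z \<sigma>) + 2 / \<mu> ^ 6 * (LBINT \<sigma>. ind {0<..<T} \<sigma> * N \<sigma> ^ 3))
      + c2 * (LBINT \<sigma>. ind {0<..<T} \<sigma> * Z \<sigma>) + c3 * (LBINT \<sigma>. ind {0<..<T} \<sigma> * ?D \<sigma>)"
  proof -
    have comb: "(LBINT x. a * f x + b * g x + c * f x + d * k x) = a * integral\<^sup>L lborel f + b * integral\<^sup>L lborel g + c * integral\<^sup>L lborel f + d * integral\<^sup>L lborel k"
      if "integrable lborel f" "integrable lborel g" "integrable lborel k" for a b c d :: real and f g k :: "real => real"
      using that by simp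
    show ?thesis unfolding re comb[OF MP(3) N(2) D] by (simp only: distrib_left mult.assoc)
  qed
  finally show ?thesis
    using A[of t t] A[of 0 0] t by (simp add: c2_def c3_def dot_square_norm)
qed

end

section \<open>Removing the mollification and the cutoff\<close>

lemma nn_integral_lborel_shift:
  fixes f :: "'a::euclidean_space => ennreal"
  assumes [measurable]: "f \<in> borel_measurable borel"
  shows "(\<integral>\<^sup>+x. f (c + x) \<partial>lborel) = (\<integral>\<^sup>+x. f x \<partial>lborel)"
proof -
  have "(\<integral>\<^sup>+x. f x \<partial>lborel) = (\<integral>\<^sup>+x. f x \<partial>distr lborel borel ((+) c))" by (simp add: lborel_distr_plus)
  also have "\<dots> = (\<integral>\<^sup>+x. f (c + x) \<partial>lborel)" by (rule nn_integral_distr) simp_all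
  finally show ?thesis by simp
qed

text \<open>If f is not integrable the left side is the default value 0; so upper bounds in extended
  integrals can be proved before integrability is known.\<close>

lemma ennreal_integral_le_nn_integral:
  assumes [measurable]: "f \<in> borel_measurable M" and "\<And>x. 0 \<le> f x"
  shows "ennreal (integral\<^sup>L M f) \<le> (\<integral>\<^sup>+x. ennreal (f x) \<partial>M)"
proof (cases "integrable M f")
  case True
  then show ?thesis using assms(2) by (simp add: nn_integral_eq_integral)
qed (simp add: not_integrable_integral_eq)

context cutoff
begin

lemma cball_sets [measurable]: "cball (c::'a) r \<in> sets borel" by simp

lemma avg_le_nn_integral:
  assumes [measurable]: "v \<in> borel_measurable borel"
  shows "ennreal (avg 3 v x) \<le> (\<integral>\<^sup>+z. ennreal (ind (cball 0 \<epsilon>) z * norm (v (x + z) - v x) ^ 3 / V) \<partial>lborel)"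
proof -
  have "avg 3 v x = (LBINT y. ind (cball x \<epsilon>) y * norm (v y - v x) ^ 3 / V)"
    by (simp add: avg_def)
  also have "ennreal \<dots> \<le> (\<integral>\<^sup>+y. ennreal (ind (cball x \<epsilon>) y * norm (v y - v x) ^ 3 / V) \<partial>lborel)"
  proof (rule ennreal_integral_le_nn_integral)
    show "(\<lambda>y. ind (cball x \<epsilon>) y * norm (v y - v x) ^ 3 / V) \<in> borel_measurable lborel" by measurable
  qed (use V_pos in auto)
  also have "\<dots> = (\<integral>\<^sup>+z. ennreal (ind (cball x \<epsilon>) (x + z) * norm (v (x + z) - v x) ^ 3 / V) \<partial>lborel)"
    by (rule nn_integral_lborel_shift[symmetric]) measurable
  also have "\<dots> = (\<integral>\<^sup>+z. ennreal (ind (cball 0 \<epsilon>) z * norm (v (x + z) - v x) ^ 3 / V) \<partial>lborel)"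
    by (intro nn_integral_cong) (auto simp: indicator_def dist_norm)
  finally show ?thesis .
qed

text \<open>Jensen's inequality for the square, obtained from the non-negativity of the variance
  about the mean \<open>mol v x\<close>.\<close>

lemma mol_square_le:
  assumes v1: "integrable lborel v" and v2: "integrable lborel (\<lambda>x. (norm (v x))^2)"
  shows "(norm (mol v x))^2 \<le> (LBINT y. \<eta> (y - x) * (norm (v y))^2)"
    "integrable lborel (\<lambda>y. \<eta> (y - x) * (norm (v y))^2)"
proof -
  let ?m = "mol v x"
  have [measurable]: "v \<in> borel_measurable borel" by (rule v_borel[OF v1])
  have iv: "integrable lborel (\<lambda>y. \<eta> (y - x) *\<^sub>R v y)" by (rule eta_v_integrable[OF v1])
  show i0: "integrable lborel (\<lambda>y. \<eta> (y - x) * (norm (v y))^2)"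
  proof (rule bochner_bound[of _ "\<lambda>y. C / V * (norm (v y))^2"])
    show "integrable lborel (\<lambda>y. C / V * (norm (v y))^2)" using v2 by simp
    show "AE y in lborel. norm (\<eta> (y - x) * (norm (v y))^2) \<le> norm (C / V * (norm (v y))^2)"
      using etaC eta0 C0 V_pos by (intro AE_I2) (simp add: abs_mult mult_right_mono del: times_divide_eq_left)
  qed measurable
  have i1: "integrable lborel (\<lambda>y. \<eta> (y - x) * (?m \<bullet> v y))" using integrable_inner_right[OF iv, of ?m] by simp
  have e1: "(LBINT y. \<eta> (y - x) * (?m \<bullet> v y)) = ?m \<bullet> ?m"
    using integral_inner_right[OF iv, of ?m] by (simp add: mol_eq)
  have "0 \<le> (LBINT y. \<eta> (y - x) * (norm (v y - ?m))^2)"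
    using eta0 by (intro Bochner_Integration.integral_nonneg) auto
  also have "(\<lambda>y. \<eta> (y - x) * (norm (v y - ?m))^2) = (\<lambda>y. \<eta> (y - x) * (norm (v y))^2 - 2 * (\<eta> (y - x) * (?m \<bullet> v y)) + \<eta> (y - x) * (?m \<bullet> ?m))"
    by (simp add: fun_eq_iff power2_norm_eq_inner inner_diff algebra_simps inner_commute)
  also have "integral\<^sup>L lborel \<dots> = (LBINT y. \<eta> (y - x) * (norm (v y))^2) - 2 * (?m \<bullet> ?m) + ?m \<bullet> ?m"
    using i0 i1 e1 eta_shift[of x] by simp
  finally show "(norm ?m)^2 \<le> (LBINT y. \<eta> (y - x) * (norm (v y))^2)" by (simp add: power2_norm_eq_inner)
qed

lemma K_integrable: "integrable lborel (ind K :: 'a => real)" and K_borel: "K \<in> sets borel"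
proof -
  show "K \<in> sets borel" using K(1) by (simp add: borel_closed compact_imp_closed)
  then show "integrable lborel (ind K :: 'a => real)"
    using emeasure_compact_finite[OF K(1)] by (intro integrable_real_indicator) auto
qed

text \<open>The constant C comes from bounding the kernel by C / V on a ball of volume V. What
  matters is that it is uniform in \<epsilon>.\<close>

lemma mol_square_integral:
  assumes v1: "integrable lborel v" and v2: "integrable lborel (\<lambda>x. (norm (v x))^2)"
  shows "integrable lborel (\<lambda>x. ind K x * (norm (mol v x))^2)"
    "(LBINT x. ind K x * (norm (mol v x))^2) \<le> C * (LBINT x. (norm (v x))^2)"
proof -
  have [measurable]: "v \<in> borel_measurable borel" "mol v \<in> borel_measurable borel" "K \<in> sets borel"
    by (rule v_borel[OF v1], rule mol_borel[OF v1], rule K_borel)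
  define G where "G x y = ind K x * \<eta> (y - x) * (norm (v y))^2" for x y
  have Gm: "case_prod G \<in> borel_measurable (lborel \<Otimes>\<^sub>M lborel)" unfolding G_def by measurable
  have a: "integrable lborel (\<lambda>x. C / V * ind K x)" using K_integrable by simp
  have Gle: "\<bar>G x y\<bar> \<le> (C / V * ind K x) * (norm (v y))^2" for x y
    using mult_right_mono[OF etaC[of "y - x"], of "(norm (v y))^2"] eta0[of "y - x"]
    by (cases "x \<in> K") (simp_all add: G_def abs_mult)
  note fub = fubini_bounded[OF Gm a v2 Gle]
  have le: "ind K x * (norm (mol v x))^2 \<le> (LBINT y. G x y)" for x
    using mol_square_le[OF v1 v2, of x] by (cases "x \<in> K") (simp_all add: G_def)
  show i: "integrable lborel (\<lambda>x. ind K x * (norm (mol v x))^2)"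
    by (rule bochner_bound[OF fub(3)])
      (measurable, use le in \<open>auto intro!: AE_I2 intro: order_trans[OF _ abs_ge_self]\<close>)
  have "(LBINT x. ind K x * (norm (mol v x))^2) \<le> (LBINT x. LBINT y. G x y)"
    by (rule integral_mono[OF i fub(3) le])
  also have "\<dots> = (LBINT y. LBINT x. G x y)" by (rule fub(2))
  also have "\<dots> \<le> (LBINT y. C * (norm (v y))^2)"
  proof (rule integral_mono[OF fub(4)])
    show "integrable lborel (\<lambda>y. C * (norm (v y))^2)" using v2 by simp
    show "(LBINT x. G x y) \<le> C * (norm (v y))^2" for y
    proof -
      have "norm (LBINT x. G x y) \<le> (LBINT x. C / V * (norm (v y))^2 * ind (cball y \<epsilon>) x)"
      proof (rule norm_integral_AE_le)
        show "integrable lborel (\<lambda>x. C / V * (norm (v y))^2 * ind (cball y \<epsilon>) x)"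
          by (intro integrable_mult_right integrable_indicator_cball)
        show "AE x in lborel. norm (G x y) \<le> C / V * (norm (v y))^2 * ind (cball y \<epsilon>) x"
        proof (rule AE_I2)
          fix x
          show "norm (G x y) \<le> C / V * (norm (v y))^2 * ind (cball y \<epsilon>) x"
          proof (cases "x \<in> cball y \<epsilon>")
            case True
            have "(C / V * ind K x) * (norm (v y))^2 \<le> C / V * 1 * (norm (v y))^2"
              using C0 V_pos by (intro mult_right_mono mult_left_mono) (auto simp: indicator_def)
            then show ?thesis using Gle[of x y] True by simp
          next
            case False
            then have "\<eta> (y - x) = 0" by (intro eta_zero) (simp add: dist_norm)
            then show ?thesis using False by (simp add: G_def)
          qed
        qed
      qed
      also have "\<dots> = C * (norm (v y))^2"
      proof -
        have "measure lborel (cball y \<epsilon>) = V" using content_cball[of \<epsilon> y] content_cball[of \<epsilon> "0::'a"] eps V by simp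
        then show ?thesis using V_pos by simp
      qed
      finally show ?thesis by simp
    qed
  qed
  finally show "(LBINT x. ind K x * (norm (mol v x))^2) \<le> C * (LBINT x. (norm (v x))^2)" by simp
qed

lemma square_perturbation:
  fixes a b :: "'b::real_inner"
  assumes "s > 0" shows "\<bar>(norm a)^2 - (norm b)^2\<bar> \<le> s * (norm b)^2 + (1 + 1 / s) * (norm (a - b))^2"
proof -
  have "(norm a)^2 - (norm b)^2 = (norm (a - b))^2 + 2 * ((a - b) \<bullet> b)"
    by (simp add: power2_norm_eq_inner inner_diff algebra_simps inner_commute)
  moreover have "\<bar>(a - b) \<bullet> b\<bar> \<le> norm (a - b) * norm b" by (rule Cauchy_Schwarz_ineq2)
  moreover have "2 * (norm (a - b) * norm b) \<le> s * (norm b)^2 + 1 / s * (norm (a - b))^2"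
  proof -
    have "0 \<le> (sqrt s * norm b - norm (a - b) / sqrt s)^2" by simp
    also have "\<dots> = s * (norm b)^2 - 2 * (norm (a - b) * norm b) + 1 / s * (norm (a - b))^2"
      using assms by (simp add: power2_diff power_mult_distrib power_divide)
    finally show ?thesis by simp
  qed
  moreover have "(1 + 1 / s) * (norm (a - b))^2 = (norm (a - b))^2 + 1 / s * (norm (a - b))^2"
    by (simp add: distrib_right)
  ultimately show ?thesis using zero_le_power2[of "norm (a - b)"] by linarith
qed

text \<open>An L^2-close Lipschitz field f splits mol v - v into mol (v - f), mol f - f and f - v.
  The first and last are small in L^2 by closeness, the middle one is at most B \<epsilon>
  pointwise; the parameter s balances the cross term of the squares.\<close>

lemma mol_energy_error:
  assumes v1: "integrable lborel v" and v2: "integrable lborel (\<lambda>x. (norm (v x))^2)"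
    and f1: "integrable lborel f" and f2: "integrable lborel (\<lambda>x. (norm (f x))^2)"
    and vf: "(LBINT x. (norm (v x - f x))^2) \<le> e" and B: "0 \<le> B" "\<And>x y. norm (f x - f y) \<le> B * norm (x - y)"
    and s: "s > 0"
  shows "\<bar>(LBINT x. \<theta> x * (norm (mol v x))^2) - (LBINT x. \<theta> x * (norm (v x))^2)\<bar> \<le>
    s * (LBINT x. (norm (v x))^2) + (1 + 1 / s) * (3 * C * e + 3 * B^2 * \<epsilon>^2 * measure lborel K + 3 * e)"
proof -
  note [measurable] = v_borel[OF v1] v_borel[OF f1] mol_borel[OF v1] K_borel
  let ?g = "\<lambda>x. v x - f x"
  have g1: "integrable lborel ?g" using v1 f1 by simp
  have g2: "integrable lborel (\<lambda>x. (norm (?g x))^2)"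
    by (rule difference_square_integrable[OF v_borel[OF v1] v_borel[OF f1] v2 f2])
  note mg = mol_square_integral[OF g1 g2]
  have mf: "norm (mol f x - f x) \<le> B * \<epsilon>" for x
  proof -
    have c: "integrable lborel (\<lambda>y. \<eta> (y - x) *\<^sub>R f x)" using eta_shift(1) by simp
    have "mol f x - f x = (LBINT y. \<eta> (y - x) *\<^sub>R f y) - (LBINT y. \<eta> (y - x) *\<^sub>R f x)"
      unfolding mol_eq using eta_shift by simp
    also have "\<dots> = (LBINT y. \<eta> (y - x) *\<^sub>R (f y - f x))"
      unfolding scaleR_diff_right using eta_v_integrable[OF f1] c by simp
    also have "norm \<dots> \<le> (LBINT y. B * \<epsilon> * \<eta> (y - x))"
    proof (rule norm_integral_AE_le)
      show "integrable lborel (\<lambda>y. B * \<epsilon> * \<eta> (y - x))" using eta_shift(1) by simp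
      show "AE y in lborel. norm (\<eta> (y - x) *\<^sub>R (f y - f x)) \<le> B * \<epsilon> * \<eta> (y - x)"
      proof (rule AE_I2)
        fix y
        show "norm (\<eta> (y - x) *\<^sub>R (f y - f x)) \<le> B * \<epsilon> * \<eta> (y - x)"
        proof (cases "norm (y - x) \<le> \<epsilon>")
          case True
          then have "norm (f y - f x) \<le> B * \<epsilon>" using B(2)[of y x] mult_left_mono[OF True B(1)] by linarith
          from mult_left_mono[OF this eta0[of "y - x"]] show ?thesis using eta0 by (simp add: mult.commute)
        qed (use eta_zero[of "y - x"] in simp)
      qed
    qed
    finally show ?thesis using eta_shift by simp
  qed
  have mlin: "mol v x = mol ?g x + mol f x" for x
    unfolding mol_eq using eta_v_integrable[OF v1, of x] eta_v_integrable[OF f1, of x] by (simp add: scaleR_diff_right)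
  have three: "(norm (a + b + c))^2 \<le> 3 * (norm a)^2 + 3 * (norm b)^2 + 3 * (norm c)^2" for a b c :: 'a
  proof -
    have "(norm (a + b + c))^2 \<le> (norm a + norm b + norm c)^2"
      using norm_triangle_ineq[of "a + b" c] norm_triangle_ineq[of a b] by (intro power_mono) auto
    also have "\<dots> \<le> 3 * (norm a)^2 + 3 * (norm b)^2 + 3 * (norm c)^2"
      using zero_le_power2[of "norm a - norm b"] zero_le_power2[of "norm b - norm c"] zero_le_power2[of "norm a - norm c"]
      by (simp add: power2_eq_square algebra_simps)
    finally show ?thesis .
  qed
  let ?R = "\<lambda>x. 3 * (ind K x * (norm (mol ?g x))^2) + 3 * (B * \<epsilon>)^2 * ind K x + 3 * (norm (?g x))^2"
  have Ri: "integrable lborel ?R" using mg(1) K_integrable g2 by simp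
  have diff: "\<theta> x * (norm (mol v x - v x))^2 \<le> ?R x" for x
  proof (cases "x \<in> K")
    case True
    have "mol v x - v x = mol ?g x + (mol f x - f x) + (f x - v x)" by (simp add: mlin)
    then have "(norm (mol v x - v x))^2 \<le> 3 * (norm (mol ?g x))^2 + 3 * (norm (mol f x - f x))^2 + 3 * (norm (f x - v x))^2"
      using three by metis
    also have "(norm (mol f x - f x))^2 \<le> (B * \<epsilon>)^2" by (intro power_mono mf) simp
    finally have "(norm (mol v x - v x))^2 \<le> ?R x" using True by (simp add: norm_minus_commute)
    moreover have "\<theta> x * (norm (mol v x - v x))^2 \<le> 1 * (norm (mol v x - v x))^2"
      using chi by (intro mult_right_mono) auto
    ultimately show ?thesis by simp
  qed (simp add: chi)
  let ?W = "\<lambda>x. s * (norm (v x))^2 + (1 + 1 / s) * ?R x"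
  have Wi: "integrable lborel ?W" using v2 Ri by simp
  have tv: "integrable lborel (\<lambda>x. \<theta> x * (norm (v x))^2)"
  proof (rule bochner_bound[OF v2])
    show "AE x in lborel. norm (\<theta> x * (norm (v x))^2) \<le> norm ((norm (v x))^2)"
      using chi by (intro AE_I2) (simp add: abs_mult mult_left_le_one_le)
  qed measurable
  have tm: "integrable lborel (\<lambda>x. \<theta> x * (norm (mol v x))^2)"
  proof (rule bochner_bound[OF mol_square_integral(1)[OF v1 v2]])
    show "AE x in lborel. norm (\<theta> x * (norm (mol v x))^2) \<le> norm (ind K x * (norm (mol v x))^2)"
    proof (rule AE_I2)
      fix x show "norm (\<theta> x * (norm (mol v x))^2) \<le> norm (ind K x * (norm (mol v x))^2)"
        using chi[of x] by (cases "x \<in> K") (simp_all add: abs_mult mult_left_le_one_le)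
    qed
  qed measurable
  have d: "(LBINT x. \<theta> x * (norm (mol v x))^2) - (LBINT x. \<theta> x * (norm (v x))^2) =
      (LBINT x. \<theta> x * (norm (mol v x))^2 - \<theta> x * (norm (v x))^2)"
    using tv tm by simp
  have W: "norm (LBINT x. \<theta> x * (norm (mol v x))^2 - \<theta> x * (norm (v x))^2) \<le> (LBINT x. ?W x)"
  proof (rule norm_integral_AE_le[OF Wi], rule AE_I2)
    fix x
    have "norm (\<theta> x * (norm (mol v x))^2 - \<theta> x * (norm (v x))^2) = \<theta> x * \<bar>(norm (mol v x))^2 - (norm (v x))^2\<bar>"
      using chi(1)[of x] by (simp add: abs_mult flip: right_diff_distrib)
    also have "\<dots> \<le> \<theta> x * (s * (norm (v x))^2 + (1 + 1 / s) * (norm (mol v x - v x))^2)"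
      by (intro mult_left_mono square_perturbation s chi)
    also have "\<dots> = \<theta> x * (s * (norm (v x))^2) + (1 + 1 / s) * (\<theta> x * (norm (mol v x - v x))^2)"
      by (simp add: algebra_simps)
    also have "\<dots> \<le> 1 * (s * (norm (v x))^2) + (1 + 1 / s) * ?R x"
      by (intro add_mono mult_right_mono mult_left_mono diff chi) (use s in auto)
    finally show "norm (\<theta> x * (norm (mol v x))^2 - \<theta> x * (norm (v x))^2) \<le> ?W x" by simp
  qed
  have WR: "(LBINT x. ?W x) = s * (LBINT x. (norm (v x))^2) + (1 + 1 / s) * (LBINT x. ?R x)"
  proof -
    have comb: "(LBINT x. a * f x + b * g x) = a * integral\<^sup>L lborel f + b * integral\<^sup>L lborel g"
      if "integrable lborel f" "integrable lborel g" for a b :: real and f g :: "'a => real"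
      using that by simp
    show ?thesis by (rule comb[OF v2 Ri])
  qed
  have fin: "\<bar>(LBINT x. \<theta> x * (norm (mol v x))^2) - (LBINT x. \<theta> x * (norm (v x))^2)\<bar> \<le>
      s * (LBINT x. (norm (v x))^2) + (1 + 1 / s) * (LBINT x. ?R x)"
    using W unfolding d WR real_norm_def .
  have "(LBINT x. ?R x) = 3 * (LBINT x. ind K x * (norm (mol ?g x))^2) + 3 * (B * \<epsilon>)^2 * measure lborel K + 3 * (LBINT x. (norm (?g x))^2)"
    using mg(1) K_integrable g2 by simp
  also have "\<dots> \<le> 3 * (C * e) + 3 * (B * \<epsilon>)^2 * measure lborel K + 3 * e"
    using order_trans[OF mg(2) mult_left_mono[OF vf C0]] vf by linarith
  also have "\<dots> = 3 * C * e + 3 * B^2 * \<epsilon>^2 * measure lborel K + 3 * e" by (simp add: power_mult_distrib)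
  finally have "(1 + 1 / s) * (LBINT x. ?R x) \<le> (1 + 1 / s) * (3 * C * e + 3 * B^2 * \<epsilon>^2 * measure lborel K + 3 * e)"
    using s by (intro mult_left_mono) auto
  with fin show ?thesis by linarith
qed

end

context euler_cutoff
begin

text \<open>Tonelli's theorem makes the displacement z the outermost variable, where the hypothesis
  bounds the inner integral by \<omega> for each z; the mean of \<omega> over the ball is \<omega>.
  Extended integrals are used throughout, so that integrability comes out as a conclusion.\<close>

lemma increments_time_average:
  assumes \<omega>: "0 \<le> \<omega>"
    and inc: "\<And>z. z \<noteq> 0 ==> norm z \<le> \<epsilon> ==>
      (\<integral>\<^sup>+\<sigma>. \<integral>\<^sup>+x. ennreal (ind {0<..<T} \<sigma> * ind K x * norm (uB (\<sigma>, x + z) - uB (\<sigma>, x)) ^ 3) \<partial>lborel \<partial>lborel) \<le> ennreal \<omega>"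
  shows "integrable lborel (\<lambda>\<sigma>. ind {0<..<T} \<sigma> * (LBINT x. ind K x * avg 3 (\<lambda>x. uB (\<sigma>, x)) x))"
    and "(LBINT \<sigma>. ind {0<..<T} \<sigma> * (LBINT x. ind K x * avg 3 (\<lambda>x. uB (\<sigma>, x)) x)) \<le> \<omega>"
proof -
  note [measurable] = K_borel
  let ?D = "\<lambda>\<sigma>. LBINT x. ind K x * avg 3 (\<lambda>x. uB (\<sigma>, x)) x"
  let ?h = "\<lambda>\<sigma>. ind {0<..<T} \<sigma> * ?D \<sigma>"
  have cb: "(\<lambda>(p::real \<times> 'a, y). ind (cball (snd p) \<epsilon>) y :: real) \<in> borel_measurable ((borel \<Otimes>\<^sub>M borel) \<Otimes>\<^sub>M borel)"
  proof -
    have "(\<lambda>(p::real \<times> 'a, y). ind (cball (snd p) \<epsilon>) y :: real) = (\<lambda>(p, y). if dist (snd p) y \<le> \<epsilon> then 1 else 0)"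
      by (auto simp: fun_eq_iff indicator_def)
    moreover have "(\<lambda>(p::real \<times> 'a, y). if dist (snd p) y \<le> \<epsilon> then 1 else 0 :: real) \<in> borel_measurable ((borel \<Otimes>\<^sub>M borel) \<Otimes>\<^sub>M borel)"
      by measurable
    ultimately show ?thesis by simp
  qed
  have "(\<lambda>(p, y). ind (cball (snd p) \<epsilon>) y * norm (uB (fst p, y) - uB (fst p, snd p)) ^ 3) \<in> borel_measurable ((borel \<Otimes>\<^sub>M borel) \<Otimes>\<^sub>M lborel)"
    using cb by measurable
  from lborel.borel_measurable_lebesgue_integral[OF this]
  have avgm: "(\<lambda>p. avg 3 (\<lambda>x. uB (fst p, x)) (snd p)) \<in> borel_measurable (borel \<Otimes>\<^sub>M borel)"
    unfolding avg_def by measurable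
  then have "(\<lambda>(\<sigma>, x). ind K x * avg 3 (\<lambda>x. uB (\<sigma>, x)) x) \<in> borel_measurable (borel \<Otimes>\<^sub>M lborel)"
    by (simp add: case_prod_beta') measurable
  from lborel.borel_measurable_lebesgue_integral[OF this]
  have Dm [measurable]: "?D \<in> borel_measurable borel" by simp
  have a0: "0 \<le> avg 3 v x" for v x
    unfolding avg_def using V_pos by (intro divide_nonneg_pos Bochner_Integration.integral_nonneg) auto
  have D0: "0 \<le> ?D \<sigma>" for \<sigma> using a0 by (intro Bochner_Integration.integral_nonneg) auto
  let ?F = "\<lambda>\<sigma> x z. ennreal (ind {0<..<T} \<sigma> * ind K x * norm (uB (\<sigma>, x + z) - uB (\<sigma>, x)) ^ 3)"
  let ?I = "\<lambda>z::'a. ennreal (ind (cball 0 \<epsilon>) z / V)"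
  have Vn: "0 \<le> 1 / V" using V_pos by simp
  have h: "ennreal (?h \<sigma>) \<le> (\<integral>\<^sup>+x. \<integral>\<^sup>+z. ?I z * ?F \<sigma> x z \<partial>lborel \<partial>lborel)" for \<sigma>
  proof (cases "\<sigma> \<in> {0<..<T}")
    case True
    have am: "(\<lambda>x. avg 3 (\<lambda>x. uB (\<sigma>, x)) x) \<in> borel_measurable borel"
      using measurable_compose[OF measurable_Pair1'[of \<sigma> borel borel] avgm] by simp
    have "ennreal (?h \<sigma>) \<le> (\<integral>\<^sup>+x. ennreal (ind K x * avg 3 (\<lambda>x. uB (\<sigma>, x)) x) \<partial>lborel)"
      using True am by (simp, intro ennreal_integral_le_nn_integral) (use a0 in auto)
    also have "\<dots> \<le> (\<integral>\<^sup>+x. \<integral>\<^sup>+z. ?I z * ?F \<sigma> x z \<partial>lborel \<partial>lborel)"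
    proof (rule nn_integral_mono)
      fix x :: 'a
      show "ennreal (ind K x * avg 3 (\<lambda>x. uB (\<sigma>, x)) x) \<le> (\<integral>\<^sup>+z. ?I z * ?F \<sigma> x z \<partial>lborel)"
      proof (cases "x \<in> K")
        case xK: True
        have um: "(\<lambda>x. uB (\<sigma>, x)) \<in> borel_measurable borel" by measurable
        have "?I z * ?F \<sigma> x z = ennreal (ind (cball 0 \<epsilon>) z * norm (uB (\<sigma>, x + z) - uB (\<sigma>, x)) ^ 3 / V)" for z
          using True xK V_pos by (subst ennreal_mult[symmetric]) auto
        then show ?thesis using avg_le_nn_integral[OF um, of x] xK by simp
      qed simp
    qed
    finally show ?thesis .
  qed simp
  have "(\<integral>\<^sup>+\<sigma>. ennreal (?h \<sigma>) \<partial>lborel) \<le> (\<integral>\<^sup>+\<sigma>. \<integral>\<^sup>+x. \<integral>\<^sup>+z. ?I z * ?F \<sigma> x z \<partial>lborel \<partial>lborel \<partial>lborel)"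
    by (rule nn_integral_mono) (rule h)
  also have "\<dots> = (\<integral>\<^sup>+\<sigma>. \<integral>\<^sup>+z. \<integral>\<^sup>+x. ?I z * ?F \<sigma> x z \<partial>lborel \<partial>lborel \<partial>lborel)"
  proof (rule nn_integral_cong)
    fix \<sigma> :: real
    show "(\<integral>\<^sup>+x. \<integral>\<^sup>+z. ?I z * ?F \<sigma> x z \<partial>lborel \<partial>lborel) = (\<integral>\<^sup>+z. \<integral>\<^sup>+x. ?I z * ?F \<sigma> x z \<partial>lborel \<partial>lborel)"
      by (rule lborel_pair.Fubini') measurable
  qed
  also have "\<dots> = (\<integral>\<^sup>+z. \<integral>\<^sup>+\<sigma>. \<integral>\<^sup>+x. ?I z * ?F \<sigma> x z \<partial>lborel \<partial>lborel \<partial>lborel)"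
  proof (rule lborel_pair.Fubini')
    have "(\<lambda>(p, x). ?I (fst p) * ?F (snd p) x (fst p)) \<in> borel_measurable ((lborel \<Otimes>\<^sub>M lborel) \<Otimes>\<^sub>M lborel)" by measurable
    from lborel.borel_measurable_nn_integral[OF this]
    show "(\<lambda>(z, \<sigma>). \<integral>\<^sup>+x. ?I z * ?F \<sigma> x z \<partial>lborel) \<in> borel_measurable (lborel \<Otimes>\<^sub>M lborel)" by (simp add: case_prod_beta')
  qed
  also have "\<dots> \<le> (\<integral>\<^sup>+z. ?I z * ennreal \<omega> \<partial>lborel)"
  proof (rule nn_integral_mono_AE)
    show "AE z in lborel. (\<integral>\<^sup>+\<sigma>. \<integral>\<^sup>+x. ?I z * ?F \<sigma> x z \<partial>lborel \<partial>lborel) \<le> ?I z * ennreal \<omega>"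
      \<comment> \<open>The displacement 0, for which the increment hypothesis says nothing, is a
        null set.\<close>
      using AE_lborel_singleton[of "0::'a"]
    proof eventually_elim
      case (elim z)
      have m1: "(\<lambda>x. ?F \<sigma> x z) \<in> borel_measurable lborel" for \<sigma> by measurable
      have m2: "(\<lambda>\<sigma>. \<integral>\<^sup>+x. ?F \<sigma> x z \<partial>lborel) \<in> borel_measurable lborel"
      proof -
        have "(\<lambda>(\<sigma>, x). ?F \<sigma> x z) \<in> borel_measurable (lborel \<Otimes>\<^sub>M lborel)" by measurable
        from lborel.borel_measurable_nn_integral[OF this] show ?thesis by simp
      qed
      have "(\<integral>\<^sup>+\<sigma>. \<integral>\<^sup>+x. ?I z * ?F \<sigma> x z \<partial>lborel \<partial>lborel) = ?I z * (\<integral>\<^sup>+\<sigma>. \<integral>\<^sup>+x. ?F \<sigma> x z \<partial>lborel \<partial>lborel)"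
        using m1 m2 by (simp add: nn_integral_cmult)
      also have "\<dots> \<le> ?I z * ennreal \<omega>"
        using inc[OF elim] by (cases "norm z \<le> \<epsilon>") (auto intro!: mult_left_mono)
      finally show ?case .
    qed
  qed
  also have "\<dots> = ennreal \<omega>"
  proof -
    have "(\<integral>\<^sup>+z. ?I z * ennreal \<omega> \<partial>lborel) = (\<integral>\<^sup>+z. ennreal (\<omega> / V) * ind (cball (0::'a) \<epsilon>) z \<partial>lborel)"
      using V_pos \<omega> by (intro nn_integral_cong) (auto simp: indicator_def ennreal_mult[symmetric])
    also have "\<dots> = ennreal (\<omega> / V) * emeasure lborel (cball (0::'a) \<epsilon>)" by (simp add: nn_integral_cmult_indicator)
    also have "emeasure lborel (cball (0::'a) \<epsilon>) = ennreal V"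
      unfolding V by (rule emeasure_eq_ennreal_measure) (use emeasure_bounded_finite[of "cball (0::'a) \<epsilon>"] in auto)
    finally show ?thesis using V_pos \<omega> by (simp add: ennreal_mult[symmetric])
  qed
  finally have fin: "(\<integral>\<^sup>+\<sigma>. ennreal (?h \<sigma>) \<partial>lborel) \<le> ennreal \<omega>" .
  have h0: "0 \<le> ?h \<sigma>" for \<sigma> using D0 by simp
  show i: "integrable lborel ?h"
    by (rule integrableI_nonneg) (use h0 fin in \<open>auto intro: le_less_trans\<close>)
  have "ennreal (integral\<^sup>L lborel ?h) = (\<integral>\<^sup>+\<sigma>. ennreal (?h \<sigma>) \<partial>lborel)"
    using nn_integral_eq_integral[OF i] h0 by simp
  then have "ennreal (integral\<^sup>L lborel ?h) \<le> ennreal \<omega>" using fin by simp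
  then show "integral\<^sup>L lborel ?h \<le> \<omega>" using \<omega> by simp
qed

end

text \<open>The threshold for \<epsilon> depends on neither V nor \<eta>, so it can be fixed before
  a mollifier of that radius is chosen.\<close>

lemma mol_energy_limit:
  fixes \<Omega> :: "'a::euclidean_space set"
  assumes v: "solenoidal_ext \<Omega> v" and \<Omega>: "open \<Omega>" "bounded \<Omega>" and e: "e > 0" and C: "0 \<le> C"
  obtains \<epsilon>0 where "\<epsilon>0 > 0" "\<And>\<epsilon> V \<eta>. \<epsilon> < \<epsilon>0 ==> cutoff \<Omega> K S0 S \<epsilon> V L C \<eta> \<theta> \<theta>' ==>
    \<bar>(LBINT x. \<theta> x * (norm (cutoff.mol \<eta> v x))^2) - (LBINT x. \<theta> x * (norm (v x))^2)\<bar> \<le> e"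
proof -
  have vm: "v \<in> borel_measurable borel" and v2: "integrable lborel (\<lambda>x. (norm (v x))^2)"
    using v unfolding solenoidal_ext_def by blast+
  note v1 = solenoidal_ext_integrable(1)[OF v \<Omega>]
  define I where "I = (LBINT x. (norm (v x))^2)"
  have I0: "0 \<le> I" by (simp add: I_def)
  define Y where "Y = I + 1"
  have Y: "Y > 0" "I \<le> Y" using I0 by (auto simp: Y_def)
  \<comment> \<open>The error e is shared out: e / 2 to the term with s, e / 4 to the L^2
    approximation, e / 4 to the radius. The bound \<epsilon> < 1 replaces \<epsilon>^2 by
    \<epsilon>.\<close>
  define s where "s = e / (2 * Y)"
  have s: "s > 0" "s * I \<le> e / 2"
  proof -
    show "s > 0" unfolding s_def using e Y by simp
    then have "s * I \<le> s * Y" using Y by simp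
    also have "\<dots> = e / 2" unfolding s_def using Y by simp
    finally show "s * I \<le> e / 2" .
  qed
  define c where "c = 1 + 1 / s"
  have c: "c > 0" unfolding c_def using s by (simp add: add_pos_pos)
  define e2 where "e2 = e / (4 * (c * (3 * C + 3)))"
  have c3: "c * (3 * C + 3) > 0" using c C by (intro mult_pos_pos) auto
  have e2: "e2 > 0" "c * ((3 * C + 3) * e2) = e / 4"
    unfolding e2_def using e c3 c C by (simp_all add: field_simps)
  obtain \<phi> where \<phi>: "\<phi> \<in> test_functions \<Omega>" "(LBINT x. (norm (v x - \<phi> x))^2) < e2"
    using v e2(1) unfolding solenoidal_ext_def by blast
  obtain B where B: "B > 0" "\<And>x y. norm (\<phi> x - \<phi> y) \<le> B * norm (x - y)" using test_function_bounds[OF \<phi>(1)] by metis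
  define X where "X = c * (3 * B^2 * measure lborel K) + 1"
  have X: "X > 0" unfolding X_def using c by (intro add_nonneg_pos mult_nonneg_nonneg) auto
  show ?thesis
  proof (rule that[of "min 1 (e / (4 * X))"])
    show "min 1 (e / (4 * X)) > 0" using e X by simp
    fix \<epsilon> V \<eta> assume \<epsilon>: "\<epsilon> < min 1 (e / (4 * X))" and "cutoff \<Omega> K S0 S \<epsilon> V L C \<eta> \<theta> \<theta>'"
    then interpret cutoff \<Omega> K S0 S \<epsilon> V L C \<eta> \<theta> \<theta>' by simp
    have "\<bar>(LBINT x. \<theta> x * (norm (mol v x))^2) - (LBINT x. \<theta> x * (norm (v x))^2)\<bar> \<le>
        s * I + c * (3 * C * e2 + 3 * B^2 * \<epsilon>^2 * measure lborel K + 3 * e2)"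
      unfolding I_def c_def
      by (rule mol_energy_error[OF v1 v2 test_function_square_integrable[OF \<phi>(1) \<Omega>(2)] less_imp_le[OF \<phi>(2)] less_imp_le[OF B(1)] B(2) s(1)])
    also have "\<dots> = s * I + c * ((3 * C + 3) * e2) + c * (3 * B^2 * measure lborel K) * \<epsilon>^2"
      by (simp add: algebra_simps)
    also have "c * (3 * B^2 * measure lborel K) * \<epsilon>^2 \<le> X * \<epsilon>"
    proof -
      have "\<epsilon>^2 \<le> \<epsilon>" using eps \<epsilon> by (simp add: power2_eq_square mult_left_le_one_le)
      then show ?thesis using X eps c by (intro mult_mono) (auto simp: X_def)
    qed
    also have "X * \<epsilon> \<le> X * (e / (4 * X))" using \<epsilon> X by (intro mult_left_mono) auto
    also have "\<dots> = e / 4" using X by simp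
    finally show "\<bar>(LBINT x. \<theta> x * (norm (mol v x))^2) - (LBINT x. \<theta> x * (norm (v x))^2)\<bar> \<le> e"
      using s(2) e2(2) by linarith
  qed
qed

section \<open>Cutoff functions near the boundary\<close>

lemma cball_subset_domain:
  fixes \<Omega> :: "'a::euclidean_space set"
  assumes x: "x \<in> \<Omega>" and r: "0 \<le> r" "r < infdist x (frontier \<Omega>)" shows "cball x r \<subseteq> \<Omega>"
proof (rule ccontr)
  assume "\<not> cball x r \<subseteq> \<Omega>"
  moreover have "cball x r \<inter> \<Omega> \<noteq> {}" using x r(1) centre_in_cball[of x r] by blast
  ultimately have "cball x r \<inter> frontier \<Omega> \<noteq> {}" by (intro connected_Int_frontier) auto
  then obtain z where "z \<in> frontier \<Omega>" "dist x z \<le> r" by auto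
  then show False using infdist_le[of z "frontier \<Omega>" x] r(2) by linarith
qed

text \<open>The cutoff at distance \<open>\<delta>\<close> from the boundary; its derivative only sees the wall-normal direction.\<close>

lemma boundary_cutoff:
  fixes \<Omega> :: "'a::euclidean_space set"
  assumes dom: "bounded_C2_domain \<Omega>"
  obtains \<theta> :: "real => 'a => real" and \<theta>' :: "real => 'a => 'a => real" and \<rho> c where "\<rho> > 0" "c > 0"
    "\<And>\<delta> x. 0 \<le> \<theta> \<delta> x" "\<And>\<delta> x. \<theta> \<delta> x \<le> 1"
    "\<And>\<delta> x. 0 < \<delta> ==> \<delta> < \<rho> ==> x \<notin> {x \<in> closure \<Omega>. \<delta> / 2 \<le> infdist x (frontier \<Omega>)} ==> \<theta> \<delta> x = 0"
    "\<And>\<delta> x. 0 < \<delta> ==> \<delta> < \<rho> ==> x \<in> \<Omega> ==> \<delta> \<le> infdist x (frontier \<Omega>) ==> \<theta> \<delta> x = 1"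
    "\<And>\<delta> x. 0 < \<delta> ==> \<delta> < \<rho> ==> (\<theta> \<delta> has_derivative \<theta>' \<delta> x) (at x)"
    "\<And>\<delta> x h. 0 < \<delta> ==> \<delta> < \<rho> ==> \<bar>\<theta>' \<delta> x h\<bar> \<le> c / \<delta> * norm h"
    "\<And>\<delta> x h. 0 < \<delta> ==> \<delta> < \<rho> ==> \<bar>\<theta>' \<delta> x h\<bar> \<le> c / \<delta> * \<bar>outward_normal \<Omega> (closest_point (frontier \<Omega>) x) \<bullet> h\<bar>"
    "\<And>\<delta> x h. 0 < \<delta> ==> \<delta> < \<rho> ==> x \<notin> {x \<in> \<Omega>. \<delta> / 2 \<le> infdist x (frontier \<Omega>) \<and> infdist x (frontier \<Omega>) \<le> \<delta>} ==> \<theta>' \<delta> x h = 0"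
proof -
  let ?F = "frontier \<Omega>" and ?d = "\<lambda>x. infdist x (frontier \<Omega>)"
  let ?n = "\<lambda>x. outward_normal \<Omega> (closest_point (frontier \<Omega>) x)"
  have op: "open \<Omega>" using dom by (simp add: bounded_C2_domain_def)
  note cF = frontier_bounded_C2[OF dom]
  obtain \<rho> where \<rho>: "\<rho> > 0" "\<And>x. x \<in> \<Omega> ==> ?d x < \<rho> ==> (?d has_derivative (\<lambda>v. - (?n x \<bullet> v))) (at x)"
    using infdist_frontier_derivative[OF dom] by metis
  obtain H H' :: "real => real" and C where H:
    "\<And>s. (H has_real_derivative H' s) (at s)" "\<And>s. s \<le> 0 ==> H s = 0" "\<And>s. s \<ge> 1 ==> H s = 1" "\<And>s. 0 \<le> H s" "\<And>s. H s \<le> 1"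
    "\<And>s. 0 \<le> H' s" "\<And>s. H' s \<le> C" "C > 0"
    using smooth_step by metis
  \<comment> \<open>The affine rescaling sends distance \<delta> / 2 to 0 and distance \<delta> to
    1, the ends of the smooth step.\<close>
  define \<theta> where "\<theta> \<delta> x = (if x \<in> \<Omega> then H (2 / \<delta> * ?d x - 1) else 0)" for \<delta> x
  define S0 where "S0 \<delta> = {x \<in> \<Omega>. \<delta> / 2 \<le> ?d x \<and> ?d x \<le> \<delta>}" for \<delta>
  define \<theta>' where "\<theta>' \<delta> x h = (if x \<in> S0 \<delta> then H' (2 / \<delta> * ?d x - 1) * (2 / \<delta> * - (?n x \<bullet> h)) else 0)" for \<delta> x h
  have n1: "norm (?n x) = 1" if "x \<in> \<Omega>" for x
  proof -
    let ?y = "closest_point ?F x"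
    have near: "nearest ?F x ?y" by (rule nearest_closest_point[OF cF])
    then have "?y \<notin> \<Omega>" using op by (auto simp: nearest_def frontier_def interior_open)
    then have "?y - x \<noteq> 0" using that by auto
    then show ?thesis using outward_normal_nearest[OF dom that near] by simp
  qed
  have cd: "continuous_on UNIV ?d" by (intro continuous_intros)
  have cl: "closed {x \<in> closure \<Omega>. \<delta> / 2 \<le> ?d x}" for \<delta>
  proof -
    have "closed (closure \<Omega> \<inter> {x. \<delta> / 2 \<le> ?d x})"
      by (intro closed_Int closed_closure closed_Collect_le continuous_on_const cd)
    then show ?thesis by (simp add: Collect_conj_eq)
  qed
  have zero: "\<theta> \<delta> x = 0" if "0 < \<delta>" "x \<notin> {x \<in> closure \<Omega>. \<delta> / 2 \<le> ?d x}" for \<delta> x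
  proof (cases "x \<in> \<Omega>")
    case True
    then have "?d x < \<delta> / 2" using that closure_subset by force
    then have "2 / \<delta> * ?d x - 1 \<le> 0" using that(1) by (simp add: field_simps)
    then show ?thesis using True H(2) by (simp add: \<theta>_def)
  qed (simp add: \<theta>_def)
  have one: "\<theta> \<delta> x = 1" if "0 < \<delta>" "x \<in> \<Omega>" "\<delta> \<le> ?d x" for \<delta> x
  proof -
    have "2 / \<delta> * ?d x - 1 \<ge> 1" using that by (simp add: field_simps)
    then show ?thesis using that H(3) by (simp add: \<theta>_def)
  qed
  have D: "(\<theta> \<delta> has_derivative \<theta>' \<delta> x) (at x)" if \<delta>: "0 < \<delta>" "\<delta> < \<rho>" for \<delta> x
  proof -
    \<comment> \<open>The band \<open>S0\<close> includes both of its edges, so the two remaining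
      regions are open and the cutoff is locally constant there; on the edges the chain rule still
      applies because \<delta> < \<rho>.\<close>
    consider "x \<notin> {x \<in> closure \<Omega>. \<delta> / 2 \<le> ?d x}" | "x \<in> S0 \<delta>" | "x \<in> \<Omega>" "\<delta> < ?d x"
    proof -
      have "x \<in> \<Omega>" if "x \<in> closure \<Omega>" "\<delta> / 2 \<le> ?d x"
      proof (rule ccontr)
        assume "x \<notin> \<Omega>"
        then have "x \<in> ?F" using that(1) op by (simp add: frontier_def interior_open)
        then show False using that(2) \<delta>(1) by simp
      qed
      then show ?thesis using that unfolding S0_def mem_Collect_eq by (meson not_le)
    qed
    then show ?thesis
    proof cases
      case 1
      have "((\<lambda>_. 0) has_derivative (\<lambda>_. 0)) (at x)" by (rule has_derivative_const)
      then have "(\<theta> \<delta> has_derivative (\<lambda>_. 0)) (at x)"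
        by (rule has_derivative_transform_within_open[where s="- {x \<in> closure \<Omega>. \<delta> / 2 \<le> ?d x}"])
          (use 1 cl zero[OF \<delta>(1)] in \<open>auto simp: open_Compl\<close>)
      moreover have "\<theta>' \<delta> x = (\<lambda>_. 0)"
        using 1 closure_subset unfolding \<theta>'_def S0_def by (auto simp: fun_eq_iff)
      ultimately show ?thesis by simp
    next
      case 2
      then have x: "x \<in> \<Omega>" "?d x < \<rho>" using \<delta> by (auto simp: S0_def)
      have "((\<lambda>y. 2 / \<delta> * ?d y - 1) has_derivative (\<lambda>h. 2 / \<delta> * - (?n x \<bullet> h))) (at x)"
        using has_derivative_diff[OF has_derivative_mult_right[OF \<rho>(2)[OF x], of "2 / \<delta>"] has_derivative_const[of 1]] by simp
      from has_derivative_compose[OF this H(1)[unfolded has_field_derivative_def]]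
      have "((\<lambda>y. H (2 / \<delta> * ?d y - 1)) has_derivative (\<lambda>h. H' (2 / \<delta> * ?d x - 1) * (2 / \<delta> * - (?n x \<bullet> h)))) (at x)" .
      then have "(\<theta> \<delta> has_derivative (\<lambda>h. H' (2 / \<delta> * ?d x - 1) * (2 / \<delta> * - (?n x \<bullet> h)))) (at x)"
        by (rule has_derivative_transform_within_open[OF _ op x(1)]) (simp add: \<theta>_def)
      then show ?thesis by (rule has_derivative_eq_rhs) (use 2 in \<open>simp add: \<theta>'_def fun_eq_iff\<close>)
    next
      case 3
      have o: "open (\<Omega> \<inter> {y. \<delta> < ?d y})" by (intro open_Int op open_Collect_less continuous_on_const cd)
      have "(\<theta> \<delta> has_derivative (\<lambda>_. 0)) (at x)"
        by (rule has_derivative_transform_within_open[OF has_derivative_const[of 1] o])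
          (use 3 one[OF \<delta>(1)] in auto)
      moreover have "\<theta>' \<delta> x = (\<lambda>_. 0)" using 3 unfolding \<theta>'_def S0_def by (auto simp: fun_eq_iff)
      ultimately show ?thesis by simp
    qed
  qed
  have b1: "\<bar>\<theta>' \<delta> x h\<bar> \<le> 2 * C / \<delta> * \<bar>?n x \<bullet> h\<bar>" if "0 < \<delta>" for \<delta> x h
  proof (cases "x \<in> S0 \<delta>")
    case True
    have "\<bar>\<theta>' \<delta> x h\<bar> = H' (2 / \<delta> * ?d x - 1) * (2 / \<delta> * \<bar>?n x \<bullet> h\<bar>)"
      using True that H(6) by (simp add: \<theta>'_def abs_mult)
    also have "\<dots> \<le> C * (2 / \<delta> * \<bar>?n x \<bullet> h\<bar>)" using H(7) that by (intro mult_right_mono) auto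
    finally show ?thesis by (simp add: mult_ac)
  next
    case False
    then show ?thesis using that H(8) by (simp add: \<theta>'_def)
  qed
  show ?thesis
  proof (rule that[of \<rho> "2 * C" \<theta> \<theta>', OF \<rho>(1)])
    show "\<bar>\<theta>' \<delta> x h\<bar> \<le> 2 * C / \<delta> * norm h" if \<delta>: "0 < \<delta>" "\<delta> < \<rho>" for \<delta> x h
    proof (cases "x \<in> S0 \<delta>")
      case True
      then have "norm (?n x) = 1" using n1 by (simp add: S0_def)
      then have "\<bar>?n x \<bullet> h\<bar> \<le> norm h" using Cauchy_Schwarz_ineq2[of "?n x" h] by simp
      then have "2 * C / \<delta> * \<bar>?n x \<bullet> h\<bar> \<le> 2 * C / \<delta> * norm h" using \<delta> H(8) by (intro mult_left_mono) auto
      then show ?thesis using b1[OF \<delta>(1), of x h] by linarith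
    next
      case False
      then show ?thesis using \<delta> H(8) by (simp add: \<theta>'_def)
    qed
    show "\<theta>' \<delta> x h = 0" if "x \<notin> {x \<in> \<Omega>. \<delta> / 2 \<le> ?d x \<and> ?d x \<le> \<delta>}" for \<delta> x h
      using that unfolding S0_def[symmetric] by (simp add: \<theta>'_def)
  qed (use H(4,5,8) zero one D b1 in \<open>auto simp: \<theta>_def\<close>)
qed

section \<open>Passage to the limit\<close>

context euler_data
begin

text \<open>For fixed \<delta> and \<mu> the mollification is removed at the price of an arbitrary
  e. Then \<delta> tends to 0 with \<mu> fixed, which kills the wall-normal integral in spite of its
  factor 2 / \<mu>^6; finally \<mu> tends to 0.\<close>

theorem energy_conserved:
  fixes N :: "real => real => real"
  assumes dom: "bounded_C2_domain \<Omega>" and S: "S = boundary_strip \<Omega> \<epsilon>0" and \<epsilon>0: "0 < \<epsilon>0"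
    and besov: "\<And>a e. 0 < a ==> 0 < e ==> \<exists>r>0. \<forall>z. z \<noteq> 0 --> norm z < r -->
      (\<integral>\<^sup>+\<sigma>. \<integral>\<^sup>+x. ennreal (ind {0<..<T} \<sigma> *
         ind {x \<in> \<Omega>. a < infdist x (frontier \<Omega>) \<and> x + z \<in> \<Omega> \<and> a < infdist (x + z) (frontier \<Omega>)} x *
         norm (uB (\<sigma>, x + z) - uB (\<sigma>, x)) ^ 3) \<partial>lborel \<partial>lborel) \<le> ennreal (e * norm z)"
    and \<delta>0: "0 < \<delta>0" and N0: "\<And>\<delta> \<sigma>. 0 \<le> N \<delta> \<sigma>"
    and Ni: "\<And>\<delta>. 0 < \<delta> ==> \<delta> < \<delta>0 ==> integrable lborel (\<lambda>\<sigma>. ind {0<..<T} \<sigma> * N \<delta> \<sigma> ^ 3)"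
    and Nb: "\<And>\<delta>. 0 < \<delta> ==> \<delta> < \<delta>0 ==> AE \<sigma> in lborel. \<sigma> \<in> {0<..<T} --> (AE x in lborel. x \<in> boundary_strip \<Omega> \<delta> -->
        \<bar>outward_normal \<Omega> (closest_point (frontier \<Omega>) x) \<bullet> uB (\<sigma>, x)\<bar> \<le> N \<delta> \<sigma>)"
    and Nlim: "((\<lambda>\<delta>. LBINT \<sigma>. ind {0<..<T} \<sigma> * N \<delta> \<sigma> ^ 3) \<longlongrightarrow> 0) (at_right 0)"
    and t: "t \<in> {0..<T}"
  shows "(LBINT x. (norm (w t x))^2) = (LBINT x. (norm (w 0 x))^2)"
proof -
  let ?F = "frontier \<Omega>" and ?d = "\<lambda>x. infdist x (frontier \<Omega>)"
  let ?n = "\<lambda>x. outward_normal \<Omega> (closest_point (frontier \<Omega>) x)"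
  note op = Omega(1)
  note cF = frontier_bounded_C2[OF dom]
  have t0: "0 \<in> {0..<T}" using Tpos by simp
  obtain \<theta> :: "real => 'a => real" and \<theta>' :: "real => 'a => 'a => real" and \<rho> c where th: "\<rho> > 0" "c > 0"
    "\<And>\<delta> x. 0 \<le> \<theta> \<delta> x" "\<And>\<delta> x. \<theta> \<delta> x \<le> 1"
    "\<And>\<delta> x. 0 < \<delta> ==> \<delta> < \<rho> ==> x \<notin> {x \<in> closure \<Omega>. \<delta> / 2 \<le> ?d x} ==> \<theta> \<delta> x = 0"
    "\<And>\<delta> x. 0 < \<delta> ==> \<delta> < \<rho> ==> x \<in> \<Omega> ==> \<delta> \<le> ?d x ==> \<theta> \<delta> x = 1"
    "\<And>\<delta> x. 0 < \<delta> ==> \<delta> < \<rho> ==> (\<theta> \<delta> has_derivative \<theta>' \<delta> x) (at x)"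
    "\<And>\<delta> x h. 0 < \<delta> ==> \<delta> < \<rho> ==> \<bar>\<theta>' \<delta> x h\<bar> \<le> c / \<delta> * norm h"
    "\<And>\<delta> x h. 0 < \<delta> ==> \<delta> < \<rho> ==> \<bar>\<theta>' \<delta> x h\<bar> \<le> c / \<delta> * \<bar>?n x \<bullet> h\<bar>"
    "\<And>\<delta> x h. 0 < \<delta> ==> \<delta> < \<rho> ==> x \<notin> {x \<in> \<Omega>. \<delta> / 2 \<le> ?d x \<and> ?d x \<le> \<delta>} ==> \<theta>' \<delta> x h = 0"
    by (rule boundary_cutoff[OF dom]) (rule that; assumption)
  obtain r1 Cm where Cm: "r1 > 0" "Cm > 0" "\<And>\<delta>. 0 < \<delta> ==> \<delta> < r1 ==> measure lborel (boundary_strip \<Omega> \<delta>) \<le> Cm * \<delta>"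
    using boundary_strip_measure[OF dom] by metis
  obtain C where C: "C > 0" "\<And>\<epsilon>. \<epsilon> > 0 ==> \<exists>\<eta>::'a => real. kernel \<epsilon> \<eta> \<and> (\<forall>z. 0 \<le> \<eta> z) \<and> integral\<^sup>L lborel \<eta> = 1 \<and>
      (\<forall>z. \<eta> z \<le> C / measure lborel (cball (0::'a) \<epsilon>)) \<and>
      (\<forall>z v. \<bar>fderiv \<eta> z v\<bar> \<le> C / (\<epsilon> * measure lborel (cball (0::'a) \<epsilon>)) * norm v)"
    using mollifier by metis
  define \<delta>1 where "\<delta>1 = min (min \<rho> (\<delta>0 / 2)) (min (r1 / 2) (\<epsilon>0 / 2))"
  have \<delta>1: "\<delta>1 > 0" "\<delta>1 \<le> \<rho>" "2 * \<delta>1 \<le> \<delta>0" "2 * \<delta>1 \<le> r1" "2 * \<delta>1 \<le> \<epsilon>0"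
    using th(1) \<delta>0 Cm(1) \<epsilon>0 by (auto simp: \<delta>1_def)
  \<comment> \<open>A cutoff gradient of size c / \<delta> integrated over a layer of measure at
    most Cm times 2 \<delta>: the powers of \<delta> cancel.\<close>
  define L1 where "L1 = 2 * c * Cm"
  have L1: "0 \<le> L1" using th(2) Cm(2) by (simp add: L1_def)
  let ?IZ = "LBINT \<sigma>. ind {0<..<T} \<sigma> * Z \<sigma>"
  let ?IN = "\<lambda>\<delta>. LBINT \<sigma>. ind {0<..<T} \<sigma> * N \<delta> \<sigma> ^ 3"
  have IZ0: "0 \<le> ?IZ" using Z_nonneg by (intro Bochner_Integration.integral_nonneg mult_nonneg_nonneg) auto
  let ?E = "\<lambda>\<delta> s. LBINT x. \<theta> \<delta> x * (norm (w s x))^2"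
  have stepA: "\<bar>?E \<delta> t - ?E \<delta> 0\<bar> \<le> 2 * (L1 * (\<mu> ^ 3 * ?IZ + 2 / \<mu> ^ 6 * ?IN (2 * \<delta>)))"
    if \<delta>: "0 < \<delta>" "\<delta> < \<delta>1" and \<mu>: "0 < \<mu>" for \<delta> \<mu>
  proof (rule field_le_epsilon)
    fix e :: real assume e: "e > 0"
    have \<delta>\<rho>: "\<delta> < \<rho>" using \<delta> \<delta>1 by linarith
    define K where "K = {x \<in> closure \<Omega>. \<delta> / 2 \<le> ?d x}"
    define S0 where "S0 = {x \<in> \<Omega>. \<delta> / 2 \<le> ?d x \<and> ?d x \<le> \<delta>}"
    define L where "L = c / \<delta>"
    have L0: "0 \<le> L" using th(2) \<delta> by (simp add: L_def)
    have cd: "continuous_on UNIV ?d" by (intro continuous_intros)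
    have cK: "compact K"
    proof -
      have "closed (closure \<Omega> \<inter> {x. \<delta> / 2 \<le> ?d x})"
        by (intro closed_Int closed_closure closed_Collect_le continuous_on_const cd)
      then have "closed K" by (simp add: K_def Collect_conj_eq)
      moreover have "bounded K" using Omega(2) by (rule bounded_subset[OF bounded_closure]) (auto simp: K_def)
      ultimately show ?thesis by (simp add: compact_eq_bounded_closed)
    qed
    have KO: "x \<in> \<Omega>" "\<delta> / 2 \<le> ?d x" if "x \<in> K" for x
    proof -
      show d: "\<delta> / 2 \<le> ?d x" using that by (simp add: K_def)
      show "x \<in> \<Omega>"
      proof (rule ccontr)
        assume "x \<notin> \<Omega>"
        then have "x \<in> ?F" using that op by (simp add: K_def frontier_def interior_open)
        then show False using d \<delta>(1) by simp
      qed
    qed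
    have S0b: "S0 \<in> sets borel"
    proof -
      have "S0 = \<Omega> \<inter> ({x. \<delta> / 2 \<le> ?d x} \<inter> {x. ?d x \<le> \<delta>})" by (auto simp: S0_def)
      moreover have "{x. \<delta> / 2 \<le> ?d x} \<in> sets borel" "{x. ?d x \<le> \<delta>} \<in> sets borel"
        by (intro borel_closed closed_Collect_le continuous_on_const cd)+
      ultimately show ?thesis using op by auto
    qed
    \<comment> \<open>first \<open>\<kappa>\<close>, then the Besov threshold, then the mollification radius\<close>
    define X where "X = 2 * (3 * L * C * measure lborel K * ?IZ) + 1"
    have X: "X > 0" unfolding X_def using L0 C(1) IZ0 by (intro add_nonneg_pos mult_nonneg_nonneg) auto
    define \<kappa> where "\<kappa> = min 1 (e / (4 * X))"
    have \<kappa>: "0 < \<kappa>" "\<kappa> \<le> 1" "\<kappa> \<le> e / (4 * X)" using e X by (auto simp: \<kappa>_def)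
    have \<kappa>X: "2 * (3 * L * C * \<kappa> ^ 3 * measure lborel K * ?IZ) \<le> e / 4"
    proof -
      have "\<kappa> ^ 3 \<le> \<kappa>" using \<kappa> power_decreasing[of 1 3 \<kappa>] by simp
      then have "\<kappa> ^ 3 \<le> e / (4 * X)" using \<kappa> by linarith
      then have "(X - 1) * \<kappa> ^ 3 \<le> X * (e / (4 * X))" using X L0 C(1) IZ0 \<kappa>(1) by (intro mult_mono) (auto simp: X_def)
      also have "\<dots> = e / 4" using X by simp
      finally show ?thesis by (simp add: X_def mult_ac)
    qed
    define Y where "Y = 2 * (6 * L * C / \<kappa> ^ 6 + 2 * C^2) + 1"
    have Y: "Y > 0" unfolding Y_def using L0 C(1) \<kappa> by (intro add_nonneg_pos mult_nonneg_nonneg add_nonneg_nonneg divide_nonneg_pos) auto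
    \<comment> \<open>Points of K are at distance at least \<delta> / 2 from the boundary, and
      displacements stay below \<delta> / 4, so both ends of an increment lie deeper than \<delta> /
      4.\<close>
    have "0 < \<delta> / 4" "0 < e / (4 * Y)" using \<delta> e Y by auto
    from besov[OF this] obtain r where r: "r > 0" "\<And>z. z \<noteq> 0 ==> norm z < r ==>
      (\<integral>\<^sup>+\<sigma>. \<integral>\<^sup>+x. ennreal (ind {0<..<T} \<sigma> *
         ind {x \<in> \<Omega>. \<delta> / 4 < ?d x \<and> x + z \<in> \<Omega> \<and> \<delta> / 4 < ?d (x + z)} x *
         norm (uB (\<sigma>, x + z) - uB (\<sigma>, x)) ^ 3) \<partial>lborel \<partial>lborel) \<le> ennreal (e / (4 * Y) * norm z)"
      by blast
    have e4: "e / 4 > 0" using e by simp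
    obtain \<epsilon>t where \<epsilon>t: "\<epsilon>t > 0" "\<And>\<epsilon> V \<eta>. \<epsilon> < \<epsilon>t ==> cutoff \<Omega> K S0 S \<epsilon> V L C \<eta> (\<theta> \<delta>) (\<theta>' \<delta>) ==>
      \<bar>(LBINT x. \<theta> \<delta> x * (norm (cutoff.mol \<eta> (w t) x))^2) - (LBINT x. \<theta> \<delta> x * (norm (w t x))^2)\<bar> \<le> e / 4"
      by (rule mol_energy_limit[where K=K and ?S0.0=S0 and S=S and L=L and \<theta>="\<theta> \<delta>" and \<theta>'="\<theta>' \<delta>", OF w[OF t] Omega e4 less_imp_le[OF C(1)]]) (rule that; assumption)
    obtain \<epsilon>z where \<epsilon>z: "\<epsilon>z > 0" "\<And>\<epsilon> V \<eta>. \<epsilon> < \<epsilon>z ==> cutoff \<Omega> K S0 S \<epsilon> V L C \<eta> (\<theta> \<delta>) (\<theta>' \<delta>) ==>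
      \<bar>(LBINT x. \<theta> \<delta> x * (norm (cutoff.mol \<eta> (w 0) x))^2) - (LBINT x. \<theta> \<delta> x * (norm (w 0 x))^2)\<bar> \<le> e / 4"
      by (rule mol_energy_limit[where K=K and ?S0.0=S0 and S=S and L=L and \<theta>="\<theta> \<delta>" and \<theta>'="\<theta>' \<delta>", OF w[OF t0] Omega e4 less_imp_le[OF C(1)]]) (rule that; assumption)
    define \<epsilon> where "\<epsilon> = min (min (r / 2) (\<delta> / 8)) (min (\<epsilon>t / 2) (min (\<epsilon>z / 2) 1))"
    have \<epsilon>: "0 < \<epsilon>" "\<epsilon> < r" "\<epsilon> < \<delta> / 4" "\<epsilon> < \<epsilon>t" "\<epsilon> < \<epsilon>z" "\<epsilon> \<le> 1"
      using r(1) \<delta>(1) \<epsilon>t(1) \<epsilon>z(1) unfolding \<epsilon>_def by (auto simp: min_less_iff_disj)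
    obtain \<eta> :: "'a => real" where \<eta>: "kernel \<epsilon> \<eta>" "\<And>z. 0 \<le> \<eta> z" "integral\<^sup>L lborel \<eta> = 1"
      "\<And>z. \<eta> z \<le> C / measure lborel (cball (0::'a) \<epsilon>)"
      "\<And>z v. \<bar>fderiv \<eta> z v\<bar> \<le> C / (\<epsilon> * measure lborel (cball (0::'a) \<epsilon>)) * norm v"
      using C(2)[OF \<epsilon>(1)] by blast
    have cut: "cutoff \<Omega> K S0 S \<epsilon> (measure lborel (cball (0::'a) \<epsilon>)) L C \<eta> (\<theta> \<delta>) (\<theta>' \<delta>)"
    proof (unfold_locales)
      show "cball x \<epsilon> \<subseteq> \<Omega>" if "x \<in> K" for x
        by (rule cball_subset_domain) (use KO[OF that] \<epsilon> \<delta> in auto)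
      show "\<theta> \<delta> x = 0" if "x \<notin> K" for x using th(5)[OF \<delta>(1) \<delta>\<rho>] that by (simp add: K_def)
      show "(\<theta> \<delta> has_derivative \<theta>' \<delta> x) (at x)" for x by (rule th(7)[OF \<delta>(1) \<delta>\<rho>])
      show "\<bar>\<theta>' \<delta> x h\<bar> \<le> L * norm h" for x h unfolding L_def by (rule th(8)[OF \<delta>(1) \<delta>\<rho>])
      show "\<theta>' \<delta> x h = 0" if "x \<notin> S0" for x h using th(10)[OF \<delta>(1) \<delta>\<rho>] that by (simp add: S0_def)
      show "S0 \<subseteq> K" using closure_subset by (auto simp: S0_def K_def)
      show "cball x \<epsilon> \<subseteq> S" if x: "x \<in> S0" for x
      proof
        fix y assume y: "y \<in> cball x \<epsilon>"
        have xO: "x \<in> \<Omega>" "\<delta> / 2 \<le> ?d x" "?d x \<le> \<delta>" using x by (auto simp: S0_def)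
        have "cball x \<epsilon> \<subseteq> \<Omega>" by (rule cball_subset_domain) (use xO \<epsilon> \<delta> in auto)
        moreover have "?d y < \<epsilon>0"
          using infdist_triangle[of y ?F x] y xO \<epsilon>(3) \<delta> \<delta>1(5) by (auto simp: dist_commute)
        ultimately show "y \<in> S" using y by (auto simp: S boundary_strip_def)
      qed
    qed (use \<epsilon>(1) C(1) L0 \<eta> cK th(3,4) in auto)
    interpret ec: euler_cutoff \<Omega> S K S0 T w uB qB M P \<epsilon> "measure lborel (cball (0::'a) \<epsilon>)" L C \<eta> "\<theta> \<delta>" "\<theta>' \<delta>"
      by (intro euler_cutoff.intro euler_cutoff_axioms.intro cut S0b) (rule euler_data_axioms)
    have \<omega>0: "0 \<le> e / (4 * Y) * \<epsilon>" using e Y \<epsilon>(1) by simp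
    have inc: "(\<integral>\<^sup>+\<sigma>. \<integral>\<^sup>+x. ennreal (ind {0<..<T} \<sigma> * ind K x * norm (uB (\<sigma>, x + z) - uB (\<sigma>, x)) ^ 3) \<partial>lborel \<partial>lborel)
        \<le> ennreal (e / (4 * Y) * \<epsilon>)" if z: "z \<noteq> 0" "norm z \<le> \<epsilon>" for z
    proof -
      have "(\<integral>\<^sup>+\<sigma>. \<integral>\<^sup>+x. ennreal (ind {0<..<T} \<sigma> * ind K x * norm (uB (\<sigma>, x + z) - uB (\<sigma>, x)) ^ 3) \<partial>lborel \<partial>lborel)
        \<le> (\<integral>\<^sup>+\<sigma>. \<integral>\<^sup>+x. ennreal (ind {0<..<T} \<sigma> *
         ind {x \<in> \<Omega>. \<delta> / 4 < ?d x \<and> x + z \<in> \<Omega> \<and> \<delta> / 4 < ?d (x + z)} x *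
         norm (uB (\<sigma>, x + z) - uB (\<sigma>, x)) ^ 3) \<partial>lborel \<partial>lborel)"
      proof (intro nn_integral_mono ennreal_leI mult_right_mono mult_left_mono)
        fix x
        show "ind K x \<le> (ind {x \<in> \<Omega>. \<delta> / 4 < ?d x \<and> x + z \<in> \<Omega> \<and> \<delta> / 4 < ?d (x + z)} x :: real)"
        proof (cases "x \<in> K")
          case True
          have "x + z \<in> cball x \<epsilon>" using z(2) by (simp add: dist_norm)
          moreover have "cball x \<epsilon> \<subseteq> \<Omega>"
            by (rule cball_subset_domain) (use KO[OF True] \<epsilon> \<delta> in auto)
          moreover have "\<delta> / 4 < ?d (x + z)"
            using infdist_triangle[of x ?F "x + z"] KO(2)[OF True] z(2) \<epsilon>(3) by (simp add: dist_norm)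
          ultimately show ?thesis using KO[OF True] \<delta>(1) by (auto simp: indicator_def)
        qed simp
      qed auto
      also have "\<dots> \<le> ennreal (e / (4 * Y) * norm z)" by (rule r(2)) (use z \<epsilon> in auto)
      also have "\<dots> \<le> ennreal (e / (4 * Y) * \<epsilon>)" using z(2) e Y by (intro ennreal_leI mult_left_mono) auto
      finally show ?thesis .
    qed
    note D = ec.increments_time_average[OF \<omega>0 inc]
    let ?ID = "LBINT \<sigma>. ind {0<..<T} \<sigma> * (LBINT x. ind K x * ec.avg 3 (\<lambda>x. uB (\<sigma>, x)) x)"
    \<comment> \<open>The strip is defined by a strict inequality while the support of the cutoff
      gradient includes distance \<delta>; width 2 \<delta> covers it with room.\<close>
    have d2: "0 < 2 * \<delta>" "2 * \<delta> < \<delta>0" "2 * \<delta> < r1" using \<delta> \<delta>1 by auto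
    have Nae: "AE \<sigma> in lborel. \<sigma> \<in> {0<..<T} --> (LBINT x. \<bar>\<theta>' \<delta> x (uB (\<sigma>, x))\<bar>) \<le> L1 * N (2 * \<delta>) \<sigma>"
      using Nb[OF d2(1,2)]
    proof eventually_elim
      case (elim \<sigma>)
      show ?case
      proof
        assume "\<sigma> \<in> {0<..<T}"
        then have ae: "AE x in lborel. x \<in> boundary_strip \<Omega> (2 * \<delta>) --> \<bar>?n x \<bullet> uB (\<sigma>, x)\<bar> \<le> N (2 * \<delta>) \<sigma>" using elim by blast
        let ?B = "boundary_strip \<Omega> (2 * \<delta>)"
        have Bb: "bounded ?B" using Omega(2) by (rule bounded_subset) (auto simp: boundary_strip_def)
        have Bi: "integrable lborel (ind ?B :: 'a => real)"
          by (rule bounded_integrable_indicator[OF boundary_strip_open[OF op] Bb])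
        have "norm (LBINT x. \<bar>\<theta>' \<delta> x (uB (\<sigma>, x))\<bar>) \<le> (LBINT x. c / \<delta> * N (2 * \<delta>) \<sigma> * ind ?B x)"
        proof (rule norm_integral_AE_le)
          show "integrable lborel (\<lambda>x. c / \<delta> * N (2 * \<delta>) \<sigma> * ind ?B x)" using Bi by simp
          show "AE x in lborel. norm \<bar>\<theta>' \<delta> x (uB (\<sigma>, x))\<bar> \<le> c / \<delta> * N (2 * \<delta>) \<sigma> * ind ?B x"
            using ae
          proof eventually_elim
            case (elim x)
            show ?case
            proof (cases "x \<in> S0")
              case True
              then have xB: "x \<in> ?B" using \<delta>(1) by (auto simp: S0_def boundary_strip_def)
              have "\<bar>\<theta>' \<delta> x (uB (\<sigma>, x))\<bar> \<le> c / \<delta> * \<bar>?n x \<bullet> uB (\<sigma>, x)\<bar>" by (rule th(9)[OF \<delta>(1) \<delta>\<rho>])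
              also have "\<dots> \<le> c / \<delta> * N (2 * \<delta>) \<sigma>" using elim xB th(2) \<delta>(1) by (intro mult_left_mono) auto
              finally show ?thesis using xB by simp
            next
              case False
              then have "\<theta>' \<delta> x (uB (\<sigma>, x)) = 0" using th(10)[OF \<delta>(1) \<delta>\<rho>] by (simp add: S0_def)
              then show ?thesis using th(2) \<delta>(1) N0 by simp
            qed
          qed
        qed
        also have "\<dots> = c / \<delta> * N (2 * \<delta>) \<sigma> * measure lborel ?B" by simp
        also have "\<dots> \<le> c / \<delta> * N (2 * \<delta>) \<sigma> * (Cm * (2 * \<delta>))"
          using Cm(3)[OF d2(1,3)] th(2) \<delta>(1) N0 by (intro mult_left_mono) auto
        also have "\<dots> = L1 * N (2 * \<delta>) \<sigma>" using \<delta>(1) by (simp add: L1_def)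
        finally show "(LBINT x. \<bar>\<theta>' \<delta> x (uB (\<sigma>, x))\<bar>) \<le> L1 * N (2 * \<delta>) \<sigma>" by simp
      qed
    qed
    have main: "\<bar>(LBINT x. \<theta> \<delta> x * (norm (ec.mol (w t) x))^2) - (LBINT x. \<theta> \<delta> x * (norm (ec.mol (w 0) x))^2)\<bar> \<le>
      2 * (L1 * (\<mu> ^ 3 * ?IZ + 2 / \<mu> ^ 6 * ?IN (2 * \<delta>)) + 3 * L * C * \<kappa> ^ 3 * measure lborel K * ?IZ
        + (6 * L * C / \<kappa> ^ 6 + 2 * C^2 / \<epsilon>) * ?ID)"
      by (rule ec.energy_cutoff[OF t \<kappa>(1) \<mu> N0 Ni[OF d2(1,2)] Nae L1 D(1)])
    \<comment> \<open>The cubic increments carry a factor \<epsilon>, the gain of regularity 1/3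
      raised to the third power, which cancels the 1/\<epsilon> of the commutator. Y was chosen to
      dominate what is left, using \<epsilon> \<le> 1.\<close>
    have last: "2 * ((6 * L * C / \<kappa> ^ 6 + 2 * C^2 / \<epsilon>) * ?ID) \<le> e / 4"
    proof -
      have alg: "(A + B / \<epsilon>) * (q * \<epsilon>) = (A * \<epsilon> + B) * q" for A B q :: real
        using \<epsilon>(1) by (simp add: field_simps)
      have "0 \<le> 6 * L * C / \<kappa> ^ 6" using L0 C(1) \<kappa>(1) by simp
      then have "(6 * L * C / \<kappa> ^ 6 + 2 * C^2 / \<epsilon>) * ?ID \<le> (6 * L * C / \<kappa> ^ 6 + 2 * C^2 / \<epsilon>) * (e / (4 * Y) * \<epsilon>)"
        using \<epsilon>(1) by (intro mult_left_mono D(2)) auto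
      also have "\<dots> = (6 * L * C / \<kappa> ^ 6 * \<epsilon> + 2 * C^2) * (e / (4 * Y))" by (rule alg)
      also have "\<dots> \<le> (6 * L * C / \<kappa> ^ 6 * 1 + 2 * C^2) * (e / (4 * Y))"
        using \<epsilon>(6) L0 C(1) \<kappa>(1) e Y by (intro mult_right_mono add_right_mono mult_left_mono) auto
      also have "6 * L * C / \<kappa> ^ 6 * 1 + 2 * C^2 = (Y - 1) / 2" by (simp add: Y_def)
      finally have fin: "(6 * L * C / \<kappa> ^ 6 + 2 * C^2 / \<epsilon>) * ?ID \<le> (Y - 1) / 2 * (e / (4 * Y))" .
      have "2 * a \<le> y * q" if "a \<le> y / 2 * q" for a y q :: real using that by simp
      from this[OF fin] have "2 * ((6 * L * C / \<kappa> ^ 6 + 2 * C^2 / \<epsilon>) * ?ID) \<le> (Y - 1) * (e / (4 * Y))" .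
      also have "\<dots> \<le> Y * (e / (4 * Y))" using e Y by (intro mult_right_mono) auto
      also have "\<dots> = e / 4" using Y by simp
      finally show ?thesis .
    qed
    \<comment> \<open>Four errors of e / 4: the \<kappa> term, the increments, and the mollification
      of the energy at time t and at time 0.\<close>
    show "\<bar>?E \<delta> t - ?E \<delta> 0\<bar> \<le> 2 * (L1 * (\<mu> ^ 3 * ?IZ + 2 / \<mu> ^ 6 * ?IN (2 * \<delta>))) + e"
      using main last \<kappa>X \<epsilon>t(2)[OF \<epsilon>(4) cut] \<epsilon>z(2)[OF \<epsilon>(5) cut] unfolding distrib_left by linarith
  qed
  define \<delta> where "\<delta> n = \<delta>1 / (2 * real (Suc n))" for n
  have \<delta>: "0 < \<delta> n" "\<delta> n < \<delta>1" for n
    using \<delta>1(1) by (auto simp: \<delta>_def divide_less_eq)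
  have \<delta>lim: "\<delta> \<longlonglongrightarrow> 0"
    unfolding \<delta>_def using tendsto_mult_right_zero[OF LIMSEQ_inverse_real_of_nat, of "\<delta>1 / 2"]
    by (simp only: divide_inverse inverse_mult_distrib mult.assoc)
  have \<delta>\<rho>: "\<delta> n < \<rho>" for n using \<delta>(2)[of n] \<delta>1(2) by linarith
  have Elim: "(\<lambda>n. ?E (\<delta> n) s) \<longlonglongrightarrow> (LBINT x. (norm (w s x))^2)" if s: "s \<in> {0..<T}" for s
  proof (rule integral_dominated_convergence[where w="\<lambda>x. (norm (w s x))^2"])
    have wm [measurable]: "w s \<in> borel_measurable borel" by (rule w_props(1)[OF s])
    show "(\<lambda>x. (norm (w s x))^2) \<in> borel_measurable lborel" by measurable
    show "(\<lambda>x. \<theta> (\<delta> n) x * (norm (w s x))^2) \<in> borel_measurable lborel" for n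
    proof -
      have "continuous_on UNIV (\<theta> (\<delta> n))"
        using has_derivative_continuous[OF th(7)[OF \<delta>(1) \<delta>\<rho>]] by (simp add: continuous_on_eq_continuous_at)
      then have [measurable]: "\<theta> (\<delta> n) \<in> borel_measurable borel" by (rule borel_measurable_continuous_onI)
      show ?thesis by measurable
    qed
    show "integrable lborel (\<lambda>x. (norm (w s x))^2)" by (rule w_props(2)[OF s])
    show "AE x in lborel. norm (\<theta> (\<delta> n) x * (norm (w s x))^2) \<le> (norm (w s x))^2" for n
      using th(3,4) by (intro AE_I2) (simp add: abs_mult mult_left_le_one_le)
    show "AE x in lborel. (\<lambda>n. \<theta> (\<delta> n) x * (norm (w s x))^2) \<longlonglongrightarrow> (norm (w s x))^2"
    proof (rule AE_I2)
      fix x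
      show "(\<lambda>n. \<theta> (\<delta> n) x * (norm (w s x))^2) \<longlonglongrightarrow> (norm (w s x))^2"
      proof (cases "x \<in> \<Omega>")
        case True
        then have "x \<notin> ?F" using op by (simp add: frontier_def interior_open)
        then have "?d x > 0" using cF in_closed_iff_infdist_zero[of ?F x] infdist_nonneg[of x ?F] by (auto simp: compact_imp_closed less_le)
        then have "\<forall>\<^sub>F n in sequentially. \<delta> n < ?d x" using order_tendstoD(2)[OF \<delta>lim] by blast
        then have "\<forall>\<^sub>F n in sequentially. \<theta> (\<delta> n) x * (norm (w s x))^2 = (norm (w s x))^2"
        proof eventually_elim
          case (elim n)
          then have "\<theta> (\<delta> n) x = 1" using th(6)[OF \<delta>(1) \<delta>\<rho> True] by simp
          then show ?case by simp
        qed
        then show ?thesis by (rule tendsto_eventually)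
      qed (use w_props(3)[OF s] in simp)
    qed
  qed
  have Nl: "(\<lambda>n. ?IN (2 * \<delta> n)) \<longlonglongrightarrow> 0"
  proof (rule filterlim_compose[OF Nlim])
    show "filterlim (\<lambda>n. 2 * \<delta> n) (at_right 0) sequentially"
      unfolding filterlim_at
    proof
      have "2 * \<delta> n \<in> {0<..} \<and> 2 * \<delta> n \<noteq> 0" for n using \<delta>(1)[of n] by simp
      then show "\<forall>\<^sub>F n in sequentially. 2 * \<delta> n \<in> {0<..} \<and> 2 * \<delta> n \<noteq> 0" by (intro always_eventually allI)
    qed (rule tendsto_mult_right_zero[OF \<delta>lim])
  qed
  \<comment> \<open>The sequence \<delta> n removes both the cutoff and the integral of the
    wall-normal majorant; only the term with \<mu>^3 survives.\<close>
  have fin: "\<bar>(LBINT x. (norm (w t x))^2) - (LBINT x. (norm (w 0 x))^2)\<bar> \<le> 2 * (L1 * (\<mu> ^ 3 * ?IZ))" if \<mu>: "0 < \<mu>" for \<mu>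
  proof (rule LIMSEQ_le)
    show "(\<lambda>n. \<bar>?E (\<delta> n) t - ?E (\<delta> n) 0\<bar>) \<longlonglongrightarrow> \<bar>(LBINT x. (norm (w t x))^2) - (LBINT x. (norm (w 0 x))^2)\<bar>"
      by (intro tendsto_intros Elim t t0)
    have "(\<lambda>n. 2 * (L1 * (\<mu> ^ 3 * ?IZ + 2 / \<mu> ^ 6 * ?IN (2 * \<delta> n)))) \<longlonglongrightarrow> 2 * (L1 * (\<mu> ^ 3 * ?IZ + 2 / \<mu> ^ 6 * 0))"
      by (intro tendsto_mult tendsto_add tendsto_const Nl)
    then show "(\<lambda>n. 2 * (L1 * (\<mu> ^ 3 * ?IZ + 2 / \<mu> ^ 6 * ?IN (2 * \<delta> n)))) \<longlonglongrightarrow> 2 * (L1 * (\<mu> ^ 3 * ?IZ))" by simp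
    show "\<exists>n0. \<forall>n\<ge>n0. \<bar>?E (\<delta> n) t - ?E (\<delta> n) 0\<bar> \<le> 2 * (L1 * (\<mu> ^ 3 * ?IZ + 2 / \<mu> ^ 6 * ?IN (2 * \<delta> n)))"
      using stepA[OF \<delta> \<mu>] by blast
  qed
  have "\<bar>(LBINT x. (norm (w t x))^2) - (LBINT x. (norm (w 0 x))^2)\<bar> \<le> 0"
  proof (rule field_le_epsilon)
    fix e :: real assume e: "e > 0"
    define X where "X = 2 * (L1 * ?IZ) + 1"
    have X: "X > 0" unfolding X_def using L1 IZ0 by (intro add_nonneg_pos mult_nonneg_nonneg) auto
    define \<mu> where "\<mu> = min 1 (e / X)"
    have \<mu>: "0 < \<mu>" "\<mu> \<le> 1" "\<mu> \<le> e / X" using e X by (auto simp: \<mu>_def)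
    have "\<mu> ^ 3 \<le> \<mu>" using \<mu> power_decreasing[of 1 3 \<mu>] by simp
    then have "(X - 1) * \<mu> ^ 3 \<le> X * (e / X)" using X L1 IZ0 \<mu> by (intro mult_mono) (auto simp: X_def)
    then have "2 * (L1 * (\<mu> ^ 3 * ?IZ)) \<le> e" using X by (simp add: X_def mult_ac)
    then show "\<bar>(LBINT x. (norm (w t x))^2) - (LBINT x. (norm (w 0 x))^2)\<bar> \<le> 0 + e"
      using fin[OF \<mu>(1)] by simp
  qed
  then show ?thesis by simp
qed

end

section \<open>Borel representatives of Lebesgue-measurable data\<close>

lemma AE_lebesgue_on:
  fixes S :: "'a::euclidean_space set"
  assumes "S \<in> sets borel" shows "(AE x in lebesgue_on S. P x) \<longleftrightarrow> (AE x in lborel. x \<in> S --> P x)"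
proof -
  have "S \<in> sets lebesgue" by (rule sets_completionI_sets) (use assms in simp)
  then show ?thesis by (simp add: AE_restrict_space_iff AE_completion_iff)
qed

lemma borel_measurable_lebesgue_AE:
  fixes f g :: "'a::euclidean_space => 'b::topological_space"
  assumes f: "f \<in> borel_measurable borel" and ae: "AE x in lborel. f x = g x"
  shows "g \<in> borel_measurable lebesgue"
proof (rule measurableI)
  fix A :: "'b set" assume A: "A \<in> sets borel"
  have fl: "f \<in> borel_measurable lebesgue" by (rule measurable_completion) (use f in simp)
  show "g -` A \<inter> space lebesgue \<in> sets lebesgue"
  proof (rule completion.in_sets_AE)
    show "f -` A \<inter> space lebesgue \<in> sets lebesgue" by (rule measurable_sets[OF fl A])
    show "AE x in lebesgue. x \<in> f -` A \<inter> space lebesgue \<longleftrightarrow> x \<in> g -` A \<inter> space lebesgue"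
      using AE_completion[OF ae] by eventually_elim simp
  qed simp
qed simp

text \<open>Measurability of g is a consequence here: Lebesgue measure is complete, and g agrees
  almost everywhere on S with a Borel function. This lets integrals of the given data be computed
  with Borel representatives.\<close>

lemma integral_lebesgue_on_eq:
  fixes f g :: "'a::euclidean_space => real"
  assumes S: "S \<in> sets borel" and f: "f \<in> borel_measurable borel" and ae: "AE x in lborel. x \<in> S --> g x = f x"
  shows "(LINT x|lebesgue_on S. g x) = (LBINT x. ind S x * f x)"
    and "integrable (lebesgue_on S) g \<longleftrightarrow> integrable lborel (\<lambda>x. ind S x * f x)"
proof -
  have Sl: "S \<in> sets lebesgue" by (rule sets_completionI_sets) (use S in simp)
  let ?f = "\<lambda>x. ind S x * f x" and ?g = "\<lambda>x. ind S x * g x"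
  have fm: "?f \<in> borel_measurable borel" using S f by measurable
  have ae': "AE x in lborel. ?f x = ?g x" using ae
  proof eventually_elim
    case (elim x)
    then show ?case by (cases "x \<in> S") simp_all
  qed
  have gm: "?g \<in> borel_measurable lebesgue" by (rule borel_measurable_lebesgue_AE[OF fm ae'])
  have fl: "?f \<in> borel_measurable lebesgue" by (rule measurable_completion) (use fm in simp)
  have ael: "AE x in lebesgue. ?g x = ?f x" using AE_completion[OF ae'] by eventually_elim (rule sym)
  have fm': "?f \<in> borel_measurable lborel" using fm by simp
  have "(LINT x|lebesgue_on S. g x) = (LINT x|lebesgue. ?g x)"
    using integral_restrict_space[of S lebesgue g] Sl by simp
  also have "\<dots> = (LINT x|lebesgue. ?f x)" by (rule integral_cong_AE[OF gm fl ael])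
  also have "\<dots> = (LBINT x. ?f x)" by (rule integral_completion[OF fm'])
  finally show "(LINT x|lebesgue_on S. g x) = (LBINT x. ?f x)" .
  have "integrable (lebesgue_on S) g \<longleftrightarrow> integrable lebesgue ?g"
    using integrable_restrict_space[of S lebesgue g] Sl by simp
  also have "\<dots> \<longleftrightarrow> integrable lebesgue ?f" by (rule integrable_cong_AE[OF gm fl ael])
  also have "\<dots> \<longleftrightarrow> integrable lborel ?f" by (rule integrable_completion[OF fm'])
  finally show "integrable (lebesgue_on S) g \<longleftrightarrow> integrable lborel ?f" .
qed

lemma borel_representative:
  fixes f :: "'a::euclidean_space => 'b::euclidean_space"
  assumes X: "X \<in> sets borel" and f: "f \<in> borel_measurable (lebesgue_on X)"
  obtains g where "g \<in> borel_measurable borel" "\<And>z. z \<notin> X ==> g z = 0" "AE z in lborel. z \<in> X --> g z = f z"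
proof -
  have Xl: "X \<in> sets lebesgue" by (rule sets_completionI_sets) (use X in simp)
  define F where "F z = (if z \<in> X then f z else 0)" for z
  have Fm: "F \<in> borel_measurable lebesgue" unfolding F_def by (rule borel_measurable_if_I[OF f Xl])
  have "\<forall>i. \<exists>g. g \<in> borel_measurable lborel \<and> (AE z in lborel. F z \<bullet> i = g z)"
  proof
    fix i :: 'b
    have "(\<lambda>z. F z \<bullet> i) \<in> borel_measurable lebesgue" using Fm by measurable
    from completion_ex_borel_measurable_real[OF this] show "\<exists>g. g \<in> borel_measurable lborel \<and> (AE z in lborel. F z \<bullet> i = g z)" by blast
  qed
  then obtain g where g: "\<And>i. g i \<in> borel_measurable lborel" "\<And>i. AE z in lborel. F z \<bullet> i = g i z" by metis
  define h where "h z = ind X z *\<^sub>R (\<Sum>i\<in>Basis. g i z *\<^sub>R i)" for z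
  show ?thesis
  proof (rule that[of h])
    have [measurable]: "g i \<in> borel_measurable borel" for i using g(1)[of i] by simp
    show "h \<in> borel_measurable borel" unfolding h_def using X by measurable
    show "h z = 0" if "z \<notin> X" for z using that by (simp add: h_def)
    have "AE z in lborel. \<forall>i\<in>Basis. F z \<bullet> i = g i z" by (rule AE_finite_allI[OF finite_Basis g(2)])
    then show "AE z in lborel. z \<in> X --> h z = f z"
    proof eventually_elim
      case (elim z)
      then have "(\<Sum>i\<in>Basis. g i z *\<^sub>R i) = (\<Sum>i\<in>Basis. (F z \<bullet> i) *\<^sub>R i)" by (intro sum.cong) auto
      then show ?case by (simp add: h_def F_def euclidean_representation)
    qed
  qed
qed

lemma Lp_norm_powr: "q > 0 ==> Lp_norm q M f powr q = (LINT x|M. norm (f x) powr q)"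
  by (simp add: Lp_norm_def powr_powr)

text \<open>The absolute value of a Borel representative is non-negative at every time, not just
  almost every one; the later conversions between \<open>powr\<close> and natural powers rely on
  this.\<close>

lemma time_representative:
  fixes h :: "real => real"
  assumes h: "h \<in> Lp_space q (lebesgue_on {0<..<T})" and q: "q > 0"
  obtains H where "H \<in> borel_measurable borel" "\<And>t. 0 \<le> H t" "AE t in lborel. t \<in> {0<..<T} --> H t = \<bar>h t\<bar>"
    "integrable lborel (\<lambda>t. ind {0<..<T} t * H t powr q)"
    "(LBINT t. ind {0<..<T} t * H t powr q) = Lp_norm q (lebesgue_on {0<..<T}) h powr q"
proof -
  have X: "{0<..<T} \<in> sets borel" by simp
  have hm: "h \<in> borel_measurable (lebesgue_on {0<..<T})" and hi: "integrable (lebesgue_on {0<..<T}) (\<lambda>t. norm (h t) powr q)"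
    using h by (auto simp: Lp_space_def)
  obtain g where g: "g \<in> borel_measurable borel" "AE t in lborel. t \<in> {0<..<T} --> g t = h t"
    using borel_representative[OF X hm] by metis
  note [measurable] = g(1)
  have Hm: "(\<lambda>t. \<bar>g t\<bar> powr q) \<in> borel_measurable borel" by measurable
  have ae: "AE t in lborel. t \<in> {0<..<T} --> norm (h t) powr q = \<bar>g t\<bar> powr q"
    using g(2) by eventually_elim auto
  note eq = integral_lebesgue_on_eq[OF X Hm ae]
  show ?thesis
  proof (rule that[of "\<lambda>t. \<bar>g t\<bar>"])
    show "(\<lambda>t. \<bar>g t\<bar>) \<in> borel_measurable borel" by measurable
    show "AE t in lborel. t \<in> {0<..<T} --> \<bar>g t\<bar> = \<bar>h t\<bar>" using g(2) by eventually_elim auto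
    show "integrable lborel (\<lambda>t. ind {0<..<T} t * \<bar>g t\<bar> powr q)" using eq(2) hi by simp
    show "(LBINT t. ind {0<..<T} t * \<bar>g t\<bar> powr q) = Lp_norm q (lebesgue_on {0<..<T}) h powr q"
      using eq(1) by (simp add: Lp_norm_powr[OF q])
  qed simp
qed

text \<open>Membership excludes the value infinity, where \<open>real_of_ereal\<close> would give 0,
  and the absolute value spares a proof that the essential supremum is non-negative.\<close>

lemma Linf_norm_AE:
  assumes "f \<in> Linf_space M" shows "AE x in M. norm (f x) \<le> \<bar>Linf_norm M f\<bar>"
proof -
  let ?e = "esssup M (\<lambda>x. ereal (norm (f x)))"
  have fin: "?e < \<infinity>" using assms by (simp add: Linf_space_def)
  have "AE x in M. ereal (norm (f x)) \<le> ?e" by (rule esssup_AE)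
  then show ?thesis
  proof eventually_elim
    case (elim x)
    then show ?case using fin unfolding Linf_norm_def by (cases ?e) auto
  qed
qed

text \<open>Turns the spatial essential supremum into a Borel majorant in time with the same norm,
  after which only pointwise bounds at almost every time are used.\<close>

lemma LqLinf_majorant:
  fixes f :: "real => 'a::euclidean_space => 'b::euclidean_space"
  assumes f: "f \<in> LqLinf_space q T S" and S: "S \<in> sets borel" and q: "q > 0"
  obtains H where "H \<in> borel_measurable borel" "\<And>t. 0 \<le> H t"
    "integrable lborel (\<lambda>t. ind {0<..<T} t * H t powr q)"
    "(LBINT t. ind {0<..<T} t * H t powr q) = LqLinf_norm q T S f powr q"
    "AE t in lborel. t \<in> {0<..<T} --> (AE x in lborel. x \<in> S --> norm (f t x) \<le> H t)"
proof -
  have X: "{0<..<T} \<in> sets borel" by simp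
  have L: "(\<lambda>t. Linf_norm (lebesgue_on S) (f t)) \<in> Lp_space q (lebesgue_on {0<..<T})"
    and ae: "AE t in lborel. t \<in> {0<..<T} --> f t \<in> Linf_space (lebesgue_on S)"
    using f by (auto simp: LqLinf_space_def AE_lebesgue_on[OF X])
  obtain H where H: "H \<in> borel_measurable borel" "\<And>t. 0 \<le> H t"
    "AE t in lborel. t \<in> {0<..<T} --> H t = \<bar>Linf_norm (lebesgue_on S) (f t)\<bar>"
    "integrable lborel (\<lambda>t. ind {0<..<T} t * H t powr q)"
    "(LBINT t. ind {0<..<T} t * H t powr q) = Lp_norm q (lebesgue_on {0<..<T}) (\<lambda>t. Linf_norm (lebesgue_on S) (f t)) powr q"
    by (rule time_representative[OF L q]) (rule that; assumption)
  show ?thesis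
  proof (rule that[OF H(1,2,4)])
    show "(LBINT t. ind {0<..<T} t * H t powr q) = LqLinf_norm q T S f powr q"
      using H(5) by (simp add: LqLinf_norm_def)
    show "AE t in lborel. t \<in> {0<..<T} --> (AE x in lborel. x \<in> S --> norm (f t x) \<le> H t)"
      using ae H(3)
    proof eventually_elim
      case (elim t)
      show ?case
      proof
        assume t: "t \<in> {0<..<T}"
        then have "AE x in lebesgue_on S. norm (f t x) \<le> \<bar>Linf_norm (lebesgue_on S) (f t)\<bar>"
          using elim by (intro Linf_norm_AE) blast
        then show "AE x in lborel. x \<in> S --> norm (f t x) \<le> H t" using elim t by (simp add: AE_lebesgue_on[OF S])
      qed
    qed
  qed
qed

lemma integral_Cauchy_Schwarz:
  fixes f g :: "'b => 'c::euclidean_space"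
  assumes [measurable]: "f \<in> borel_measurable M" "g \<in> borel_measurable M"
    and f2: "integrable M (\<lambda>x. (norm (f x))^2)" and g2: "integrable M (\<lambda>x. (norm (g x))^2)"
  shows "integrable M (\<lambda>x. f x \<bullet> g x)"
    "\<bar>LINT x|M. f x \<bullet> g x\<bar> \<le> sqrt (LINT x|M. (norm (f x))^2) * sqrt (LINT x|M. (norm (g x))^2)"
proof -
  let ?F = "LINT x|M. (norm (f x))^2" and ?G = "LINT x|M. (norm (g x))^2" and ?I = "LINT x|M. \<bar>f x \<bullet> g x\<bar>"
  have b: "\<bar>f x \<bullet> g x\<bar> \<le> (norm (f x))^2 + (norm (g x))^2" for x
  proof -
    have "\<bar>f x \<bullet> g x\<bar> \<le> norm (f x) * norm (g x)" by (rule Cauchy_Schwarz_ineq2)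
    also have "\<dots> \<le> (norm (f x))^2 + (norm (g x))^2"
      using sum_squares_bound[of "norm (f x)" "norm (g x)"] mult_nonneg_nonneg[OF norm_ge_zero[of "f x"] norm_ge_zero[of "g x"]] by linarith
    finally show ?thesis .
  qed
  show i: "integrable M (\<lambda>x. f x \<bullet> g x)"
    by (rule bochner_bound[OF bochner_add[OF f2 g2]])
      (measurable, use b in \<open>auto intro!: AE_I2 intro: order_trans[OF _ abs_ge_self]\<close>)
  have I0: "0 \<le> ?I" by simp
  have "ennreal (?I^2) = (\<integral>\<^sup>+x. ennreal \<bar>f x \<bullet> g x\<bar> \<partial>M)^2"
    using nn_integral_eq_integral[OF integrable_abs[OF i]] I0 by (simp add: ennreal_power)
  also have "\<dots> \<le> (\<integral>\<^sup>+x. ennreal (norm (f x)) * ennreal (norm (g x)) \<partial>M)^2"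
    by (intro power_mono nn_integral_mono) (simp_all add: ennreal_mult[symmetric] Cauchy_Schwarz_ineq2 ennreal_leI)
  also have "\<dots> \<le> (\<integral>\<^sup>+x. ennreal (norm (f x)) ^ 2 \<partial>M) * (\<integral>\<^sup>+x. ennreal (norm (g x)) ^ 2 \<partial>M)"
    by (rule Cauchy_Schwarz_nn_integral) measurable
  also have "\<dots> = ennreal (?F * ?G)"
    using nn_integral_eq_integral[OF f2] nn_integral_eq_integral[OF g2] by (simp add: ennreal_power ennreal_mult)
  finally have "?I^2 \<le> ?F * ?G" by (subst (asm) ennreal_le_iff) simp_all
  then have "?I \<le> sqrt ?F * sqrt ?G" unfolding real_sqrt_mult[symmetric] by (rule real_le_rsqrt)
  then show "\<bar>LINT x|M. f x \<bullet> g x\<bar> \<le> sqrt ?F * sqrt ?G" by (rule order_trans[OF integral_abs_bound])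
qed

lemma Lp_norm_2: "Lp_norm 2 M f = sqrt (LINT x|M. (norm (f x))^2)"
  by (simp add: Lp_norm_def powr_half_sqrt)

lemma Lp_space_2: "f \<in> Lp_space 2 M \<longleftrightarrow> f \<in> borel_measurable M \<and> integrable M (\<lambda>x. (norm (f x))^2)"
  by (simp add: Lp_space_def)


section \<open>Uniform boundedness of weakly continuous functions\<close>

text \<open>The sign of the n-th coefficient is chosen so that the n-th term does not cancel the earlier
  ones at \<open>x n\<close>; the later terms contribute at most half of it.\<close>

lemma gliding_hump:
  fixes e :: "nat => 'v => real" and N :: "'v => real"
  assumes bd: "\<And>n f. f \<in> X ==> \<bar>e n f\<bar> \<le> N f" and x: "\<And>n. x n \<in> X" "\<And>n. e n (x n) = N (x n)"
  obtains c where "\<And>f. f \<in> X ==> summable (\<lambda>k. c k * e k f)" "\<And>f. f \<in> X ==> \<bar>\<Sum>k. c k * e k f\<bar> \<le> 3 / 2 * N f"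
    "\<And>n. N (x n) / (2 * 3 ^ n) \<le> \<bar>\<Sum>k. c k * e k (x n)\<bar>"
proof -
  \<comment> \<open>The partial sums are built as functions of f, so that the sign at stage n can
    consult the partial sum at x n before the coefficient is fixed.\<close>
  define s where "s = rec_nat (\<lambda>f::'v. 0::real) (\<lambda>n S f. S f + (if 0 \<le> S (x n) then 1 else -1) / 3 ^ n * e n f)"
  define c :: "nat => real" where "c n = (if 0 \<le> s n (x n) then 1 else -1) / 3 ^ n" for n
  have s0: "s 0 f = 0" and sS: "s (Suc n) f = s n f + c n * e n f" for n f by (simp_all add: s_def c_def)
  have s: "s n f = (\<Sum>k<n. c k * e k f)" for n f by (induction n) (simp_all add: s0 sS)
  have ca: "\<bar>c n\<bar> = (1 / 3) ^ n" for n by (simp add: c_def power_one_over abs_if)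
  have b: "\<bar>c k * e k f\<bar> \<le> N f * (1 / 3) ^ k" if "f \<in> X" for f k
    using mult_right_mono[OF bd[OF that, of k], of "(1 / 3) ^ k"] by (simp add: abs_mult ca mult.commute)
  have geo: "summable (\<lambda>k. a * (1 / 3) ^ k)" "(\<Sum>k. a * (1 / 3) ^ k) = 3 / 2 * a" for a :: real
    using summable_mult[OF summable_geometric[of "1/3::real"], of a] suminf_mult[OF summable_geometric[of "1/3::real"], of a]
      suminf_geometric[of "1/3::real"] by simp_all
  have sa: "summable (\<lambda>k. \<bar>c k * e k f\<bar>)" if "f \<in> X" for f
    by (rule summable_comparison_test'[OF geo(1)[of "N f"]]) (use b[OF that] in simp)
  show ?thesis
  proof (rule that[of c])
    show sm: "summable (\<lambda>k. c k * e k f)" if "f \<in> X" for f by (rule summable_rabs_cancel[OF sa[OF that]])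
    show "\<bar>\<Sum>k. c k * e k f\<bar> \<le> 3 / 2 * N f" if f: "f \<in> X" for f
    proof -
      have "\<bar>\<Sum>k. c k * e k f\<bar> \<le> (\<Sum>k. \<bar>c k * e k f\<bar>)" by (rule summable_rabs[OF sa[OF f]])
      also have "\<dots> \<le> (\<Sum>k. N f * (1 / 3) ^ k)" by (rule suminf_le[OF b[OF f] sa[OF f] geo(1)])
      finally show ?thesis by (simp only: geo(2))
    qed
    show "N (x n) / (2 * 3 ^ n) \<le> \<bar>\<Sum>k. c k * e k (x n)\<bar>" for n
    proof -
      let ?a = "\<lambda>k. c k * e k (x n)"
      have N0: "0 \<le> N (x n)" using bd[OF x(1), of 0 n] by linarith
      have split: "(\<Sum>k. ?a k) = (\<Sum>k. ?a (k + Suc n)) + s (Suc n) (x n)"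
        unfolding s by (rule suminf_split_initial_segment[OF sm[OF x(1)]])
      have "\<bar>\<Sum>k. ?a (k + Suc n)\<bar> \<le> (\<Sum>k. \<bar>?a (k + Suc n)\<bar>)"
        using sa[OF x(1)] by (intro summable_rabs) (subst summable_iff_shift)
      also have "\<dots> \<le> (\<Sum>k. N (x n) * (1 / 3) ^ Suc n * (1 / 3) ^ k)"
      proof (rule suminf_le)
        show "\<bar>?a (k + Suc n)\<bar> \<le> N (x n) * (1 / 3) ^ Suc n * (1 / 3) ^ k" for k
          using b[OF x(1), of "k + Suc n" n] by (simp only: power_add mult_ac)
        show "summable (\<lambda>k. \<bar>?a (k + Suc n)\<bar>)" using sa[OF x(1)] by (subst summable_iff_shift)
      qed (rule geo(1))
      \<comment> \<open>A geometric tail that starts at (1/3)^(n+1) sums to 3/2 of its first term,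
        hence to half of (1/3)^n.\<close>
      also have "\<dots> = N (x n) / (2 * 3 ^ n)" by (simp only: geo(2)) (simp add: power_one_over)
      finally have tail: "\<bar>\<Sum>k. ?a (k + Suc n)\<bar> \<le> N (x n) / (2 * 3 ^ n)" .
      have "\<bar>s (Suc n) (x n)\<bar> \<ge> N (x n) / 3 ^ n"
      proof (cases "0 \<le> s n (x n)")
        case True
        then have "s (Suc n) (x n) = s n (x n) + N (x n) / 3 ^ n" by (simp add: sS x(2) c_def)
        then show ?thesis using True by linarith
      next
        case False
        then have "s (Suc n) (x n) = s n (x n) - N (x n) / 3 ^ n" by (simp add: sS x(2) c_def)
        then show ?thesis using False by linarith
      qed
      moreover have "N (x n) / 3 ^ n = 2 * (N (x n) / (2 * 3 ^ n))" by simp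
      ultimately show ?thesis unfolding split using tail by linarith
    qed
  qed
qed

text \<open>Pairings with arbitrary square-integrable fields, solenoidal or not, are admissible
  functionals; through them weak continuity yields continuity of mollified values in time.\<close>

lemma pairing_dual:
  assumes g: "g \<in> Lp_space 2 (lebesgue_on \<Omega>)"
  shows "(\<lambda>f. LINT x|lebesgue_on \<Omega>. f x \<bullet> g x) \<in> solenoidal_dual \<Omega>"
proof -
  have gm: "g \<in> borel_measurable (lebesgue_on \<Omega>)" "integrable (lebesgue_on \<Omega>) (\<lambda>x. (norm (g x))^2)"
    using g by (auto simp: Lp_space_2)
  have f: "f \<in> borel_measurable (lebesgue_on \<Omega>)" "integrable (lebesgue_on \<Omega>) (\<lambda>x. (norm (f x))^2)"
    if "f \<in> solenoidal_L2 \<Omega>" for f using that by (auto simp: solenoidal_L2_def Lp_space_2)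
  note CS = integral_Cauchy_Schwarz[OF f(1) gm(1) f(2) gm(2)]
  show ?thesis
    unfolding solenoidal_dual_def mem_Collect_eq
  proof (intro conjI ballI allI exI)
    show "(LINT x|lebesgue_on \<Omega>. (f x + f' x) \<bullet> g x) = (LINT x|lebesgue_on \<Omega>. f x \<bullet> g x) + (LINT x|lebesgue_on \<Omega>. f' x \<bullet> g x)"
      if "f \<in> solenoidal_L2 \<Omega>" "f' \<in> solenoidal_L2 \<Omega>" for f f'
      unfolding inner_add_left by (rule Bochner_Integration.integral_add[OF CS(1) CS(1)]) (rule that)+
    show "\<bar>LINT x|lebesgue_on \<Omega>. f x \<bullet> g x\<bar> \<le> Lp_norm 2 (lebesgue_on \<Omega>) g * Lp_norm 2 (lebesgue_on \<Omega>) f"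
      if "f \<in> solenoidal_L2 \<Omega>" for f
      using CS(2)[OF that that] by (simp only: Lp_norm_2 mult.commute)
  qed simp
qed

text \<open>The uniform boundedness principle in explicit form: if the norms were unbounded on
  [0,b], \<open>gliding_hump\<close> applied to normalised pairings with velocities of huge norm
  would give one bounded functional that is unbounded along them. But along the velocity that
  functional is continuous on the compact interval.\<close>

theorem solenoidal_norm_bounded:
  assumes u: "u \<in> weakly_continuous_solenoidal T \<Omega>" and b: "b < T"
  shows "\<exists>B. \<forall>t\<in>{0..b}. (LINT x|lebesgue_on \<Omega>. (norm (u t x))^2) \<le> B"
proof (rule ccontr)
  assume "\<not> ?thesis"
  then have "\<forall>B. \<exists>t\<in>{0..b}. (LINT x|lebesgue_on \<Omega>. (norm (u t x))^2) > B" by (simp add: not_le)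
  \<comment> \<open>Norms above 4^n outgrow the loss 3^n in the gliding hump; the functional then
    exceeds (4/3)^n / 2.\<close>
  then have "\<forall>n. \<exists>t\<in>{0..b}. (LINT x|lebesgue_on \<Omega>. (norm (u t x))^2) > (4 ^ n)^2" by blast
  then obtain t where t: "\<And>n. t n \<in> {0..b}" "\<And>n::nat. (LINT x|lebesgue_on \<Omega>. (norm (u (t n) x))^2) > (4 ^ n)^2"
    by metis
  define N where "N f = Lp_norm 2 (lebesgue_on \<Omega>) f" for f :: "'a => 'a"
  have N: "4 ^ n < N (u (t n))" for n
    unfolding N_def Lp_norm_2 using t(2)[of n] by (rule real_less_rsqrt)
  have N0: "0 < N (u (t n))" for n using N[of n] by (rule less_trans[rotated]) simp
  have X: "u (t n) \<in> solenoidal_L2 \<Omega>" for n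
    using u t(1)[of n] b by (auto simp: weakly_continuous_solenoidal_def)
  have L2: "f \<in> Lp_space 2 (lebesgue_on \<Omega>)" if "f \<in> solenoidal_L2 \<Omega>" for f using that by (simp add: solenoidal_L2_def)
  have f: "f \<in> borel_measurable (lebesgue_on \<Omega>)" "integrable (lebesgue_on \<Omega>) (\<lambda>x. (norm (f x))^2)"
    if "f \<in> solenoidal_L2 \<Omega>" for f using L2[OF that] by (auto simp: Lp_space_2)
  define e where "e n f = (LINT x|lebesgue_on \<Omega>. f x \<bullet> u (t n) x) / N (u (t n))" for n f
  have e1: "\<bar>e n f\<bar> \<le> N f" if "f \<in> solenoidal_L2 \<Omega>" for n f
    using integral_Cauchy_Schwarz(2)[OF f(1)[OF that] f(1)[OF X] f(2)[OF that] f(2)[OF X], of n] N0[of n]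
    by (simp add: e_def N_def Lp_norm_2 divide_le_eq)
  have e2: "e n (u (t n)) = N (u (t n))" for n
  proof -
    have "(LINT x|lebesgue_on \<Omega>. u (t n) x \<bullet> u (t n) x) = N (u (t n)) * N (u (t n))"
      by (simp add: N_def Lp_norm_2 power2_norm_eq_inner[symmetric])
    then show ?thesis using N0[of n] by (simp add: e_def)
  qed
  obtain c where c: "\<And>f. f \<in> solenoidal_L2 \<Omega> ==> summable (\<lambda>k. c k * e k f)"
    "\<And>f. f \<in> solenoidal_L2 \<Omega> ==> \<bar>\<Sum>k. c k * e k f\<bar> \<le> 3 / 2 * N f"
    "\<And>n. N (u (t n)) / (2 * 3 ^ n) \<le> \<bar>\<Sum>k. c k * e k (u (t n))\<bar>"
    by (rule gliding_hump[of "solenoidal_L2 \<Omega>" e N "\<lambda>n. u (t n)"]) (rule e1, assumption, rule X, rule e2, (rule that; assumption))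
  define l where "l f = (\<Sum>k. c k * e k f)" for f
  have pd: "(\<lambda>f. LINT x|lebesgue_on \<Omega>. f x \<bullet> u (t n) x) \<in> solenoidal_dual \<Omega>" for n
    by (rule pairing_dual[OF L2[OF X]])
  have ea: "e n (\<lambda>x. f x + g x) = e n f + e n g" if "f \<in> solenoidal_L2 \<Omega>" "g \<in> solenoidal_L2 \<Omega>" for n f g
    using pd[of n] that unfolding solenoidal_dual_def e_def by (simp add: add_divide_distrib)
  have es: "e n (\<lambda>x. r *\<^sub>R f x) = r * e n f" for n r f by (simp add: e_def)
  have "l \<in> solenoidal_dual \<Omega>"
    unfolding solenoidal_dual_def mem_Collect_eq
  proof (intro conjI ballI allI exI)
    show "l (\<lambda>x. f x + g x) = l f + l g" if "f \<in> solenoidal_L2 \<Omega>" "g \<in> solenoidal_L2 \<Omega>" for f g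
      unfolding l_def using suminf_add[OF c(1)[OF that(1)] c(1)[OF that(2)]] by (simp add: ea[OF that] distrib_left)
    show "l (\<lambda>x. r *\<^sub>R f x) = r * l f" if "f \<in> solenoidal_L2 \<Omega>" for r f
      unfolding l_def es using suminf_mult[OF c(1)[OF that], of r] by (simp add: mult.left_commute)
    show "\<bar>l f\<bar> \<le> 3 / 2 * Lp_norm 2 (lebesgue_on \<Omega>) f" if "f \<in> solenoidal_L2 \<Omega>" for f
      using c(2)[OF that] by (simp add: l_def N_def)
  qed
  then have "continuous_on {0..<T} (\<lambda>s. l (u s))" using u by (simp add: weakly_continuous_solenoidal_def)
  then have "continuous_on {0..b} (\<lambda>s. l (u s))" by (rule continuous_on_subset) (use b in auto)
  then have "bounded ((\<lambda>s. l (u s)) ` {0..b})" by (intro compact_imp_bounded compact_continuous_image) auto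
  then obtain B where "\<forall>y\<in>(\<lambda>s. l (u s)) ` {0..b}. norm y \<le> B" unfolding bounded_iff by blast
  then have B: "\<And>s. s \<in> {0..b} ==> \<bar>l (u s)\<bar> \<le> B" by simp
  obtain n where n: "2 * B < (4 / 3) ^ n" using real_arch_pow[of "4/3" "2 * B"] by auto
  have "(4 / 3) ^ n / 2 = (4 ^ n / (2 * 3 ^ n) :: real)" by (simp add: power_divide)
  also have "\<dots> \<le> N (u (t n)) / (2 * 3 ^ n)" using N[of n] by (intro divide_right_mono) auto
  also have "\<dots> \<le> \<bar>l (u (t n))\<bar>" using c(3)[of n] by (simp add: l_def)
  also have "\<dots> \<le> B" by (rule B[OF t(1)])
  finally show False using n by simp
qed

section \<open>Test functions separated in time and space\<close>

lemma test_function_product: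
  fixes \<phi> :: "real => real" and \<psi> :: "'a::euclidean_space => 'a"
  assumes \<phi>: "\<phi> \<in> test_functions I" and \<psi>: "\<psi> \<in> test_functions \<Omega>"
  shows "(\<lambda>z. \<phi> (fst z) *\<^sub>R \<psi> (snd z)) \<in> test_functions (I \<times> \<Omega>)"
proof -
  let ?A = "closure {x. \<phi> x \<noteq> 0}" and ?B = "closure {x. \<psi> x \<noteq> 0}" and ?f = "\<lambda>z. \<phi> (fst z) *\<^sub>R \<psi> (snd z)"
  have AB: "compact ?A" "?A \<subseteq> I" "compact ?B" "?B \<subseteq> \<Omega>" using \<phi> \<psi> by (auto simp: test_functions_def)
  have "Ck_on k UNIV (\<lambda>z. \<phi> (fst z + 0) *\<^sub>R \<psi> (snd z + 0))" for k
    by (rule Ck_on_scaleR[OF Ck_on_compose_affine[OF bounded_linear_fst test_function_Ck[OF \<phi>]]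
          Ck_on_compose_affine[OF bounded_linear_snd test_function_Ck[OF \<psi>]]])
  then have ck: "\<forall>k. Ck_on k UNIV ?f" by simp
  have cp: "compact (?A \<times> ?B)" using AB by (intro compact_Times) auto
  have "{z. ?f z \<noteq> 0} \<subseteq> {x. \<phi> x \<noteq> 0} \<times> {x. \<psi> x \<noteq> 0}" by (auto simp: mem_Times_iff)
  also have "\<dots> \<subseteq> ?A \<times> ?B" by (intro Sigma_mono closure_subset)
  finally have sub: "closure {z. ?f z \<noteq> 0} \<subseteq> ?A \<times> ?B" using cp by (intro closure_minimal) (auto simp: compact_imp_closed)
  have "compact (closure {z. ?f z \<noteq> 0})"
    using compact_Int_closed[OF cp closed_closure, of "{z. ?f z \<noteq> 0}"] sub by (simp add: Int_absorb1)
  moreover have "?A \<times> ?B \<subseteq> I \<times> \<Omega>" using AB by (intro Sigma_mono) auto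
  ultimately show ?thesis using ck sub unfolding test_functions_def by blast
qed

lemma tensor_grad_eq:
  assumes "bounded_linear (fderiv w x)"
  shows "tensor_grad a w x = fderiv w x a \<bullet> a"
proof -
  let ?D = "fderiv w x"
  have "?D a \<bullet> a = (\<Sum>i\<in>Basis. (a \<bullet> i) *\<^sub>R ?D i) \<bullet> a"
    by (simp only: linear_expand[OF assms, of a, symmetric])
  also have "\<dots> = (\<Sum>i\<in>Basis. (a \<bullet> i) * (?D i \<bullet> a))" by (simp add: inner_sum_left)
  also have "\<dots> = tensor_grad a w x"
    unfolding tensor_grad_def
  proof (rule sum.cong[OF refl])
    fix i :: 'a
    show "(a \<bullet> i) * (?D i \<bullet> a) = (\<Sum>j\<in>Basis. (a \<bullet> i) * (a \<bullet> j) * (?D i \<bullet> j))"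
      by (subst euclidean_inner[of "?D i" a]) (simp add: sum_distrib_left mult_ac)
  qed
  finally show ?thesis by simp
qed

lemma separated_derivatives:
  fixes \<psi> :: "'a::euclidean_space => 'a"
  assumes \<phi>: "(\<phi> has_real_derivative d) (at t)" and \<psi>: "\<psi> \<in> test_functions \<Omega>"
  shows "vector_derivative (\<lambda>s. \<phi> s *\<^sub>R c) (at t) = d *\<^sub>R c"
    and "tensor_grad a (\<lambda>y. r *\<^sub>R \<psi> y) x = r * (fderiv \<psi> x a \<bullet> a)"
    and "divergence (\<lambda>y. r *\<^sub>R \<psi> y) x = r * divergence \<psi> x"
proof -
  have "((\<lambda>s. \<phi> s *\<^sub>R c) has_derivative (\<lambda>h. (d * h) *\<^sub>R c)) (at t)"
    by (rule has_derivative_scaleR_left[OF \<phi>[unfolded has_field_derivative_def]])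
  then have "((\<lambda>s. \<phi> s *\<^sub>R c) has_vector_derivative d *\<^sub>R c) (at t)"
    unfolding has_vector_derivative_def by (rule has_derivative_eq_rhs) (simp add: fun_eq_iff mult.commute)
  then show "vector_derivative (\<lambda>s. \<phi> s *\<^sub>R c) (at t) = d *\<^sub>R c" by (rule vector_derivative_at)
  have D: "((\<lambda>y. r *\<^sub>R \<psi> y) has_derivative (\<lambda>h. r *\<^sub>R fderiv \<psi> x h)) (at x)"
    by (rule has_derivative_scaleR_right[OF test_function_derivative[OF \<psi>]])
  then have fd: "fderiv (\<lambda>y. r *\<^sub>R \<psi> y) x = (\<lambda>h. r *\<^sub>R fderiv \<psi> x h)"
    by (rule frechet_derivative_at[symmetric])
  have "bounded_linear (fderiv (\<lambda>y. r *\<^sub>R \<psi> y) x)"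
    unfolding fd by (rule has_derivative_bounded_linear[OF D])
  from tensor_grad_eq[OF this, of a] show "tensor_grad a (\<lambda>y. r *\<^sub>R \<psi> y) x = r * (fderiv \<psi> x a \<bullet> a)"
    by (simp add: fd)
  show "divergence (\<lambda>y. r *\<^sub>R \<psi> y) x = r * divergence \<psi> x"
    by (simp add: divergence_def fd sum_distrib_left)
qed

section \<open>Reduction to Borel data\<close>

lemma AE_slice:
  fixes S :: "'a::euclidean_space set"
  assumes "AE z in lborel. z \<in> I \<times> S --> Q (fst z) (snd z)"
  shows "AE t in lborel. t \<in> I --> (AE x in lborel. x \<in> S --> Q (t::real) x)"
proof -
  have "AE z in lborel \<Otimes>\<^sub>M lborel. z \<in> I \<times> S --> Q (fst z) (snd z)" using assms by (simp only: lborel_prod)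
  from lborel_pair.AE_pair[OF this] show ?thesis
  proof eventually_elim
    case (elim t)
    show ?case
    proof
      assume "t \<in> I"
      with elim show "AE x in lborel. x \<in> S --> Q t x" by (auto elim: eventually_mono)
    qed
  qed
qed

lemma AE_lborel_shift:
  fixes z :: "'a::euclidean_space"
  assumes "AE x in lborel. Q x" shows "AE x in lborel. Q (x + z)"
proof -
  obtain N where N: "{x \<in> space lborel. \<not> Q x} \<subseteq> N" "N \<in> sets lborel" "emeasure lborel N = 0"
    using assms by (rule AE_E) blast
  have "AE x in lborel. x \<notin> N" using N by (intro AE_not_in) (auto simp: null_sets_def)
  then have "AE x in distr lborel borel ((+) z). x \<notin> N" by (subst lborel_distr_plus)
  then have "AE x in lborel. z + x \<notin> N" using N(2) by (subst (asm) AE_distr_iff) auto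
  then show ?thesis
  proof eventually_elim
    case (elim x)
    then have "z + x \<notin> {x \<in> space lborel. \<not> Q x}" using N(1) by blast
    then show ?case by (simp add: add.commute)
  qed
qed

lemma borel_measurable_lebesgue_on:
  assumes "f \<in> borel_measurable borel" shows "f \<in> borel_measurable (lebesgue_on S)"
  by (intro measurable_restrict_space1 measurable_completion) (use assms in simp)

section \<open>Representatives of a weak solution\<close>

locale weak_euler =
  fixes \<Omega> :: "'a::euclidean_space set" and T :: real and u :: "real => 'a => 'a" and p :: "real => 'a => real"
    and \<epsilon> :: real
  assumes dom: "bounded_C2_domain \<Omega>" and Tpos: "T > 0" and sol: "weak_euler_solution T \<Omega> u p"
    and besov: "\<And>U. open U ==> compact (closure U) ==> closure U \<subseteq> \<Omega> ==> u \<in> Lq_besov_c0 3 3 (1/3) T U"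
    and \<epsilon>: "\<epsilon> > 0" and uS: "u \<in> LqLinf_space 3 T (boundary_strip \<Omega> \<epsilon>)"
    and pS: "p \<in> LqLinf_space (3/2) T (boundary_strip \<Omega> \<epsilon>)"
    and normal: "normal_velocity_vanishes 3 T \<Omega> u"
begin

abbreviation "I \<equiv> {0<..<T}"
abbreviation "S \<equiv> boundary_strip \<Omega> \<epsilon>"
abbreviation "U a \<equiv> {x \<in> \<Omega>. a < infdist x (frontier \<Omega>)}"

lemma Omega: "open \<Omega>" "bounded \<Omega>" using dom by (auto simp: bounded_C2_domain_def)

lemma open_S: "open S" by (rule boundary_strip_open[OF Omega(1)])

lemma open_U: "open (U a)"
proof -
  have "U a = \<Omega> \<inter> {x. a < infdist x (frontier \<Omega>)}" by auto
  then show ?thesis using Omega(1) by (simp add: open_Int open_Collect_less continuous_on_infdist)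
qed

lemma borel_sets: "\<Omega> \<in> sets borel" "S \<in> sets borel" "U a \<in> sets borel"
  using Omega open_S open_U by auto

lemma closure_U:
  assumes "0 < a" shows "compact (closure (U a))" "closure (U a) \<subseteq> \<Omega>"
proof -
  have "bounded (U a)" by (rule bounded_subset[OF Omega(2)]) auto
  then show "compact (closure (U a))" by simp
  have "closed {x. a \<le> infdist x (frontier \<Omega>)}" by (intro closed_Collect_le continuous_on_const continuous_on_infdist continuous_on_id)
  then have "closure (U a) \<subseteq> {x. a \<le> infdist x (frontier \<Omega>)}" by (intro closure_minimal) auto
  moreover have "closure (U a) \<subseteq> closure \<Omega>" by (intro closure_mono) auto
  moreover have "x \<in> \<Omega>" if "x \<in> closure \<Omega>" "a \<le> infdist x (frontier \<Omega>)" for x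
  proof (rule ccontr)
    assume "x \<notin> \<Omega>"
    then have "x \<in> frontier \<Omega>" using that(1) Omega(1) by (simp add: frontier_def interior_open)
    then show False using that(2) assms by simp
  qed
  ultimately show "closure (U a) \<subseteq> \<Omega>" by blast
qed

lemma besov_U: "0 < a ==> u \<in> Lq_besov_c0 3 3 (1/3) T (U a)"
  by (rule besov[OF open_U closure_U])

lemma Omega_cover: "x \<in> \<Omega> ==> x \<in> S \<or> x \<in> U (\<epsilon> / 2)"
  using \<epsilon> by (auto simp: boundary_strip_def)

lemma spacetime_borel: "open V ==> I \<times> V \<in> sets borel" for V :: "'a set"
  by (intro borel_open open_Times) auto

text \<open>Joint measurability of the velocity is known separately in the boundary strip and in the
  interior, from the two regularity hypotheses. The two representatives are glued; the regions
  overlap, since the interior one starts at distance \<epsilon> / 2.\<close>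

lemma velocity_representative:
  obtains uB where "uB \<in> borel_measurable borel" "\<And>z. z \<notin> I \<times> \<Omega> ==> uB z = 0"
    "AE z in lborel. z \<in> I \<times> \<Omega> --> uB z = u (fst z) (snd z)"
proof -
  have "(\<lambda>z. u (fst z) (snd z)) \<in> borel_measurable (lebesgue_on (I \<times> S))"
    using uS by (simp add: LqLinf_space_def spacetime_measurable_def)
  then obtain g where g: "g \<in> borel_measurable borel" "AE z in lborel. z \<in> I \<times> S --> g z = u (fst z) (snd z)"
    by (rule borel_representative[OF spacetime_borel[OF open_S]]) (rule that; assumption)
  have "(\<lambda>z. u (fst z) (snd z)) \<in> borel_measurable (lebesgue_on (I \<times> U (\<epsilon> / 2)))"
    using besov_U[of "\<epsilon> / 2"] \<epsilon> by (simp add: Lq_besov_c0_def LqLp_space_def spacetime_measurable_def)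
  then obtain h where h: "h \<in> borel_measurable borel" "\<And>z. z \<notin> I \<times> U (\<epsilon> / 2) ==> h z = 0"
      "AE z in lborel. z \<in> I \<times> U (\<epsilon> / 2) --> h z = u (fst z) (snd z)"
    by (rule borel_representative[OF spacetime_borel[OF open_U]]) (rule that; assumption)
  define f where "f z = (if z \<in> I \<times> S then g z else h z)" for z
  show ?thesis
  proof (rule that[of f])
    show "f \<in> borel_measurable borel"
      unfolding f_def using g(1) h(1) spacetime_borel[OF open_S] by (intro measurable_If_set) auto
    show "f z = 0" if "z \<notin> I \<times> \<Omega>" for z
      using that h(2)[of z] by (auto simp: f_def boundary_strip_def)
    show "AE z in lborel. z \<in> I \<times> \<Omega> --> f z = u (fst z) (snd z)"
      using g(2) h(3)
    proof eventually_elim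
      case (elim z)
      then show ?case using Omega_cover[of "snd z"] by (cases z) (auto simp: f_def)
    qed
  qed
qed

lemma pressure_representative:
  obtains qB where "qB \<in> borel_measurable borel" "AE z in lborel. z \<in> I \<times> S --> qB z = p (fst z) (snd z)"
proof -
  have "(\<lambda>z. p (fst z) (snd z)) \<in> borel_measurable (lebesgue_on (I \<times> S))"
    using pS by (simp add: LqLinf_space_def spacetime_measurable_def)
  then show ?thesis by (rule borel_representative[OF spacetime_borel[OF open_S]]) (rule that; assumption)
qed

lemma u_L2: "t \<in> {0..<T} ==> u t \<in> solenoidal_L2 \<Omega>"
  using sol by (auto simp: weak_euler_solution_def weakly_continuous_solenoidal_def)

text \<open>The jointly Borel function agrees with the velocity only at almost every time, while the
  energy is compared at every time. At exceptional times, including 0, a separate Borel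
  representative of the slice is taken, so that w is faithful everywhere and equals the joint one
  almost always.\<close>

lemma slice_representative:
  assumes uB: "uB \<in> borel_measurable borel" "\<And>z. z \<notin> I \<times> \<Omega> ==> uB z = 0"
    "AE z in lborel. z \<in> I \<times> \<Omega> --> uB z = u (fst z) (snd z)"
  obtains w where "\<And>t. t \<in> {0..<T} ==> w t \<in> borel_measurable borel" "\<And>t x. t \<in> {0..<T} ==> x \<notin> \<Omega> ==> w t x = 0"
    "\<And>t. t \<in> {0..<T} ==> AE x in lborel. x \<in> \<Omega> --> w t x = u t x"
    "AE t in lborel. t \<in> I --> w t = (\<lambda>x. uB (t, x))"
proof -
  have "\<forall>t. \<exists>r. t \<in> {0..<T} --> r \<in> borel_measurable borel \<and> (\<forall>x. x \<notin> \<Omega> --> r x = 0) \<and> (AE x in lborel. x \<in> \<Omega> --> r x = u t x)"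
  proof
    fix t
    show "\<exists>r. t \<in> {0..<T} --> r \<in> borel_measurable borel \<and> (\<forall>x. x \<notin> \<Omega> --> r x = 0) \<and> (AE x in lborel. x \<in> \<Omega> --> r x = u t x)"
    proof (cases "t \<in> {0..<T}")
      case True
      then have "u t \<in> borel_measurable (lebesgue_on \<Omega>)" using u_L2 by (simp add: solenoidal_L2_def Lp_space_def)
      then obtain r where "r \<in> borel_measurable borel" "\<And>x. x \<notin> \<Omega> ==> r x = 0" "AE x in lborel. x \<in> \<Omega> --> r x = u t x"
        by (rule borel_representative[OF borel_sets(1)]) (rule that; assumption)
      then show ?thesis by (intro exI[of _ r]) simp
    next
      case False
      then show ?thesis by blast
    qed
  qed
  from choice[OF this] obtain r where r':
    "\<forall>t. t \<in> {0..<T} --> r t \<in> borel_measurable borel \<and> (\<forall>x. x \<notin> \<Omega> --> r t x = 0) \<and> (AE x in lborel. x \<in> \<Omega> --> r t x = u t x)" ..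
  have r: "\<And>t. t \<in> {0..<T} ==> r t \<in> borel_measurable borel" "\<And>t x. t \<in> {0..<T} ==> x \<notin> \<Omega> ==> r t x = 0"
    "\<And>t. t \<in> {0..<T} ==> AE x in lborel. x \<in> \<Omega> --> r t x = u t x"
    using r' by simp_all
  define Q where "Q t \<longleftrightarrow> t \<in> I \<and> (AE x in lborel. x \<in> \<Omega> --> uB (t, x) = u t x)" for t
  define w where "w t = (if Q t then (\<lambda>x. uB (t, x)) else r t)" for t
  show ?thesis
  proof (rule that[of w])
    fix t assume t: "t \<in> {0..<T}"
    have [measurable]: "uB \<in> borel_measurable (borel \<Otimes>\<^sub>M borel)" using uB(1) by (simp add: borel_prod)
    have "(\<lambda>x. uB (t, x)) \<in> borel_measurable borel" by measurable
    then show "w t \<in> borel_measurable borel" using r(1)[OF t] by (simp add: w_def)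
    show "w t x = 0" if "x \<notin> \<Omega>" for x using r(2)[OF t that] uB(2)[of "(t, x)"] that by (simp add: w_def)
    show "AE x in lborel. x \<in> \<Omega> --> w t x = u t x" using r(3)[OF t] by (cases "Q t") (simp_all add: w_def Q_def)
  next
    have "AE z in lborel. z \<in> I \<times> \<Omega> --> uB (fst z, snd z) = u (fst z) (snd z)" using uB(3) by simp
    from AE_slice[OF this] show "AE t in lborel. t \<in> I --> w t = (\<lambda>x. uB (t, x))"
      by eventually_elim (simp add: w_def Q_def)
  qed
qed

end

section \<open>The representatives satisfy the assumptions of the energy balance\<close>

locale euler_representatives = weak_euler +
  fixes uB :: "real \<times> 'a => 'a" and qB :: "real \<times> 'a => real" and w :: "real => 'a => 'a" and M P :: "real => real"
  assumes uB: "uB \<in> borel_measurable borel" and uB0: "\<And>z. z \<notin> I \<times> \<Omega> ==> uB z = 0"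
    and qB: "qB \<in> borel_measurable borel"
    and qBp: "AE t in lborel. t \<in> I --> (AE x in lborel. x \<in> S --> qB (t, x) = p t x)"
    and wm: "\<And>t. t \<in> {0..<T} ==> w t \<in> borel_measurable borel"
    and w0: "\<And>t x. t \<in> {0..<T} ==> x \<notin> \<Omega> ==> w t x = 0"
    and wu: "\<And>t. t \<in> {0..<T} ==> AE x in lborel. x \<in> \<Omega> --> w t x = u t x"
    and wB: "AE t in lborel. t \<in> I --> w t = (\<lambda>x. uB (t, x))"
    and M: "\<And>t. 0 \<le> M t" "integrable lborel (\<lambda>t. ind I t * M t ^ 3)"
      "AE t in lborel. t \<in> I --> (AE x in lborel. x \<in> S --> norm (u t x) \<le> M t)"
    and P: "\<And>t. 0 \<le> P t" "integrable lborel (\<lambda>t. ind I t * P t powr (3/2))"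
      "AE t in lborel. t \<in> I --> (AE x in lborel. x \<in> S --> norm (p t x) \<le> P t)"
begin

lemma uBm [measurable]: "uB \<in> borel_measurable (borel \<Otimes>\<^sub>M borel)" using uB by (simp add: borel_prod)

lemma qBm [measurable]: "qB \<in> borel_measurable (borel \<Otimes>\<^sub>M borel)" using qB by (simp add: borel_prod)

text \<open>The integrand takes the point and the velocity value separately, so that one transfer
  from u to w serves energies, pairings with test fields and cubic norms.\<close>

lemma integral_u:
  fixes h :: "'a => 'a => real"
  assumes t: "t \<in> {0..<T}" and V: "V \<in> sets borel" "V \<subseteq> \<Omega>"
    and h: "(\<lambda>x. h x (w t x)) \<in> borel_measurable borel"
  shows "(LINT x|lebesgue_on V. h x (u t x)) = (LBINT x. ind V x * h x (w t x))"
    "integrable (lebesgue_on V) (\<lambda>x. h x (u t x)) \<longleftrightarrow> integrable lborel (\<lambda>x. ind V x * h x (w t x))"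
proof -
  have "AE x in lborel. x \<in> V --> h x (u t x) = h x (w t x)" using wu[OF t] V(2) by (auto elim: eventually_mono)
  from integral_lebesgue_on_eq[OF V(1) h this]
  show "(LINT x|lebesgue_on V. h x (u t x)) = (LBINT x. ind V x * h x (w t x))"
    "integrable (lebesgue_on V) (\<lambda>x. h x (u t x)) \<longleftrightarrow> integrable lborel (\<lambda>x. ind V x * h x (w t x))" by blast+
qed

lemma integral_u_Omega:
  fixes h :: "'a => 'a => real"
  assumes t: "t \<in> {0..<T}" and h: "(\<lambda>x. h x (w t x)) \<in> borel_measurable borel" and h0: "\<And>x. x \<notin> \<Omega> ==> h x 0 = 0"
  shows "(LINT x|lebesgue_on \<Omega>. h x (u t x)) = (LBINT x. h x (w t x))"
    "integrable (lebesgue_on \<Omega>) (\<lambda>x. h x (u t x)) \<longleftrightarrow> integrable lborel (\<lambda>x. h x (w t x))"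
proof -
  have "(\<lambda>x. ind \<Omega> x * h x (w t x)) = (\<lambda>x. h x (w t x))"
    using h0 w0[OF t] by (auto simp: fun_eq_iff indicator_def)
  then show "(LINT x|lebesgue_on \<Omega>. h x (u t x)) = (LBINT x. h x (w t x))"
    "integrable (lebesgue_on \<Omega>) (\<lambda>x. h x (u t x)) \<longleftrightarrow> integrable lborel (\<lambda>x. h x (w t x))"
    using integral_u[where h=h, OF t borel_sets(1) subset_refl h] by simp_all
qed

lemma energy_eq:
  assumes t: "t \<in> {0..<T}"
  shows "(LINT x|lebesgue_on \<Omega>. (norm (u t x))^2) = (LBINT x. (norm (w t x))^2)"
    "integrable lborel (\<lambda>x. (norm (w t x))^2)"
proof -
  note [measurable] = wm[OF t]
  have hm: "(\<lambda>x. (norm (w t x))^2) \<in> borel_measurable borel" by measurable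
  note eq = integral_u_Omega[OF t, of "\<lambda>x v. (norm v)^2", OF hm]
  show "(LINT x|lebesgue_on \<Omega>. (norm (u t x))^2) = (LBINT x. (norm (w t x))^2)"
    by (rule eq(1)) simp
  have "integrable (lebesgue_on \<Omega>) (\<lambda>x. (norm (u t x))^2)"
    using u_L2[OF t] by (simp add: solenoidal_L2_def Lp_space_2)
  moreover have "integrable (lebesgue_on \<Omega>) (\<lambda>x. (norm (u t x))^2) \<longleftrightarrow> integrable lborel (\<lambda>x. (norm (w t x))^2)"
    by (rule eq(2)) simp
  ultimately show "integrable lborel (\<lambda>x. (norm (w t x))^2)" by blast
qed

lemma w_solenoidal:
  assumes t: "t \<in> {0..<T}" shows "solenoidal_ext \<Omega> (w t)"
  unfolding solenoidal_ext_def
proof (intro conjI allI impI)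
  note [measurable] = wm[OF t]
  show "w t \<in> borel_measurable borel" by (rule wm[OF t])
  show "integrable lborel (\<lambda>x. (norm (w t x))^2)" by (rule energy_eq(2)[OF t])
  show "w t x = 0" if "x \<notin> \<Omega>" for x by (rule w0[OF t that])
  fix e :: real assume "0 < e"
  then obtain \<phi> where \<phi>: "\<phi> \<in> test_functions \<Omega>" "\<forall>x. divergence \<phi> x = 0"
    "Lp_norm 2 (lebesgue_on \<Omega>) (\<lambda>x. u t x - \<phi> x) < sqrt e"
    using u_L2[OF t] unfolding solenoidal_L2_def by (auto dest!: spec[of _ "sqrt e"])
  note [measurable] = test_function_borel[OF \<phi>(1)]
  have hm: "(\<lambda>x. (norm (w t x - \<phi> x))^2) \<in> borel_measurable borel" by measurable
  have "(LINT x|lebesgue_on \<Omega>. (norm (u t x - \<phi> x))^2) = (LBINT x. (norm (w t x - \<phi> x))^2)"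
    by (rule integral_u_Omega(1)[OF t, of "\<lambda>x v. (norm (v - \<phi> x))^2", OF hm]) (simp add: test_function_zero[OF \<phi>(1)])
  then have "(LBINT x. (norm (w t x - \<phi> x))^2) < e" using \<phi>(3) by (simp add: Lp_norm_2)
  then show "\<exists>\<phi>\<in>test_functions \<Omega>. (\<forall>x. divergence \<phi> x = 0) \<and> (LBINT x. (norm (w t x - \<phi> x))^2) < e"
    using \<phi>(1,2) by blast
qed

lemma w_weakly_continuous:
  assumes g: "g \<in> borel_measurable borel" and B: "\<And>x. norm (g x) \<le> B"
  shows "continuous_on {0..<T} (\<lambda>t. LBINT x. w t x \<bullet> g x)"
proof -
  note [measurable] = g
  have "integrable lborel (\<lambda>x. ind \<Omega> x * (norm (g x))^2)"
  proof (rule bochner_bound)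
    show "integrable lborel (\<lambda>x. B^2 * ind \<Omega> x)" using bounded_integrable_indicator[OF Omega] by simp
    show "(\<lambda>x. ind \<Omega> x * (norm (g x))^2) \<in> borel_measurable lborel" using borel_sets(1) by measurable
    show "AE x in lborel. norm (ind \<Omega> x * (norm (g x))^2) \<le> norm (B^2 * ind \<Omega> x)"
      using B by (intro AE_I2) (simp add: indicator_def power_mono)
  qed
  then have "integrable (lebesgue_on \<Omega>) (\<lambda>x. (norm (g x))^2)"
    by (subst integral_lebesgue_on_eq(2)[OF borel_sets(1), where f="\<lambda>x. (norm (g x))^2"]) simp_all
  then have "g \<in> Lp_space 2 (lebesgue_on \<Omega>)" using borel_measurable_lebesgue_on[OF g] by (simp add: Lp_space_2)
  from pairing_dual[OF this] have "continuous_on {0..<T} (\<lambda>t. LINT x|lebesgue_on \<Omega>. u t x \<bullet> g x)"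
    using sol by (auto simp: weak_euler_solution_def weakly_continuous_solenoidal_def)
  moreover have "(LINT x|lebesgue_on \<Omega>. u t x \<bullet> g x) = (LBINT x. w t x \<bullet> g x)" if t: "t \<in> {0..<T}" for t
  proof -
    note [measurable] = wm[OF t]
    have hm: "(\<lambda>x. w t x \<bullet> g x) \<in> borel_measurable borel" by measurable
    show ?thesis by (rule integral_u_Omega(1)[OF t, of "\<lambda>x v. v \<bullet> g x", OF hm]) simp
  qed
  ultimately show ?thesis by (rule continuous_on_eq)
qed

lemma w_bounded: "b < T ==> \<exists>B. \<forall>t\<in>{0..b}. (LBINT x. (norm (w t x))^2) \<le> B"
proof -
  assume b: "b < T"
  have "u \<in> weakly_continuous_solenoidal T \<Omega>" using sol by (simp add: weak_euler_solution_def)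
  from solenoidal_norm_bounded[OF this b] obtain B where
    "\<forall>t\<in>{0..b}. (LINT x|lebesgue_on \<Omega>. (norm (u t x))^2) \<le> B" ..
  then have "\<forall>t\<in>{0..b}. (LBINT x. (norm (w t x))^2) \<le> B" using energy_eq(1) b by simp
  then show ?thesis by blast
qed

lemma uB_M: "AE t in lborel. t \<in> I --> (AE x in lborel. x \<in> S --> norm (uB (t, x)) \<le> M t)"
  using M(3) wB
proof eventually_elim
  case (elim t)
  show ?case
  proof
    assume t: "t \<in> I"
    have "AE x in lborel. x \<in> S --> norm (u t x) \<le> M t" using elim t by blast
    moreover have "AE x in lborel. x \<in> \<Omega> --> w t x = u t x" by (rule wu) (use t in simp)
    ultimately show "AE x in lborel. x \<in> S --> norm (uB (t, x)) \<le> M t"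
    proof eventually_elim
      case inner: (elim x)
      then show ?case using elim t by (auto simp: boundary_strip_def)
    qed
  qed
qed

lemma qB_P: "AE t in lborel. t \<in> I --> (AE x in lborel. x \<in> S --> \<bar>qB (t, x)\<bar> \<le> P t)"
  using P(3) qBp
proof eventually_elim
  case (elim t)
  show ?case
  proof
    assume t: "t \<in> I"
    then have "AE x in lborel. x \<in> S --> norm (p t x) \<le> P t" "AE x in lborel. x \<in> S --> qB (t, x) = p t x"
      using elim by auto
    then show "AE x in lborel. x \<in> S --> \<bar>qB (t, x)\<bar> \<le> P t" by eventually_elim simp
  qed
qed

text \<open>In the strip the cube is at most M^3 on a set of finite measure, in the interior it is
  the third power of the spatial norm; both are integrable in time, and the two regions cover the
  domain.\<close>

lemma uB_cube: "integrable lborel (\<lambda>z. norm (uB z) ^ 3)"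
proof -
  have e2: "0 < \<epsilon> / 2" using \<epsilon> by simp
  let ?U = "U (\<epsilon> / 2)" and ?m = "measure lborel \<Omega>"
  have three: "(3::real) > 0" by simp
  have UL: "AE t in lborel. t \<in> I --> u t \<in> Lp_space 3 (lebesgue_on ?U)"
    and L: "(\<lambda>t. Lp_norm 3 (lebesgue_on ?U) (u t)) \<in> Lp_space 3 (lebesgue_on I)"
    using besov_U[OF e2] by (auto simp: Lq_besov_c0_def LqLp_space_def AE_lebesgue_on)
  obtain H where H: "\<And>t. 0 \<le> H t" "AE t in lborel. t \<in> I --> H t = \<bar>Lp_norm 3 (lebesgue_on ?U) (u t)\<bar>"
    "integrable lborel (\<lambda>t. ind I t * H t powr 3)"
    by (rule time_representative[OF L three]) (rule that; assumption)
  have H3: "integrable lborel (\<lambda>t. ind I t * H t ^ 3)" using H(1,3) by simp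
  have mi: "integrable lborel (ind \<Omega> :: 'a => real)" by (rule bounded_integrable_indicator[OF Omega])
  have sec: "AE t in lborel. (\<integral>\<^sup>+x. ennreal (norm (uB (t, x)) ^ 3) \<partial>lborel) \<le> ennreal (?m * (ind I t * M t ^ 3) + ind I t * H t ^ 3)"
    using uB_M UL H(2) wB
  proof eventually_elim
    case (elim t)
    show ?case
    proof (cases "t \<in> I")
      case True
      then have t: "t \<in> {0..<T}" by simp
      have wB': "\<And>x. w t x = uB (t, x)" using elim True by simp
      note [measurable] = wm[OF t] borel_sets
      have ui: "integrable (lebesgue_on ?U) (\<lambda>x. norm (u t x) ^ 3)" using elim True by (simp add: Lp_space_def)
      have "(\<lambda>x. norm (w t x) ^ 3) \<in> borel_measurable borel" by measurable
      note eq = integral_u[where h="\<lambda>x v. norm v ^ 3", OF t borel_sets(3)[of "\<epsilon> / 2"] _ this]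
      have wi: "integrable lborel (\<lambda>x. ind ?U x * norm (w t x) ^ 3)" using eq(2) ui by auto
      have Ht: "H t = Lp_norm 3 (lebesgue_on ?U) (u t)" using elim True by (simp add: Lp_norm_def)
      have "H t ^ 3 = H t powr 3" using H(1) by simp
      also have "\<dots> = (LINT x|lebesgue_on ?U. norm (u t x) ^ 3)" unfolding Ht by (simp add: Lp_norm_powr)
      also have "\<dots> = (LBINT x. ind ?U x * norm (w t x) ^ 3)" by (rule eq(1)) auto
      finally have Heq: "H t ^ 3 = (LBINT x. ind ?U x * norm (w t x) ^ 3)" .
      let ?g = "\<lambda>x. M t ^ 3 * ind \<Omega> x + ind ?U x * norm (w t x) ^ 3"
      have gi: "integrable lborel ?g" using mi wi by simp
      have "(\<integral>\<^sup>+x. ennreal (norm (uB (t, x)) ^ 3) \<partial>lborel) \<le> (\<integral>\<^sup>+x. ennreal (?g x) \<partial>lborel)"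
      proof (rule nn_integral_mono_AE)
        have "AE x in lborel. x \<in> S --> norm (uB (t, x)) \<le> M t" using elim True by blast
        then show "AE x in lborel. ennreal (norm (uB (t, x)) ^ 3) \<le> ennreal (?g x)"
        proof eventually_elim
          case inner: (elim x)
          have M0: "0 \<le> M t ^ 3" using M(1) by simp
          consider "x \<notin> \<Omega>" | "x \<in> ?U" | "x \<in> S" "x \<in> \<Omega>" using Omega_cover[of x] by blast
          then have "norm (uB (t, x)) ^ 3 \<le> ?g x"
          proof cases
            case 1
            then show ?thesis using uB0[of "(t, x)"] by simp
          next
            case 2
            then show ?thesis using M0 by (simp add: wB')
          next
            case 3
            then have "norm (uB (t, x)) ^ 3 \<le> M t ^ 3" using inner by (intro power_mono) auto
            then show ?thesis using 3 by (simp add: add_increasing2)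
          qed
          then show ?case by (rule ennreal_leI)
        qed
      qed
      also have "\<dots> = ennreal (integral\<^sup>L lborel ?g)" using M(1) by (intro nn_integral_eq_integral[OF gi]) simp
      also have "integral\<^sup>L lborel ?g = ?m * (ind I t * M t ^ 3) + ind I t * H t ^ 3"
        using mi wi True by (simp add: Heq)
      finally show ?thesis .
    next
      case False
      then have "uB (t, x) = 0" for x using uB0[of "(t, x)"] by auto
      then show ?thesis by simp
    qed
  qed
  have ti: "integrable lborel (\<lambda>t. ?m * (ind I t * M t ^ 3) + ind I t * H t ^ 3)" using M(2) H3 by simp
  have "(\<integral>\<^sup>+z. ennreal (norm (uB z) ^ 3) \<partial>lborel) = (\<integral>\<^sup>+z. ennreal (norm (uB z) ^ 3) \<partial>(lborel \<Otimes>\<^sub>M lborel))"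
    by (simp only: lborel_prod)
  also have "\<dots> = (\<integral>\<^sup>+t. \<integral>\<^sup>+x. ennreal (norm (uB (t, x)) ^ 3) \<partial>lborel \<partial>lborel)"
    by (rule lborel.nn_integral_fst[symmetric]) measurable
  also have "\<dots> \<le> (\<integral>\<^sup>+t. ennreal (?m * (ind I t * M t ^ 3) + ind I t * H t ^ 3) \<partial>lborel)"
    by (rule nn_integral_mono_AE[OF sec])
  also have "\<dots> = ennreal (LBINT t. ?m * (ind I t * M t ^ 3) + ind I t * H t ^ 3)"
    using M(1) H(1) by (intro nn_integral_eq_integral[OF ti]) simp
  also have "\<dots> < \<infinity>" by simp
  finally show ?thesis using uB by (intro integrableI_nonneg) auto
qed

lemma cube_diff_le: "norm (a - b) ^ 3 \<le> 4 * norm a ^ 3 + 4 * norm (b::'a) ^ 3"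
proof -
  have conv: "(r + s) ^ 3 \<le> 4 * r ^ 3 + 4 * s ^ 3" if "0 \<le> r" "0 \<le> s" for r s :: real
  proof -
    have "4 * r ^ 3 + 4 * s ^ 3 - (r + s) ^ 3 = 3 * ((r + s) * (r - s)^2)"
      by (simp add: power2_eq_square power3_eq_cube algebra_simps)
    moreover have "0 \<le> (r + s) * (r - s)^2" using that by simp
    ultimately show ?thesis by linarith
  qed
  have "norm (a - b) ^ 3 \<le> (norm a + norm b) ^ 3" by (intro power_mono norm_triangle_ineq4) auto
  also have "\<dots> \<le> 4 * norm a ^ 3 + 4 * norm b ^ 3" by (rule conv) auto
  finally show ?thesis .
qed

lemma shifted_cube: "integrable lborel (\<lambda>y. norm (uB (c + y)) ^ 3)"
proof (rule integrableI_nonneg)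
  show "(\<lambda>y. norm (uB (c + y)) ^ 3) \<in> borel_measurable lborel" using uB by measurable
  have "(\<integral>\<^sup>+y. ennreal (norm (uB (c + y)) ^ 3) \<partial>lborel) = (\<integral>\<^sup>+y. ennreal (norm (uB y) ^ 3) \<partial>lborel)"
    by (rule nn_integral_lborel_shift) (use uB in measurable)
  then show "(\<integral>\<^sup>+y. ennreal (norm (uB (c + y)) ^ 3) \<partial>lborel) < \<infinity>"
    using nn_integral_eq_integral[OF uB_cube] by simp
qed simp

text \<open>The real-valued norm would be 0 by default for a non-integrable increment. Integrability
  of the cubes of \<open>uB\<close> and of its translate rules this out, so the norm really equals
  the extended integral.\<close>

lemma increment_integral:
  assumes a: "0 < a"
  defines "V z \<equiv> {x \<in> \<Omega>. a < infdist x (frontier \<Omega>) \<and> x + z \<in> \<Omega> \<and> a < infdist (x + z) (frontier \<Omega>)}"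
  shows "(\<integral>\<^sup>+\<sigma>. \<integral>\<^sup>+x. ennreal (ind I \<sigma> * ind (V z) x * norm (uB (\<sigma>, x + z) - uB (\<sigma>, x)) ^ 3) \<partial>lborel \<partial>lborel)
    = ennreal (LqLp_norm 3 3 T (U a \<inter> (\<lambda>x. x - z) ` U a) (\<lambda>t x. u t (x + z) - u t x) powr 3)"
proof -
  have Veq: "U a \<inter> (\<lambda>x. x - z) ` U a = V z"
  proof -
    have "x \<in> (\<lambda>x. x - z) ` U a \<longleftrightarrow> x + z \<in> U a" for x by (auto simp: image_iff algebra_simps intro!: bexI[of _ "x + z"])
    then show ?thesis by (auto simp: V_def)
  qed
  have "open ((\<lambda>x. x - z) ` U a)" using open_translation_subtract[OF open_U[of a], of z] by simp
  then have "open (V z)" using open_U[of a] by (simp add: Veq[symmetric] open_Int)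
  then have Vb [measurable]: "V z \<in> sets borel" by simp
  let ?D = "\<lambda>\<sigma> x. norm (uB (\<sigma>, x + z) - uB (\<sigma>, x)) ^ 3"
  let ?F = "\<lambda>\<sigma> x. ind I \<sigma> * ind (V z) x * ?D \<sigma> x :: real"
  let ?k = "\<lambda>\<sigma>. LBINT x. ind (V z) x * ?D \<sigma> x"
  have Fm: "case_prod ?F \<in> borel_measurable (lborel \<Otimes>\<^sub>M lborel)" by measurable
  have km [measurable]: "?k \<in> borel_measurable borel"
  proof -
    have "(\<lambda>(\<sigma>, x). ind (V z) x * ?D \<sigma> x) \<in> borel_measurable (borel \<Otimes>\<^sub>M lborel)" by measurable
    from lborel.borel_measurable_lebesgue_integral[OF this] show ?thesis by simp
  qed
  have "integrable lborel (\<lambda>y. 4 * norm (uB ((0, z) + y)) ^ 3 + 4 * norm (uB y) ^ 3)"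
    using shifted_cube[of "(0, z)"] uB_cube by simp
  then have dom: "integrable (lborel \<Otimes>\<^sub>M lborel) (\<lambda>y. 4 * norm (uB ((0, z) + y)) ^ 3 + 4 * norm (uB y) ^ 3)"
    by (simp only: lborel_prod)
  have Fi: "integrable (lborel \<Otimes>\<^sub>M lborel) (case_prod ?F)"
  proof (rule bochner_bound[OF dom Fm])
    show "AE y in lborel \<Otimes>\<^sub>M lborel. norm (case_prod ?F y) \<le> norm (4 * norm (uB ((0, z) + y)) ^ 3 + 4 * norm (uB y) ^ 3)"
    proof (rule AE_I2)
      fix y :: "real \<times> 'a"
      obtain \<sigma> x where y: "y = (\<sigma>, x)" by (cases y)
      have "\<bar>?F \<sigma> x\<bar> \<le> ?D \<sigma> x" by (simp add: indicator_def)
      also have "\<dots> \<le> 4 * norm (uB (\<sigma>, x + z)) ^ 3 + 4 * norm (uB (\<sigma>, x)) ^ 3" by (rule cube_diff_le)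
      finally show "norm (case_prod ?F y) \<le> norm (4 * norm (uB ((0, z) + y)) ^ 3 + 4 * norm (uB y) ^ 3)"
        by (simp add: y add.commute)
    qed
  qed
  have inner: "AE \<sigma> in lborel. \<sigma> \<in> I -->
      norm (Lp_norm 3 (lebesgue_on (V z)) (\<lambda>x. u \<sigma> (x + z) - u \<sigma> x)) powr 3 = ?k \<sigma>"
    using wB
  proof eventually_elim
    case (elim \<sigma>)
    show ?case
    proof
      assume \<sigma>: "\<sigma> \<in> I"
      have wB': "\<And>x. w \<sigma> x = uB (\<sigma>, x)" using elim \<sigma> by simp
      have ae: "AE x in lborel. x \<in> \<Omega> --> w \<sigma> x = u \<sigma> x" by (rule wu) (use \<sigma> in simp)
      have Dm: "?D \<sigma> \<in> borel_measurable borel" by measurable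
      have "AE x in lborel. x \<in> V z --> norm (u \<sigma> (x + z) - u \<sigma> x) ^ 3 = ?D \<sigma> x"
        using ae AE_lborel_shift[OF ae, of z] by eventually_elim (simp add: V_def wB')
      from integral_lebesgue_on_eq(1)[OF Vb Dm this]
      have "(LINT x|lebesgue_on (V z). norm (u \<sigma> (x + z) - u \<sigma> x) ^ 3) = ?k \<sigma>" .
      moreover have "norm (Lp_norm 3 (lebesgue_on (V z)) (\<lambda>x. u \<sigma> (x + z) - u \<sigma> x)) powr 3
          = Lp_norm 3 (lebesgue_on (V z)) (\<lambda>x. u \<sigma> (x + z) - u \<sigma> x) powr 3" by (simp add: Lp_norm_def)
      ultimately show "norm (Lp_norm 3 (lebesgue_on (V z)) (\<lambda>x. u \<sigma> (x + z) - u \<sigma> x)) powr 3 = ?k \<sigma>"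
        by (simp add: Lp_norm_powr)
    qed
  qed
  have Ib: "I \<in> sets borel" by simp
  have three: "(3::real) > 0" by simp
  have "LqLp_norm 3 3 T (V z) (\<lambda>t x. u t (x + z) - u t x) powr 3
      = (LINT \<sigma>|lebesgue_on I. norm (Lp_norm 3 (lebesgue_on (V z)) (\<lambda>x. u \<sigma> (x + z) - u \<sigma> x)) powr 3)"
    unfolding LqLp_norm_def by (rule Lp_norm_powr[OF three])
  also have "\<dots> = (LBINT \<sigma>. ind I \<sigma> * ?k \<sigma>)" by (rule integral_lebesgue_on_eq(1)[OF Ib km inner])
  also have "\<dots> = (LBINT \<sigma>. LBINT x. ?F \<sigma> x)" by (simp add: mult.assoc)
  also have "\<dots> = integral\<^sup>L (lborel \<Otimes>\<^sub>M lborel) (case_prod ?F)" by (rule lborel_pair.integral_fst'[OF Fi, simplified])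
  finally have 1: "LqLp_norm 3 3 T (V z) (\<lambda>t x. u t (x + z) - u t x) powr 3 = integral\<^sup>L (lborel \<Otimes>\<^sub>M lborel) (case_prod ?F)" .
  have "(\<integral>\<^sup>+\<sigma>. \<integral>\<^sup>+x. ennreal (?F \<sigma> x) \<partial>lborel \<partial>lborel) = (\<integral>\<^sup>+y. ennreal (case_prod ?F y) \<partial>(lborel \<Otimes>\<^sub>M lborel))"
    using lborel.nn_integral_fst[of "\<lambda>y. ennreal (case_prod ?F y)" lborel] Fm by simp
  also have "\<dots> = ennreal (integral\<^sup>L (lborel \<Otimes>\<^sub>M lborel) (case_prod ?F))"
    by (rule nn_integral_eq_integral[OF Fi]) (intro AE_I2, simp add: case_prod_beta')
  finally show ?thesis unfolding Veq 1 .
qed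

text \<open>The Besov condition says that the norm is o(|z|^(1/3)); its third power is o(|z|). The
  threshold s is the cube root of e.\<close>

lemma increments_small:
  assumes a: "0 < a" and e: "0 < e"
  shows "\<exists>r>0. \<forall>z. z \<noteq> 0 --> norm z < r -->
      (\<integral>\<^sup>+\<sigma>. \<integral>\<^sup>+x. ennreal (ind I \<sigma> *
         ind {x \<in> \<Omega>. a < infdist x (frontier \<Omega>) \<and> x + z \<in> \<Omega> \<and> a < infdist (x + z) (frontier \<Omega>)} x *
         norm (uB (\<sigma>, x + z) - uB (\<sigma>, x)) ^ 3) \<partial>lborel \<partial>lborel) \<le> ennreal (e * norm z)"
proof -
  let ?L = "\<lambda>z. LqLp_norm 3 3 T (U a \<inter> (\<lambda>x. x - z) ` U a) (\<lambda>t x. u t (x + z) - u t x)"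
  define s where "s = e powr (1/3)"
  have s: "0 < s" "s powr 3 = e" using e by (simp_all add: s_def powr_powr)
  have lim: "((\<lambda>z. ?L z / norm z powr (1/3)) \<longlongrightarrow> 0) (at 0)"
    using besov_U[OF a] by (simp add: Lq_besov_c0_def)
  obtain r where r: "r > 0" "\<And>z. z \<noteq> 0 ==> norm z < r ==> ?L z / norm z powr (1/3) < s"
    using order_tendstoD(2)[OF lim s(1)] unfolding eventually_at by (auto simp: dist_norm)
  have "?L z powr 3 \<le> e * norm z" if z: "z \<noteq> 0" "norm z < r" for z
  proof -
    have "?L z < s * norm z powr (1/3)" using r(2)[OF z] z(1) by (simp add: pos_divide_less_eq)
    then have "?L z powr 3 \<le> (s * norm z powr (1/3)) powr 3"
      by (intro powr_mono2) (auto simp: LqLp_norm_def Lp_norm_def)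
    also have "\<dots> = e * norm z" using s by (simp add: powr_mult powr_powr)
    finally show ?thesis .
  qed
  then show ?thesis using r(1) by (intro exI[of _ r]) (simp add: increment_integral[OF a] ennreal_leI)
qed

text \<open>Product test functions separate time and space. The pressure has a representative only
  in the strip, and it may replace p because the divergence of \<psi> vanishes elsewhere.\<close>

lemma weak_form:
  assumes \<psi>: "\<psi> \<in> test_functions \<Omega>" and div: "\<And>y. y \<notin> S ==> divergence \<psi> y = 0"
    and \<phi>: "\<phi> \<in> test_functions I" and \<phi>': "\<And>t. (\<phi> has_real_derivative \<phi>' t) (at t)" "continuous_on UNIV \<phi>'"
  shows "(LBINT t. ind I t * (\<phi>' t * (LBINT x. w t x \<bullet> \<psi> x)
         + \<phi> t * flux (\<lambda>x. uB (t, x)) (\<lambda>x. qB (t, x)) \<psi>)) = 0"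
proof -
  let ?D = "\<lambda>y. fderiv \<psi> y"
  note \<psi>m [measurable] = test_function_borel[OF \<psi>]
  note [measurable] = test_function_flux_data(1,2)[OF \<psi>]
  have [measurable]: "\<phi>' \<in> borel_measurable borel" "\<phi> \<in> borel_measurable borel"
    using \<phi>'(2) test_function_borel[OF \<phi>] by (auto intro: borel_measurable_continuous_onI)
  obtain B where B: "B > 0" "\<And>x. norm (\<psi> x) \<le> B" "\<And>x h. norm (?D x h) \<le> B * norm h"
    by (rule test_function_bounds[OF \<psi>]) (rule that; assumption)
  let ?g = "\<lambda>t x. u t x \<bullet> vector_derivative (\<lambda>s. \<phi> s *\<^sub>R \<psi> x) (at t) + tensor_grad (u t x) (\<lambda>y. \<phi> t *\<^sub>R \<psi> y) x
           + p t x * divergence (\<lambda>y. \<phi> t *\<^sub>R \<psi> y) x"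
  let ?R = "\<lambda>t. \<phi>' t * (LBINT x. w t x \<bullet> \<psi> x) + \<phi> t * flux (\<lambda>x. uB (t, x)) (\<lambda>x. qB (t, x)) \<psi>"
  have g: "?g t x = \<phi>' t * (u t x \<bullet> \<psi> x) + \<phi> t * (?D x (u t x) \<bullet> u t x + p t x * divergence \<psi> x)" for t x
    unfolding separated_derivatives[OF \<phi>'(1) \<psi>] by (simp add: algebra_simps)
  have "(\<lambda>z. \<phi> (fst z) *\<^sub>R \<psi> (snd z)) \<in> test_functions (I \<times> \<Omega>)" by (rule test_function_product[OF \<phi> \<psi>])
  then have eq0: "(LINT t|lebesgue_on I. LINT x|lebesgue_on \<Omega>. ?g t x) = 0"
    using sol unfolding weak_euler_solution_def by fastforce
  have inner: "AE t in lborel. t \<in> I --> (LINT x|lebesgue_on \<Omega>. ?g t x) = ind I t * ?R t"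
    using wB qBp qB_P
  proof eventually_elim
    case (elim t)
    show ?case
    proof
      assume tI: "t \<in> I"
      then have t: "t \<in> {0..<T}" by simp
      have wB': "\<And>x. w t x = uB (t, x)" using elim tI by simp
      have qp: "AE x in lborel. x \<in> S --> qB (t, x) = p t x" and qP: "AE x in lborel. x \<in> S --> \<bar>qB (t, x)\<bar> \<le> P t"
        using elim tI by auto
      note [measurable] = wm[OF t] borel_sets
      have [measurable]: "(\<lambda>x. ?D x (w t x)) \<in> borel_measurable borel"
        unfolding linear_expand[OF test_function_flux_data(3)[OF \<psi>], of _ "w t _"] by measurable
      let ?h = "\<lambda>x. ?D x (w t x) \<bullet> w t x + qB (t, x) * divergence \<psi> x"
      let ?f = "\<lambda>x. \<phi>' t * (w t x \<bullet> \<psi> x) + \<phi> t * ?h x"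
      have hm: "?h \<in> borel_measurable borel" by measurable
      have fm: "?f \<in> borel_measurable borel" by measurable
      have "AE x in lborel. x \<in> \<Omega> --> ?g t x = ?f x"
        using wu[OF t] qp
      proof eventually_elim
        case inner: (elim x)
        show ?case
        proof
          assume "x \<in> \<Omega>"
          then have "w t x = u t x" using inner by blast
          moreover have "p t x * divergence \<psi> x = qB (t, x) * divergence \<psi> x" using inner div[of x] by (cases "x \<in> S") auto
          ultimately show "?g t x = ?f x" unfolding g by simp
        qed
      qed
      from integral_lebesgue_on_eq(1)[OF borel_sets(1) fm this]
      have "(LINT x|lebesgue_on \<Omega>. ?g t x) = (LBINT x. ind \<Omega> x * ?f x)" .
      also have "(\<lambda>x. ind \<Omega> x * ?f x) = ?f"
      proof
        fix x
        show "ind \<Omega> x * ?f x = ?f x"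
          using w0[OF t, of x] div[of x] by (cases "x \<in> \<Omega>") (auto simp: boundary_strip_def)
      qed
      also have "(LBINT x. ?f x) = \<phi>' t * (LBINT x. w t x \<bullet> \<psi> x) + \<phi> t * (LBINT x. ?h x)"
      proof -
        have 1: "integrable lborel (\<lambda>x. w t x \<bullet> \<psi> x)"
          by (rule integral_Cauchy_Schwarz(1)) (use wm[OF t] \<psi>m energy_eq(2)[OF t] test_function_square_integrable(2)[OF \<psi> Omega(2)] in simp_all)
        have Si: "integrable lborel (ind S :: 'a => real)"
          by (rule bounded_integrable_indicator[OF open_S bounded_subset[OF Omega(2)]]) (auto simp: boundary_strip_def)
        have 2: "integrable lborel ?h"
        proof (rule bochner_bound)
          show "integrable lborel (\<lambda>x. B * (norm (w t x))^2 + P t * (real DIM('a) * B) * ind S x)"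
            using energy_eq(2)[OF t] Si by simp
          show "?h \<in> borel_measurable lborel" using hm by simp
          show "AE x in lborel. norm (?h x) \<le> norm (B * (norm (w t x))^2 + P t * (real DIM('a) * B) * ind S x)"
            using qP
          proof eventually_elim
            case inner: (elim x)
            have "\<bar>?D x (w t x) \<bullet> w t x\<bar> \<le> norm (?D x (w t x)) * norm (w t x)" by (rule Cauchy_Schwarz_ineq2)
            also have "\<dots> \<le> B * norm (w t x) * norm (w t x)" by (rule mult_right_mono[OF B(3)]) simp
            finally have a: "\<bar>?D x (w t x) \<bullet> w t x\<bar> \<le> B * (norm (w t x))^2" by (simp add: power2_eq_square)
            have b: "\<bar>qB (t, x) * divergence \<psi> x\<bar> \<le> P t * (real DIM('a) * B) * ind S x"
            proof (cases "x \<in> S")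
              case True
              have "\<bar>divergence \<psi> x\<bar> \<le> real DIM('a) * B" unfolding divergence_def by (rule divergence_le[OF B(3)])
              then have "\<bar>qB (t, x)\<bar> * \<bar>divergence \<psi> x\<bar> \<le> P t * (real DIM('a) * B)"
                using inner True P(1) by (intro mult_mono) auto
              then show ?thesis using True by (simp add: abs_mult)
            qed (simp add: div)
            have "norm (?h x) \<le> B * (norm (w t x))^2 + P t * (real DIM('a) * B) * ind S x"
              using a b unfolding real_norm_def by linarith
            then show ?case by (rule order_trans) simp
          qed
        qed
        show ?thesis using 1 2 by simp
      qed
      also have "(LBINT x. ?h x) = flux (\<lambda>x. uB (t, x)) (\<lambda>x. qB (t, x)) \<psi>" by (simp add: flux_def wB')
      finally show "(LINT x|lebesgue_on \<Omega>. ?g t x) = ind I t * ?R t" using tI by simp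
    qed
  qed
  have Ib: "I \<in> sets borel" by simp
  have "continuous_on {0<..<T} (\<lambda>t. LBINT x. w t x \<bullet> \<psi> x)"
    by (rule continuous_on_subset[OF w_weakly_continuous[OF \<psi>m B(2)]]) auto
  from borel_measurable_continuous_on_indicator[OF Ib this]
  have m1 [measurable]: "(\<lambda>t. ind I t * (LBINT x. w t x \<bullet> \<psi> x)) \<in> borel_measurable borel" by simp
  note m2 [measurable] = flux_section_measurable[OF uB qB \<psi>]
  have "(\<lambda>t. \<phi>' t * (ind I t * (LBINT x. w t x \<bullet> \<psi> x)) + ind I t * (\<phi> t * flux (\<lambda>x. uB (t, x)) (\<lambda>x. qB (t, x)) \<psi>)) \<in> borel_measurable borel"
    by measurable
  then have Rm: "(\<lambda>t. ind I t * ?R t) \<in> borel_measurable borel" by (simp add: distrib_left mult.left_commute)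
  have "0 = (LBINT t. ind I t * (ind I t * ?R t))"
    using integral_lebesgue_on_eq(1)[OF Ib Rm inner] eq0 by simp
  also have "\<dots> = (LBINT t. ind I t * ?R t)" by (simp add: mult.assoc[symmetric] indicator_inter_arith[symmetric])
  finally show ?thesis by simp
qed

lemma euler_data_axioms: "euler_data \<Omega> S T w uB qB M P"
proof (rule euler_data.intro)
  have "integrable lborel (\<lambda>t. ind I t * M t ^ 3 + ind I t * P t powr (3/2))" using M(2) P(2) by simp
  then show "integrable lborel (\<lambda>t. ind I t * (M t ^ 3 + P t powr (3/2)))" by (simp add: distrib_left)
  show "S \<subseteq> \<Omega>" by (auto simp: boundary_strip_def)
qed (fact Tpos Omega w_solenoidal w_weakly_continuous w_bounded uB uB_cube wB qB M(1) P(1) uB_M qB_P weak_form)+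

text \<open>For each small \<delta> a majorant is chosen whose cube has integral equal to the third
  power of the mixed norm, so the assumed convergence of the norms becomes convergence of these
  integrals. Outside (0, \<delta>0) the zero function only makes the choice total.\<close>

lemma wall_normal_majorant:
  obtains \<delta>0 N where "0 < \<delta>0" "\<And>\<delta> \<sigma>. 0 \<le> N \<delta> \<sigma>"
    "\<And>\<delta>. 0 < \<delta> ==> \<delta> < \<delta>0 ==> integrable lborel (\<lambda>\<sigma>. ind I \<sigma> * N \<delta> \<sigma> ^ 3)"
    "\<And>\<delta>. 0 < \<delta> ==> \<delta> < \<delta>0 ==> AE \<sigma> in lborel. \<sigma> \<in> I --> (AE x in lborel. x \<in> boundary_strip \<Omega> \<delta> -->
        \<bar>outward_normal \<Omega> (closest_point (frontier \<Omega>) x) \<bullet> uB (\<sigma>, x)\<bar> \<le> N \<delta> \<sigma>)"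
    "((\<lambda>\<delta>. LBINT \<sigma>. ind I \<sigma> * N \<delta> \<sigma> ^ 3) \<longlongrightarrow> 0) (at_right 0)"
proof -
  let ?B = "boundary_strip \<Omega>" and ?W = "wall_normal_component \<Omega> u"
  let ?n = "\<lambda>x. outward_normal \<Omega> (closest_point (frontier \<Omega>) x)"
  obtain \<delta>0 where \<delta>0: "\<delta>0 > 0" "\<And>\<delta>. 0 < \<delta> ==> \<delta> < \<delta>0 ==> ?W \<in> LqLinf_space 3 T (?B \<delta>)"
    using normal unfolding normal_velocity_vanishes_def eventually_at_right_field by auto
  have Bb: "?B \<delta> \<in> sets borel" for \<delta> using boundary_strip_open[OF Omega(1)] by (rule borel_open)
  let ?P = "\<lambda>\<delta> H. (\<forall>t. 0 \<le> H t) \<and> (0 < \<delta> \<and> \<delta> < \<delta>0 --> integrable lborel (\<lambda>t. ind I t * H t ^ 3) \<and>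
      (LBINT t. ind I t * H t ^ 3) = LqLinf_norm 3 T (?B \<delta>) ?W ^ 3 \<and>
      (AE t in lborel. t \<in> I --> (AE x in lborel. x \<in> ?B \<delta> --> norm (?W t x) \<le> H t)))"
  have "\<forall>\<delta>. \<exists>H. ?P \<delta> H"
  proof
    fix \<delta> show "\<exists>H. ?P \<delta> H"
    proof (cases "0 < \<delta> \<and> \<delta> < \<delta>0")
      case True
      have W: "?W \<in> LqLinf_space 3 T (?B \<delta>)" using \<delta>0(2) True by blast
      have three: "(3::real) > 0" by simp
      obtain H where H: "\<And>t. 0 \<le> H t" "integrable lborel (\<lambda>t. ind I t * H t powr 3)"
        "(LBINT t. ind I t * H t powr 3) = LqLinf_norm 3 T (?B \<delta>) ?W powr 3"
        "AE t in lborel. t \<in> I --> (AE x in lborel. x \<in> ?B \<delta> --> norm (?W t x) \<le> H t)"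
        by (rule LqLinf_majorant[OF W Bb three]) (rule that; assumption)
      have "0 \<le> LqLinf_norm 3 T (?B \<delta>) ?W" by (simp add: LqLinf_norm_def Lp_norm_def)
      then show ?thesis using H by (intro exI[of _ H]) simp
    qed (auto intro!: exI[of _ "\<lambda>_. 0"])
  qed
  from choice[OF this] obtain N where N': "\<forall>\<delta>. ?P \<delta> (N \<delta>)" ..
  have N: "\<And>\<delta> t. 0 \<le> N \<delta> t" "\<And>\<delta>. 0 < \<delta> ==> \<delta> < \<delta>0 ==> integrable lborel (\<lambda>t. ind I t * N \<delta> t ^ 3)"
    "\<And>\<delta>. 0 < \<delta> ==> \<delta> < \<delta>0 ==> (LBINT t. ind I t * N \<delta> t ^ 3) = LqLinf_norm 3 T (?B \<delta>) ?W ^ 3"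
    "\<And>\<delta>. 0 < \<delta> ==> \<delta> < \<delta>0 ==> AE t in lborel. t \<in> I --> (AE x in lborel. x \<in> ?B \<delta> --> norm (?W t x) \<le> N \<delta> t)"
    using N' by blast+
  show ?thesis
  proof (rule that[OF \<delta>0(1) N(1,2)])
    fix \<delta> assume \<delta>: "0 < \<delta>" "\<delta> < \<delta>0"
    show "AE \<sigma> in lborel. \<sigma> \<in> I --> (AE x in lborel. x \<in> ?B \<delta> --> \<bar>?n x \<bullet> uB (\<sigma>, x)\<bar> \<le> N \<delta> \<sigma>)"
      using N(4)[OF \<delta>] wB
    proof eventually_elim
      case (elim \<sigma>)
      show ?case
      proof
        assume \<sigma>: "\<sigma> \<in> I"
        have "AE x in lborel. x \<in> ?B \<delta> --> norm (?W \<sigma> x) \<le> N \<delta> \<sigma>" using elim \<sigma> by blast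
        moreover have "AE x in lborel. x \<in> \<Omega> --> w \<sigma> x = u \<sigma> x" by (rule wu) (use \<sigma> in simp)
        ultimately show "AE x in lborel. x \<in> ?B \<delta> --> \<bar>?n x \<bullet> uB (\<sigma>, x)\<bar> \<le> N \<delta> \<sigma>"
        proof eventually_elim
          case inner: (elim x)
          then show ?case using elim \<sigma> by (auto simp: boundary_strip_def wall_normal_component_def)
        qed
      qed
    qed
  next
    have a: "((\<lambda>\<delta>. LqLinf_norm 3 T (?B \<delta>) ?W ^ 3) \<longlongrightarrow> 0 ^ 3) (at_right 0)"
      using normal unfolding normal_velocity_vanishes_def by (intro tendsto_power) blast
    have b: "\<forall>\<^sub>F \<delta> in at_right 0. LqLinf_norm 3 T (?B \<delta>) ?W ^ 3 = (LBINT \<sigma>. ind I \<sigma> * N \<delta> \<sigma> ^ 3)"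
      unfolding eventually_at_right_field using \<delta>0(1) N(3) by (intro exI[of _ \<delta>0]) auto
    show "((\<lambda>\<delta>. LBINT \<sigma>. ind I \<sigma> * N \<delta> \<sigma> ^ 3) \<longlongrightarrow> 0) (at_right 0)"
      using Lim_transform_eventually[OF a b] by simp
  qed assumption+
qed

lemma energy_conservation:
  assumes t: "t \<in> {0..<T}"
  shows "(LINT x|lebesgue_on \<Omega>. (norm (u t x))^2) = (LINT x|lebesgue_on \<Omega>. (norm (u 0 x))^2)"
proof -
  obtain \<delta>0 N where N: "0 < \<delta>0" "\<And>\<delta> \<sigma>. 0 \<le> N \<delta> \<sigma>"
    "\<And>\<delta>. 0 < \<delta> ==> \<delta> < \<delta>0 ==> integrable lborel (\<lambda>\<sigma>. ind I \<sigma> * N \<delta> \<sigma> ^ 3)"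
    "\<And>\<delta>. 0 < \<delta> ==> \<delta> < \<delta>0 ==> AE \<sigma> in lborel. \<sigma> \<in> I --> (AE x in lborel. x \<in> boundary_strip \<Omega> \<delta> -->
        \<bar>outward_normal \<Omega> (closest_point (frontier \<Omega>) x) \<bullet> uB (\<sigma>, x)\<bar> \<le> N \<delta> \<sigma>)"
    "((\<lambda>\<delta>. LBINT \<sigma>. ind I \<sigma> * N \<delta> \<sigma> ^ 3) \<longlongrightarrow> 0) (at_right 0)"
    by (rule wall_normal_majorant) (rule that; assumption)
  have "(LBINT x. (norm (w t x))^2) = (LBINT x. (norm (w 0 x))^2)"
    by (rule euler_data.energy_conserved[OF euler_data_axioms dom refl \<epsilon> increments_small N t])
  then show ?thesis using energy_eq(1)[OF t] energy_eq(1)[of 0] Tpos by simp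
qed

end

theorem (in weak_euler) energy_conservation:
  assumes t: "t \<in> {0..<T}"
  shows "(LINT x|lebesgue_on \<Omega>. (norm (u t x))^2) = (LINT x|lebesgue_on \<Omega>. (norm (u 0 x))^2)"
proof -
  obtain uB where uB: "uB \<in> borel_measurable borel" "\<And>z. z \<notin> I \<times> \<Omega> ==> uB z = 0"
    "AE z in lborel. z \<in> I \<times> \<Omega> --> uB z = u (fst z) (snd z)" by (rule velocity_representative) (rule that; assumption)
  obtain qB where qB: "qB \<in> borel_measurable borel" "AE z in lborel. z \<in> I \<times> S --> qB z = p (fst z) (snd z)"
    by (rule pressure_representative) (rule that; assumption)
  have "AE z in lborel. z \<in> I \<times> S --> qB (fst z, snd z) = p (fst z) (snd z)" using qB(2) by simp
  note qs = AE_slice[OF this]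
  obtain w where w: "\<And>t. t \<in> {0..<T} ==> w t \<in> borel_measurable borel" "\<And>t x. t \<in> {0..<T} ==> x \<notin> \<Omega> ==> w t x = 0"
    "\<And>t. t \<in> {0..<T} ==> AE x in lborel. x \<in> \<Omega> --> w t x = u t x"
    "AE t in lborel. t \<in> I --> w t = (\<lambda>x. uB (t, x))" by (rule slice_representative[OF uB]) (assumption, (rule that; assumption))
  have q: "(3::real) > 0" "(3/2::real) > 0" by simp_all
  obtain M where M: "\<And>t. 0 \<le> M t" "integrable lborel (\<lambda>t. ind I t * M t powr 3)"
    "AE t in lborel. t \<in> I --> (AE x in lborel. x \<in> S --> norm (u t x) \<le> M t)"
    by (rule LqLinf_majorant[OF uS borel_sets(2) q(1)]) (rule that; assumption)
  obtain P where P: "\<And>t. 0 \<le> P t" "integrable lborel (\<lambda>t. ind I t * P t powr (3/2))"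
    "AE t in lborel. t \<in> I --> (AE x in lborel. x \<in> S --> norm (p t x) \<le> P t)"
    by (rule LqLinf_majorant[OF pS borel_sets(2) q(2)]) (rule that; assumption)
  have M3: "integrable lborel (\<lambda>t. ind I t * M t ^ 3)" using M(1,2) by simp
  interpret euler_representatives \<Omega> T u p \<epsilon> uB qB w M P
    by (intro euler_representatives.intro euler_representatives_axioms.intro weak_euler_axioms)
      (fact uB(1,2) qB(1) qs w M(1,3) M3 P)+
  show ?thesis by (rule energy_conservation[OF t])
qed

theorem theorem1:
  fixes \<Omega> :: "'a::euclidean_space set"
    and T :: real
    and u :: "real \<Rightarrow> 'a \<Rightarrow> 'a"
    and p :: "real \<Rightarrow> 'a \<Rightarrow> real"
  assumes "DIM('a) \<ge> 2"
    and "bounded_C2_domain \<Omega>"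
    and "T > 0"
    and "weak_euler_solution T \<Omega> u p"
    and interior_regularity:
      "\<And>U. open U \<Longrightarrow> compact (closure U) \<Longrightarrow> closure U \<subseteq> \<Omega> \<Longrightarrow> u \<in> Lq_besov_c0 3 3 (1/3) T U"
    and near_wall_boundedness:
      "\<exists>\<epsilon>>0. u \<in> LqLinf_space 3 T (boundary_strip \<Omega> \<epsilon>) \<and>
              p \<in> LqLinf_space (3/2) T (boundary_strip \<Omega> \<epsilon>)"
    and "normal_velocity_vanishes 3 T \<Omega> u"
  shows "\<forall>t\<in>{0..<T}. 1/2 * (LINT x|lebesgue_on \<Omega>. (norm (u t x))\<^sup>2)
                    = 1/2 * (LINT x|lebesgue_on \<Omega>. (norm (u 0 x))\<^sup>2)"
proof
  fix t assume t: "t \<in> {0..<T}"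
  obtain \<epsilon> where \<epsilon>: "\<epsilon> > 0" "u \<in> LqLinf_space 3 T (boundary_strip \<Omega> \<epsilon>)" "p \<in> LqLinf_space (3/2) T (boundary_strip \<Omega> \<epsilon>)"
    using near_wall_boundedness by blast
  interpret weak_euler \<Omega> T u p \<epsilon> by unfold_locales fact+
  show "1/2 * (LINT x|lebesgue_on \<Omega>. (norm (u t x))^2) = 1/2 * (LINT x|lebesgue_on \<Omega>. (norm (u 0 x))^2)"
    using energy_conservation[OF t] by simp
qed

end
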